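(* The following decision problem is NP-complete: given a cubic graph $\Gamma$, decide whether there exists a rotation system (embedding) of $\Gamma$ with respect to which $\Gamma$ has a nowhere-identity dihedral $2$-flow.
   Context: Graphs are finite and connected and may have loops and parallel edges; cubic means every vertex has degree $3$. An embedding of a graph $\Gamma=(V,E)$ is given by a rotation system $\pi=\{\pi_v\mid v\in V\}$, where $\pi_v$ is a cyclic order of the edges incident with $v$ (a loop at $v$ appears twice); equivalently, it is a cellular embedding in a closed connected orientable surface. For a group $G$ and an orientation of the edges, a $G$-flow is a map $f:E\to G$ such that at each vertex $v$ the product of the values of the incident edges, taken in the order $\pi_v$, is the identity, where the inverse $f(e)^{-1}$ is used for an edge leaving $v$ (so a loop contributes $f(e)$ at one end and $f(e)^{-1}$ at the other). It is nowhere-identity if $f(e)\neq1$ for all $e$. Existence does not depend on the orientation. $\mathbb{D}=\{\begin{pmatrix}\pm1&a\\0&1\end{pmatrix}\mid a\in\mathbb{Z}\}$ and $\mathbb{D}^{<2}=\{\begin{pmatrix}\pm1&a\\0&1\end{pmatrix}\in\mathbb{D}\mid |a|<2\}$. A nowhere-identity dihedral $2$-flow is a nowhere-identity $\mathbb{D}$-flow with all values in $\mathbb{D}^{<2}$. *)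

theory Defs
  imports
    "HOL-Algebra.Group"
    "HOL-Analysis.Cartesian_Space"
    "HOL-Computational_Algebra.Polynomial"
    "HOL-Combinatorics.Orbits"
    "Graph_Theory.Digraph_Component"
begin

section \<open>Turing machines and NP-completeness\<close>

text \<open>
  Deterministic multi-tape Turing machines with two-way infinite tapes. A machine has the states
  \<open>0, ..., states - 1\<close>, where \<open>0\<close> is initial and \<open>1\<close> is halting, and the tape symbols
  \<open>0, ..., symbols - 1\<close>, where \<open>0\<close> is the blank and \<open>1\<close>, \<open>2\<close> stand for the input bits.
  A tape is stored relative to its head, which always scans cell \<open>0\<close>: moving the head by \<open>d\<close>
  shifts the tape contents.
\<close>

type_synonym tape = "int \<Rightarrow> nat"

record machine =
  tapes :: nat
  states :: nat
  symbols :: nat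
  trans :: "nat \<Rightarrow> nat list \<Rightarrow> nat \<times> (nat \<times> int) list"

definition turing_machine :: "machine \<Rightarrow> bool" where
  "turing_machine M \<longleftrightarrow>
     1 \<le> tapes M \<and> 2 \<le> states M \<and> 3 \<le> symbols M \<and>
     (\<forall>q a. q < states M \<longrightarrow> length a = tapes M \<longrightarrow> set a \<subseteq> {..<symbols M} \<longrightarrow>
        fst (trans M q a) < states M \<and>
        length (snd (trans M q a)) = tapes M \<and>
        (\<forall>(s, d) \<in> set (snd (trans M q a)). s < symbols M \<and> d \<in> {-1, 0, 1}))"

definition write_move :: "nat \<times> int \<Rightarrow> tape \<Rightarrow> tape" where
  "write_move = (\<lambda>(s, d) t i. (t(0 := s)) (i + d))"

text \<open>A halted configuration is repeated for ever, so that being in the halting state after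
  exactly \<open>n\<close> steps means having halted within \<open>n\<close> steps.\<close>

definition step :: "machine \<Rightarrow> nat \<times> tape list \<Rightarrow> nat \<times> tape list" where
  "step M = (\<lambda>(q, ts).
     if q = 1 then (q, ts)
     else let (q', acts) = trans M q (map (\<lambda>t. t 0) ts) in (q', map2 write_move acts ts))"

definition word_tape :: "bool list \<Rightarrow> tape" where
  "word_tape w = (\<lambda>i. if 0 \<le> i \<and> nat i < length w then (if w ! nat i then 2 else 1) else 0)"

text \<open>The input words are placed on separate tapes.\<close>

definition init_config :: "machine \<Rightarrow> bool list list \<Rightarrow> nat \<times> tape list" where
  "init_config M ws =
     (0, map (\<lambda>k. if k < length ws then word_tape (ws ! k) else word_tape []) [0..<tapes M])"

text \<open>The output is read from the first tape, from the head rightwards up to the first blank.\<close>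

definition computes_within :: "machine \<Rightarrow> bool list list \<Rightarrow> bool list \<Rightarrow> nat \<Rightarrow> bool" where
  "computes_within M ws y n \<longleftrightarrow>
     (case (step M ^^ n) (init_config M ws) of (q, ts) \<Rightarrow>
        q = 1 \<and> (\<forall>j\<le>length y. hd ts (int j) = word_tape y (int j)))"

definition polytime_computable :: "(bool list \<Rightarrow> bool list) \<Rightarrow> bool" where
  "polytime_computable f \<longleftrightarrow>
     (\<exists>M p. turing_machine M \<and> (\<forall>x. computes_within M [x] (f x) (poly p (length x))))"

definition polytime_verifier :: "(bool list \<Rightarrow> bool list \<Rightarrow> bool) \<Rightarrow> bool" where
  "polytime_verifier V \<longleftrightarrow>
     (\<exists>M p. turing_machine M \<and> 2 \<le> tapes M \<and>
        (\<forall>x u. computes_within M [x, u] [V x u] (poly p (length x + length u))))"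

definition in_NP :: "bool list set \<Rightarrow> bool" where
  "in_NP L \<longleftrightarrow>
     (\<exists>V p. polytime_verifier V \<and>
        (\<forall>x. x \<in> L \<longleftrightarrow> (\<exists>u. length u \<le> poly p (length x) \<and> V x u)))"

definition polytime_reducible :: "bool list set \<Rightarrow> bool list set \<Rightarrow> bool" where
  "polytime_reducible K L \<longleftrightarrow> (\<exists>f. polytime_computable f \<and> (\<forall>x. x \<in> K \<longleftrightarrow> f x \<in> L))"

definition NP_complete :: "bool list set \<Rightarrow> bool" where
  "NP_complete L \<longleftrightarrow> in_NP L \<and> (\<forall>K. in_NP K \<longrightarrow> polytime_reducible K L)"

section \<open>Graphs, rotation systems and flows\<close>

text \<open>
  An undirected graph with loops and parallel edges is given by the library's arc-labelled
  digraphs; here \<^const>\<open>tail\<close> and \<^const>\<open>head\<close> merely name the two ends of an edge, and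
  orientations are a separate parameter below. The dart \<open>(e, b)\<close> is the occurrence of the edge \<open>e\<close>
  at its head if \<open>b\<close> and at its tail otherwise; thus a loop contributes two darts to its vertex.
\<close>

definition darts_at :: "('v, 'e) pre_digraph \<Rightarrow> 'v \<Rightarrow> ('e \<times> bool) set" where
  "darts_at G v = {(e, b). e \<in> arcs G \<and> (if b then head G e else tail G e) = v}"

definition cubic_graph :: "('v, 'e) pre_digraph \<Rightarrow> bool" where
  "cubic_graph G \<longleftrightarrow>
     fin_digraph G \<and> Digraph_Component.connected G \<and> (\<forall>v\<in>verts G. card (darts_at G v) = 3)"

text \<open>\<open>\<pi> v d\<close> is the successor of the dart \<open>d\<close> in the cyclic order at \<open>v\<close>.\<close>

definition rotation_system ::
    "('v, 'e) pre_digraph \<Rightarrow> ('v \<Rightarrow> 'e \<times> bool \<Rightarrow> 'e \<times> bool) \<Rightarrow> bool" where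
  "rotation_system G \<pi> \<longleftrightarrow>
     (\<forall>v\<in>verts G. darts_at G v \<noteq> {} \<longrightarrow> cyclic_on (\<pi> v) (darts_at G v))"

text \<open>An orientation \<open>\<omega>\<close> directs the edge \<open>e\<close> from its tail to its head if \<open>\<omega> e\<close>, and from its head
  to its tail otherwise; so \<open>e\<close> enters at the dart \<open>(e, \<omega> e)\<close> and leaves at the other one.\<close>

definition dart_value ::
    "('g, 'm) monoid_scheme \<Rightarrow> ('e \<Rightarrow> bool) \<Rightarrow> ('e \<Rightarrow> 'g) \<Rightarrow> 'e \<times> bool \<Rightarrow> 'g" where
  "dart_value A \<omega> f = (\<lambda>(e, b). if b = \<omega> e then f e else inv\<^bsub>A\<^esub> (f e))"

text \<open>The products over a cyclic order for different first darts are conjugate, so requiring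
  the product to be the identity for every first dart is the same as requiring it for one.\<close>

definition group_flow ::
    "('g, 'm) monoid_scheme \<Rightarrow> ('v, 'e) pre_digraph \<Rightarrow> ('v \<Rightarrow> 'e \<times> bool \<Rightarrow> 'e \<times> bool) \<Rightarrow>
     ('e \<Rightarrow> bool) \<Rightarrow> ('e \<Rightarrow> 'g) \<Rightarrow> bool" where
  "group_flow A G \<pi> \<omega> f \<longleftrightarrow>
     (\<forall>e\<in>arcs G. f e \<in> carrier A) \<and>
     (\<forall>v\<in>verts G. \<forall>d\<in>darts_at G v.
        foldr (\<lambda>x y. x \<otimes>\<^bsub>A\<^esub> y)
          (map (\<lambda>i. dart_value A \<omega> f ((\<pi> v ^^ i) d)) [0..<card (darts_at G v)]) \<one>\<^bsub>A\<^esub> = \<one>\<^bsub>A\<^esub>)"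

definition dihedral_matrix :: "int \<Rightarrow> int \<Rightarrow> int^2^2" where
  "dihedral_matrix s a = vector [vector [s, a], vector [0, 1]]"

definition dihedral_group :: "(int^2^2) monoid" where
  "dihedral_group =
     \<lparr>carrier = {dihedral_matrix s a | s a. s \<in> {1, -1}}, monoid.mult = (**), one = mat 1\<rparr>"

definition dihedral_below :: "int \<Rightarrow> (int^2^2) set" where
  "dihedral_below k = {dihedral_matrix s a | s a. s \<in> {1, -1} \<and> \<bar>a\<bar> < k}"

lemma dihedral_matrix_mult:
  "dihedral_matrix s a ** dihedral_matrix t b = dihedral_matrix (s * t) (s * b + a)"
  by (simp add: dihedral_matrix_def matrix_matrix_mult_def vec_eq_iff forall_2 sum_2 vector_2)

lemma dihedral_matrix_one: "mat 1 = dihedral_matrix 1 0"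
  by (simp add: dihedral_matrix_def mat_def vec_eq_iff forall_2 vector_2)

lemma group_dihedral_group: "group dihedral_group"
proof (rule groupI)
  fix x assume "x \<in> carrier dihedral_group"
  then obtain s a where x: "x = dihedral_matrix s a" and s: "s \<in> {1, -1}"
    by (auto simp: dihedral_group_def)
  have "dihedral_matrix s (- s * a) ** x = mat 1"
    using s by (auto simp: x dihedral_matrix_mult dihedral_matrix_one)
  moreover have "dihedral_matrix s (- s * a) \<in> carrier dihedral_group"
    using s unfolding dihedral_group_def by auto
  ultimately show
    "\<exists>y\<in>carrier dihedral_group. y \<otimes>\<^bsub>dihedral_group\<^esub> x = \<one>\<^bsub>dihedral_group\<^esub>"
    by (auto simp: dihedral_group_def)
next
  fix x y assume "x \<in> carrier dihedral_group" "y \<in> carrier dihedral_group"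
  then show "x \<otimes>\<^bsub>dihedral_group\<^esub> y \<in> carrier dihedral_group"
    by (fastforce simp: dihedral_group_def dihedral_matrix_mult)
next
  show "\<one>\<^bsub>dihedral_group\<^esub> \<in> carrier dihedral_group"
    by (auto simp: dihedral_group_def dihedral_matrix_one)
qed (auto simp: dihedral_group_def matrix_mul_assoc)

definition nowhere_identity_dihedral_flow ::
    "int \<Rightarrow> ('v, 'e) pre_digraph \<Rightarrow> ('v \<Rightarrow> 'e \<times> bool \<Rightarrow> 'e \<times> bool) \<Rightarrow>
     ('e \<Rightarrow> bool) \<Rightarrow> ('e \<Rightarrow> int^2^2) \<Rightarrow> bool" where
  "nowhere_identity_dihedral_flow k G \<pi> \<omega> f \<longleftrightarrow>
     group_flow dihedral_group G \<pi> \<omega> f \<and>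
     (\<forall>e\<in>arcs G. f e \<noteq> \<one>\<^bsub>dihedral_group\<^esub>) \<and>
     (\<forall>e\<in>arcs G. f e \<in> dihedral_below k)"

section \<open>Graphs as words\<close>

text \<open>A graph is listed as its number \<open>n\<close> of vertices, which are named \<open>0, ..., n - 1\<close>, followed by
  the pairs of ends of its edges. Vertices are written in unary; as \<open>n\<close> is at most the size of
  the graph, the word has length polynomial in the number of vertices and edges, as for
  adjacency matrices.\<close>

definition listed_graph :: "nat \<Rightarrow> (nat \<times> nat) list \<Rightarrow> (nat, nat) pre_digraph" where
  "listed_graph n es =
     \<lparr>verts = {..<n}, arcs = {..<length es}, tail = (\<lambda>e. fst (es ! e)), head = (\<lambda>e. snd (es ! e))\<rparr>"

definition unary :: "nat \<Rightarrow> bool list" where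
  "unary m = replicate m True @ [False]"

definition encode_graph :: "nat \<Rightarrow> (nat \<times> nat) list \<Rightarrow> bool list" where
  "encode_graph n es = unary n @ concat (map (\<lambda>(u, v). unary u @ unary v) es)"

end

theory Submission
  imports Defs
begin

text \<open>In a nowhere-identity dihedral 2-flow on a cubic graph, the product around a vertex is the identity only if exactly one
  of the three values is a translation and exactly one of the two reflections has entry 0. So the flow is a
  3-edge-colouring, and conversely a 3-edge-colouring gives a flow for the rotation system that orders
  the colours suitably at each vertex. It remains to show that 3-edge-colourability is NP-complete.

  For hardness, an accepting computation is a tiling of a torus, a tiling is a solution of a system of
  clauses between neighbouring cells, and the clauses become a cubic graph built from Holyer's inverting
  components. For membership, a colouring and a vertex order witnessing connectedness are checked by a
  first-order formula over the positions of the input, with order, addition and letters. Both the listing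
  of the graph and the formula are given in small loop languages that compile to multi-tape machines.\<close>

section \<open>Structured programs for Turing machines\<close>

text \<open>The reduction has to be an actual multi-tape machine, and this shapes every
  construction. The graph is made uniform: each cell of the torus carries the same gadgets, one for
  every conceivable clause, whether or not the clause applies there. Position and input decide only
  how the closing edges are attached. The machine that is simulated enters through constants alone:
  the number of bits per tile, the list of edges of one cell, and a finite table of forbidden
  patterns. So the listing comes from a fixed nest of loops over positions with finitely many tests;
  a preliminary pass writes polynomial bounds in unary, so that these loops are long enough.
  Everything exists in two copies because the inverting components and the inactive clauses have
  surplus half-edges. Joining each of them to its twin keeps the graph cubic, and colouring both
  copies alike makes the joining edges consistent.\<close>

datatype prog =
    Act nat "nat \<Rightarrow> nat \<times> int"
  | Seq prog prog
  | Cond "nat list \<Rightarrow> bool" prog prog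
  | While "nat list \<Rightarrow> bool" prog

abbreviation scan :: "tape list \<Rightarrow> nat list" where
  "scan ts \<equiv> map (\<lambda>t. t 0) ts"

text \<open>The step counts are those of the compiled code: a test costs one step, and the first
  branch of \<open>Cond\<close> and every round of \<open>While\<close> pay for one more jump at
  their end.\<close>

inductive exec :: "prog \<Rightarrow> tape list \<Rightarrow> nat \<Rightarrow> tape list \<Rightarrow> bool" where
  Act: "exec (Act r h) ts 1 (ts[r := write_move (h ((ts ! r) 0)) (ts ! r)])"
| Seq: "exec p ts n1 ts1 \<Longrightarrow> exec q ts1 n2 ts2 \<Longrightarrow> exec (Seq p q) ts (n1 + n2) ts2"
| CondT: "c (scan ts) \<Longrightarrow> exec p ts n ts' \<Longrightarrow> exec (Cond c p q) ts (n + 2) ts'"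
| CondF: "\<not> c (scan ts) \<Longrightarrow> exec q ts n ts' \<Longrightarrow> exec (Cond c p q) ts (n + 1) ts'"
| WhileF: "\<not> c (scan ts) \<Longrightarrow> exec (While c p) ts 1 ts"
| WhileT: "c (scan ts) \<Longrightarrow> exec p ts n1 ts1 \<Longrightarrow> exec (While c p) ts1 n2 ts2 \<Longrightarrow>
    exec (While c p) ts (n1 + n2 + 2) ts2"

text \<open>Six symbols serve for all programs: the blank, the two bits, and the marks
  \<open>3\<close>, \<open>4\<close>, \<open>5\<close> of \<open>label\<close>.\<close>

fun wfp :: "nat \<Rightarrow> prog \<Rightarrow> bool" where
  "wfp K (Act r h) \<longleftrightarrow> r < K \<and> (\<forall>a<6. fst (h a) < 6 \<and> snd (h a) \<in> {-1, 0, 1})"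
| "wfp K (Seq p q) \<longleftrightarrow> wfp K p \<and> wfp K q"
| "wfp K (Cond c p q) \<longleftrightarrow> wfp K p \<and> wfp K q"
| "wfp K (While c p) \<longleftrightarrow> wfp K p"

type_synonym instr = "nat list \<Rightarrow> nat \<times> (nat \<times> int) list"

definition branch :: "(nat list \<Rightarrow> bool) \<Rightarrow> nat \<Rightarrow> nat \<Rightarrow> instr" where
  "branch c b1 b2 = (\<lambda>a. (if c a then b1 else b2, map (\<lambda>s. (s, 0)) a))"

fun psize :: "prog \<Rightarrow> nat" where
  "psize (Act r h) = 1"
| "psize (Seq p q) = psize p + psize q"
| "psize (Cond c p q) = psize p + psize q + 2"
| "psize (While c p) = psize p + 2"

fun comp :: "prog \<Rightarrow> nat \<Rightarrow> instr list" where
  "comp (Act r h) b = [\<lambda>a. (b + 1, (map (\<lambda>s. (s, 0)) a)[r := h (a ! r)])]"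
| "comp (Seq p q) b = comp p b @ comp q (b + psize p)"
| "comp (Cond c p q) b = [branch c (b + 1) (b + psize p + 2)] @ comp p (b + 1) @
     [branch (\<lambda>_. True) (b + psize p + psize q + 2) 0] @ comp q (b + psize p + 2)"
| "comp (While c p) b = [branch c (b + 1) (b + psize p + 2)] @ comp p (b + 1) @
     [branch (\<lambda>_. True) b 0]"

lemma length_comp [simp]: "length (comp p b) = psize p"
  by (induction p arbitrary: b) auto

lemma comp_nonempty [simp]: "comp p b \<noteq> []"
  by (induction p arbitrary: b) auto

text \<open>State 0 is initial and state 1 is halting, so the code of \<open>p\<close> starts at state 2.\<close>

definition prog_machine :: "nat \<Rightarrow> prog \<Rightarrow> machine" where
  "prog_machine K p = (let code = [branch (\<lambda>_. True) 2 0, branch (\<lambda>_. True) 1 0] @ comp p 2 @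
       [branch (\<lambda>_. True) 1 0]
     in \<lparr>tapes = K, states = psize p + 3, symbols = 6, trans = (\<lambda>q. code ! q)\<rparr>)"

lemma write_move_stay [simp]: "write_move (t 0, 0) t = t"
  by (auto simp: write_move_def)

lemma map2_write_move_stay [simp]: "map2 write_move (map (\<lambda>t. (t 0, 0)) ts) ts = ts"
  by (induction ts) auto

lemma map2_write_move_act:
  "map2 write_move ((map (\<lambda>t. (t 0, 0)) ts)[r := x]) ts = ts[r := write_move x (ts ! r)]"
proof (induction ts arbitrary: r)
  case (Cons t ts) then show ?case by (cases r) auto
qed simp

text \<open>The condition \<open>2 \<le> b\<close> keeps code off the halting state
  \<open>1\<close>, on which \<open>step\<close> does not consult \<open>trans\<close>.\<close>

definition has_code :: "machine \<Rightarrow> nat \<Rightarrow> instr list \<Rightarrow> bool" where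
  "has_code M b cs \<longleftrightarrow> 2 \<le> b \<and> (\<forall>i<length cs. trans M (b + i) = cs ! i)"

lemma has_code_append:
  "has_code M b (cs @ ds) \<longleftrightarrow> has_code M b cs \<and> (2 \<le> b \<longrightarrow> has_code M (b + length cs) ds)"
proof -
  have "(\<forall>i<length cs + length ds. P i) \<longleftrightarrow> (\<forall>i<length cs. P i) \<and> (\<forall>i<length ds. P (length cs + i))"
    for P
  proof (intro iffI conjI allI impI; (elim conjE)?)
    fix i assume *: "\<forall>i<length cs. P i" "\<forall>i<length ds. P (length cs + i)" "i < length cs + length ds"
    show "P i"
      using * by (cases "i < length cs") (auto dest: spec[of _ "i - length cs"])
  qed auto
  from this[of "\<lambda>i. trans M (b + i) = (cs @ ds) ! i"] show ?thesis
    by (auto simp: has_code_def nth_append add.assoc)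
qed

lemma has_code_single: "has_code M b [c] \<longleftrightarrow> 2 \<le> b \<and> trans M b = c"
  by (auto simp: has_code_def)

lemma has_code_Cons:
  "ds \<noteq> [] \<Longrightarrow> has_code M b (c # ds) \<longleftrightarrow> has_code M b [c] \<and> (2 \<le> b \<longrightarrow> has_code M (Suc b) ds)"
  using has_code_append[of M b "[c]" ds] by simp

lemma step_branch:
  "has_code M b [branch c b1 b2] \<Longrightarrow> step M (b, ts) = (if c (scan ts) then b1 else b2, ts)"
  by (auto simp: has_code_single step_def branch_def comp_def)

text \<open>Induction on the execution and not on the program, because a further round of
  \<open>While\<close> runs the same code again at the same address.\<close>

lemma comp_correct:
  assumes "exec p ts n ts'" "wfp (length ts) p" "has_code M b (comp p b)"
  shows "(step M ^^ n) (b, ts) = (b + psize p, ts') \<and> length ts' = length ts"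
  using assms
proof (induction arbitrary: b)
  case (Act r h ts)
  then show ?case
    by (auto simp: has_code_single step_def Let_def map2_write_move_act comp_def)
next
  case (Seq p ts n1 ts1 q n2 ts2)
  have "2 \<le> b" using Seq.prems by (simp add: has_code_def)
  then have cs: "has_code M b (comp p b)" "has_code M (b + psize p) (comp q (b + psize p))"
    using Seq.prems by (auto simp: has_code_append)
  have "(step M ^^ n1) (b, ts) = (b + psize p, ts1) \<and> length ts1 = length ts"
    using Seq cs by auto
  moreover have "(step M ^^ n2) (b + psize p, ts1) = (b + psize p + psize q, ts2) \<and> length ts2 = length ts1"
    using Seq cs calculation by auto
  ultimately show ?case by (simp add: funpow_add add.commute[of n1] add.assoc)
next
  case (CondT c ts p n ts' q)
  have "2 \<le> b" using CondT.prems by (simp add: has_code_def)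
  then have cs: "has_code M b [branch c (b + 1) (b + psize p + 2)]" "has_code M (b + 1) (comp p (b + 1))"
    "has_code M (b + 1 + psize p) [branch (\<lambda>_. True) (b + psize p + psize q + 2) 0]"
    using CondT.prems by (auto simp: has_code_append has_code_Cons)
  have "(step M ^^ (1 + n + 1)) (b, ts) = step M ((step M ^^ n) (step M (b, ts)))"
    by (simp add: funpow_swap1)
  moreover have "(step M ^^ n) (b + 1, ts) = (b + 1 + psize p, ts') \<and> length ts' = length ts"
    using CondT cs by auto
  ultimately show ?case using step_branch[OF cs(1), of ts] step_branch[OF cs(3), of ts'] CondT.hyps(1)
    by (auto simp: ac_simps)
next
  case (CondF c ts q n ts' p)
  have "2 \<le> b" using CondF.prems by (simp add: has_code_def)
  then have cs: "has_code M b [branch c (b + 1) (b + psize p + 2)]"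
    "has_code M (b + psize p + 2) (comp q (b + psize p + 2))"
    using CondF.prems by (auto simp: has_code_append has_code_Cons)
  have "(step M ^^ (1 + n)) (b, ts) = (step M ^^ n) (step M (b, ts))"
    by (simp add: funpow_swap1)
  moreover have "(step M ^^ n) (b + psize p + 2, ts) = (b + psize p + 2 + psize q, ts') \<and> length ts' = length ts"
    using CondF cs by auto
  ultimately show ?case using step_branch[OF cs(1), of ts] CondF.hyps(1) by (auto simp: ac_simps)
next
  case (WhileF c ts p)
  have "2 \<le> b" using WhileF.prems by (simp add: has_code_def)
  then have cs: "has_code M b [branch c (b + 1) (b + psize p + 2)]"
    using WhileF.prems by (auto simp: has_code_append has_code_Cons)
  then show ?case using step_branch[OF cs, of ts] WhileF.hyps by auto
next
  case (WhileT c ts p n1 ts1 n2 ts2)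
  have "2 \<le> b" using WhileT.prems by (simp add: has_code_def)
  then have cs: "has_code M b [branch c (b + 1) (b + psize p + 2)]" "has_code M (b + 1) (comp p (b + 1))"
    "has_code M (b + 1 + psize p) [branch (\<lambda>_. True) b 0]"
    using WhileT.prems by (auto simp: has_code_append has_code_Cons)
  have "(step M ^^ (n1 + n2 + 2)) (b, ts) =
      (step M ^^ n2) (step M ((step M ^^ n1) (step M (b, ts))))"
    by (simp add: funpow_add funpow_swap1 add.commute[of n1])
  moreover have "(step M ^^ n1) (b + 1, ts) = (b + 1 + psize p, ts1) \<and> length ts1 = length ts"
    using WhileT cs by auto
  moreover have "(step M ^^ n2) (b, ts1) = (b + psize (While c p), ts2) \<and> length ts2 = length ts1"
    using WhileT calculation(2) by auto
  ultimately show ?case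
    using step_branch[OF cs(1), of ts] step_branch[OF cs(3), of ts1] WhileT.hyps(1)
    by (auto simp: ac_simps)
qed

lemma comp_wf:
  assumes "wfp K p" "i < psize p" "length a = K" "set a \<subseteq> {..<6}"
  shows "fst ((comp p b ! i) a) \<le> b + psize p \<and> length (snd ((comp p b ! i) a)) = K \<and>
    (\<forall>(s, d) \<in> set (snd ((comp p b ! i) a)). s < 6 \<and> d \<in> {-1, 0, 1})"
  using assms
proof (induction p arbitrary: b i)
  case (Act r h)
  have "(s, d) \<in> set ((map (\<lambda>s. (s, 0)) a)[r := h (a ! r)]) \<Longrightarrow> s < 6 \<and> d \<in> {-1, 0, 1}" for s d
  proof -
    assume "(s, d) \<in> set ((map (\<lambda>s. (s, 0)) a)[r := h (a ! r)])"
    then consider "(s, d) = h (a ! r)" | "s \<in> set a" "d = 0"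
      using set_update_subset_insert by fastforce
    then show ?thesis
    proof cases
      case 1 then show ?thesis using Act nth_mem[of r a] by (metis fst_conv lessThan_iff snd_conv subsetD wfp.simps(1))
    qed (use Act in auto)
  qed
  then show ?case using Act by auto
next
  case (Seq p q)
  show ?case
  proof (cases "i < psize p")
    case True
    then show ?thesis using Seq.prems Seq.IH(1)[of i b] by (auto simp: nth_append)
  next
    case False
    then show ?thesis using Seq.prems Seq.IH(2)[of "i - psize p" "b + psize p"]
      by (auto simp: nth_append add.assoc)
  qed
next
  case (Cond c p q)
  consider "i = 0" | "0 < i" "i < psize p + 1" | "i = psize p + 1" | "i > psize p + 1" by linarith
  then show ?case
  proof cases
    case 2
    then show ?thesis using Cond.prems Cond.IH(1)[of "i - 1" "b + 1"] by (auto simp: nth_append nth_Cons')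
  next
    case 4
    then show ?thesis using Cond.prems Cond.IH(2)[of "i - psize p - 2" "b + psize p + 2"]
      by (auto simp: nth_append nth_Cons' numeral_2_eq_2 add.assoc)
  qed (use Cond.prems in \<open>auto simp: nth_append nth_Cons' branch_def\<close>)
next
  case (While c p)
  consider "i = 0" | "0 < i" "i < psize p + 1" | "i = psize p + 1" using While.prems by fastforce
  then show ?case
  proof cases
    case 2
    then show ?thesis using While.prems While.IH[of "i - 1" "b + 1"] by (auto simp: nth_append nth_Cons')
  qed (use While.prems in \<open>auto simp: nth_append nth_Cons' branch_def\<close>)
qed

lemma turing_machine_prog_machine:
  assumes "wfp K p" "1 \<le> K"
  shows "turing_machine (prog_machine K p)"
proof -
  have "fst (trans (prog_machine K p) q a) < states (prog_machine K p) \<and>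
      length (snd (trans (prog_machine K p) q a)) = K \<and>
      (\<forall>(s, d) \<in> set (snd (trans (prog_machine K p) q a)). s < 6 \<and> d \<in> {-1, 0, 1})"
    if "q < psize p + 3" "length a = K" "set a \<subseteq> {..<6}" for q a
  proof -
    consider "q = 0" | "q = 1" | "2 \<le> q" "q < psize p + 2" | "q = psize p + 2" using \<open>q < psize p + 3\<close> by linarith
    then show ?thesis
    proof cases
      case 3
      then have "trans (prog_machine K p) q = comp p 2 ! (q - 2)"
        by (auto simp: prog_machine_def Let_def nth_append nth_Cons' numeral_2_eq_2)
      moreover have "states (prog_machine K p) = psize p + 3" by (simp add: prog_machine_def Let_def)
      moreover have "q - 2 < psize p" using 3 by simp
      ultimately show ?thesis using comp_wf[OF assms(1) _ that(2,3), of "q - 2" 2] by simp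
    qed (use that in \<open>auto simp: prog_machine_def Let_def branch_def nth_append nth_Cons'\<close>)
  qed
  then show ?thesis using assms(2) by (auto simp: turing_machine_def prog_machine_def Let_def)
qed

text \<open>The two extra steps lead from the initial state into the code and from its end into the
  halting state. Any larger \<open>N\<close> will do because a halted configuration repeats.\<close>

lemma prog_machine_halts:
  assumes "exec p ts n ts'" "wfp K p" "length ts = K" "n + 2 \<le> N"
  shows "(step (prog_machine K p) ^^ N) (0, ts) = (1, ts')"
proof -
  let ?M = "prog_machine K p"
  have hc: "has_code ?M 2 (comp p 2)"
    "has_code ?M (2 + psize p) [branch (\<lambda>_. True) 1 0]"
    by (auto simp: has_code_def prog_machine_def Let_def nth_append)
  have s0: "step ?M (0, ts) = (2, ts)"
    by (auto simp: step_def prog_machine_def branch_def Let_def comp_def)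
  have "(step ?M ^^ n) (2, ts) = (2 + psize p, ts')" using comp_correct[OF assms(1) _ hc(1)] assms(2,3) by auto
  moreover have "step ?M (2 + psize p, ts') = (1, ts')" using step_branch[OF hc(2), of ts'] by simp
  ultimately have "(step ?M ^^ (n + 2)) (0, ts) = (1, ts')" using s0 by (simp add: funpow_swap1)
  moreover have "(step ?M ^^ j) (1, ts') = (1, ts')" for j
    by (induction j) (auto simp: step_def)
  moreover have "(step ?M ^^ N) = (step ?M ^^ (N - (n + 2))) \<circ> (step ?M ^^ (n + 2))"
    by (metis assms(4) funpow_add le_add_diff_inverse2)
  ultimately show ?thesis by simp
qed

subsection \<open>Bounded runs\<close>

definition runs :: "prog \<Rightarrow> tape list \<Rightarrow> tape list \<Rightarrow> nat \<Rightarrow> bool" where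
  "runs p ts ts' N \<longleftrightarrow> (\<exists>n\<le>N. exec p ts n ts')"

lemma runs_mono: "runs p ts ts' N \<Longrightarrow> N \<le> N' \<Longrightarrow> runs p ts ts' N'"
  unfolding runs_def using le_trans by blast

lemma runs_Act: "ts' = ts[r := write_move (h ((ts ! r) 0)) (ts ! r)] \<Longrightarrow> runs (Act r h) ts ts' 1"
  unfolding runs_def using exec.Act by blast

lemma runs_Seq: "runs p ts ts1 N1 \<Longrightarrow> runs q ts1 ts2 N2 \<Longrightarrow> runs (Seq p q) ts ts2 (N1 + N2)"
  unfolding runs_def using exec.Seq add_mono by blast

lemma runs_Cond:
  "(c (scan ts) \<Longrightarrow> runs p ts ts' N) \<Longrightarrow> (\<not> c (scan ts) \<Longrightarrow> runs q ts ts' N) \<Longrightarrow>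
    runs (Cond c p q) ts ts' (N + 2)"
  unfolding runs_def by (metis add_le_mono exec.CondF exec.CondT le_refl one_le_numeral)

text \<open>The sequence \<open>s\<close> is the loop invariant made explicit: \<open>s i\<close>
  are the tapes after \<open>i\<close> rounds. The induction is on the number of rounds still to
  come, as the rules of \<open>exec\<close> peel off the first one.\<close>

lemma runs_While:
  assumes "\<And>i. i < N \<Longrightarrow> c (scan (s i)) \<and> runs p (s i) (s (Suc i)) T" "\<not> c (scan (s N))"
  shows "runs (While c p) (s 0) (s N) (N * (T + 2) + 1)"
proof -
  have "runs (While c p) (s (N - k)) (s N) (k * (T + 2) + 1)" if "k \<le> N" for k
    using that
  proof (induction k)
    case 0
    then show ?case using assms(2) exec.WhileF[of c "s N" p] by (auto simp: runs_def)
  next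
    case (Suc k)
    then have e: "N - k = Suc (N - Suc k)" by simp
    from Suc obtain n2 where n2: "n2 \<le> k * (T + 2) + 1" "exec (While c p) (s (N - k)) n2 (s N)"
      unfolding runs_def by auto
    obtain n1 where n1: "n1 \<le> T" "exec p (s (N - Suc k)) n1 (s (N - k))"
      using assms(1)[of "N - Suc k"] Suc.prems unfolding runs_def e by auto
    have "exec (While c p) (s (N - Suc k)) (n1 + n2 + 2) (s N)"
      using exec.WhileT n1(2) n2(2) assms(1)[of "N - Suc k"] Suc.prems by auto
    moreover have "n1 + n2 + 2 \<le> Suc k * (T + 2) + 1" using n1 n2 by simp
    ultimately show ?case unfolding runs_def by blast
  qed
  from this[of N] show ?thesis by simp
qed

fun seqs :: "prog list \<Rightarrow> prog" where
  "seqs [] = Act 0 (\<lambda>s. (s, 0))"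
| "seqs (p # ps) = Seq p (seqs ps)"

lemma wfp_seqs: "wfp K (seqs ps) \<longleftrightarrow> 0 < K \<and> (\<forall>p\<in>set ps. wfp K p)"
  by (induction ps) auto

lemma runs_seqs:
  assumes "\<And>i. i < length ps \<Longrightarrow> runs (ps ! i) (s i) (s (Suc i)) T"
  shows "runs (seqs ps) (s 0) (s (length ps)) (length ps * T + 1)"
  using assms
proof (induction ps arbitrary: s)
  case Nil
  then show ?case using runs_Act[of "s 0" "s 0" 0 "\<lambda>s. (s, 0)"] by simp
next
  case (Cons p ps)
  have "runs p (s 0) (s 1) T" using Cons.prems[of 0] by simp
  moreover have "runs (seqs ps) (s 1) (s (Suc (length ps))) (length ps * T + 1)"
    using Cons.IH[of "\<lambda>i. s (Suc i)"] Cons.prems by force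
  ultimately show ?case using runs_Seq by fastforce
qed

section \<open>Dihedral flows and three-edge-colourings\<close>

text \<open>Injectivity is required on darts and not on edges, so a graph with a loop has no such
  colouring: both darts of the loop carry the same colour.\<close>

definition three_colouring :: "('v, 'e) pre_digraph \<Rightarrow> ('e \<Rightarrow> nat) \<Rightarrow> bool" where
  "three_colouring G col \<longleftrightarrow>
     (\<forall>e\<in>arcs G. col e < 3) \<and> (\<forall>v\<in>verts G. inj_on (\<lambda>d. col (fst d)) (darts_at G v))"

lemma dihedral_matrix_eq: "dihedral_matrix s a = dihedral_matrix t b \<longleftrightarrow> s = t \<and> a = b"
  by (auto simp: dihedral_matrix_def vec_eq_iff forall_2 vector_2)

lemma dihedral_one: "\<one>\<^bsub>dihedral_group\<^esub> = dihedral_matrix 1 0"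
  by (simp add: dihedral_group_def dihedral_matrix_one)

lemma dihedral_mult:
  "dihedral_matrix s a \<otimes>\<^bsub>dihedral_group\<^esub> dihedral_matrix t b = dihedral_matrix (s * t) (s * b + a)"
  by (simp add: dihedral_group_def dihedral_matrix_mult)

lemma dihedral_carrier: "s \<in> {1, -1} \<Longrightarrow> dihedral_matrix s a \<in> carrier dihedral_group"
  by (auto simp: dihedral_group_def)

lemma dihedral_inv:
  assumes "s \<in> {1, -1}"
  shows "inv\<^bsub>dihedral_group\<^esub> (dihedral_matrix s a) = dihedral_matrix s (- s * a)"
proof -
  interpret Group.group dihedral_group by (rule group_dihedral_group)
  show ?thesis
    by (rule inv_equality) (use assms in \<open>auto simp: dihedral_mult dihedral_one intro: dihedral_carrier\<close>)
qed

lemma dihedral_below_2: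
  assumes "x \<in> dihedral_below 2" "x \<noteq> \<one>\<^bsub>dihedral_group\<^esub>"
  shows "\<exists>s a. x = dihedral_matrix s a \<and> (s, a) \<in> {(1, 1), (1, -1), (-1, 0), (-1, 1), (-1, -1)}"
proof -
  obtain s a where x: "x = dihedral_matrix s a" "s \<in> {1, -1}" "\<bar>a\<bar> < 2"
    using assms(1) by (auto simp: dihedral_below_def)
  then have "a = -1 \<or> a = 0 \<or> a = 1" by linarith
  then show ?thesis using x assms(2) unfolding dihedral_one
    by (intro exI[of _ s] exI[of _ a]) auto
qed

lemma cyclic_on_3:
  assumes "cyclic_on f S" "card S = 3" "d \<in> S"
  shows "S = {d, f d, f (f d)}" "distinct [d, f d, f (f d)]"
proof -
  have S: "S = orbit f d" "d \<in> orbit f d" using assms by (auto simp: cyclic_on_alldef)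
  have o: "orbit f d = (\<lambda>n. (f ^^ n) d) ` {0..<funpow_dist1 f d d}"
    using S(2) by (rule orbit_conv_funpow_dist1)
  moreover have inj: "inj_on (\<lambda>n. (f ^^ n) d) {0..<funpow_dist1 f d d}"
    using S(2) by (rule inj_on_funpow_dist1)
  ultimately have n: "funpow_dist1 f d d = 3" using assms(2) S(1) card_image by fastforce
  have e: "{0..<3::nat} = {0, 1, 2}" by auto
  show "S = {d, f d, f (f d)}" using S(1) o unfolding n e by (simp add: numeral_2_eq_2)
  show "distinct [d, f d, f (f d)]"
    using inj unfolding n e by (auto simp: numeral_2_eq_2)
qed

lemma cyclic_on_3I:
  assumes "S = {a, b, c}" "f a = b" "f b = c" "f c = a"
  shows "cyclic_on f S"
proof -
  have "S = orbit f s" if "s \<in> S" for s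
  proof
    show "S \<subseteq> orbit f s"
      using that assms orbit.base[of f s] orbit.step[of "f s" f s] orbit.step[of "f (f s)" f s] by auto
    have "x \<in> S" if "x \<in> orbit f s" for x
      using that by induction (use \<open>s \<in> S\<close> assms in auto)
    then show "orbit f s \<subseteq> S" by blast
  qed
  then show ?thesis using assms(1) by (auto simp: cyclic_on_alldef)
qed

text \<open>The signs multiply to 1, so a vertex has no reflection or two. Without reflections three
  entries 1 or -1 would have to add up to 0, against parity. With two, the entries of the
  reflections must differ by exactly 1 to cancel the translation; as they lie between -1 and 1,
  exactly one of them is 0.\<close>

lemma colouring_of_flow:
  assumes cub: "cubic_graph G" and rot: "rotation_system G \<pi>"
    and flow: "nowhere_identity_dihedral_flow 2 G \<pi> \<omega> f"
  shows "\<exists>col. three_colouring G col"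
proof -
  let ?D = "dihedral_group"
  define V where "V = {(1::int, 1::int), (1, -1), (-1, 0), (-1, 1), (-1, -1)}"
  have "\<forall>e\<in>arcs G. \<exists>p. f e = dihedral_matrix (fst p) (snd p) \<and> p \<in> V"
  proof
    fix e assume "e \<in> arcs G"
    then obtain s a where "f e = dihedral_matrix s a" "(s, a) \<in> V"
      using dihedral_below_2[of "f e"] flow unfolding nowhere_identity_dihedral_flow_def V_def by blast
    then show "\<exists>p. f e = dihedral_matrix (fst p) (snd p) \<and> p \<in> V" by (intro exI[of _ "(s, a)"]) simp
  qed
  then obtain P where P: "\<And>e. e \<in> arcs G \<Longrightarrow> f e = dihedral_matrix (fst (P e)) (snd (P e)) \<and> P e \<in> V"
    by metis
  define kind where "kind p = (if fst p = (1::int) then 2 else if snd p = (0::int) then 0 else 1::nat)" for p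
  define col where "col e = kind (P e)" for e
  \<comment> \<open>Inversion negates the entry of a translation and fixes a reflection, so it
    preserves the kind. Hence the colour belongs to the edge and does not depend on the end at which
    the value is read.\<close>
  have VV: "\<forall>p\<in>V. (fst p, - fst p * snd p) \<in> V \<and> kind (fst p, - fst p * snd p) = kind p \<and> fst p \<in> {1, -1}"
    by (simp add: V_def kind_def)
  have dv: "\<exists>p\<in>V. dart_value ?D \<omega> f d = dihedral_matrix (fst p) (snd p) \<and> kind p = col (fst d)"
    if "fst d \<in> arcs G" for d
  proof (cases "snd d = \<omega> (fst d)")
    case True
    have "P (fst d) \<in> V" using P that by blast
    moreover have "dart_value ?D \<omega> f d = f (fst d)" using True by (simp add: dart_value_def case_prod_beta)
    ultimately show ?thesis using P[OF that] unfolding col_def by metis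
  next
    case False
    let ?p = "P (fst d)"
    have p: "?p \<in> V" using P that by blast
    have "dart_value ?D \<omega> f d = inv\<^bsub>?D\<^esub> (f (fst d))" using False by (simp add: dart_value_def case_prod_beta)
    also have "\<dots> = dihedral_matrix (fst ?p) (- fst ?p * snd ?p)"
      using P[OF that] dihedral_inv[of "fst ?p" "snd ?p"] VV p by metis
    finally show ?thesis using VV p unfolding col_def
      by (intro bexI[of _ "(fst ?p, - fst ?p * snd ?p)"]) auto
  qed
  have "\<forall>p\<in>V. \<forall>q\<in>V. \<forall>r\<in>V. fst p * (fst q * fst r) = 1 \<and> fst p * (fst q * snd r + snd q) + snd p = 0 \<longrightarrow>
      kind p \<noteq> kind q \<and> kind p \<noteq> kind r \<and> kind q \<noteq> kind r"
    unfolding V_def kind_def by simp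
  then have key: "kind p \<noteq> kind q \<and> kind p \<noteq> kind r \<and> kind q \<noteq> kind r"
    if "p \<in> V" "q \<in> V" "r \<in> V" "fst p * (fst q * fst r) = 1"
      "fst p * (fst q * snd r + snd q) + snd p = 0" for p q r
    using that by blast
  have "inj_on (\<lambda>d. col (fst d)) (darts_at G v)" if v: "v \<in> verts G" for v
  proof -
    have c3: "card (darts_at G v) = 3" using cub v by (simp add: cubic_graph_def)
    then have "darts_at G v \<noteq> {}" by auto
    then obtain d where d: "d \<in> darts_at G v" by blast
    have cyc: "cyclic_on (\<pi> v) (darts_at G v)" using rot v d by (auto simp: rotation_system_def)
    note S = cyclic_on_3[OF cyc c3 d]
    let ?d1 = "\<pi> v d" and ?d2 = "\<pi> v (\<pi> v d)"
    have mem: "fst d \<in> arcs G" "fst ?d1 \<in> arcs G" "fst ?d2 \<in> arcs G"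
    proof -
      have "x \<in> darts_at G v \<Longrightarrow> fst x \<in> arcs G" for x by (auto simp: darts_at_def)
      then show "fst d \<in> arcs G" "fst ?d1 \<in> arcs G" "fst ?d2 \<in> arcs G" using S(1) by blast+
    qed
    have l: "[0..<card (darts_at G v)] = [0, 1, 2]" by (simp add: c3 upt_rec)
    have "foldr (\<lambda>x y. x \<otimes>\<^bsub>?D\<^esub> y)
          (map (\<lambda>i. dart_value ?D \<omega> f ((\<pi> v ^^ i) d)) [0..<card (darts_at G v)]) \<one>\<^bsub>?D\<^esub> = \<one>\<^bsub>?D\<^esub>"
      using flow v d unfolding nowhere_identity_dihedral_flow_def group_flow_def by blast
    then have prod: "dart_value ?D \<omega> f d \<otimes>\<^bsub>?D\<^esub> (dart_value ?D \<omega> f ?d1 \<otimes>\<^bsub>?D\<^esub> (dart_value ?D \<omega> f ?d2 \<otimes>\<^bsub>?D\<^esub> \<one>\<^bsub>?D\<^esub>))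
        = \<one>\<^bsub>?D\<^esub>"
      unfolding l by (simp add: numeral_2_eq_2)
    obtain p q r where pqr: "p \<in> V" "dart_value ?D \<omega> f d = dihedral_matrix (fst p) (snd p)" "kind p = col (fst d)"
      "q \<in> V" "dart_value ?D \<omega> f ?d1 = dihedral_matrix (fst q) (snd q)" "kind q = col (fst ?d1)"
      "r \<in> V" "dart_value ?D \<omega> f ?d2 = dihedral_matrix (fst r) (snd r)" "kind r = col (fst ?d2)"
      using dv[OF mem(1)] dv[OF mem(2)] dv[OF mem(3)] by blast
    have "kind p \<noteq> kind q \<and> kind p \<noteq> kind r \<and> kind q \<noteq> kind r"
      using prod pqr unfolding dihedral_one by (intro key) (simp_all add: dihedral_mult dihedral_matrix_eq)
    then show ?thesis unfolding S(1) inj_on_def using pqr by auto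
  qed
  moreover have "col e < 3" for e by (simp add: col_def kind_def)
  ultimately show ?thesis unfolding three_colouring_def by blast
qed

text \<open>The reflections with entries 0 and 1 are involutions, so they look the same at both ends
  of an edge, and their product in this order is the translation by -1. Thus the order 0, 1, 2 works
  where the edge of colour 2 enters, and the reversed order where it leaves. This uses the freedom
  to choose the rotation separately at every vertex.\<close>

lemma flow_of_colouring:
  fixes G :: "('v, 'e) pre_digraph"
  assumes cub: "cubic_graph G" and col: "three_colouring G col"
  shows "\<exists>\<pi>. rotation_system G \<pi> \<and> (\<exists>\<omega> f. nowhere_identity_dihedral_flow 2 G \<pi> \<omega> f)"
proof -
  let ?D = "dihedral_group"
  define f where "f e = (if col e = 2 then dihedral_matrix 1 1 else if col e = 0 then dihedral_matrix (-1) 0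
    else dihedral_matrix (-1) 1)" for e
  define D :: "'v \<Rightarrow> nat \<Rightarrow> 'e \<times> bool" where "D v c = (THE d. d \<in> darts_at G v \<and> col (fst d) = c)" for v c
  \<comment> \<open>\<open>snd (D v 2)\<close> tells whether the translation enters at
    \<open>v\<close>; adding 2 instead of 1 modulo 3 reverses the cyclic order.\<close>
  define \<pi> :: "'v \<Rightarrow> 'e \<times> bool \<Rightarrow> 'e \<times> bool" where "\<pi> v d = D v ((col (fst d) + (if snd (D v 2) then 1 else 2)) mod 3)" for v d
  have bij: "bij_betw (\<lambda>d. col (fst d)) (darts_at G v) {..<3}" if v: "v \<in> verts G" for v
  proof -
    have inj: "inj_on (\<lambda>d. col (fst d)) (darts_at G v)" using col v by (auto simp: three_colouring_def)
    moreover have "(\<lambda>d. col (fst d)) ` darts_at G v \<subseteq> {..<3}"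
      using col by (auto simp: three_colouring_def darts_at_def)
    moreover have "card ((\<lambda>d. col (fst d)) ` darts_at G v) = 3"
      using card_image[OF inj] cub v by (simp add: cubic_graph_def)
    ultimately show ?thesis by (metis bij_betw_def card_lessThan card_subset_eq finite_lessThan)
  qed
  have D: "D v c \<in> darts_at G v \<and> col (fst (D v c)) = c" if "v \<in> verts G" "c < 3" for v c
  proof -
    have "\<exists>!d. d \<in> darts_at G v \<and> col (fst d) = c"
      using bij[OF that(1)] that(2) unfolding bij_betw_def inj_on_def by (metis (mono_tags, lifting) imageE lessThan_iff)
    then show ?thesis unfolding D_def by (rule theI')
  qed
  have DD: "D v (col (fst d)) = d" if "v \<in> verts G" "d \<in> darts_at G v" for v d
  proof -
    have "col (fst d) < 3" using bij[OF that(1)] that(2) by (auto simp: bij_betw_def)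
    then show ?thesis using D[OF that(1)] bij[OF that(1)] that(2) by (meson bij_betw_def inj_onD)
  qed
  have \<pi>D: "\<pi> v (D v c) = D v ((c + (if snd (D v 2) then 1 else 2)) mod 3)" if "v \<in> verts G" "c < 3" for v c
    using D[OF that] by (simp add: \<pi>_def)
  have rot: "rotation_system G \<pi>"
    unfolding rotation_system_def
  proof (intro ballI impI)
    fix v assume v: "v \<in> verts G"
    have all: "darts_at G v = {D v 0, D v 1, D v 2}"
    proof
      show "darts_at G v \<subseteq> {D v 0, D v 1, D v 2}"
      proof
        fix d assume d: "d \<in> darts_at G v"
        have "col (fst d) < 3" using bij[OF v] d by (auto simp: bij_betw_def)
        then have "col (fst d) = 0 \<or> col (fst d) = 1 \<or> col (fst d) = 2" by linarith
        then show "d \<in> {D v 0, D v 1, D v 2}" using DD[OF v d] by auto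
      qed
    qed (use D[OF v] in auto)
    show "cyclic_on (\<pi> v) (darts_at G v)"
    proof (cases "snd (D v 2)")
      case True
      then show ?thesis using all \<pi>D[OF v, of 0] \<pi>D[OF v, of 1] \<pi>D[OF v, of 2]
        by (intro cyclic_on_3I[of _ "D v 0" "D v 1" "D v 2"]) (auto simp: numeral_2_eq_2)
    next
      case False
      then show ?thesis using all \<pi>D[OF v, of 0] \<pi>D[OF v, of 1] \<pi>D[OF v, of 2]
        by (intro cyclic_on_3I[of _ "D v 0" "D v 2" "D v 1"]) (auto simp: numeral_2_eq_2)
    qed
  qed
  have val: "dart_value ?D (\<lambda>_. True) f (D v 0) = dihedral_matrix (-1) 0"
    "dart_value ?D (\<lambda>_. True) f (D v 1) = dihedral_matrix (-1) 1"
    "dart_value ?D (\<lambda>_. True) f (D v 2) = dihedral_matrix 1 (if snd (D v 2) then 1 else -1)"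
    if "v \<in> verts G" for v
    using D[OF that, of 0] D[OF that, of 1] D[OF that, of 2]
    by (auto simp: dart_value_def f_def dihedral_inv split: prod.splits)
  have flow: "group_flow ?D G \<pi> (\<lambda>_. True) f"
    unfolding group_flow_def
  proof (intro conjI ballI)
    fix e show "f e \<in> carrier ?D" by (auto simp: f_def intro!: dihedral_carrier)
  next
    fix v d assume v: "v \<in> verts G" and d: "d \<in> darts_at G v"
    have c3: "card (darts_at G v) = 3" using cub v by (simp add: cubic_graph_def)
    have l: "[0..<card (darts_at G v)] = [0, 1, 2]" by (simp add: c3 upt_rec)
    obtain c where c: "d = D v c" "c < 3" using DD[OF v d] bij[OF v] d by (metis bij_betw_apply lessThan_iff)
    then have c012: "c = 0 \<or> c = 1 \<or> c = 2" by linarith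
    have "dart_value ?D (\<lambda>_. True) f d \<otimes>\<^bsub>?D\<^esub> (dart_value ?D (\<lambda>_. True) f (\<pi> v d) \<otimes>\<^bsub>?D\<^esub>
        (dart_value ?D (\<lambda>_. True) f (\<pi> v (\<pi> v d)) \<otimes>\<^bsub>?D\<^esub> \<one>\<^bsub>?D\<^esub>)) = \<one>\<^bsub>?D\<^esub>"
      using c012 \<pi>D[OF v, of 0] \<pi>D[OF v, of 1] \<pi>D[OF v, of 2] val[OF v] unfolding c(1)
      by (elim disjE; cases "snd (D v 2)")
        (simp_all add: dihedral_mult dihedral_one dihedral_matrix_eq flip: numeral_2_eq_2)
    then show "foldr (\<lambda>x y. x \<otimes>\<^bsub>?D\<^esub> y)
          (map (\<lambda>i. dart_value ?D (\<lambda>_. True) f ((\<pi> v ^^ i) d)) [0..<card (darts_at G v)]) \<one>\<^bsub>?D\<^esub> = \<one>\<^bsub>?D\<^esub>"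
      unfolding l by (simp add: numeral_2_eq_2)
  qed
  have "f e \<noteq> \<one>\<^bsub>?D\<^esub> \<and> f e \<in> dihedral_below 2" for e
    by (force simp: f_def dihedral_one dihedral_matrix_eq dihedral_below_def)
  then have "nowhere_identity_dihedral_flow 2 G \<pi> (\<lambda>_. True) f"
    using flow by (simp add: nowhere_identity_dihedral_flow_def)
  then show ?thesis using rot by blast
qed

lemma flow_iff_three_colouring:
  assumes "cubic_graph G"
  shows "(\<exists>\<pi>. rotation_system G \<pi> \<and> (\<exists>\<omega> f. nowhere_identity_dihedral_flow 2 G \<pi> \<omega> f)) \<longleftrightarrow>
    (\<exists>col. three_colouring G col)"
  using colouring_of_flow flow_of_colouring assms by blast

section \<open>First-order definable conditions and list-producing loops\<close>

text \<open>Variables range over the positions of a word, the last one excluded. In the compiled machine a variable is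
  a head on its own copy of the word; this is why \<open>wff\<close> allocates bound variables in increasing order and wants
  the variables of \<open>Plus\<close> distinct.\<close>

datatype fm = Sym nat nat | Plus nat nat nat | Neg fm | And fm fm | Ex nat fm

fun evf :: "fm \<Rightarrow> nat list \<Rightarrow> (nat \<Rightarrow> nat) \<Rightarrow> bool" where
  "evf (Sym r s) ws \<sigma> \<longleftrightarrow> ws ! \<sigma> r = s"
| "evf (Plus a b c) ws \<sigma> \<longleftrightarrow> \<sigma> a + \<sigma> b = \<sigma> c"
| "evf (Neg \<phi>) ws \<sigma> \<longleftrightarrow> \<not> evf \<phi> ws \<sigma>"
| "evf (And \<phi> \<psi>) ws \<sigma> \<longleftrightarrow> evf \<phi> ws \<sigma> \<and> evf \<psi> ws \<sigma>"
| "evf (Ex r \<phi>) ws \<sigma> \<longleftrightarrow> (\<exists>i<length ws - 1. evf \<phi> ws (\<sigma>(r := i)))"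

fun wff :: "nat \<Rightarrow> fm \<Rightarrow> bool" where
  "wff k (Sym r s) \<longleftrightarrow> r < k"
| "wff k (Plus a b c) \<longleftrightarrow> a < k \<and> b < k \<and> c < k \<and> a \<noteq> b \<and> a \<noteq> c \<and> b \<noteq> c"
| "wff k (Neg \<phi>) \<longleftrightarrow> wff k \<phi>"
| "wff k (And \<phi> \<psi>) \<longleftrightarrow> wff k \<phi> \<and> wff k \<psi>"
| "wff k (Ex r \<phi>) \<longleftrightarrow> k \<le> r \<and> wff (Suc r) \<phi>"

text \<open>All loops are bounded by the length of the word, so every fixed generator has polynomial
  run time and output.\<close>

datatype gn = GNil | Emit bool | Cat gn gn | GIf fm gn gn | For nat gn

fun og :: "gn \<Rightarrow> nat list \<Rightarrow> (nat \<Rightarrow> nat) \<Rightarrow> bool list" where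
  "og GNil ws \<sigma> = []"
| "og (Emit b) ws \<sigma> = [b]"
| "og (Cat g h) ws \<sigma> = og g ws \<sigma> @ og h ws \<sigma>"
| "og (GIf \<phi> g h) ws \<sigma> = (if evf \<phi> ws \<sigma> then og g ws \<sigma> else og h ws \<sigma>)"
| "og (For r g) ws \<sigma> = concat (map (\<lambda>i. og g ws (\<sigma>(r := i))) [0..<length ws - 1])"

fun wfg :: "nat \<Rightarrow> gn \<Rightarrow> bool" where
  "wfg k GNil \<longleftrightarrow> True"
| "wfg k (Emit b) \<longleftrightarrow> True"
| "wfg k (Cat g h) \<longleftrightarrow> wfg k g \<and> wfg k h"
| "wfg k (GIf \<phi> g h) \<longleftrightarrow> wff k \<phi> \<and> wfg k g \<and> wfg k h"
| "wfg k (For r g) \<longleftrightarrow> k \<le> r \<and> wfg (Suc r) g"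

definition bitn :: "bool \<Rightarrow> nat" where
  "bitn b = (if b then 2 else 1)"

text \<open>The letters of the two words are written as on the input tapes of a machine; 3, 4 and 5 mark the start, the
  separator and the end.\<close>

definition label :: "bool list \<Rightarrow> bool list \<Rightarrow> nat list" where
  "label x u = 3 # map bitn x @ [4] @ map bitn u @ [5]"

lemma length_label [simp]: "length (label x u) = length x + length u + 3"
  by (simp add: label_def)

text \<open>The marks are where heads stop: \<open>3\<close> ends a rewind and \<open>5\<close> ends
  a loop, so they must not occur in between.\<close>

definition marked :: "nat list \<Rightarrow> bool" where
  "marked ws \<longleftrightarrow> (\<exists>mid. ws = 3 # mid @ [5] \<and> set mid \<subseteq> {0, 1, 2, 4})"

lemma marked_label: "marked (label x u)"
  unfolding marked_def label_def by (intro exI[of _ "map bitn x @ [4] @ map bitn u"]) (auto simp: bitn_def)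

lemma marked_nth:
  assumes "marked ws" "i < length ws"
  shows "ws ! i = 3 \<longleftrightarrow> i = 0" "ws ! i = 5 \<longleftrightarrow> i = length ws - 1"
proof -
  obtain mid where ws: "ws = 3 # mid @ [5]" "set mid \<subseteq> {0, 1, 2, 4}"
    using assms(1) by (auto simp: marked_def)
  have mem: "j < length mid \<Longrightarrow> mid ! j \<in> {0, 1, 2, 4}" for j using ws(2) nth_mem by blast
  show "ws ! i = 3 \<longleftrightarrow> i = 0" "ws ! i = 5 \<longleftrightarrow> i = length ws - 1"
    using assms(2) mem[of "i - 1"] by (auto simp: ws(1) nth_Cons' nth_append)
qed

lemma marked_hd: "marked ws \<Longrightarrow> ws ! 0 = 3 \<and> ws \<noteq> []"
  by (auto simp: marked_def)

lemma marked_length: "marked ws \<Longrightarrow> 2 \<le> length ws"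
  by (auto simp: marked_def)

subsection \<open>Tapes with a fixed content\<close>

definition tp :: "nat list \<Rightarrow> nat \<Rightarrow> tape" where
  "tp ws i = (\<lambda>z. if 0 \<le> int i + z \<and> nat (int i + z) < length ws then ws ! nat (int i + z) else 0)"

lemma tp_0 [simp]: "i < length ws \<Longrightarrow> tp ws i 0 = ws ! i"
  by (simp add: tp_def)

lemma write_move_same: "write_move (t 0, d) t = (\<lambda>z. t (z + d))"
  by (auto simp: write_move_def)

lemma tp_right: "write_move (tp ws i 0, 1) (tp ws i) = tp ws (Suc i)"
  unfolding write_move_same by (simp add: tp_def fun_eq_iff algebra_simps)

lemma tp_left: "0 < i \<Longrightarrow> write_move (tp ws i 0, -1) (tp ws i) = tp ws (i - 1)"
  unfolding write_move_same by (simp add: tp_def fun_eq_iff of_nat_diff algebra_simps)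

lemma tp_append: "write_move (s, 1) (tp ws (length ws)) = tp (ws @ [s]) (Suc (length ws))"
proof
  fix z :: int
  consider "z = -1" | "z < -1" | "z > -1" by linarith
  then show "write_move (s, 1) (tp ws (length ws)) z = tp (ws @ [s]) (Suc (length ws)) z"
    by cases (auto simp: write_move_def tp_def nth_append algebra_simps)
qed

lemma tp_blank: "tp [] 0 = (\<lambda>_. 0)"
  by (simp add: tp_def)

definition regs :: "nat \<Rightarrow> nat list \<Rightarrow> (nat \<Rightarrow> nat) \<Rightarrow> tape list" where
  "regs m ws \<sigma> = map (\<lambda>r. tp ws (\<sigma> r)) [0..<m]"

text \<open>\<open>pre\<close> holds the output tape, the second input tape and the flag tape,
  possibly followed by tapes of earlier phases. The middle tapes are the variables, and
  \<open>post\<close> is left for later phases.\<close>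

abbreviation cfg :: "tape list \<Rightarrow> nat \<Rightarrow> nat list \<Rightarrow> (nat \<Rightarrow> nat) \<Rightarrow> tape list \<Rightarrow> tape list" where
  "cfg pre m ws \<sigma> post \<equiv> pre @ regs m ws \<sigma> @ post"

lemma length_regs [simp]: "length (regs m ws \<sigma>) = m"
  by (simp add: regs_def)

lemma regs_nth [simp]:
  "r < m \<Longrightarrow> (regs m ws \<sigma> @ post) ! r = tp ws (\<sigma> r)"
  by (simp add: nth_append regs_def)

lemma scan_cfg [simp]:
  "r < m \<Longrightarrow> \<sigma> r < length ws \<Longrightarrow> scan (cfg pre m ws \<sigma> post) ! (length pre + r) = ws ! \<sigma> r"
  by (simp add: nth_append regs_def)

lemma cfg_update:
  "r < m \<Longrightarrow> (cfg pre m ws \<sigma> post)[length pre + r := tp ws i] = cfg pre m ws (\<sigma>(r := i)) post"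
  by (rule nth_equalityI) (auto simp: regs_def nth_append nth_list_update)

definition mv :: "nat \<Rightarrow> int \<Rightarrow> prog" where
  "mv r d = Act r (\<lambda>s. (s, d))"

lemma runs_right:
  "r < m \<Longrightarrow> \<beta> = length pre \<Longrightarrow>
    runs (mv (\<beta> + r) 1) (cfg pre m ws \<sigma> post) (cfg pre m ws (\<sigma>(r := Suc (\<sigma> r))) post) 1"
  unfolding mv_def by (rule runs_Act) (simp add: cfg_update tp_right)

lemma runs_left:
  "r < m \<Longrightarrow> \<beta> = length pre \<Longrightarrow> 0 < \<sigma> r \<Longrightarrow>
    runs (mv (\<beta> + r) (-1)) (cfg pre m ws \<sigma> post) (cfg pre m ws (\<sigma>(r := \<sigma> r - 1)) post) 1"
  unfolding mv_def by (rule runs_Act) (simp add: cfg_update tp_left)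

definition flg :: "bool \<Rightarrow> tape \<Rightarrow> tape" where
  "flg b t = t(0 := bitn b)"

lemma flg_flg [simp]: "flg b (flg c t) = flg b t"
  by (simp add: flg_def)

lemma flg_0 [simp]: "flg b t 0 = bitn b"
  by (simp add: flg_def)

lemma bitn_eq [simp]: "bitn b = 2 \<longleftrightarrow> b" "bitn b = Suc 0 \<longleftrightarrow> \<not> b" "bitn b \<noteq> 0"
  by (auto simp: bitn_def)

lemma write_stay: "write_move (s, 0) t = t(0 := s)"
  by (auto simp: write_move_def)

definition setf :: "bool \<Rightarrow> prog" where
  "setf b = Act 2 (\<lambda>_. (bitn b, 0))"

lemma runs_setf:
  "3 \<le> length pre \<Longrightarrow> runs (setf b) (pre @ ts) (pre[2 := flg b (pre ! 2)] @ ts) 1"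
  unfolding setf_def
  by (rule runs_Act) (simp add: flg_def write_stay nth_append list_update_append)

definition rew :: "nat \<Rightarrow> prog" where
  "rew r = While (\<lambda>a. a ! r \<noteq> 3) (mv r (-1))"

lemma runs_rew:
  assumes "r < m" "\<beta> = length pre" "marked ws" "\<sigma> r < length ws"
  shows "runs (rew (\<beta> + r)) (cfg pre m ws \<sigma> post) (cfg pre m ws (\<sigma>(r := 0)) post) (length ws * 3 + 1)"
proof -
  define s where "s i = cfg pre m ws (\<sigma>(r := \<sigma> r - i)) post" for i
  have "runs (rew (\<beta> + r)) (s 0) (s (\<sigma> r)) (\<sigma> r * (1 + 2) + 1)"
    unfolding rew_def
  proof (rule runs_While)
    fix i assume i: "i < \<sigma> r"
    have "ws ! (\<sigma> r - i) \<noteq> 3" using marked_nth(1)[OF assms(3), of "\<sigma> r - i"] assms i by auto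
    moreover have "runs (mv (\<beta> + r) (-1)) (s i) (s (Suc i)) 1"
      using runs_left[of r m \<beta> pre "\<sigma>(r := \<sigma> r - i)" ws post] assms i by (simp add: s_def)
    ultimately show "scan (s i) ! (\<beta> + r) \<noteq> 3 \<and> runs (mv (\<beta> + r) (-1)) (s i) (s (Suc i)) 1"
      using assms by (simp add: s_def del: map_append)
  next
    show "\<not> scan (s (\<sigma> r)) ! (\<beta> + r) \<noteq> 3"
      using assms marked_hd[OF assms(3)] by (simp add: s_def del: map_append)
  qed
  moreover have "s 0 = cfg pre m ws \<sigma> post" "s (\<sigma> r) = cfg pre m ws (\<sigma>(r := 0)) post" by (simp_all add: s_def)
  ultimately show ?thesis using runs_mono[of _ _ _ "\<sigma> r * (1 + 2) + 1"] assms(4) by simp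
qed

subsection \<open>Compilation of conditions\<close>

definition lock :: "nat \<Rightarrow> nat \<Rightarrow> nat \<Rightarrow> prog" where
  "lock a c k = While (\<lambda>s. s ! a \<noteq> 3 \<and> s ! c \<noteq> 3) (Seq (mv a (-1)) (Seq (mv c (-1)) (mv k 1)))"

definition unlock :: "nat \<Rightarrow> nat \<Rightarrow> nat \<Rightarrow> prog" where
  "unlock a c k = While (\<lambda>s. s ! k \<noteq> 3) (Seq (mv a 1) (Seq (mv c 1) (mv k (-1))))"

lemma runs_lock:
  assumes "a < m" "c < m" "k < m" "a \<noteq> c" "a \<noteq> k" "c \<noteq> k" "\<beta> = length pre" "marked ws"
    "\<sigma> a < length ws" "\<sigma> c < length ws" "\<sigma> k = 0" "d = min (\<sigma> a) (\<sigma> c)"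
  shows "runs (lock (\<beta> + a) (\<beta> + c) (\<beta> + k)) (cfg pre m ws \<sigma> post)
    (cfg pre m ws (\<sigma>(a := \<sigma> a - d, c := \<sigma> c - d, k := d)) post) (length ws * 5 + 1)"
proof -
  define s where "s i = cfg pre m ws (\<sigma>(a := \<sigma> a - i, c := \<sigma> c - i, k := i)) post" for i
  have "runs (lock (\<beta> + a) (\<beta> + c) (\<beta> + k)) (s 0) (s d) (d * (3 + 2) + 1)"
    unfolding lock_def
  proof (rule runs_While)
    fix i assume i: "i < d"
    let ?\<sigma> = "\<sigma>(a := \<sigma> a - i, c := \<sigma> c - i, k := i)"
    have "ws ! (\<sigma> a - i) \<noteq> 3" "ws ! (\<sigma> c - i) \<noteq> 3"
      using marked_nth(1)[OF assms(8), of "\<sigma> a - i"] marked_nth(1)[OF assms(8), of "\<sigma> c - i"] assms i by auto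
    moreover have "runs (Seq (mv (\<beta> + a) (-1)) (Seq (mv (\<beta> + c) (-1)) (mv (\<beta> + k) 1))) (s i) (s (Suc i)) (1 + (1 + 1))"
    proof (intro runs_Seq)
      show "runs (mv (\<beta> + a) (-1)) (s i) (cfg pre m ws (?\<sigma>(a := \<sigma> a - Suc i)) post) 1"
        using runs_left[of a m \<beta> pre ?\<sigma> ws post] assms i by (simp add: s_def fun_upd_twist)
      show "runs (mv (\<beta> + c) (-1)) (cfg pre m ws (?\<sigma>(a := \<sigma> a - Suc i)) post)
          (cfg pre m ws (?\<sigma>(a := \<sigma> a - Suc i, c := \<sigma> c - Suc i)) post) 1"
        using runs_left[of c m \<beta> pre "?\<sigma>(a := \<sigma> a - Suc i)" ws post] assms i by simp
      have "?\<sigma>(a := \<sigma> a - Suc i, c := \<sigma> c - Suc i, k := Suc i) =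
          \<sigma>(a := \<sigma> a - Suc i, c := \<sigma> c - Suc i, k := Suc i)" by auto
      then show "runs (mv (\<beta> + k) 1) (cfg pre m ws (?\<sigma>(a := \<sigma> a - Suc i, c := \<sigma> c - Suc i)) post) (s (Suc i)) 1"
        using runs_right[of k m \<beta> pre ws "?\<sigma>(a := \<sigma> a - Suc i, c := \<sigma> c - Suc i)" post] assms i
        by (simp add: s_def)
    qed
    ultimately show "(scan (s i) ! (\<beta> + a) \<noteq> 3 \<and> scan (s i) ! (\<beta> + c) \<noteq> 3) \<and>
        runs (Seq (mv (\<beta> + a) (-1)) (Seq (mv (\<beta> + c) (-1)) (mv (\<beta> + k) 1))) (s i) (s (Suc i)) 3"
      using assms i by (simp add: s_def less_imp_diff_less numeral_3_eq_3 del: map_append)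
  next
    have "d = \<sigma> a \<or> d = \<sigma> c" using assms(12) by (simp add: min_def)
    then show "\<not> (scan (s d) ! (\<beta> + a) \<noteq> 3 \<and> scan (s d) ! (\<beta> + c) \<noteq> 3)"
      using assms(1-10) marked_hd[OF assms(8)] by (elim disjE) (simp_all add: s_def del: map_append)
  qed
  moreover have "s 0 = cfg pre m ws \<sigma> post" using assms by (simp add: s_def fun_upd_idem)
  ultimately show ?thesis using runs_mono[of _ _ _ "d * (3 + 2) + 1"] assms by (simp add: s_def)
qed

lemma runs_unlock:
  assumes "a < m" "c < m" "k < m" "a \<noteq> c" "a \<noteq> k" "c \<noteq> k" "\<beta> = length pre" "marked ws" "\<sigma> k < length ws"
  shows "runs (unlock (\<beta> + a) (\<beta> + c) (\<beta> + k)) (cfg pre m ws \<sigma> post)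
    (cfg pre m ws (\<sigma>(a := \<sigma> a + \<sigma> k, c := \<sigma> c + \<sigma> k, k := 0)) post) (length ws * 5 + 1)"
proof -
  define s where "s i = cfg pre m ws (\<sigma>(a := \<sigma> a + i, c := \<sigma> c + i, k := \<sigma> k - i)) post" for i
  have "runs (unlock (\<beta> + a) (\<beta> + c) (\<beta> + k)) (s 0) (s (\<sigma> k)) (\<sigma> k * (3 + 2) + 1)"
    unfolding unlock_def
  proof (rule runs_While)
    fix i assume i: "i < \<sigma> k"
    let ?\<sigma> = "\<sigma>(a := \<sigma> a + i, c := \<sigma> c + i, k := \<sigma> k - i)"
    have "ws ! (\<sigma> k - i) \<noteq> 3"
      using marked_nth(1)[OF assms(8), of "\<sigma> k - i"] assms i by auto
    moreover have "runs (Seq (mv (\<beta> + a) 1) (Seq (mv (\<beta> + c) 1) (mv (\<beta> + k) (-1)))) (s i) (s (Suc i)) (1 + (1 + 1))"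
    proof (intro runs_Seq)
      show "runs (mv (\<beta> + a) 1) (s i) (cfg pre m ws (?\<sigma>(a := \<sigma> a + Suc i)) post) 1"
        using runs_right[of a m \<beta> pre ws ?\<sigma> post] assms i by (simp add: s_def fun_upd_twist)
      show "runs (mv (\<beta> + c) 1) (cfg pre m ws (?\<sigma>(a := \<sigma> a + Suc i)) post)
          (cfg pre m ws (?\<sigma>(a := \<sigma> a + Suc i, c := \<sigma> c + Suc i)) post) 1"
        using runs_right[of c m \<beta> pre ws "?\<sigma>(a := \<sigma> a + Suc i)" post] assms i by simp
      have "?\<sigma>(a := \<sigma> a + Suc i, c := \<sigma> c + Suc i, k := \<sigma> k - Suc i) =
          \<sigma>(a := \<sigma> a + Suc i, c := \<sigma> c + Suc i, k := \<sigma> k - Suc i)" by auto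
      then show "runs (mv (\<beta> + k) (-1)) (cfg pre m ws (?\<sigma>(a := \<sigma> a + Suc i, c := \<sigma> c + Suc i)) post) (s (Suc i)) 1"
        using runs_left[of k m \<beta> pre "?\<sigma>(a := \<sigma> a + Suc i, c := \<sigma> c + Suc i)" ws post] assms i
        by (simp add: s_def)
    qed
    ultimately show "scan (s i) ! (\<beta> + k) \<noteq> 3 \<and>
        runs (Seq (mv (\<beta> + a) 1) (Seq (mv (\<beta> + c) 1) (mv (\<beta> + k) (-1)))) (s i) (s (Suc i)) 3"
      using assms i by (simp add: s_def less_imp_diff_less numeral_3_eq_3 del: map_append)
  next
    show "\<not> (scan (s (\<sigma> k)) ! (\<beta> + k) \<noteq> 3)"
      using assms marked_hd[OF assms(8)] by (simp add: s_def del: map_append)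
  qed
  moreover have "s 0 = cfg pre m ws \<sigma> post" using assms by (simp add: s_def fun_upd_idem)
  ultimately show ?thesis using runs_mono[of _ _ _ "\<sigma> k * (3 + 2) + 1"] assms by (simp add: s_def)
qed

text \<open>Tape 2 carries the truth value, and tape \<open>\<beta> + r\<close> the variable \<open>r\<close>. Addition is tested by moving the head of the
  sum to the left together with each summand; two spare heads remember the distances.\<close>

fun cf :: "nat \<Rightarrow> nat \<Rightarrow> fm \<Rightarrow> prog" where
  "cf \<beta> k (Sym r s) = Cond (\<lambda>a. a ! (\<beta> + r) = s) (setf True) (setf False)"
| "cf \<beta> k (Plus a b c) = Seq (lock (\<beta> + a) (\<beta> + c) (\<beta> + k)) (Seq (lock (\<beta> + b) (\<beta> + c) (\<beta> + Suc k))
     (Seq (Cond (\<lambda>s. s ! (\<beta> + a) = 3 \<and> s ! (\<beta> + b) = 3 \<and> s ! (\<beta> + c) = 3) (setf True) (setf False))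
     (Seq (unlock (\<beta> + b) (\<beta> + c) (\<beta> + Suc k)) (unlock (\<beta> + a) (\<beta> + c) (\<beta> + k)))))"
| "cf \<beta> k (Neg \<phi>) = Seq (cf \<beta> k \<phi>) (Cond (\<lambda>a. a ! 2 = 2) (setf False) (setf True))"
| "cf \<beta> k (And \<phi> \<psi>) = Seq (cf \<beta> k \<phi>) (Cond (\<lambda>a. a ! 2 = 2) (cf \<beta> k \<psi>) (setf False))"
| "cf \<beta> k (Ex r \<phi>) = Seq (setf False) (Seq (While (\<lambda>a. a ! (\<beta> + r) \<noteq> 5 \<and> a ! 2 \<noteq> 2)
     (Seq (cf \<beta> (Suc r) \<phi>) (mv (\<beta> + r) 1))) (rew (\<beta> + r)))"

text \<open>Bounds the variable tapes in use; \<open>Plus\<close> needs two spare heads on top of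
  the variables in scope.\<close>

fun nrf :: "nat \<Rightarrow> fm \<Rightarrow> nat" where
  "nrf k (Sym r s) = k"
| "nrf k (Plus a b c) = k + 2"
| "nrf k (Neg \<phi>) = nrf k \<phi>"
| "nrf k (And \<phi> \<psi>) = max (nrf k \<phi>) (nrf k \<psi>)"
| "nrf k (Ex r \<phi>) = nrf (Suc r) \<phi>"

lemma nrf_ge: "wff k \<phi> \<Longrightarrow> k \<le> nrf k \<phi>"
  by (induction \<phi> arbitrary: k) (auto simp: le_max_iff_disj dest!: Suc_leD intro: order_trans)

fun tf :: "fm \<Rightarrow> nat \<Rightarrow> nat" where
  "tf (Sym r s) L = 3"
| "tf (Plus a b c) L = 4 * (L * 5 + 1) + 3"
| "tf (Neg \<phi>) L = tf \<phi> L + 3"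
| "tf (And \<phi> \<psi>) L = tf \<phi> L + (tf \<psi> L + 1 + 2)"
| "tf (Ex r \<phi>) L = 1 + (L * (tf \<phi> L + 1 + 2) + 1) + (L * 3 + 1)"

lemma wfp_mv [simp]: "r < K \<Longrightarrow> d \<in> {-1, 0, 1} \<Longrightarrow> wfp K (mv r d)"
  by (auto simp: mv_def)

lemma wfp_setf [simp]: "wfp K (setf b) \<longleftrightarrow> 2 < K"
  by (auto simp: setf_def bitn_def)

lemma wfp_cf: "wff k \<phi> \<Longrightarrow> 3 \<le> \<beta> \<Longrightarrow> \<beta> + nrf k \<phi> \<le> K \<Longrightarrow> wfp K (cf \<beta> k \<phi>)"
proof (induction \<phi> arbitrary: k)
  case (Ex r \<phi>)
  then show ?case using nrf_ge[of "Suc r" \<phi>] by (auto simp: rew_def)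
qed (auto simp: lock_def unlock_def)

text \<open>Registers from \<open>k\<close> on rest at position 0 before and after every subformula.
  So a quantifier can start its loop, and \<open>Plus\<close> can use its spare heads, without
  knowing what ran before.\<close>

lemma cf_correct:
  assumes "wff k \<phi>" "nrf k \<phi> \<le> m" "3 \<le> length pre" "marked ws"
    "\<And>r. r < k \<Longrightarrow> \<sigma> r < length ws - 1" "\<And>r. k \<le> r \<Longrightarrow> \<sigma> r = 0"
  shows "runs (cf (length pre) k \<phi>) (cfg pre m ws \<sigma> post)
    (cfg (pre[2 := flg (evf \<phi> ws \<sigma>) (pre ! 2)]) m ws \<sigma> post) (tf \<phi> (length ws))"
  using assms
proof (induction \<phi> arbitrary: k \<sigma> pre)
  case (Sym r s)
  then have "r < m" "\<sigma> r < length ws" by (auto dest: less_imp_diff_less) (metis diff_le_self less_le_trans)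
  then have "runs (cf (length pre) k (Sym r s)) (cfg pre m ws \<sigma> post)
    (cfg (pre[2 := flg (evf (Sym r s) ws \<sigma>) (pre ! 2)]) m ws \<sigma> post) (1 + 2)"
    unfolding cf.simps
    by (intro runs_Cond) (use Sym runs_setf in \<open>auto simp del: map_append\<close>)
  then show ?case by (simp add: numeral_3_eq_3)
next
  case (Plus a b c)
  let ?\<beta> = "length pre"
  define d where "d = min (\<sigma> a) (\<sigma> c)"
  define e where "e = min (\<sigma> b) (\<sigma> c - d)"
  define \<sigma>1 where "\<sigma>1 = \<sigma>(a := \<sigma> a - d, c := \<sigma> c - d, k := d)"
  define \<sigma>2 where "\<sigma>2 = \<sigma>1(b := \<sigma>1 b - e, c := \<sigma>1 c - e, Suc k := e)"
  define pre' where "pre' = pre[2 := flg (evf (Plus a b c) ws \<sigma>) (pre ! 2)]"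
  have P: "a < k" "b < k" "c < k" "a \<noteq> b" "a \<noteq> c" "b \<noteq> c" "Suc (Suc k) \<le> m" "3 \<le> length pre" "marked ws"
    "\<sigma> k = 0" "\<sigma> (Suc k) = 0"
    using Plus.prems(1-4) Plus.prems(6)[of k] Plus.prems(6)[of "Suc k"] by auto
  have lt: "\<sigma> a < length ws" "\<sigma> b < length ws" "\<sigma> c < length ws"
    using Plus.prems(1) Plus.prems(5)[of a] Plus.prems(5)[of b] Plus.prems(5)[of c] by auto
  have lt2: "\<sigma>2 k < length ws" "\<sigma>2 (Suc k) < length ws" "\<sigma>2 a < length ws" "\<sigma>2 b < length ws" "\<sigma>2 c < length ws"
    using P lt by (auto simp: \<sigma>2_def \<sigma>1_def d_def e_def)
  have 1: "runs (lock (?\<beta> + a) (?\<beta> + c) (?\<beta> + k)) (cfg pre m ws \<sigma> post) (cfg pre m ws \<sigma>1 post) (length ws * 5 + 1)"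
    unfolding \<sigma>1_def using P lt by (intro runs_lock) (auto simp: d_def)
  have 2: "runs (lock (?\<beta> + b) (?\<beta> + c) (?\<beta> + Suc k)) (cfg pre m ws \<sigma>1 post) (cfg pre m ws \<sigma>2 post) (length ws * 5 + 1)"
    unfolding \<sigma>2_def using P lt
    by (intro runs_lock) (auto simp: \<sigma>1_def e_def)
  \<comment> \<open>Truncated subtraction loses information only if a summand exceeds what is left
    of \<open>c\<close>, and then a positive remainder stays on the summand. So all three heads
    reach 0 exactly if the sum is right.\<close>
  have val: "evf (Plus a b c) ws \<sigma> \<longleftrightarrow> \<sigma>2 a = 0 \<and> \<sigma>2 b = 0 \<and> \<sigma>2 c = 0"
    using P by (auto simp: \<sigma>2_def \<sigma>1_def d_def e_def min_def)
  have 3: "runs (Cond (\<lambda>s. s ! (?\<beta> + a) = 3 \<and> s ! (?\<beta> + b) = 3 \<and> s ! (?\<beta> + c) = 3) (setf True) (setf False))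
      (cfg pre m ws \<sigma>2 post) (cfg pre' m ws \<sigma>2 post) (1 + 2)"
  proof -
    have *: "scan (cfg pre m ws \<sigma>2 post) ! (?\<beta> + a) = 3 \<and> scan (cfg pre m ws \<sigma>2 post) ! (?\<beta> + b) = 3 \<and>
       scan (cfg pre m ws \<sigma>2 post) ! (?\<beta> + c) = 3 \<longleftrightarrow> evf (Plus a b c) ws \<sigma>"
      unfolding val using P lt2 marked_nth(1)[OF Plus.prems(4)] by (simp del: map_append)
    show ?thesis
      by (rule runs_Cond; unfold *; use runs_setf P in \<open>auto simp: pre'_def\<close>)
  qed
  have 4: "runs (unlock (?\<beta> + b) (?\<beta> + c) (?\<beta> + Suc k)) (cfg pre' m ws \<sigma>2 post)
      (cfg pre' m ws (\<sigma>2(b := \<sigma>2 b + \<sigma>2 (Suc k), c := \<sigma>2 c + \<sigma>2 (Suc k), Suc k := 0)) post) (length ws * 5 + 1)"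
    using P lt2 by (intro runs_unlock) (auto simp: pre'_def)
  have e4: "\<sigma>2(b := \<sigma>2 b + \<sigma>2 (Suc k), c := \<sigma>2 c + \<sigma>2 (Suc k), Suc k := 0) = \<sigma>1"
    using P by (auto simp: \<sigma>2_def \<sigma>1_def d_def e_def min_def fun_eq_iff)
  have 5: "runs (unlock (?\<beta> + a) (?\<beta> + c) (?\<beta> + k)) (cfg pre' m ws \<sigma>1 post)
      (cfg pre' m ws (\<sigma>1(a := \<sigma>1 a + \<sigma>1 k, c := \<sigma>1 c + \<sigma>1 k, k := 0)) post) (length ws * 5 + 1)"
    using P lt by (intro runs_unlock) (auto simp: pre'_def \<sigma>1_def d_def)
  have e5: "\<sigma>1(a := \<sigma>1 a + \<sigma>1 k, c := \<sigma>1 c + \<sigma>1 k, k := 0) = \<sigma>"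
    using P by (auto simp: \<sigma>1_def d_def min_def fun_eq_iff)
  have "(length ws * 5 + 1) + ((length ws * 5 + 1) + ((1 + 2) + ((length ws * 5 + 1) + (length ws * 5 + 1)))) =
      4 * (length ws * 5 + 1) + 3" by simp
  with runs_Seq[OF 1 runs_Seq[OF 2 runs_Seq[OF 3 runs_Seq[OF 4[unfolded e4] 5[unfolded e5]]]]]
  show ?case by (simp only: pre'_def cf.simps tf.simps)
next
  case (Neg \<phi>)
  have "runs (Cond (\<lambda>a. a ! 2 = 2) (setf False) (setf True))
      (cfg (pre[2 := flg (evf \<phi> ws \<sigma>) (pre ! 2)]) m ws \<sigma> post)
      (cfg (pre[2 := flg (\<not> evf \<phi> ws \<sigma>) (pre ! 2)]) m ws \<sigma> post) (1 + 2)"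
    using runs_setf[of "pre[2 := flg (evf \<phi> ws \<sigma>) (pre ! 2)]" "\<not> evf \<phi> ws \<sigma>"] Neg.prems
    by (intro runs_Cond) (auto simp: nth_append)
  moreover have "runs (cf (length pre) k \<phi>) (cfg pre m ws \<sigma> post)
      (cfg (pre[2 := flg (evf \<phi> ws \<sigma>) (pre ! 2)]) m ws \<sigma> post) (tf \<phi> (length ws))"
    using Neg.prems by (intro Neg.IH) auto
  ultimately have "runs (cf (length pre) k (Neg \<phi>)) (cfg pre m ws \<sigma> post)
      (cfg (pre[2 := flg (\<not> evf \<phi> ws \<sigma>) (pre ! 2)]) m ws \<sigma> post) (tf \<phi> (length ws) + (1 + 2))"
    unfolding cf.simps by (intro runs_Seq)
  then show ?case by (simp add: numeral_3_eq_3)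
next
  case (And \<phi> \<psi>)
  let ?pre = "pre[2 := flg (evf \<phi> ws \<sigma>) (pre ! 2)]"
  have "runs (Cond (\<lambda>a. a ! 2 = 2) (cf (length ?pre) k \<psi>) (setf False))
      (cfg ?pre m ws \<sigma> post)
      (cfg (pre[2 := flg (evf (And \<phi> \<psi>) ws \<sigma>) (pre ! 2)]) m ws \<sigma> post) (tf \<psi> (length ws) + 1 + 2)"
  proof (rule runs_Cond)
    assume "scan (cfg ?pre m ws \<sigma> post) ! 2 = 2"
    then have "evf \<phi> ws \<sigma>" using And.prems by (simp add: nth_append)
    then show "runs (cf (length ?pre) k \<psi>) (cfg ?pre m ws \<sigma> post)
        (cfg (pre[2 := flg (evf (And \<phi> \<psi>) ws \<sigma>) (pre ! 2)]) m ws \<sigma> post) (tf \<psi> (length ws) + 1)"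
      using And.IH(2)[of k ?pre \<sigma>] And.prems by (auto intro: runs_mono)
  next
    assume "scan (cfg ?pre m ws \<sigma> post) ! 2 \<noteq> 2"
    then have "\<not> evf \<phi> ws \<sigma>" using And.prems by (simp add: nth_append)
    then show "runs (setf False) (cfg ?pre m ws \<sigma> post)
        (cfg (pre[2 := flg (evf (And \<phi> \<psi>) ws \<sigma>) (pre ! 2)]) m ws \<sigma> post) (tf \<psi> (length ws) + 1)"
      using runs_setf[of ?pre False] And.prems by (auto intro: runs_mono)
  qed
  moreover have 1: "runs (cf (length pre) k \<phi>) (cfg pre m ws \<sigma> post) (cfg ?pre m ws \<sigma> post) (tf \<phi> (length ws))"
    using And.prems by (intro And.IH(1)) auto
  ultimately show ?case using runs_Seq[OF 1] by (simp only: cf.simps tf.simps length_list_update)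
next
  case (Ex r \<phi>)
  let ?\<beta> = "length pre" and ?L = "length ws - 1"
  have r: "r < m" "k \<le> r" "wff (Suc r) \<phi>" using Ex.prems nrf_ge[of "Suc r" \<phi>] by auto
  have L: "2 \<le> length ws" using Ex.prems marked_length by auto
  define P where "P i = evf \<phi> ws (\<sigma>(r := i))" for i
  define s where "s i = cfg (pre[2 := flg (0 < i \<and> P (i - 1)) (pre ! 2)]) m ws (\<sigma>(r := i)) post" for i
  \<comment> \<open>\<open>N\<close> is the number of rounds: one past the first witness, or all
    positions if there is none. After \<open>i\<close> rounds the flag shows the value at position
    \<open>i - 1\<close>.\<close>
  obtain N where N: "N \<le> ?L" "\<And>i. 0 < i \<Longrightarrow> i < N \<Longrightarrow> \<not> P (i - 1)" "N = ?L \<or> (0 < N \<and> P (N - 1))"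
    "(0 < N \<and> P (N - 1)) \<longleftrightarrow> (\<exists>i<?L. P i)"
  proof (cases "\<exists>i<?L. P i")
    case True
    define i where "i = (LEAST i. P i)"
    have "P i" "i < ?L" using True LeastI_ex[of P] Least_le[of P] unfolding i_def by (auto intro: le_less_trans)
    moreover have "\<not> P j" if "j < i" for j using that not_less_Least unfolding i_def by blast
    ultimately show ?thesis by (intro that[of "Suc i"]) auto
  next
    case False
    then show ?thesis using L by (intro that[of ?L]) auto
  qed
  have "runs (While (\<lambda>a. a ! (?\<beta> + r) \<noteq> 5 \<and> a ! 2 \<noteq> 2) (Seq (cf ?\<beta> (Suc r) \<phi>) (mv (?\<beta> + r) 1)))
      (s 0) (s N) (N * (tf \<phi> (length ws) + 1 + 2) + 1)"
  proof (rule runs_While)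
    fix i assume i: "i < N"
    let ?pre = "pre[2 := flg (0 < i \<and> P (i - 1)) (pre ! 2)]"
    have \<sigma>: "(\<sigma>(r := i)) j < length ws - 1" if "j < Suc r" for j
      using Ex.prems(5)[of j] Ex.prems(6)[of j] that i N(1) L by (cases "j < k") auto
    have "runs (cf (length ?pre) (Suc r) \<phi>) (cfg ?pre m ws (\<sigma>(r := i)) post)
       (cfg (?pre[2 := flg (evf \<phi> ws (\<sigma>(r := i))) (?pre ! 2)]) m ws (\<sigma>(r := i)) post) (tf \<phi> (length ws))"
      using Ex.prems(1-4) Ex.prems(6) r \<sigma> by (intro Ex.IH) auto
    then have 1: "runs (cf ?\<beta> (Suc r) \<phi>) (s i) (cfg (pre[2 := flg (P i) (pre ! 2)]) m ws (\<sigma>(r := i)) post) (tf \<phi> (length ws))"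
      using Ex.prems by (simp add: s_def P_def)
    have 2: "runs (mv (?\<beta> + r) 1) (cfg (pre[2 := flg (P i) (pre ! 2)]) m ws (\<sigma>(r := i)) post) (s (Suc i)) 1"
      using runs_right[of r m ?\<beta> "pre[2 := flg (P i) (pre ! 2)]" ws "\<sigma>(r := i)" post] r by (simp add: s_def)
    have "scan (s i) ! 2 \<noteq> 2" using i N(2)[of i] Ex.prems(3) by (auto simp: s_def nth_append)
    moreover have "scan (s i) ! (?\<beta> + r) \<noteq> 5"
      using scan_cfg[of r m "\<sigma>(r := i)" ws "pre[2 := flg (0 < i \<and> P (i - 1)) (pre ! 2)]" post] r i N(1)
        marked_nth(2)[OF Ex.prems(4), of i] by (simp add: s_def del: map_append)
    ultimately show "(scan (s i) ! (?\<beta> + r) \<noteq> 5 \<and> scan (s i) ! 2 \<noteq> 2) \<and>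
       runs (Seq (cf ?\<beta> (Suc r) \<phi>) (mv (?\<beta> + r) 1)) (s i) (s (Suc i)) (tf \<phi> (length ws) + 1)"
      using runs_Seq[OF 1 2] by blast
  next
    have "N < length ws" using N(1) L by auto
    then have "scan (s N) ! (?\<beta> + r) = ws ! N"
      using scan_cfg[of r m "\<sigma>(r := N)" ws "pre[2 := flg (0 < N \<and> P (N - 1)) (pre ! 2)]" post] r
      by (simp add: s_def del: map_append)
    moreover have "scan (s N) ! 2 = bitn (0 < N \<and> P (N - 1))" using Ex.prems(3) by (simp add: s_def nth_append)
    ultimately show "\<not> (scan (s N) ! (?\<beta> + r) \<noteq> 5 \<and> scan (s N) ! 2 \<noteq> 2)"
      using N(3) marked_nth(2)[OF Ex.prems(4), of N] \<open>N < length ws\<close> by auto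
  qed
  then have 2: "runs (While (\<lambda>a. a ! (?\<beta> + r) \<noteq> 5 \<and> a ! 2 \<noteq> 2) (Seq (cf ?\<beta> (Suc r) \<phi>) (mv (?\<beta> + r) 1)))
      (s 0) (s N) (length ws * (tf \<phi> (length ws) + 1 + 2) + 1)"
    by (rule runs_mono) (use N(1) in \<open>simp add: mult_le_mono1 del: mult_Suc_right\<close>)
  have "\<sigma>(r := 0) = \<sigma>" using Ex.prems(6) r by (auto simp: fun_eq_iff)
  then have 1: "runs (setf False) (cfg pre m ws \<sigma> post) (s 0) 1"
    using runs_setf[of pre False] Ex.prems by (simp add: s_def)
  have 3: "runs (rew (?\<beta> + r)) (s N) (cfg (pre[2 := flg (evf (Ex r \<phi>) ws \<sigma>) (pre ! 2)]) m ws \<sigma> post) (length ws * 3 + 1)"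
    using runs_rew[of r m ?\<beta> "pre[2 := flg (0 < N \<and> P (N - 1)) (pre ! 2)]" ws "\<sigma>(r := N)" post] r N Ex.prems L
    by (auto simp: s_def P_def \<open>\<sigma>(r := 0) = \<sigma>\<close>)
  show ?case using runs_Seq[OF 1 runs_Seq[OF 2 3]] by (simp add: algebra_simps)
qed

subsection \<open>Compilation of generators\<close>

definition outp :: "tape \<Rightarrow> bool list \<Rightarrow> tape" where
  "outp = foldl (\<lambda>t b. write_move (bitn b, 1) t)"

lemma outp_simps [simp]: "outp t [] = t" "outp t (b # bs) = outp (write_move (bitn b, 1) t) bs"
  "outp (outp t xs) ys = outp t (xs @ ys)"
  by (auto simp: outp_def)

lemma outp_snoc: "outp t (xs @ [b]) = write_move (bitn b, 1) (outp t xs)"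
  by (auto simp: outp_def)

lemma outp_nth:
  "outp t ys z = (if - int (length ys) \<le> z \<and> z < 0 then bitn (ys ! nat (z + int (length ys)))
     else t (z + int (length ys)))"
proof (induction ys arbitrary: z rule: rev_induct)
  case (snoc y ys)
  consider "z = -1" | "z < -1" | "z > -1" by linarith
  then show ?case
    by cases (auto simp: outp_snoc write_move_def snoc.IH nth_append algebra_simps)
qed simp

text \<open>Every generator leaves the flag cleared, whatever it tested last. So the final tapes are
  determined by the emitted word alone, which is what \<open>emitted\<close> records.\<close>

fun cg :: "nat \<Rightarrow> nat \<Rightarrow> gn \<Rightarrow> prog" where
  "cg \<beta> k GNil = setf False"
| "cg \<beta> k (Emit b) = Seq (Act 0 (\<lambda>_. (bitn b, 1))) (setf False)"
| "cg \<beta> k (Cat g h) = Seq (cg \<beta> k g) (cg \<beta> k h)"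
| "cg \<beta> k (GIf \<phi> g h) = Seq (cf \<beta> k \<phi>) (Cond (\<lambda>a. a ! 2 = 2) (cg \<beta> k g) (cg \<beta> k h))"
| "cg \<beta> k (For r g) = Seq (setf False)
     (Seq (While (\<lambda>a. a ! (\<beta> + r) \<noteq> 5) (Seq (cg \<beta> (Suc r) g) (mv (\<beta> + r) 1))) (rew (\<beta> + r)))"

fun nrg :: "nat \<Rightarrow> gn \<Rightarrow> nat" where
  "nrg k GNil = k"
| "nrg k (Emit b) = k"
| "nrg k (Cat g h) = max (nrg k g) (nrg k h)"
| "nrg k (GIf \<phi> g h) = max (nrf k \<phi>) (max (nrg k g) (nrg k h))"
| "nrg k (For r g) = nrg (Suc r) g"

lemma nrg_ge: "wfg k g \<Longrightarrow> k \<le> nrg k g"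
  by (induction g arbitrary: k) (auto simp: le_max_iff_disj dest!: Suc_leD intro: order_trans)

fun tg :: "gn \<Rightarrow> nat \<Rightarrow> nat" where
  "tg GNil L = 1"
| "tg (Emit b) L = 2"
| "tg (Cat g h) L = tg g L + tg h L"
| "tg (GIf \<phi> g h) L = tf \<phi> L + (tg g L + tg h L + 2)"
| "tg (For r g) L = 1 + (L * (tg g L + 1 + 2) + 1) + (L * 3 + 1)"

lemma length_og: "length (og g ws \<sigma>) \<le> tg g (length ws)"
proof (induction g arbitrary: \<sigma>)
  case (For r g)
  have "length (og (For r g) ws \<sigma>) = (\<Sum>i\<leftarrow>[0..<length ws - 1]. length (og g ws (\<sigma>(r := i))))"
    by (simp add: length_concat comp_def)
  also have "\<dots> \<le> (\<Sum>i\<leftarrow>[0..<length ws - 1]. tg g (length ws))"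
    by (rule sum_list_mono) (rule For)
  also have "\<dots> \<le> length ws * tg g (length ws)" by (simp add: sum_list_triv)
  finally show ?case by (simp add: add_mult_distrib2)
next
  case (GIf \<phi> g h)
  show ?case using GIf.IH[of \<sigma>] by auto
next
  case (Cat g h)
  show ?case using Cat.IH[of \<sigma>] by auto
qed auto

lemma wfp_cg: "wfg k g \<Longrightarrow> 3 \<le> \<beta> \<Longrightarrow> \<beta> + nrg k g \<le> K \<Longrightarrow> wfp K (cg \<beta> k g)"
proof (induction g arbitrary: k)
  case (For r g)
  then show ?case using nrg_ge[of "Suc r" g] by (auto simp: rew_def)
qed (auto simp: wfp_cf bitn_def)

definition emitted :: "tape list \<Rightarrow> bool list \<Rightarrow> tape list" where
  "emitted pre ys = pre[0 := outp (pre ! 0) ys, 2 := flg False (pre ! 2)]"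

lemma length_emitted [simp]: "length (emitted pre ys) = length pre"
  by (simp add: emitted_def)

lemma emitted_emitted:
  assumes "3 \<le> length pre"
  shows "emitted (emitted pre xs) ys = emitted pre (xs @ ys)"
proof -
  obtain a b c r where "pre = a # b # c # r" using assms by (auto simp: numeral_3_eq_3 Suc_le_length_iff)
  then show ?thesis by (simp add: emitted_def numeral_2_eq_2)
qed

lemma emitted_flg: "3 \<le> length pre \<Longrightarrow> emitted (pre[2 := flg b (pre ! 2)]) ys = emitted pre ys"
  by (simp add: emitted_def list_update_swap)

lemma emitted_Nil: "emitted pre [] = pre[2 := flg False (pre ! 2)]"
  by (simp add: emitted_def)

lemma cg_correct:
  assumes "wfg k g" "nrg k g \<le> m" "3 \<le> length pre" "marked ws"
    "\<And>r. r < k \<Longrightarrow> \<sigma> r < length ws - 1" "\<And>r. k \<le> r \<Longrightarrow> \<sigma> r = 0"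
  shows "runs (cg (length pre) k g) (cfg pre m ws \<sigma> post)
    (cfg (emitted pre (og g ws \<sigma>)) m ws \<sigma> post) (tg g (length ws))"
  using assms
proof (induction g arbitrary: k \<sigma> pre)
  case GNil
  then show ?case using runs_setf[of pre False] by (simp add: emitted_Nil)
next
  case (Emit b)
  have "runs (Act 0 (\<lambda>_. (bitn b, 1))) (cfg pre m ws \<sigma> post) (cfg (pre[0 := outp (pre ! 0) [b]]) m ws \<sigma> post) 1"
    by (rule runs_Act) (use Emit.prems in \<open>auto simp: nth_append list_update_append\<close>)
  moreover have "runs (setf False) (cfg (pre[0 := outp (pre ! 0) [b]]) m ws \<sigma> post)
     (cfg (emitted pre [b]) m ws \<sigma> post) 1"
    using runs_setf[of "pre[0 := outp (pre ! 0) [b]]" False] Emit.prems by (simp add: emitted_def)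
  ultimately show ?case using runs_Seq by (fastforce simp: numeral_2_eq_2)
next
  case (Cat g h)
  then show ?case
    using runs_Seq[OF Cat.IH(1)[of k pre \<sigma>] Cat.IH(2)[of k "emitted pre (og g ws \<sigma>)" \<sigma>]]
    by (simp add: emitted_emitted)
next
  case (GIf \<phi> g h)
  let ?pre = "pre[2 := flg (evf \<phi> ws \<sigma>) (pre ! 2)]"
  have 1: "runs (cf (length pre) k \<phi>) (cfg pre m ws \<sigma> post) (cfg ?pre m ws \<sigma> post) (tf \<phi> (length ws))"
    using GIf.prems by (intro cf_correct) auto
  have c: "scan (cfg ?pre m ws \<sigma> post) ! 2 = 2 \<longleftrightarrow> evf \<phi> ws \<sigma>" using GIf.prems by (simp add: nth_append)
  have "runs (Cond (\<lambda>a. a ! 2 = 2) (cg (length ?pre) k g) (cg (length ?pre) k h)) (cfg ?pre m ws \<sigma> post)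
     (cfg (emitted pre (og (GIf \<phi> g h) ws \<sigma>)) m ws \<sigma> post) (tg g (length ws) + tg h (length ws) + 2)"
  proof (rule runs_Cond; unfold c)
    assume "evf \<phi> ws \<sigma>"
    then show "runs (cg (length ?pre) k g) (cfg ?pre m ws \<sigma> post)
       (cfg (emitted pre (og (GIf \<phi> g h) ws \<sigma>)) m ws \<sigma> post) (tg g (length ws) + tg h (length ws))"
      using GIf.IH(1)[of k ?pre \<sigma>] GIf.prems by (auto simp: emitted_flg intro: runs_mono)
  next
    assume "\<not> evf \<phi> ws \<sigma>"
    then show "runs (cg (length ?pre) k h) (cfg ?pre m ws \<sigma> post)
       (cfg (emitted pre (og (GIf \<phi> g h) ws \<sigma>)) m ws \<sigma> post) (tg g (length ws) + tg h (length ws))"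
      using GIf.IH(2)[of k ?pre \<sigma>] GIf.prems by (auto simp: emitted_flg intro: runs_mono)
  qed
  from runs_Seq[OF 1 this] show ?case by (simp only: cg.simps tg.simps length_list_update)
next
  case (For r g)
  let ?\<beta> = "length pre" and ?L = "length ws - 1"
  have r: "r < m" "k \<le> r" "wfg (Suc r) g" using For.prems nrg_ge[of "Suc r" g] by auto
  have L: "2 \<le> length ws" using For.prems marked_length by auto
  define y where "y i = concat (map (\<lambda>i. og g ws (\<sigma>(r := i))) [0..<i])" for i
  define s where "s i = cfg (emitted pre (y i)) m ws (\<sigma>(r := i)) post" for i
  have "runs (While (\<lambda>a. a ! (?\<beta> + r) \<noteq> 5) (Seq (cg ?\<beta> (Suc r) g) (mv (?\<beta> + r) 1)))
      (s 0) (s ?L) (?L * (tg g (length ws) + 1 + 2) + 1)"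
  proof (rule runs_While)
    fix i assume i: "i < ?L"
    have \<sigma>: "(\<sigma>(r := i)) j < length ws - 1" if "j < Suc r" for j
      using For.prems(5)[of j] For.prems(6)[of j] that i L by (cases "j < k") auto
    have "runs (cg (length (emitted pre (y i))) (Suc r) g) (cfg (emitted pre (y i)) m ws (\<sigma>(r := i)) post)
       (cfg (emitted (emitted pre (y i)) (og g ws (\<sigma>(r := i)))) m ws (\<sigma>(r := i)) post) (tg g (length ws))"
      using For.prems(1-4) For.prems(6) r \<sigma> by (intro For.IH) auto
    then have 1: "runs (cg ?\<beta> (Suc r) g) (s i) (cfg (emitted pre (y (Suc i))) m ws (\<sigma>(r := i)) post) (tg g (length ws))"
      using For.prems by (simp add: s_def y_def emitted_emitted)
    have 2: "runs (mv (?\<beta> + r) 1) (cfg (emitted pre (y (Suc i))) m ws (\<sigma>(r := i)) post) (s (Suc i)) 1"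
      using runs_right[of r m ?\<beta> "emitted pre (y (Suc i))" ws "\<sigma>(r := i)" post] r by (simp add: s_def)
    have "scan (s i) ! (?\<beta> + r) \<noteq> 5"
      using scan_cfg[of r m "\<sigma>(r := i)" ws "emitted pre (y i)" post] r i
        marked_nth(2)[OF For.prems(4), of i] by (simp add: s_def del: map_append)
    then show "scan (s i) ! (?\<beta> + r) \<noteq> 5 \<and>
       runs (Seq (cg ?\<beta> (Suc r) g) (mv (?\<beta> + r) 1)) (s i) (s (Suc i)) (tg g (length ws) + 1)"
      using runs_Seq[OF 1 2] by blast
  next
    have "?L < length ws" using L by auto
    then have "scan (s ?L) ! (?\<beta> + r) = ws ! ?L"
      using scan_cfg[of r m "\<sigma>(r := ?L)" ws "emitted pre (y ?L)" post] r
      by (simp add: s_def del: map_append)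
    then show "\<not> (scan (s ?L) ! (?\<beta> + r) \<noteq> 5)"
      using marked_nth(2)[OF For.prems(4), of ?L] \<open>?L < length ws\<close> by auto
  qed
  then have 2: "runs (While (\<lambda>a. a ! (?\<beta> + r) \<noteq> 5) (Seq (cg ?\<beta> (Suc r) g) (mv (?\<beta> + r) 1)))
      (s 0) (s ?L) (length ws * (tg g (length ws) + 1 + 2) + 1)"
    by (rule runs_mono) (simp add: mult_le_mono1 del: mult_Suc_right)
  have z: "\<sigma>(r := 0) = \<sigma>" using For.prems(6) r by (auto simp: fun_eq_iff)
  then have 1: "runs (setf False) (cfg pre m ws \<sigma> post) (s 0) 1"
    using runs_setf[of pre False] For.prems by (simp add: s_def y_def emitted_Nil)
  have 3: "runs (rew (?\<beta> + r)) (s ?L) (cfg (emitted pre (og (For r g) ws \<sigma>)) m ws \<sigma> post) (length ws * 3 + 1)"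
    using runs_rew[of r m ?\<beta> "emitted pre (y ?L)" ws "\<sigma>(r := ?L)" post] r For.prems L
    by (simp add: s_def y_def z)
  show ?case using runs_Seq[OF 1 runs_Seq[OF 2 3]] by (simp add: algebra_simps)
qed

subsection \<open>Polynomial bounds\<close>

definition poly_bounded :: "(nat \<Rightarrow> nat) \<Rightarrow> bool" where
  "poly_bounded f \<longleftrightarrow> (\<exists>q. \<forall>n. f n \<le> poly q n)"

lemma poly_nat_mono: "m \<le> n \<Longrightarrow> poly (q :: nat poly) m \<le> poly q n"
  by (induction q) (auto intro: add_mono mult_mono)

lemma poly_bounded_const: "poly_bounded (\<lambda>n. c)"
  unfolding poly_bounded_def by (intro exI[of _ "[:c:]"]) simp

lemma poly_bounded_id: "poly_bounded (\<lambda>n. n)"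
  unfolding poly_bounded_def by (intro exI[of _ "[:0, 1:]"]) simp

lemma poly_bounded_poly: "poly_bounded (poly q)"
  unfolding poly_bounded_def by blast

lemma poly_bounded_add: "poly_bounded f \<Longrightarrow> poly_bounded g \<Longrightarrow> poly_bounded (\<lambda>n. f n + g n)"
  unfolding poly_bounded_def by (metis add_mono poly_add)

lemma poly_bounded_mult: "poly_bounded f \<Longrightarrow> poly_bounded g \<Longrightarrow> poly_bounded (\<lambda>n. f n * g n)"
  unfolding poly_bounded_def by (metis mult_le_mono poly_mult)

lemma poly_bounded_compose:
  assumes "poly_bounded f" "poly_bounded g"
  shows "poly_bounded (\<lambda>n. f (g n))"
proof -
  obtain p q where "\<And>n. f n \<le> poly p n" "\<And>n. g n \<le> poly q n"
    using assms by (auto simp: poly_bounded_def)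
  then have "f (g n) \<le> poly (pcompose p q) n" for n
    by (metis le_trans poly_nat_mono poly_pcompose)
  then show ?thesis unfolding poly_bounded_def by blast
qed

lemmas poly_bounded_intros = poly_bounded_const poly_bounded_id poly_bounded_add poly_bounded_mult

lemma poly_bounded_tf: "poly_bounded (tf \<phi>)"
proof (induction \<phi>)
  case (Ex r \<phi>)
  then show ?case unfolding tf.simps[abs_def] by (intro poly_bounded_intros)
next
  case (And \<phi> \<psi>)
  then show ?case unfolding tf.simps[abs_def] by (intro poly_bounded_intros)
next
  case (Neg \<phi>)
  then show ?case unfolding tf.simps[abs_def] by (intro poly_bounded_intros)
next
  case (Sym r s)
  show ?case unfolding tf.simps[abs_def] by (intro poly_bounded_intros)
next
  case (Plus a b c)
  show ?case unfolding tf.simps[abs_def] by (intro poly_bounded_intros)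
qed

lemma poly_bounded_tg: "poly_bounded (tg g)"
proof (induction g)
  case (For r g)
  then show ?case unfolding tg.simps[abs_def] by (intro poly_bounded_intros)
next
  case (GIf \<phi> g h)
  then show ?case unfolding tg.simps[abs_def] by (intro poly_bounded_intros poly_bounded_tf)
next
  case (Cat g h)
  then show ?case unfolding tg.simps[abs_def] by (intro poly_bounded_intros)
next
  case GNil
  show ?case unfolding tg.simps[abs_def] by (intro poly_bounded_intros)
next
  case (Emit b)
  show ?case unfolding tg.simps[abs_def] by (intro poly_bounded_intros)
qed

subsection \<open>Generators as Turing machines\<close>

text \<open>The interface between phases. On the two input tapes only the cells from the head
  rightwards are described, since used input may remain on the left; every phase takes blank tapes
  from \<open>\<beta>\<close> on as its registers.\<close>

definition ready :: "nat \<Rightarrow> nat \<Rightarrow> bool list \<Rightarrow> bool list \<Rightarrow> tape list \<Rightarrow> bool" where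
  "ready K \<beta> x u ts \<longleftrightarrow> length ts = K \<and> 3 \<le> \<beta> \<and> \<beta> \<le> K \<and>
     (\<forall>z\<ge>0. (ts ! 0) z = word_tape x z) \<and> (\<forall>z\<ge>0. (ts ! 1) z = word_tape u z) \<and>
     (\<forall>i. \<beta> \<le> i \<longrightarrow> i < K \<longrightarrow> ts ! i = (\<lambda>_. 0))"

definition wr :: "nat \<Rightarrow> nat \<Rightarrow> nat \<Rightarrow> prog" where
  "wr \<beta> m s = seqs (map (\<lambda>r. Act (\<beta> + r) (\<lambda>_. (s, 1))) [0..<m])"

abbreviation filled :: "tape list \<Rightarrow> nat \<Rightarrow> nat list \<Rightarrow> tape list \<Rightarrow> tape list" where
  "filled pre m ws post \<equiv> cfg pre m ws (\<lambda>_. length ws) post"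

lemma runs_wr:
  assumes "\<beta> = length pre"
  shows "runs (wr \<beta> m s) (filled pre m ws post) (filled pre m (ws @ [s]) post) (m + 1)"
proof -
  define st where "st i = pre @ map (\<lambda>r. if r < i then tp (ws @ [s]) (Suc (length ws)) else tp ws (length ws)) [0..<m] @ post" for i
  have "runs (seqs (map (\<lambda>r. Act (\<beta> + r) (\<lambda>_. (s, 1))) [0..<m])) (st 0)
     (st (length (map (\<lambda>r. Act (\<beta> + r) (\<lambda>_. (s, 1))) [0..<m])))
     (length (map (\<lambda>r. Act (\<beta> + r) (\<lambda>_. (s, 1))) [0..<m]) * 1 + 1)"
  proof (rule runs_seqs)
    fix i assume "i < length (map (\<lambda>r. Act (\<beta> + r) (\<lambda>_. (s, 1::int))) [0..<m])"
    then have i: "i < m" by simp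
    have "runs (Act (\<beta> + i) (\<lambda>_. (s, 1))) (st i) (st (Suc i)) 1"
    proof (rule runs_Act)
      have n: "st i ! (\<beta> + i) = tp ws (length ws)" using i assms by (simp add: st_def nth_append)
      show "st (Suc i) = (st i)[\<beta> + i := write_move (s, 1) (st i ! (\<beta> + i))]"
        unfolding n tp_append using assms i
        by (intro nth_equalityI) (auto simp: st_def nth_append nth_list_update)
    qed
    then show "runs (map (\<lambda>r. Act (\<beta> + r) (\<lambda>_. (s, 1))) [0..<m] ! i) (st i) (st (Suc i)) 1" using i by simp
  qed
  moreover have "st m = filled pre m (ws @ [s]) post" "st 0 = filled pre m ws post"
    by (auto simp: st_def regs_def)
  ultimately show ?thesis by (simp add: wr_def)
qed

definition shift :: "nat \<Rightarrow> tape \<Rightarrow> tape" where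
  "shift n t = (\<lambda>z. t (z + int n))"

lemma shift_simps [simp]: "shift 0 t = t" "shift m (shift n t) = shift (m + n) t"
  by (auto simp: shift_def add.assoc)

definition copy_word :: "nat \<Rightarrow> nat \<Rightarrow> nat \<Rightarrow> prog" where
  "copy_word \<beta> m k = While (\<lambda>a. a ! k \<noteq> 0)
     (Seq (Cond (\<lambda>a. a ! k = 1) (wr \<beta> m 1) (wr \<beta> m 2)) (mv k 1))"

lemma runs_copy_word:
  assumes "\<beta> = length pre" "k < \<beta>" "\<And>z. z \<ge> 0 \<Longrightarrow> (pre ! k) z = word_tape x z"
  shows "runs (copy_word \<beta> m k) (filled pre m ws post)
    (filled (pre[k := shift (length x) (pre ! k)]) m (ws @ map bitn x) post) (length x * (m + 6) + 1)"
proof -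
  define p where "p i = pre[k := shift i (pre ! k)]" for i
  define s where "s i = filled (p i) m (ws @ map bitn (take i x)) post" for i
  have p: "length (p i) = \<beta>" "p i ! k = shift i (pre ! k)" for i using assms by (auto simp: p_def)
  have sk: "scan (s i) ! k = word_tape x (int i)" for i
    using assms(2,3) p by (simp add: s_def shift_def nth_append)
  have "runs (copy_word \<beta> m k) (s 0) (s (length x)) (length x * ((m + 1) + 2 + 1 + 2) + 1)"
    unfolding copy_word_def
  proof (rule runs_While)
    fix i assume i: "i < length x"
    have c: "scan (s i) ! k = bitn (x ! i)" using sk i by (simp add: word_tape_def bitn_def)
    have "runs (Cond (\<lambda>a. a ! k = 1) (wr \<beta> m 1) (wr \<beta> m 2)) (s i)
       (filled (p i) m ((ws @ map bitn (take i x)) @ [bitn (x ! i)]) post) (m + 1 + 2)"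
      using runs_wr[OF p(1)[symmetric], of m 1 i "ws @ map bitn (take i x)" post]
        runs_wr[OF p(1)[symmetric], of m 2 i "ws @ map bitn (take i x)" post]
      by (intro runs_Cond; unfold c) (auto simp: s_def bitn_def split: if_splits)
    moreover have "runs (mv k 1) (filled (p i) m ((ws @ map bitn (take i x)) @ [bitn (x ! i)]) post) (s (Suc i)) 1"
      unfolding mv_def
    proof (rule runs_Act)
      let ?t = "filled (p i) m ((ws @ map bitn (take i x)) @ [bitn (x ! i)]) post"
      have "?t ! k = shift i (pre ! k)" using p assms(2) by (simp add: nth_append)
      moreover have "write_move (shift i (pre ! k) 0, 1) (shift i (pre ! k)) = shift (Suc i) (pre ! k)"
        unfolding write_move_same by (simp add: shift_def algebra_simps)
      ultimately show "s (Suc i) = ?t[k := write_move ((?t ! k) 0, 1) (?t ! k)]"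
        using i assms(1,2) by (simp add: s_def p_def list_update_append take_Suc_conv_app_nth)
    qed
    ultimately show "scan (s i) ! k \<noteq> 0 \<and>
       runs (Seq (Cond (\<lambda>a. a ! k = 1) (wr \<beta> m 1) (wr \<beta> m 2)) (mv k 1)) (s i) (s (Suc i)) ((m + 1) + 2 + 1)"
      using c runs_Seq by (metis bitn_eq(3))
  next
    show "\<not> scan (s (length x)) ! k \<noteq> 0" using sk by (simp add: word_tape_def)
  qed
  moreover have "(m + 1) + 2 + 1 + 2 = m + 6" by simp
  moreover have "s 0 = filled pre m ws post" by (simp add: s_def p_def)
  moreover have "s (length x) = filled (pre[k := shift (length x) (pre ! k)]) m (ws @ map bitn x) post"
    by (simp add: s_def p_def)
  ultimately show ?thesis by metis
qed

definition rewind_all :: "nat \<Rightarrow> nat \<Rightarrow> prog" where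
  "rewind_all \<beta> m = seqs (map (\<lambda>r. Seq (mv (\<beta> + r) (-1)) (rew (\<beta> + r))) [0..<m])"

lemma runs_rewind_all:
  assumes "\<beta> = length pre" "marked ws"
  shows "runs (rewind_all \<beta> m) (filled pre m ws post) (cfg pre m ws (\<lambda>_. 0) post) (m * (length ws * 3 + 2) + 1)"
proof -
  let ?ps = "map (\<lambda>r. Seq (mv (\<beta> + r) (-1)) (rew (\<beta> + r))) [0..<m]"
  define \<sigma> where "\<sigma> i = (\<lambda>r. if r < i then 0 else length ws)" for i :: nat
  define st where "st i = cfg pre m ws (\<sigma> i) post" for i
  have "runs (seqs ?ps) (st 0) (st (length ?ps)) (length ?ps * (1 + (length ws * 3 + 1)) + 1)"
  proof (rule runs_seqs)
    fix i assume "i < length ?ps"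
    then have i: "i < m" by simp
    have "runs (mv (\<beta> + i) (-1)) (st i) (cfg pre m ws ((\<sigma> i)(i := length ws - 1)) post) 1"
      using runs_left[of i m \<beta> pre "\<sigma> i" ws post] i assms marked_hd[OF assms(2)] by (simp add: st_def \<sigma>_def)
    moreover have "runs (rew (\<beta> + i)) (cfg pre m ws ((\<sigma> i)(i := length ws - 1)) post) (st (Suc i)) (length ws * 3 + 1)"
    proof -
      have "\<sigma> (Suc i) = (\<sigma> i)(i := 0)" by (auto simp: \<sigma>_def)
      then show ?thesis
        using runs_rew[of i m \<beta> pre ws "(\<sigma> i)(i := length ws - 1)" post] i assms marked_hd[OF assms(2)] by (simp add: st_def)
    qed
    ultimately have "runs (Seq (mv (\<beta> + i) (-1)) (rew (\<beta> + i))) (st i) (st (Suc i)) (1 + (length ws * 3 + 1))"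
      by (rule runs_Seq)
    then show "runs (?ps ! i) (st i) (st (Suc i)) (1 + (length ws * 3 + 1))" using i by simp
  qed
  moreover have "st 0 = filled pre m ws post" "st m = cfg pre m ws (\<lambda>_. 0) post"
    by (auto simp: st_def \<sigma>_def regs_def)
  ultimately show ?thesis by (simp add: rewind_all_def)
qed

definition finish :: prog where
  "finish = Seq (mv 0 (-1)) (Seq (While (\<lambda>a. a ! 0 \<noteq> 0) (mv 0 (-1))) (mv 0 1))"

lemma runs_mv_0: "ts \<noteq> [] \<Longrightarrow> runs (mv 0 d) ts (ts[0 := (\<lambda>z. (ts ! 0) (z + d))]) 1"
  unfolding mv_def by (rule runs_Act) (simp add: write_move_same)

lemma runs_finish:
  assumes "ts \<noteq> []" "ts ! 0 = outp t y" "t (-1) = 0"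
  shows "runs finish ts (ts[0 := (\<lambda>z. outp t y (z - int (length y)))]) (length y * 3 + 3)"
proof -
  define s where "s i = ts[0 := (\<lambda>z. outp t y (z - 1 - int i))]" for i
  have "runs (mv 0 (-1)) ts (s 0) 1" using runs_mv_0[OF assms(1), of "-1"] assms by (simp add: s_def)
  moreover have "runs (While (\<lambda>a. a ! 0 \<noteq> 0) (mv 0 (-1))) (s 0) (s (length y)) (length y * (1 + 2) + 1)"
  proof (rule runs_While)
    fix i assume "i < length y"
    then have "scan (s i) ! 0 \<noteq> 0" using assms(1) by (simp add: s_def outp_nth)
    moreover have "runs (mv 0 (-1)) (s i) (s (Suc i)) 1"
      using runs_mv_0[of "s i" "-1"] assms(1) by (simp add: s_def algebra_simps)
    ultimately show "scan (s i) ! 0 \<noteq> 0 \<and> runs (mv 0 (-1)) (s i) (s (Suc i)) 1" by blast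
  next
    show "\<not> scan (s (length y)) ! 0 \<noteq> 0" using assms by (simp add: s_def outp_nth)
  qed
  moreover have "runs (mv 0 1) (s (length y)) (ts[0 := (\<lambda>z. outp t y (z - int (length y)))]) 1"
    using runs_mv_0[of "s (length y)" 1] assms(1) by (simp add: s_def algebra_simps)
  ultimately have "runs finish ts (ts[0 := (\<lambda>z. outp t y (z - int (length y)))]) (1 + (length y * (1 + 2) + 1 + 1))"
    unfolding finish_def by (intro runs_Seq)
  then show ?thesis by (simp add: numeral_3_eq_3)
qed

text \<open>After copying, the head of tape 0 stands on the blank behind the first word. The extra
  \<open>mv 0 1\<close> keeps this blank between the old word and the output, and
  \<open>finish\<close> stops at it on its way back to the first output bit.\<close>

definition phase :: "nat \<Rightarrow> gn \<Rightarrow> prog" where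
  "phase \<beta> g = (let m = nrg 0 g in
     Seq (wr \<beta> m 3) (Seq (copy_word \<beta> m 0) (Seq (wr \<beta> m 4) (Seq (copy_word \<beta> m 1) (Seq (wr \<beta> m 5)
     (Seq (rewind_all \<beta> m) (Seq (mv 0 1) (Seq (cg \<beta> 0 g) finish))))))))"

lemma wfp_phase:
  assumes "wfg 0 g" "3 \<le> \<beta>" "\<beta> + nrg 0 g \<le> K"
  shows "wfp K (phase \<beta> g)"
  using assms wfp_cg[OF assms]
  by (auto simp: phase_def Let_def wr_def wfp_seqs copy_word_def rewind_all_def rew_def finish_def)

lemma phase_correct:
  assumes g: "wfg 0 g" and r: "ready K \<beta> x u ts" and K: "\<beta> + nrg 0 g \<le> K"
  defines "n \<equiv> length x + length u + 3" and "m \<equiv> nrg 0 g" and "y \<equiv> og g (label x u) (\<lambda>_. 0)"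
  shows "\<exists>ts'. runs (phase \<beta> g) ts ts' (n * (m * 8 + 20) + 4 * tg g n) \<and> ready K (\<beta> + m) y [] ts'"
proof -
  define pre where "pre = take \<beta> ts"
  define post where "post = drop (\<beta> + m) ts"
  have len: "length ts = K" "3 \<le> \<beta>" "\<beta> + m \<le> K" using r K by (auto simp: ready_def m_def)
  have \<beta>: "length pre = \<beta>" using len by (simp add: pre_def)
  have "take m (drop \<beta> ts) = regs m [] (\<lambda>_. 0)"
    by (rule nth_equalityI) (use len r in \<open>auto simp: regs_def tp_blank ready_def\<close>)
  then have ts: "ts = filled pre m [] post"
    unfolding pre_def post_def by (metis append_take_drop_id drop_drop add.commute list.size(3))
  have p01: "pre ! 0 = ts ! 0" "pre ! 1 = ts ! 1" using len by (auto simp: pre_def)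
  let ?w = "label x u"
  define pre1 where "pre1 = pre[0 := shift (length x) (pre ! 0)]"
  define pre2 where "pre2 = pre1[1 := shift (length u) (pre1 ! 1)]"
  define t where "t = (\<lambda>z. shift (length x) (pre ! 0) (z + 1))"
  define pre3 where "pre3 = pre2[0 := t]"
  have l: "length pre1 = \<beta>" "length pre2 = \<beta>" "length pre3 = \<beta>" using \<beta> by (auto simp: pre1_def pre2_def pre3_def)
  have ne: "pre1 \<noteq> []" "pre2 \<noteq> []" "pre3 \<noteq> []" using l len by auto
  have 1: "runs (wr \<beta> m 3) ts (filled pre m [3] post) (m + 1)"
    using runs_wr[of \<beta> pre m 3 "[]" post] \<beta> ts by simp
  have 2: "runs (copy_word \<beta> m 0) (filled pre m [3] post) (filled pre1 m ([3] @ map bitn x) post) (length x * (m + 6) + 1)"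
    unfolding pre1_def using \<beta> len r p01 by (intro runs_copy_word) (auto simp: ready_def)
  have 3: "runs (wr \<beta> m 4) (filled pre1 m ([3] @ map bitn x) post) (filled pre1 m (([3] @ map bitn x) @ [4]) post) (m + 1)"
    using l by (intro runs_wr) auto
  have 4: "runs (copy_word \<beta> m 1) (filled pre1 m (([3] @ map bitn x) @ [4]) post)
      (filled pre2 m ((([3] @ map bitn x) @ [4]) @ map bitn u) post) (length u * (m + 6) + 1)"
    unfolding pre2_def using \<beta> len r p01 l by (intro runs_copy_word) (auto simp: ready_def pre1_def)
  have 5: "runs (wr \<beta> m 5) (filled pre2 m ((([3] @ map bitn x) @ [4]) @ map bitn u) post)
      (filled pre2 m (((([3] @ map bitn x) @ [4]) @ map bitn u) @ [5]) post) (m + 1)"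
    using l by (intro runs_wr) auto
  have w: "((([3] @ map bitn x) @ [4]) @ map bitn u) @ [5] = ?w" by (simp add: label_def)
  have 6: "runs (rewind_all \<beta> m) (filled pre2 m ?w post) (cfg pre2 m ?w (\<lambda>_. 0) post) (m * (n * 3 + 2) + 1)"
    using runs_rewind_all[OF _ marked_label, of \<beta> pre2 m x u post] l by (simp add: n_def)
  have 7: "runs (mv 0 1) (cfg pre2 m ?w (\<lambda>_. 0) post) (cfg pre3 m ?w (\<lambda>_. 0) post) 1"
    using runs_mv_0[of "cfg pre2 m ?w (\<lambda>_. 0) post" 1] ne l len \<beta>
    by (auto simp: pre3_def t_def list_update_append nth_append pre2_def pre1_def)
  have 8: "runs (cg \<beta> 0 g) (cfg pre3 m ?w (\<lambda>_. 0) post) (cfg (emitted pre3 y) m ?w (\<lambda>_. 0) post) (tg g n)"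
    using cg_correct[of 0 g m pre3 ?w "\<lambda>_. 0" post] g l len marked_label
    by (simp add: m_def y_def n_def)
  let ?ts = "cfg (emitted pre3 y) m ?w (\<lambda>_. 0) post"
  define ts' where "ts' = ?ts[0 := (\<lambda>z. outp t y (z - int (length y)))]"
  have t0: "t z = 0" if "z \<ge> -1" for z
    using r that p01 by (auto simp: t_def shift_def ready_def word_tape_def)
  have 9: "runs finish ?ts ts' (length y * 3 + 3)"
    unfolding ts'_def using l len ne
    by (intro runs_finish) (auto simp: t0 nth_append emitted_def pre3_def)
  have ly: "length y \<le> tg g n" unfolding y_def n_def using length_og[of g ?w] by simp
  have "runs (phase \<beta> g) ts ts' ((m + 1) + ((length x * (m + 6) + 1) + ((m + 1) + ((length u * (m + 6) + 1)
     + ((m + 1) + ((m * (n * 3 + 2) + 1) + (1 + (tg g n + (length y * 3 + 3)))))))))"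
    unfolding phase_def Let_def m_def[symmetric]
    using 1 2 3 4 5[unfolded w] 6 7 8 9 by (intro runs_Seq)
  moreover have "(m + 1) + ((length x * (m + 6) + 1) + ((m + 1) + ((length u * (m + 6) + 1)
     + ((m + 1) + ((m * (n * 3 + 2) + 1) + (1 + (tg g n + (length y * 3 + 3)))))))) \<le> n * (m * 8 + 20) + 4 * tg g n"
    using ly unfolding n_def by (simp add: algebra_simps)
  moreover have "ready K (\<beta> + m) y [] ts'"
  proof -
    have "ts' ! 0 = (\<lambda>z. outp t y (z - int (length y)))" using l ne by (auto simp: ts'_def)
    then have "(ts' ! 0) z = word_tape y z" if "z \<ge> 0" for z
      using that by (auto simp: outp_nth word_tape_def bitn_def t0)
    moreover have "ts' ! 1 = shift (length u) (pre ! 1)"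
      using l len \<beta> by (auto simp: ts'_def nth_append emitted_def pre3_def pre2_def pre1_def)
    then have "(ts' ! 1) z = word_tape [] z" if "z \<ge> 0" for z
      using that r p01 by (auto simp: shift_def ready_def word_tape_def)
    moreover have "ts' ! i = (\<lambda>_. 0)" if "\<beta> + m \<le> i" "i < K" for i
      using that l len r by (auto simp: ts'_def nth_append post_def ready_def)
    moreover have "length ts' = K" using l len by (simp add: ts'_def post_def)
    ultimately show ?thesis using len unfolding ready_def by auto
  qed
  ultimately show ?thesis by (meson runs_mono)
qed

text \<open>\<open>\<beta>\<close> and \<open>\<beta>'\<close> are the first free tapes before and
  after the program. The bound on the length of \<open>F x u\<close> is included because a following
  phase takes time polynomial in that length.\<close>

definition realizes :: "prog \<Rightarrow> nat \<Rightarrow> nat \<Rightarrow> (bool list \<Rightarrow> bool list \<Rightarrow> bool list) \<Rightarrow> bool" where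
  "realizes p \<beta> \<beta>' F \<longleftrightarrow> \<beta> \<le> \<beta>' \<and> (\<forall>K\<ge>\<beta>'. wfp K p) \<and> (\<exists>T. poly_bounded T \<and>
     (\<forall>K x u ts. \<beta>' \<le> K \<longrightarrow> ready K \<beta> x u ts \<longrightarrow>
        length (F x u) \<le> T (length x + length u) \<and>
        (\<exists>ts'. runs p ts ts' (T (length x + length u)) \<and> ready K \<beta>' (F x u) [] ts')))"

lemma realizes_phase:
  assumes "wfg 0 g" "3 \<le> \<beta>"
  shows "realizes (phase \<beta> g) \<beta> (\<beta> + nrg 0 g) (\<lambda>x u. og g (label x u) (\<lambda>_. 0))"
proof -
  let ?T = "\<lambda>n. (n + 3) * (nrg 0 g * 8 + 20) + 4 * tg g (n + 3)"
  have "poly_bounded ?T"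
    by (intro poly_bounded_intros poly_bounded_compose[OF poly_bounded_tg[of g]])
  moreover have "length (og g (label x u) (\<lambda>_. 0)) \<le> ?T (length x + length u)" for x u
    using length_og[of g "label x u" "\<lambda>_. 0"] by simp
  ultimately show ?thesis unfolding realizes_def
    using assms phase_correct[OF assms(1)] wfp_phase[OF assms] by (intro conjI exI[of _ ?T]) auto
qed

lemma realizes_Seq:
  assumes "realizes p \<beta> \<beta>' F" "realizes q \<beta>' \<beta>'' G"
  shows "realizes (Seq p q) \<beta> \<beta>'' (\<lambda>x u. G (F x u) [])"
proof -
  obtain T1 where b1: "poly_bounded T1" and c1: "\<And>K x u ts. \<beta>' \<le> K \<Longrightarrow> ready K \<beta> x u ts \<Longrightarrow>
        length (F x u) \<le> T1 (length x + length u) \<and>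
        (\<exists>ts'. runs p ts ts' (T1 (length x + length u)) \<and> ready K \<beta>' (F x u) [] ts')"
    using assms(1) unfolding realizes_def by blast
  obtain q1 where "\<And>n. T1 n \<le> poly q1 n" using b1 unfolding poly_bounded_def by blast
  note T1 = this c1
  obtain T2 where b2: "poly_bounded T2" and c2: "\<And>K x u ts. \<beta>'' \<le> K \<Longrightarrow> ready K \<beta>' x u ts \<Longrightarrow>
        length (G x u) \<le> T2 (length x + length u) \<and>
        (\<exists>ts'. runs q ts ts' (T2 (length x + length u)) \<and> ready K \<beta>'' (G x u) [] ts')"
    using assms(2) unfolding realizes_def by blast
  obtain q2 where "\<And>n. T2 n \<le> poly q2 n" using b2 unfolding poly_bounded_def by blast
  note T2 = this c2
  define T where "T = poly (q1 + pcompose q2 q1)"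
  have le: "T2 (length (F x u)) \<le> poly (pcompose q2 q1) (length x + length u)"
    if "length (F x u) \<le> T1 (length x + length u)" for x u
    unfolding poly_pcompose using that T1(1) T2(1) poly_nat_mono le_trans by metis
  have \<beta>: "\<beta> \<le> \<beta>'" "\<beta>' \<le> \<beta>''" using assms by (auto simp: realizes_def)
  have "length (G (F x u) []) \<le> T (length x + length u) \<and>
        (\<exists>ts'. runs (Seq p q) ts ts' (T (length x + length u)) \<and> ready K \<beta>'' (G (F x u) []) [] ts')"
    if *: "\<beta>'' \<le> K" "ready K \<beta> x u ts" for K x u ts
  proof -
    obtain ts1 where 1: "length (F x u) \<le> T1 (length x + length u)" "runs p ts ts1 (T1 (length x + length u))"
      "ready K \<beta>' (F x u) [] ts1" using T1(2)[of K x u ts] * \<beta> by auto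
    obtain ts2 where 2: "length (G (F x u) []) \<le> T2 (length (F x u))" "runs q ts1 ts2 (T2 (length (F x u)))"
      "ready K \<beta>'' (G (F x u) []) [] ts2" using T2(2)[of K "F x u" "[]" ts1] * 1 by auto
    have "runs (Seq p q) ts ts2 (T1 (length x + length u) + T2 (length (F x u)))"
      using 1 2 runs_Seq by blast
    moreover have "T1 (length x + length u) + T2 (length (F x u)) \<le> T (length x + length u)"
      using le[OF 1(1)] T1(1)[of "length x + length u"] by (simp add: T_def)
    ultimately show ?thesis using 2 runs_mono by fastforce
  qed
  then show ?thesis unfolding realizes_def
    using \<beta> assms by (intro conjI exI[of _ T]) (auto simp: T_def poly_bounded_poly realizes_def)
qed

lemma ready_init:
  assumes "3 \<le> K" "tapes M = K"
  shows "ready K 3 x u (snd (init_config M [x, u]))" "init_config M [x] = init_config M [x, []]"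
proof -
  have [simp]: "word_tape [] = (\<lambda>_. 0)" by (auto simp: word_tape_def)
  show "ready K 3 x u (snd (init_config M [x, u]))"
    using assms by (auto simp: ready_def init_config_def)
  show "init_config M [x] = init_config M [x, []]" by (auto simp: init_config_def less_Suc_eq)
qed

lemma realizes_machine:
  assumes "realizes p 3 \<beta> F"
  shows "\<exists>M q. turing_machine M \<and> 2 \<le> tapes M \<and>
    (\<forall>x u. computes_within M [x, u] (F x u) (poly q (length x + length u))) \<and>
    (\<forall>x. computes_within M [x] (F x []) (poly q (length x)))"
proof -
  define M where "M = prog_machine \<beta> p"
  have \<beta>: "3 \<le> \<beta>" "wfp \<beta> p" using assms by (auto simp: realizes_def)
  have M: "tapes M = \<beta>" by (simp add: M_def prog_machine_def Let_def)
  obtain T where b: "poly_bounded T" and c: "\<And>x u ts. ready \<beta> 3 x u ts \<Longrightarrow>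
        (\<exists>ts'. runs p ts ts' (T (length x + length u)) \<and> ready \<beta> \<beta> (F x u) [] ts')"
    using assms unfolding realizes_def by blast
  obtain q where "\<And>n. T n \<le> poly q n" using b unfolding poly_bounded_def by blast
  note T = this c
  have c: "computes_within M [x, u] (F x u) (poly (q + [:2:]) (length x + length u))" for x u
  proof -
    have r: "ready \<beta> 3 x u (snd (init_config M [x, u]))" using ready_init \<beta> M by auto
    then obtain n ts' where n: "n \<le> T (length x + length u)" "exec p (snd (init_config M [x, u])) n ts'"
      "ready \<beta> \<beta> (F x u) [] ts'" using T(2) unfolding runs_def by blast
    have "(step M ^^ poly (q + [:2:]) (length x + length u)) (0, snd (init_config M [x, u])) = (1, ts')"
      using prog_machine_halts[OF n(2) \<beta>(2), of "poly (q + [:2:]) (length x + length u)"]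
        n(1) T(1)[of "length x + length u"] r by (simp add: M_def[symmetric] ready_def)
    moreover have "init_config M [x, u] = (0, snd (init_config M [x, u]))" by (simp add: init_config_def)
    moreover have "hd ts' = ts' ! 0" using n(3) \<beta> by (cases ts') (auto simp: ready_def)
    ultimately show ?thesis using n(3) unfolding computes_within_def by (auto simp: ready_def)
  qed
  have "computes_within M [x] (F x []) (poly (q + [:2:]) (length x))" for x
    using c[of x "[]"] ready_init(2)[of \<beta> M x] \<beta> M unfolding computes_within_def by simp
  moreover have "turing_machine M" unfolding M_def using \<beta> by (intro turing_machine_prog_machine) auto
  ultimately show ?thesis using c M \<beta> by (intro exI[of _ M] exI[of _ "q + [:2:]"]) auto
qed

text \<open>Two phases, because the loops of a generator run over the positions of its own input:
  the first can lengthen the word polynomially, which gives the second correspondingly longer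
  loops.\<close>

lemma polytime_computable_generated:
  assumes "wfg 0 g" "wfg 0 h"
  shows "polytime_computable (\<lambda>x. og h (label (og g (label x []) (\<lambda>_. 0)) []) (\<lambda>_. 0))"
  using realizes_machine[OF realizes_Seq[OF realizes_phase[OF assms(1), of 3] realizes_phase[OF assms(2)]]]
  unfolding polytime_computable_def by auto

lemma polytime_verifier_definable:
  assumes "wff 0 \<phi>"
  shows "polytime_verifier (\<lambda>x u. evf \<phi> (label x u) (\<lambda>_. 0))"
proof -
  let ?g = "GIf \<phi> (Emit True) (Emit False)"
  have "og ?g (label x u) (\<lambda>_. 0) = [evf \<phi> (label x u) (\<lambda>_. 0)]" for x u by simp
  moreover have "wfg 0 ?g" using assms by simp
  ultimately show ?thesis
    using realizes_machine[OF realizes_phase[of ?g 3]] unfolding polytime_verifier_def by auto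
qed

section \<open>Listing graphs given by incidence data\<close>

definition dart_end :: "('e \<Rightarrow> 'v \<times> 'v) \<Rightarrow> 'e \<times> bool \<Rightarrow> 'v" where
  "dart_end ends d = (if snd d then snd (ends (fst d)) else fst (ends (fst d)))"

definition neighbours :: "('e \<Rightarrow> 'v \<times> 'v) \<Rightarrow> 'e set \<Rightarrow> ('v \<times> 'v) set" where
  "neighbours ends E = {(dart_end ends (e, s), dart_end ends (e, \<not> s)) | e s. e \<in> E}"

text \<open>The ends of edges and the darts at vertices are given independently, and
  \<open>e1\<close> and \<open>e2\<close> say that they agree. This replaces the counting of darts
  by a local check and turns a proper colouring into a condition on lists of length three.\<close>

lemma listed_graph_of_incidence:
  fixes ends :: "'e \<Rightarrow> 'v \<times> 'v" and vn :: "'v \<Rightarrow> nat"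
  assumes names: "distinct names" and vn: "bij_betw vn V {..<nv}" and ne: "V \<noteq> {}"
    and e1: "\<And>d. fst d \<in> set names \<Longrightarrow> dart_end ends d \<in> V \<and> d \<in> set (inc (dart_end ends d))"
    and e2: "\<And>v. v \<in> V \<Longrightarrow> length (inc v) = 3 \<and> distinct (inc v) \<and>
      (\<forall>d\<in>set (inc v). fst d \<in> set names \<and> dart_end ends d = v)"
    and conn: "\<And>u v. u \<in> V \<Longrightarrow> v \<in> V \<Longrightarrow> (u, v) \<in> (neighbours ends (set names))\<^sup>*"
  defines "G \<equiv> listed_graph nv (map (\<lambda>e. (vn (fst (ends e)), vn (snd (ends e)))) names)"
  shows "cubic_graph G"
    and "(\<exists>col. three_colouring G col) \<longleftrightarrow>
      (\<exists>col :: 'e \<Rightarrow> nat. (\<forall>e\<in>set names. col e < 3) \<and> (\<forall>v\<in>V. distinct (map (\<lambda>d. col (fst d)) (inc v))))"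
proof -
  let ?n = "length names"
  have arcs: "arcs G = {..<?n}" and verts: "verts G = {..<nv}" by (auto simp: G_def listed_graph_def)
  have hd_tl: "(if s then head G j else tail G j) = vn (dart_end ends (names ! j, s))" if "j < ?n" for j s
    using that by (simp add: G_def listed_graph_def dart_end_def)
  have vnV: "vn v < nv" if "v \<in> V" for v using vn that by (auto simp: bij_betw_def)
  have vV: "verts G = vn ` V" using vn by (auto simp: bij_betw_def verts)
  have inj: "inj_on vn V" using vn by (auto simp: bij_betw_def)
  define jx where "jx e = inv_into {..<?n} ((!) names) e" for e
  have jb: "bij_betw ((!) names) {..<?n} (set names)" using names bij_betw_nth by blast
  have jx: "jx e < ?n" "names ! jx e = e" if "e \<in> set names" for e
    using jb that unfolding jx_def bij_betw_def by (metis inv_into_into lessThan_iff, metis f_inv_into_f)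
  have jx2: "jx (names ! j) = j" if "j < ?n" for j
    using jb that unfolding jx_def bij_betw_def by (simp add: inv_into_f_f)
  have mem: "dart_end ends (names ! j, s) \<in> V" if "j < ?n" for j s
    using e1[of "(names ! j, s)"] that by simp
  have darts: "darts_at G (vn v) = (\<lambda>d. (jx (fst d), snd d)) ` set (inc v)" if v: "v \<in> V" for v
  proof
    show "darts_at G (vn v) \<subseteq> (\<lambda>d. (jx (fst d), snd d)) ` set (inc v)"
    proof
      fix x assume "x \<in> darts_at G (vn v)"
      then obtain j s where x: "x = (j, s)" "j < ?n" "(if s then head G j else tail G j) = vn v"
        by (auto simp: darts_at_def arcs)
      then have "vn (dart_end ends (names ! j, s)) = vn v" using hd_tl by simp
      then have "dart_end ends (names ! j, s) = v" using inj mem[OF x(2)] v by (meson inj_onD)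
      then have "(names ! j, s) \<in> set (inc v)" using e1[of "(names ! j, s)"] x(2) by auto
      then show "x \<in> (\<lambda>d. (jx (fst d), snd d)) ` set (inc v)"
        using jx2[OF x(2)] x(1) by force
    qed
  next
    show "(\<lambda>d. (jx (fst d), snd d)) ` set (inc v) \<subseteq> darts_at G (vn v)"
    proof clarify
      fix e s assume "(e, s) \<in> set (inc v)"
      then have "e \<in> set names" "dart_end ends (e, s) = v" using e2[OF v] by force+
      then show "(jx (fst (e, s)), snd (e, s)) \<in> darts_at G (vn v)"
        using hd_tl[of "jx e" s] jx[of e] by (auto simp: darts_at_def arcs)
    qed
  qed
  have injd: "inj_on (\<lambda>d. (jx (fst d), snd d)) (set (inc v))" if v: "v \<in> V" for v
  proof (rule inj_onI)
    fix d d' assume "d \<in> set (inc v)" "d' \<in> set (inc v)" "(jx (fst d), snd d) = (jx (fst d'), snd d')"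
    then show "d = d'" using e2[OF v] jx(2) by (metis Pair_inject prod.collapse)
  qed
  have card3: "card (darts_at G w) = 3" if w: "w \<in> verts G" for w
  proof -
    obtain v where v: "v \<in> V" "w = vn v" using w unfolding vV by blast
    have "card (darts_at G w) = card (set (inc v))"
      unfolding v(2) darts[OF v(1)] by (rule card_image[OF injd[OF v(1)]])
    then show ?thesis using e2[OF v(1)] distinct_card by metis
  qed
  have fin: "fin_digraph G"
  proof
    fix j assume "j \<in> arcs G"
    then show "tail G j \<in> verts G" "head G j \<in> verts G"
      using hd_tl[of j True] hd_tl[of j False] mem vnV by (simp_all add: arcs verts)
  qed (auto simp: arcs verts)
  have conn': "Digraph_Component.connected G"
    unfolding connected_def strongly_connected_def
  proof (intro conjI ballI)
    show "verts (with_proj (mk_symmetric G)) \<noteq> {}" using ne by (simp add: vV)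
    fix w w' assume "w \<in> verts (with_proj (mk_symmetric G))" "w' \<in> verts (with_proj (mk_symmetric G))"
    then obtain u v where uv: "u \<in> V" "w = vn u" "v \<in> V" "w' = vn v"
      by (auto simp: vV)
    let ?S = "with_proj (mk_symmetric G)"
    have "(u, v) \<in> (neighbours ends (set names))\<^sup>*" using conn uv by blast
    then have "v \<in> V \<and> (vn u, vn v) \<in> rtrancl_on (verts ?S) (arcs_ends ?S)"
    proof induction
      case base
      then show ?case using uv by (auto simp: vV)
    next
      case (step y z)
      then obtain e s where e: "e \<in> set names" "y = dart_end ends (e, s)" "z = dart_end ends (e, \<not> s)"
        by (auto simp: neighbours_def)
      have z: "z \<in> V" using e1[of "(e, \<not> s)"] e by simp
      have "head G (jx e) = vn (dart_end ends (e, True))" "tail G (jx e) = vn (dart_end ends (e, False))"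
        using hd_tl[of "jx e" True] hd_tl[of "jx e" False] jx[OF e(1)] by simp_all
      then have "(vn y, vn z) \<in> {(tail G (jx e), head G (jx e)), (head G (jx e), tail G (jx e))}"
        using e by (cases s) simp_all
      then have "(vn y, vn z) \<in> parcs (mk_symmetric G)"
        unfolding parcs_mk_symmetric using jx(1)[OF e(1)] arcs by blast
      then have "(vn y, vn z) \<in> arcs_ends ?S" by simp
      moreover have "vn z \<in> verts ?S" using z by (simp add: vV)
      ultimately show ?case using step.IH z rtrancl_on_into_rtrancl_on by fastforce
    qed
    then show "w \<rightarrow>\<^sup>*\<^bsub>?S\<^esub> w'" using uv by (simp add: reachable_def)
  qed
  show "cubic_graph G" unfolding cubic_graph_def using fin conn' card3 by blast
  have key: "inj_on (\<lambda>d. col (fst d)) (darts_at G (vn v)) \<longleftrightarrow> distinct (map (\<lambda>d. col (jx (fst d))) (inc v))"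
    if v: "v \<in> V" for v and col :: "nat \<Rightarrow> nat"
  proof -
    have "inj_on (\<lambda>d. col (fst d)) (darts_at G (vn v)) \<longleftrightarrow> inj_on ((\<lambda>d. col (fst d)) \<circ> (\<lambda>d. (jx (fst d), snd d))) (set (inc v))"
      unfolding darts[OF v] using comp_inj_on_iff[OF injd[OF v]] by blast
    then show ?thesis using e2[OF v] by (simp add: distinct_map comp_def)
  qed
  have V: "(\<forall>w\<in>verts G. P w) \<longleftrightarrow> (\<forall>v\<in>V. P (vn v))" for P
    unfolding vV by blast
  show "(\<exists>col. three_colouring G col) \<longleftrightarrow>
      (\<exists>col :: 'e \<Rightarrow> nat. (\<forall>e\<in>set names. col e < 3) \<and> (\<forall>v\<in>V. distinct (map (\<lambda>d. col (fst d)) (inc v))))"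
  proof
    assume "\<exists>col. three_colouring G col"
    then obtain col where "three_colouring G col" by blast
    then show "\<exists>col :: 'e \<Rightarrow> nat. (\<forall>e\<in>set names. col e < 3) \<and> (\<forall>v\<in>V. distinct (map (\<lambda>d. col (fst d)) (inc v)))"
      using key jx(1) unfolding three_colouring_def V arcs by (intro exI[of _ "\<lambda>e. col (jx e)"]) auto
  next
    assume "\<exists>col :: 'e \<Rightarrow> nat. (\<forall>e\<in>set names. col e < 3) \<and> (\<forall>v\<in>V. distinct (map (\<lambda>d. col (fst d)) (inc v)))"
    then obtain col :: "'e \<Rightarrow> nat" where col: "\<And>e. e \<in> set names \<Longrightarrow> col e < 3"
      "\<And>v. v \<in> V \<Longrightarrow> distinct (map (\<lambda>d. col (fst d)) (inc v))" by blast
    have "distinct (map (\<lambda>d. col (names ! jx (fst d))) (inc v))" if "v \<in> V" for v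
    proof -
      have eq: "map (\<lambda>d. col (names ! jx (fst d))) (inc v) = map (\<lambda>d. col (fst d)) (inc v)"
        using e2[OF that] jx(2) by (intro map_cong) auto
      show ?thesis unfolding eq using col(2)[OF that] .
    qed
    then have "three_colouring G (\<lambda>j. col (names ! j))"
      unfolding three_colouring_def V arcs using key[of _ "\<lambda>j. col (names ! j)"] col(1) by auto
    then show "\<exists>col. three_colouring G col" by blast
  qed
qed

section \<open>The inverting gadget\<close>

text \<open>Holyer's inverting component, the Petersen graph minus a path: seven vertices, eight inner edges \<open>f 0, \<dots>, f 7\<close>
  and five half-edges. The pair \<open>a\<close>, \<open>b\<close> has equal colours exactly if the pair \<open>c\<close>, \<open>d\<close> has different ones.\<close>

definition inv_rel :: "nat \<Rightarrow> nat \<Rightarrow> nat \<Rightarrow> nat \<Rightarrow> nat \<Rightarrow> bool" where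
  "inv_rel a b c d e \<longleftrightarrow> (a = b \<and> distinct [c, d, e]) \<or> (c = d \<and> distinct [a, b, e])"

text \<open>One conjunct for each of the vertices 0 to 6 in the numbering of
  \<open>int_ends\<close>, with the edges in the order in which \<open>inc\<close> lists
  them.\<close>

definition inv_proper :: "(nat \<Rightarrow> nat) \<Rightarrow> nat \<Rightarrow> nat \<Rightarrow> nat \<Rightarrow> nat \<Rightarrow> nat \<Rightarrow> bool" where
  "inv_proper f a b c d e \<longleftrightarrow> distinct [f 0, f 2, c] \<and> distinct [f 0, f 1, a] \<and> distinct [f 3, f 7, b] \<and>
     distinct [f 5, f 6, e] \<and> distinct [f 3, f 4, d] \<and> distinct [f 2, f 6, f 7] \<and> distinct [f 1, f 4, f 5]"

lemma third_colour:
  "distinct [x, y, z] \<Longrightarrow> x < 3 \<Longrightarrow> y < 3 \<Longrightarrow> z < (3::nat) \<Longrightarrow> x \<noteq> y \<and> z = 3 - x - y"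
  by auto

lemma less_3_cases: "(x::nat) < 3 \<Longrightarrow> x = 0 \<or> x = 1 \<or> x = 2"
  by linarith

lemma inv_proper_sound:
  assumes p: "inv_proper f a b c d e" and lt: "\<And>h. h < 8 \<Longrightarrow> f h < 3" "a < 3" "b < 3" "c < 3" "d < 3" "e < 3"
  shows "inv_rel a b c d e"
proof -
  have f: "f 0 < 3" "f 1 < 3" "f 2 < 3" "f 3 < 3" "f 4 < 3" "f 5 < 3" "f 6 < 3" "f 7 < 3" using lt(1) by auto
  have "f 0 \<noteq> f 2 \<and> c = 3 - f 0 - f 2" "f 0 \<noteq> f 1 \<and> a = 3 - f 0 - f 1" "f 3 \<noteq> f 7 \<and> b = 3 - f 3 - f 7"
    "f 5 \<noteq> f 6 \<and> e = 3 - f 5 - f 6" "f 3 \<noteq> f 4 \<and> d = 3 - f 3 - f 4" "f 2 \<noteq> f 6 \<and> f 7 = 3 - f 2 - f 6"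
    "f 1 \<noteq> f 4 \<and> f 5 = 3 - f 1 - f 4"
    using p third_colour f lt(2-6) unfolding inv_proper_def by blast+
  moreover obtain x0 x1 x2 x3 x4 x6 where x: "x0 = f 0" "x1 = f 1" "x2 = f 2" "x3 = f 3" "x4 = f 4" "x6 = f 6" by simp
  ultimately have eq: "x0 \<noteq> x2" "c = 3 - x0 - x2" "x0 \<noteq> x1" "a = 3 - x0 - x1" "x3 \<noteq> 3 - x2 - x6" "b = 3 - x3 - (3 - x2 - x6)"
    "3 - x1 - x4 \<noteq> x6" "e = 3 - (3 - x1 - x4) - x6" "x3 \<noteq> x4" "d = 3 - x3 - x4" "x2 \<noteq> x6" "x1 \<noteq> x4"
    by auto
  have l: "x0 = 0 \<or> x0 = 1 \<or> x0 = 2" "x1 = 0 \<or> x1 = 1 \<or> x1 = 2" "x2 = 0 \<or> x2 = 1 \<or> x2 = 2"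
    "x3 = 0 \<or> x3 = 1 \<or> x3 = 2" "x4 = 0 \<or> x4 = 1 \<or> x4 = 2" "x6 = 0 \<or> x6 = 1 \<or> x6 = 2"
    unfolding x using f less_3_cases by blast+
  \<comment> \<open>Of the thirteen colours seven are forced, the third colour at a vertex being 3
    minus the other two. The remaining six are enumerated, with the inequalities placed early to cut
    the search.\<close>
  have all: "\<forall>x0\<in>{0,1,2}. \<forall>x1\<in>{0,1,2}. x0 \<noteq> x1 \<longrightarrow> (\<forall>x2\<in>{0,1,2}. x0 \<noteq> x2 \<longrightarrow> (\<forall>x4\<in>{0,1,2}. x1 \<noteq> x4 \<longrightarrow>
     (\<forall>x6\<in>{0,1,2}. x2 \<noteq> x6 \<longrightarrow> 3 - x1 - x4 \<noteq> x6 \<longrightarrow> (\<forall>x3\<in>{0,1,2}. x3 \<noteq> x4 \<longrightarrow> x3 \<noteq> 3 - x2 - x6 \<longrightarrow>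
     inv_rel (3 - x0 - x1) (3 - x3 - (3 - x2 - x6)) (3 - x0 - x2) (3 - x3 - x4) (3 - (3 - x1 - x4) - x6)))))"
    unfolding inv_rel_def by code_simp
  have m: "x0 \<in> {0,1,2}" "x1 \<in> {0,1,2}" "x2 \<in> {0,1,2}" "x3 \<in> {0,1,2}" "x4 \<in> {0,1,2}" "x6 \<in> {0,1,2}"
    using l by auto
  show ?thesis unfolding eq(2,4,6,8,10)
    by (rule all[rule_format]) (fact m eq(1) eq(3) eq(5) eq(7) eq(9) eq(11) eq(12))+
qed

text \<open>Up to renaming colours only the place of the repeated colour among the three different
  ones matters. This leaves three cases for each disjunct of \<open>inv_rel\<close>, and each list
  gives \<open>f 0, ..., f 7\<close> for one of them.\<close>

lemma inv_proper_complete: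
  assumes r: "inv_rel a b c d e" and lt: "a < 3" "b < 3" "c < 3" "d < 3" "e < 3"
  shows "\<exists>f. (\<forall>h. f h < 3) \<and> inv_proper f a b c d e"
proof -
  have w: "\<exists>f. (\<forall>h. f h < 3) \<and> inv_proper f a b c d e"
    if "xs \<in> lists {..<3}" "length xs = 8" "inv_proper ((!) xs) a b c d e" for xs
  proof (intro exI conjI allI)
    fix h show "(if h < 8 then xs ! h else 0) < 3" using that nth_mem[of h xs] by auto
    show "inv_proper (\<lambda>h. if h < 8 then xs ! h else 0) a b c d e" using that(3) by (simp add: inv_proper_def)
  qed
  consider "a = b" "distinct [c, d, e]" | "c = d" "distinct [a, b, e]" using r by (auto simp: inv_rel_def)
  then show ?thesis
  proof cases
    case 1
    then have "a = c \<or> a = d \<or> a = e" using lt by auto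
    then show ?thesis
    proof (elim disjE)
      assume "a = c" then show ?thesis using 1 lt
        by (intro w[of "[d, e, e, e, c, d, c, d]"]) (auto simp: inv_proper_def numeral_eq_Suc)
    next
      assume "a = d" then show ?thesis using 1 lt
        by (intro w[of "[e, c, d, c, e, d, c, e]"]) (auto simp: inv_proper_def numeral_eq_Suc)
    next
      assume "a = e" then show ?thesis using 1 lt
        by (intro w[of "[d, c, e, c, e, d, c, d]"]) (auto simp: inv_proper_def numeral_eq_Suc)
    qed
  next
    case 2
    then have "c = a \<or> c = b \<or> c = e" using lt by auto
    then show ?thesis
    proof (elim disjE)
      assume "c = a" then show ?thesis using 2 lt
        by (intro w[of "[b, e, e, e, b, a, b, a]"]) (auto simp: inv_proper_def numeral_eq_Suc)
    next
      assume "c = b" then show ?thesis using 2 lt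
        by (intro w[of "[e, b, a, a, e, a, b, e]"]) (auto simp: inv_proper_def numeral_eq_Suc)
    next
      assume "c = e" then show ?thesis using 2 lt
        by (intro w[of "[b, e, a, a, b, a, b, e]"]) (auto simp: inv_proper_def numeral_eq_Suc)
    qed
  qed
qed

section \<open>From local clauses to cubic graphs\<close>

text \<open>There are two copies \<open>k\<close> of everything. \<open>IV k \<alpha> r q g\<close> is vertex \<open>g\<close> of the inverting component \<open>q < 4\<close> in the slot \<open>r\<close> of
  the variable \<open>\<alpha>\<close>, and \<open>ZV k a\<close> a vertex for the clause \<open>a\<close>. Edges are, in this order: inner edges of a component,
  the pairs of edges chaining the components of a variable into a ring, the edges joining the two copies of an unused
  fifth half-edge, the edges of the thread of a clause through its literals, its closing edge, and the third edge at
  the clause vertex. A pair in the ring with different colours encodes one truth value, a pair with equal colours the other, in roles that alternate along the ring;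
  the closing edge of an inactive clause joins the two copies, which leaves the clause unconstrained.\<close>

datatype lvert = IV bool nat nat nat nat | ZV bool nat

datatype ledge =
    Inn bool nat nat nat nat
  | Ch bool nat nat nat bool
  | Fr nat nat bool
  | Th bool nat nat
  | Cl nat bool
  | ZZ nat

definition bit_of :: "nat \<Rightarrow> nat \<Rightarrow> bool" where
  "bit_of a i \<longleftrightarrow> odd (a div 2 ^ i)"

text \<open>A literal occupies two consecutive components of its slot, starting at this one.
  Starting at 0 or at 1 selects the phase of the alternating ring, so that the forbidden truth value
  always shows as different colours on the pair between the two components.\<close>

definition port :: "nat \<Rightarrow> nat \<Rightarrow> nat" where
  "port a i = (if bit_of a i then 1 else 0)"

definition int_ends :: "(nat \<times> nat) list" where
  "int_ends = [(0, 1), (1, 6), (0, 5), (2, 4), (4, 6), (6, 3), (3, 5), (5, 2)]"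

text \<open>Each of the \<open>n\<close> cells has \<open>b\<close> Boolean variables. Clause \<open>a\<close> of a cell, if active, excludes that the \<open>3 * b\<close> variables of
  the cell and of its two neighbours are the bits of \<open>a\<close>. Slot \<open>r = i * N + a\<close> of a variable serves clause \<open>a\<close> of the cell whose
  \<open>i\<close>-th neighbour contains the variable.\<close>

locale clause_system =
  fixes n b :: nat and nb nbi :: "nat \<Rightarrow> nat \<Rightarrow> nat" and act :: "nat \<Rightarrow> nat \<Rightarrow> bool"
  assumes n_pos: "0 < n" and b_pos: "0 < b"
    and nb: "\<And>i c. i < 3 \<Longrightarrow> c < n \<Longrightarrow> nb i c < n \<and> nbi i (nb i c) = c"
    and nbi: "\<And>i c. i < 3 \<Longrightarrow> c < n \<Longrightarrow> nbi i c < n \<and> nb i (nbi i c) = c"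
    and nb_0: "\<And>c. nb 0 c = c" and nb_1: "\<And>c. c < n \<Longrightarrow> nb 1 c = Suc c mod n"
begin

definition m :: nat where "m = 3 * b"
definition N :: nat where "N = 2 ^ m"
definition Q :: nat where "Q = 3 * N"

definition lit_cell :: "nat \<Rightarrow> nat \<Rightarrow> nat" where "lit_cell c i = nb (i div b) c"
definition lit_row :: "nat \<Rightarrow> nat \<Rightarrow> nat" where "lit_row a i = (i div b) * N + a"
definition row_clause :: "nat \<Rightarrow> nat" where "row_clause r = r mod N"
definition row_lit :: "nat \<Rightarrow> nat \<Rightarrow> nat" where "row_lit \<alpha> r = (r div N) * b + \<alpha>"
definition row_port :: "nat \<Rightarrow> nat \<Rightarrow> nat" where "row_port \<alpha> r = port (row_clause r) (row_lit \<alpha> r)"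
definition row_centre :: "nat \<Rightarrow> nat \<Rightarrow> nat" where "row_centre r c = nbi (r div N) c"

definition next_slot :: "nat \<Rightarrow> nat" where "next_slot r = Suc r mod Q"
definition prev_slot :: "nat \<Rightarrow> nat" where "prev_slot r = (if r = 0 then Q - 1 else r - 1)"
text \<open>Three components would have room for a literal in either phase; the fourth makes the
  slot even, so that the phase is the same in all slots and the ring closes consistently. The two
  components off the thread are returned here.\<close>

definition unused :: "nat \<Rightarrow> nat \<Rightarrow> bool \<Rightarrow> nat" where
  "unused \<alpha> r s = (if s then 3 else if row_port \<alpha> r = 0 then 2 else 0)"

definition lit_in :: "nat \<Rightarrow> bool \<Rightarrow> nat \<Rightarrow> nat \<Rightarrow> nat \<times> lvert" where
  "lit_in c k a i = (lit_cell c i, IV k (i mod b) (lit_row a i) (port a i) 3)"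
definition lit_out :: "nat \<Rightarrow> bool \<Rightarrow> nat \<Rightarrow> nat \<Rightarrow> nat \<times> lvert" where
  "lit_out c k a i = (lit_cell c i, IV k (i mod b) (lit_row a i) (Suc (port a i)) 3)"

fun ends :: "nat \<times> ledge \<Rightarrow> (nat \<times> lvert) \<times> (nat \<times> lvert)" where
  "ends (c, Inn k \<alpha> r q h) = ((c, IV k \<alpha> r q (fst (int_ends ! h))), (c, IV k \<alpha> r q (snd (int_ends ! h))))"
| "ends (c, Ch k \<alpha> r q s) = ((c, IV k \<alpha> r q (if s then 4 else 0)),
     (c, if q < 3 then IV k \<alpha> r (Suc q) (if s then 2 else 1) else IV k \<alpha> (next_slot r) 0 (if s then 2 else 1)))"
| "ends (c, Fr \<alpha> r s) = ((c, IV False \<alpha> r (unused \<alpha> r s) 3), (c, IV True \<alpha> r (unused \<alpha> r s) 3))"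
| "ends (c, Th k a i) = (if i = 0 then (c, ZV k a) else lit_out c k a (i - 1), lit_in c k a i)"
| "ends (c, Cl a k) = (if act c a then (lit_out c k a (m - 1), (c, ZV k a))
     else if k then ((c, ZV False a), (c, ZV True a)) else (lit_out c False a (m - 1), lit_out c True a (m - 1)))"
| "ends (c, ZZ a) = ((c, ZV False a), (c, ZV True a))"

fun valid_edge :: "ledge \<Rightarrow> bool" where
  "valid_edge (Inn k \<alpha> r q h) \<longleftrightarrow> \<alpha> < b \<and> r < Q \<and> q < 4 \<and> h < 8"
| "valid_edge (Ch k \<alpha> r q s) \<longleftrightarrow> \<alpha> < b \<and> r < Q \<and> q < 4"
| "valid_edge (Fr \<alpha> r s) \<longleftrightarrow> \<alpha> < b \<and> r < Q"
| "valid_edge (Th k a i) \<longleftrightarrow> a < N \<and> i < m"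
| "valid_edge (Cl a k) \<longleftrightarrow> a < N"
| "valid_edge (ZZ a) \<longleftrightarrow> a < N"

fun valid_vert :: "lvert \<Rightarrow> bool" where
  "valid_vert (IV k \<alpha> r q g) \<longleftrightarrow> \<alpha> < b \<and> r < Q \<and> q < 4 \<and> g < 7"
| "valid_vert (ZV k a) \<longleftrightarrow> a < N"

definition V :: "(nat \<times> lvert) set" where "V = {..<n} \<times> Collect valid_vert"
definition E :: "(nat \<times> ledge) set" where "E = {..<n} \<times> Collect valid_edge"

text \<open>The edge leaving the gadget \<open>q\<close> of a slot at its fifth terminal, with the side at which it does.\<close>

definition outer :: "nat \<Rightarrow> bool \<Rightarrow> nat \<Rightarrow> nat \<Rightarrow> nat \<Rightarrow> (nat \<times> ledge) \<times> bool" where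
  "outer c k \<alpha> r q = (let a = row_clause r; i = row_lit \<alpha> r; c0 = row_centre r c; p = row_port \<alpha> r in
     if q = p then ((c0, Th k a i), True)
     else if q = Suc p then
       (if Suc i < m then ((c0, Th k a (Suc i)), False)
        else if act c0 a then ((c0, Cl a k), False) else ((c0, Cl a False), k))
     else ((c, Fr \<alpha> r (q = 3)), k))"

definition pred_ch :: "nat \<Rightarrow> bool \<Rightarrow> nat \<Rightarrow> nat \<Rightarrow> nat \<Rightarrow> bool \<Rightarrow> nat \<times> ledge" where
  "pred_ch c k \<alpha> r q s = (c, if q = 0 then Ch k \<alpha> (prev_slot r) 3 s else Ch k \<alpha> r (q - 1) s)"

fun inc :: "nat \<times> lvert \<Rightarrow> ((nat \<times> ledge) \<times> bool) list" where
  "inc (c, IV k \<alpha> r q g) = (let I = (\<lambda>h. (c, Inn k \<alpha> r q h)) in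
     if g = 0 then [(I 0, False), (I 2, False), ((c, Ch k \<alpha> r q False), False)]
     else if g = 1 then [(I 0, True), (I 1, False), (pred_ch c k \<alpha> r q False, True)]
     else if g = 2 then [(I 3, False), (I 7, True), (pred_ch c k \<alpha> r q True, True)]
     else if g = 3 then [(I 5, True), (I 6, False), outer c k \<alpha> r q]
     else if g = 4 then [(I 3, True), (I 4, False), ((c, Ch k \<alpha> r q True), False)]
     else if g = 5 then [(I 2, True), (I 6, True), (I 7, False)]
     else [(I 1, True), (I 4, True), (I 5, False)])"
| "inc (c, ZV k a) = [((c, ZZ a), k), ((c, Th k a 0), False),
     if act c a then ((c, Cl a k), True) else ((c, Cl a True), k)]"

section \<open>Index arithmetic of slots, and agreement of ends with incidence lists\<close>

lemma N_pos: "0 < N" and m_pos: "0 < m" and Q_pos: "0 < Q"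
  using b_pos by (auto simp: N_def m_def Q_def)

lemma lit_bounds:
  assumes "a < N" "i < m"
  shows "i div b < 3" "i mod b < b" "lit_row a i < Q" "row_clause (lit_row a i) = a"
    "row_lit (i mod b) (lit_row a i) = i" "lit_row a i div N = i div b"
proof -
  show d: "i div b < 3" using assms b_pos by (simp add: m_def div_less_iff_less_mult)
  show "i mod b < b" using b_pos by simp
  have "(i div b) * N + a < (i div b) * N + N" using assms by simp
  also have "\<dots> = Suc (i div b) * N" by simp
  also have "\<dots> \<le> 3 * N" using d by (intro mult_le_mono1) simp
  finally show "lit_row a i < Q" by (simp add: lit_row_def Q_def)
  show "row_clause (lit_row a i) = a" using assms by (simp add: row_clause_def lit_row_def)
  show e: "lit_row a i div N = i div b" using assms by (simp add: lit_row_def)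
  show "row_lit (i mod b) (lit_row a i) = i" unfolding row_lit_def e by simp
qed

text \<open>Inverse to \<open>lit_bounds\<close>: literals of clauses and slots of variables
  correspond one to one, which is why exactly one thread runs through each slot in each
  copy.\<close>

lemma row_bounds:
  assumes "\<alpha> < b" "r < Q"
  shows "row_clause r < N" "row_lit \<alpha> r < m" "r div N < 3" "row_lit \<alpha> r mod b = \<alpha>" "row_lit \<alpha> r div b = r div N"
    "lit_row (row_clause r) (row_lit \<alpha> r) = r"
proof -
  show "row_clause r < N" using N_pos by (simp add: row_clause_def)
  show d: "r div N < 3" using assms N_pos by (simp add: Q_def div_less_iff_less_mult)
  have "(r div N) * b + \<alpha> < Suc (r div N) * b" using assms by simp
  also have "\<dots> \<le> 3 * b" using d by (intro mult_le_mono1) simp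
  finally show "row_lit \<alpha> r < m" by (simp add: row_lit_def m_def)
  show "row_lit \<alpha> r mod b = \<alpha>" "row_lit \<alpha> r div b = r div N" using assms by (simp_all add: row_lit_def)
  then show "lit_row (row_clause r) (row_lit \<alpha> r) = r" by (simp add: lit_row_def row_clause_def)
qed

lemma slot_bounds:
  assumes "r < Q"
  shows "next_slot r < Q" "prev_slot r < Q" "prev_slot (next_slot r) = r" "next_slot (prev_slot r) = r"
  using assms Q_pos by (auto simp: next_slot_def prev_slot_def mod_Suc)

lemma port_le: "port a i \<le> 1"
  by (simp add: port_def)

lemma outer_in:
  assumes "c < n" "a < N" "i < m"
  shows "outer (lit_cell c i) k (i mod b) (lit_row a i) (port a i) = ((c, Th k a i), True)"
  using lit_bounds[OF assms(2,3)] nb assms(1)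
  by (simp add: outer_def row_port_def row_centre_def lit_cell_def Let_def)

lemma outer_out:
  assumes "c < n" "a < N" "i < m"
  shows "outer (lit_cell c i) k (i mod b) (lit_row a i) (Suc (port a i)) =
     (if Suc i < m then ((c, Th k a (Suc i)), False)
        else if act c a then ((c, Cl a k), False) else ((c, Cl a False), k))"
  using lit_bounds[OF assms(2,3)] nb assms(1)
  by (simp add: outer_def row_port_def row_centre_def lit_cell_def Let_def)

lemma lit_cell_lt: "c < n \<Longrightarrow> i < m \<Longrightarrow> lit_cell c i < n"
  using lit_bounds(1)[OF N_pos] nb by (simp add: lit_cell_def)

lemma outer_unused: "outer c k \<alpha> r (unused \<alpha> r s) = ((c, Fr \<alpha> r s), k)"
  using port_le[of "row_clause r" "row_lit \<alpha> r"]
  by (auto simp: outer_def unused_def row_port_def Let_def)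

text \<open>One half of the agreement between \<open>ends\<close> and \<open>inc\<close>. Only
  threads and closing edges leave their cell; for them \<open>outer_in\<close> and
  \<open>outer_out\<close> undo \<open>lit_cell\<close> by \<open>row_centre\<close>.\<close>

lemma incidence1:
  assumes "fst d \<in> E"
  shows "dart_end ends d \<in> V \<and> d \<in> set (inc (dart_end ends d))"
proof -
  obtain c e s where d: "d = ((c, e), s)" by (metis prod.exhaust)
  have c: "c < n" and e: "valid_edge e" using assms by (auto simp: E_def d)
  have bit: "port a i < 2" for a i using port_le[of a i] by simp
  show ?thesis
  proof (cases e)
    case (Inn k \<alpha> r q h)
    then have "h = 0 \<or> h = 1 \<or> h = 2 \<or> h = 3 \<or> h = 4 \<or> h = 5 \<or> h = 6 \<or> h = 7" using e by auto
    then show ?thesis using c e Inn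
      by (elim disjE; cases s) (simp_all add: d dart_end_def V_def int_ends_def Let_def)
  next
    case (Ch k \<alpha> r q x)
    then show ?thesis using c e slot_bounds[of r]
      by (cases s; cases x) (auto simp: d dart_end_def V_def Let_def pred_ch_def)
  next
    case (Fr \<alpha> r x)
    then show ?thesis using c e outer_unused[of c _ \<alpha> r x]
      by (cases s) (auto simp: d dart_end_def V_def Let_def unused_def)
  next
    case (Th k a i)
    then have a: "a < N" "i < m" using e by auto
    show ?thesis
    proof (cases s)
      case True
      then show ?thesis using c Th a lit_bounds[OF a] outer_in[OF c a, of k] lit_cell_lt[OF c] bit[of a i]
        by (simp add: d dart_end_def V_def Let_def lit_in_def)
    next
      case False
      then show ?thesis
      proof (cases "i = 0")
        case False
        then have i: "i - 1 < m" "Suc (i - 1) = i" using a by auto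
        then show ?thesis
          using c Th a lit_bounds[OF a(1) i(1)] outer_out[OF c a(1) i(1), of k] lit_cell_lt[OF c] bit[of a "i - 1"] \<open>\<not> s\<close> False
          by (simp add: d dart_end_def V_def Let_def lit_out_def)
      qed (use c Th a \<open>\<not> s\<close> in \<open>simp add: d dart_end_def V_def\<close>)
    qed
  next
    case (Cl a k)
    obtain i where i: "m = Suc i" using m_pos by (cases m) auto
    have a: "a < N" "i < m" using Cl e i by auto
    have o: "outer (lit_cell c i) k' (i mod b) (lit_row a i) (Suc (port a i)) =
        (if act c a then ((c, Cl a k'), False) else ((c, Cl a False), k'))" for k'
      using outer_out[OF c a, of k'] i by simp
    have v: "lit_out c k' a i \<in> V" for k'
      using lit_bounds[OF a] lit_cell_lt[OF c a(2)] bit[of a i] by (simp add: V_def lit_out_def)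
    have z: "(c, ZV k' a) \<in> V" for k' using c a by (simp add: V_def)
    have inc: "((c, Cl a k'), False) \<in> set (inc (lit_out c k' a i))" if "act c a" for k'
      using o[of k'] that by (simp add: lit_out_def Let_def)
    have inc': "((c, Cl a False), k') \<in> set (inc (lit_out c k' a i))" if "\<not> act c a" for k'
      using o[of k'] that by (simp add: lit_out_def Let_def)
    have ends: "ends (c, Cl a k') = (if act c a then (lit_out c k' a i, (c, ZV k' a))
     else if k' then ((c, ZV False a), (c, ZV True a)) else (lit_out c False a i, lit_out c True a i))" for k'
      by (simp add: i)
    show ?thesis
      using v z inc inc' by (cases s; cases "act c a"; cases k) (simp_all add: d dart_end_def Cl ends del: ends.simps(5))
  next
    case (ZZ a)
    then show ?thesis using c e by (cases s) (simp_all add: d dart_end_def V_def)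
  qed
qed

lemma incidence2:
  assumes "v \<in> V"
  shows "length (inc v) = 3 \<and> distinct (inc v) \<and> (\<forall>d\<in>set (inc v). fst d \<in> E \<and> dart_end ends d = v)"
proof -
  obtain c l where v: "v = (c, l)" by (metis prod.exhaust)
  have c: "c < n" and l: "valid_vert l" using assms by (auto simp: V_def v)
  show ?thesis
  proof (cases l)
    case (ZV k a)
    then show ?thesis using c l m_pos by (auto simp: v E_def dart_end_def)
  next
    case (IV k \<alpha> r q g)
    then have b: "\<alpha> < b" "r < Q" "q < 4" using l by auto
    have "g = 0 \<or> g = 1 \<or> g = 2 \<or> g = 3 \<or> g = 4 \<or> g = 5 \<or> g = 6" using l IV by auto
    moreover have ?thesis if "g = 1 \<or> g = 2"
      using that b c slot_bounds[OF b(2)]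
      by (auto simp: v IV Let_def E_def dart_end_def int_ends_def pred_ch_def)
    moreover have ?thesis if g: "g = 3"
    proof -
      note rb = row_bounds[OF b(1,2)]
      define a i c0 where "a = row_clause r" and "i = row_lit \<alpha> r" and "c0 = row_centre r c"
      have c0: "c0 < n" "lit_cell c0 i = c" using nbi[OF rb(3) c] rb by (auto simp: c0_def row_centre_def lit_cell_def i_def)
      have ai: "a < N" "i < m" "i mod b = \<alpha>" "lit_row a i = r" using rb by (auto simp: a_def i_def)
      have p: "row_port \<alpha> r = port a i" by (simp add: row_port_def a_def i_def)
      have o: "fst (outer c k \<alpha> r q) \<in> E \<and> dart_end ends (outer c k \<alpha> r q) = v"
      proof -
        consider "q = port a i" | "q = Suc (port a i)" | "q \<noteq> port a i" "q \<noteq> Suc (port a i)" by blast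
        then show ?thesis
        proof cases
          case 1
          then have "outer c k \<alpha> r q = ((c0, Th k a i), True)"
            using outer_in[OF c0(1) ai(1,2), of k] c0 ai by simp
          then show ?thesis using c0 ai 1 g by (simp add: E_def dart_end_def lit_in_def v IV)
        next
          case 2
          have o: "outer c k' \<alpha> r (Suc (port a i)) = (if Suc i < m then ((c0, Th k' a (Suc i)), False)
              else if act c0 a then ((c0, Cl a k'), False) else ((c0, Cl a False), k'))" for k'
            using outer_out[OF c0(1) ai(1,2), of k'] c0 ai by simp
          have mi: "m - Suc 0 = i" if "\<not> Suc i < m" using that ai by simp
          show ?thesis
            by (cases "Suc i < m"; cases "act c0 a"; cases k)
              (simp_all add: o c0 ai 2 g mi E_def dart_end_def lit_out_def v IV)
        next
          case 3
          then have "outer c k \<alpha> r q = ((c, Fr \<alpha> r (q = 3)), k)"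
            by (simp add: outer_def Let_def p)
          moreover have "unused \<alpha> r (q = 3) = q" using 3 b port_le[of a i] by (auto simp: unused_def p)
          ultimately show ?thesis using c b g by (auto simp: E_def dart_end_def v IV)
        qed
      qed
      have "outer c k \<alpha> r q \<noteq> ((c, Inn k \<alpha> r q h), s)" "((c, Inn k \<alpha> r q h), s) \<noteq> outer c k \<alpha> r q" for h s
        by (auto simp: outer_def Let_def)
      then show ?thesis using o g b c by (auto simp: v IV Let_def E_def dart_end_def int_ends_def)
    qed
    moreover have ?thesis if "g = 0 \<or> g = 4 \<or> g = 5 \<or> g = 6"
      using that b c by (auto simp: v IV Let_def E_def dart_end_def int_ends_def)
    ultimately show ?thesis by blast
  qed
qed

section \<open>Connectedness of the clause graph\<close>

abbreviation R :: "((nat \<times> lvert) \<times> (nat \<times> lvert)) set" where "R \<equiv> (neighbours ends E)\<^sup>*"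

lemma R_sym: "(u, v) \<in> R \<Longrightarrow> (v, u) \<in> R"
proof -
  have "sym (neighbours ends E)"
  proof (rule symI)
    fix x y assume "(x, y) \<in> neighbours ends E"
    then obtain e s where e: "e \<in> E" "x = dart_end ends (e, s)" "y = dart_end ends (e, \<not> s)"
      unfolding neighbours_def by blast
    show "(y, x) \<in> neighbours ends E"
      unfolding neighbours_def by (intro CollectI exI[of _ e] exI[of _ "\<not> s"]) (simp add: e)
  qed
  then show "(u, v) \<in> R \<Longrightarrow> (v, u) \<in> R" by (meson sym_rtrancl symD)
qed

lemma R_edge:
  assumes "c < n" "valid_edge e" "ends (c, e) = (u, v)"
  shows "(u, v) \<in> R"
proof -
  have "(dart_end ends ((c, e), False), dart_end ends ((c, e), \<not> False)) \<in> neighbours ends E"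
    unfolding neighbours_def using assms(1,2)
    by (intro CollectI exI[of _ "(c, e)"] exI[of _ False]) (simp add: E_def)
  then show ?thesis using assms(3) by (auto simp: dart_end_def)
qed

lemma R_trans: "(u, v) \<in> R \<Longrightarrow> (v, w) \<in> R \<Longrightarrow> (u, w) \<in> R"
  by (rule rtrancl_trans)

lemma R_gadget:
  assumes "c < n" "\<alpha> < b" "r < Q" "q < 4" "g < 7"
  shows "((c, IV k \<alpha> r q 0), (c, IV k \<alpha> r q g)) \<in> R"
proof -
  let ?v = "\<lambda>g. (c, IV k \<alpha> r q g)"
  have e: "(?v (fst (int_ends ! h)), ?v (snd (int_ends ! h))) \<in> R" if "h < 8" for h
    using R_edge[of c "Inn k \<alpha> r q h"] assms that by auto
  have e': "(?v 0, ?v 1) \<in> R" "(?v 1, ?v 6) \<in> R" "(?v 0, ?v 5) \<in> R" "(?v 4, ?v 6) \<in> R" "(?v 3, ?v 5) \<in> R" "(?v 5, ?v 2) \<in> R"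
    using e[of 0] e[of 1] e[of 2] e[of 4] e[of 6] e[of 7] by (auto simp: int_ends_def)
  have "g = 0 \<or> g = 1 \<or> g = 2 \<or> g = 3 \<or> g = 4 \<or> g = 5 \<or> g = 6" using assms by auto
  then show ?thesis
    using e' R_trans[OF e'(1,2)] R_trans[OF e'(3,6)] R_trans[OF R_trans[OF e'(1,2)] R_sym[OF e'(4)]]
      R_trans[OF e'(3) R_sym[OF e'(5)]] by (elim disjE) simp_all
qed

lemma R_slot:
  assumes "c < n" "\<alpha> < b" "r < Q" "q < 4"
  shows "((c, IV k \<alpha> 0 0 0), (c, IV k \<alpha> r q 0)) \<in> R"
proof -
  have step: "((c, IV k \<alpha> r q 0), (c, if q < 3 then IV k \<alpha> r (Suc q) 0 else IV k \<alpha> (next_slot r) 0 0)) \<in> R"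
    if "r < Q" "q < 4" for r q
  proof -
    have "((c, IV k \<alpha> r q 0), (c, if q < 3 then IV k \<alpha> r (Suc q) 1 else IV k \<alpha> (next_slot r) 0 1)) \<in> R"
      using R_edge[of c "Ch k \<alpha> r q False"] assms that by auto
    moreover have "((c, if q < 3 then IV k \<alpha> r (Suc q) 1 else IV k \<alpha> (next_slot r) 0 1),
        (c, if q < 3 then IV k \<alpha> r (Suc q) 0 else IV k \<alpha> (next_slot r) 0 0)) \<in> R"
      using R_sym[OF R_gadget[of c \<alpha> r "Suc q" 1 k]] R_sym[OF R_gadget[of c \<alpha> "next_slot r" 0 1 k]]
        assms that slot_bounds[of r] by auto
    ultimately show ?thesis by (rule R_trans)
  qed
  have row: "((c, IV k \<alpha> r 0 0), (c, IV k \<alpha> r q 0)) \<in> R" if "r < Q" "q < 4" for r q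
    using that
  proof (induction q)
    case (Suc q)
    then show ?case using R_trans[OF Suc.IH step[of r q]] by simp
  qed simp
  have first: "((c, IV k \<alpha> 0 0 0), (c, IV k \<alpha> r 0 0)) \<in> R" if "r < Q" for r
    using that
  proof (induction r)
    case (Suc r)
    then have "((c, IV k \<alpha> r 3 0), (c, IV k \<alpha> (Suc r) 0 0)) \<in> R"
      using step[of r 3] by (simp add: next_slot_def)
    then show ?case using R_trans[OF R_trans[OF Suc.IH row[of r 3]]] Suc.prems by simp
  qed simp
  show ?thesis by (rule R_trans[OF first row]) (fact assms)+
qed

lemma R_thread:
  assumes "c < n" "a < N" "i < m"
  shows "((c, ZV k a), lit_in c k a i) \<in> R"
  using assms(3)
proof (induction i)
  case 0
  then show ?case using R_edge[of c "Th k a 0"] assms by simp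
next
  case (Suc i)
  have i: "i < m" using Suc.prems by simp
  note lb = lit_bounds[OF assms(2) i]
  have p: "port a i < 3" using port_le[of a i] by simp
  have "(lit_in c k a i, lit_out c k a i) \<in> R"
  proof -
    let ?c = "lit_cell c i" and ?\<alpha> = "i mod b" and ?r = "lit_row a i"
    have "?c < n" using lit_cell_lt assms(1) i by blast
    then have h: "((?c, IV k ?\<alpha> 0 0 0), (?c, IV k ?\<alpha> ?r q 3)) \<in> R" if "q < 4" for q
      using R_trans[OF R_slot R_gadget] lb that by simp
    have "port a i < 4" "Suc (port a i) < 4" using p by auto
    then show ?thesis unfolding lit_in_def lit_out_def using R_trans[OF R_sym[OF h] h] by blast
  qed
  moreover have "(lit_out c k a i, lit_in c k a (Suc i)) \<in> R"
    using R_edge[of c "Th k a (Suc i)"] assms Suc.prems by simp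
  ultimately show ?case by (rule R_trans[OF R_trans[OF Suc.IH[OF i]]])
qed

text \<open>Rings connect the slots of a variable, and the thread of clause 0 connects the variables
  of its cell. Its literal \<open>b\<close> lies in the next cell, which links cell to cell;
  \<open>ZZ\<close> links the two copies, and every other clause vertex is reached through its first
  literal, which lies in its own cell.\<close>

lemma R_all:
  assumes "u \<in> V" "v \<in> V"
  shows "(u, v) \<in> R"
proof -
  have slot: "((c, ZV k 0), (lit_cell c i, IV k (i mod b) r q g)) \<in> R"
    if "c < n" "i < m" "r < Q" "q < 4" "g < 7" for c k i r q g
  proof -
    have l: "lit_cell c i < n" "i mod b < b" "lit_row 0 i < Q" "port 0 i < 4"
      using lit_cell_lt lit_bounds[OF N_pos \<open>i < m\<close>] port_le[of 0 i] that by auto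
    have A: "((c, ZV k 0), (lit_cell c i, IV k (i mod b) (lit_row 0 i) (port 0 i) 3)) \<in> R"
      using R_thread[OF \<open>c < n\<close> N_pos \<open>i < m\<close>] by (simp add: lit_in_def)
    have B: "((lit_cell c i, IV k (i mod b) 0 0 0), (lit_cell c i, IV k (i mod b) (lit_row 0 i) (port 0 i) 3)) \<in> R"
      using R_trans[OF R_slot R_gadget] l by simp
    have C: "((lit_cell c i, IV k (i mod b) 0 0 0), (lit_cell c i, IV k (i mod b) r q g)) \<in> R"
      using R_trans[OF R_slot R_gadget] l that by simp
    show ?thesis by (rule R_trans[OF A R_trans[OF R_sym[OF B] C]])
  qed
  have own: "((c, ZV k 0), (c, IV k \<alpha> r q g)) \<in> R" if "c < n" "\<alpha> < b" "r < Q" "q < 4" "g < 7" for c k \<alpha> r q g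
    using slot[of c \<alpha> r q g k] that by (simp add: lit_cell_def nb_0 m_def)
  have copy: "((c, ZV False 0), (c, ZV True 0)) \<in> R" if "c < n" for c
    using R_edge[of c "ZZ 0"] that N_pos by simp
  have cell: "((0, ZV False 0), (c, ZV False 0)) \<in> R" if "c < n" for c
    using that
  proof (induction c)
    case (Suc c)
    have bm: "b < m" using b_pos by (simp add: m_def)
    have A: "((c, ZV False 0), (Suc c, IV False 0 0 0 0)) \<in> R"
      using slot[of c b 0 0 0 False] Suc.prems bm Q_pos b_pos nb_1[of c] by (simp add: lit_cell_def)
    have B: "((Suc c, ZV False 0), (Suc c, IV False 0 0 0 0)) \<in> R"
      using own Suc.prems b_pos Q_pos by simp
    have "((0, ZV False 0), (c, ZV False 0)) \<in> R" using Suc by simp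
    then show ?case by (rule R_trans[OF _ R_trans[OF A R_sym[OF B]]])
  qed simp
  have base: "((0, ZV False 0), w) \<in> R" if w: "w \<in> V" for w
  proof -
    obtain c l where cl: "w = (c, l)" "c < n" "valid_vert l" using w by (auto simp: V_def)
    have k: "((0, ZV False 0), (c, ZV k 0)) \<in> R" for k
      using cell[OF cl(2)] R_trans[OF cell[OF cl(2)] copy[OF cl(2)]] by (cases k) simp_all
    show ?thesis
    proof (cases l)
      case (IV k \<alpha> r q g)
      then show ?thesis using cl R_trans[OF k[of k] own[of c \<alpha> r q g k]] by simp
    next
      case (ZV k a)
      then have "a < N" using cl by simp
      have A: "((c, ZV k a), lit_in c k a 0) \<in> R" using R_thread cl \<open>a < N\<close> m_pos by blast
      have B: "((c, ZV k 0), lit_in c k a 0) \<in> R"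
        using own[of c 0 "lit_row a 0" "port a 0" 3 k] lit_bounds[OF \<open>a < N\<close> m_pos] cl b_pos port_le[of a 0]
        by (simp add: lit_in_def lit_cell_def nb_0)
      show ?thesis using R_trans[OF k[of k] R_trans[OF B R_sym[OF A]]] cl ZV by simp
    qed
  qed
  show ?thesis by (rule R_trans[OF R_sym[OF base[OF assms(1)]] base[OF assms(2)]])
qed

subsection \<open>Colourings and assignments\<close>

definition proper :: "(nat \<times> ledge \<Rightarrow> nat) \<Rightarrow> bool" where
  "proper col \<longleftrightarrow> (\<forall>e\<in>E. col e < 3) \<and> (\<forall>v\<in>V. distinct (map (\<lambda>d. col (fst d)) (inc v)))"

definition satisfies :: "(nat \<Rightarrow> nat \<Rightarrow> bool) \<Rightarrow> bool" where
  "satisfies val \<longleftrightarrow>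
     (\<forall>c<n. \<forall>a<N. act c a \<longrightarrow> (\<exists>i<m. val (lit_cell c i) (i mod b) \<noteq> bit_of a i))"

lemma outer_E: "c < n \<Longrightarrow> \<alpha> < b \<Longrightarrow> r < Q \<Longrightarrow> q < 4 \<Longrightarrow> fst (outer c k \<alpha> r q) \<in> E"
  using incidence2[of "(c, IV k \<alpha> r q 3)"] by (simp add: V_def Let_def)

lemma gadget_rel:
  assumes "proper col" "c < n" "\<alpha> < b" "r < Q" "q < 4"
  shows "inv_rel (col (pred_ch c k \<alpha> r q False)) (col (pred_ch c k \<alpha> r q True))
    (col (c, Ch k \<alpha> r q False)) (col (c, Ch k \<alpha> r q True)) (col (fst (outer c k \<alpha> r q)))"
proof (rule inv_proper_sound)
  have lt: "e \<in> E \<Longrightarrow> col e < 3" for e using assms(1) by (simp add: proper_def)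
  show "inv_proper (\<lambda>h. col (c, Inn k \<alpha> r q h)) (col (pred_ch c k \<alpha> r q False)) (col (pred_ch c k \<alpha> r q True))
    (col (c, Ch k \<alpha> r q False)) (col (c, Ch k \<alpha> r q True)) (col (fst (outer c k \<alpha> r q)))"
  proof -
    have "distinct (map (\<lambda>d. col (fst d)) (inc (c, IV k \<alpha> r q g)))" if "g < 7" for g
    proof -
      have "(c, IV k \<alpha> r q g) \<in> V" using assms that by (simp add: V_def)
      then show ?thesis using assms(1) unfolding proper_def by blast
    qed
    from this[of 0] this[of 1] this[of 2] this[of 3] this[of 4] this[of 5] this[of 6] show ?thesis
      by (simp add: inv_proper_def Let_def)
  qed
  show "h < 8 \<Longrightarrow> col (c, Inn k \<alpha> r q h) < 3" for h using lt assms by (simp add: E_def)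
  show "col (pred_ch c k \<alpha> r q False) < 3" "col (pred_ch c k \<alpha> r q True) < 3"
    using slot_bounds[OF assms(4)] assms by (auto intro!: lt simp: pred_ch_def E_def)
  show "col (c, Ch k \<alpha> r q False) < 3" "col (c, Ch k \<alpha> r q True) < 3" using lt assms by (auto simp: E_def)
  show "col (fst (outer c k \<alpha> r q)) < 3" using lt outer_E assms by blast
qed

text \<open>Only the copy \<open>False\<close> is read. Each component inverts, so \<open>un\<close>
  alternates around the ring and defines a truth value. At a literal with the forbidden value the
  pair between its two components has different colours, and both fifth half-edges get the third
  colour: the thread passes with its colour unchanged. If this happened at all literals of an active
  clause, thread and closing edge would meet in equal colours at the clause vertex.\<close>

lemma satisfies_of_proper:
  assumes p: "proper col"
  shows "\<exists>val. satisfies val"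
proof -
  define un where "un c \<alpha> r q \<longleftrightarrow> col (c, Ch False \<alpha> r q False) \<noteq> col (c, Ch False \<alpha> r q True)" for c \<alpha> r q
  have lt: "e \<in> E \<Longrightarrow> col e < 3" for e using p by (simp add: proper_def)
  \<comment> \<open>The reference is the pair that closes the ring, entering component 0 of slot
    0.\<close>
  define val where "val c \<alpha> = un c \<alpha> (Q - 1) 3" for c \<alpha>
  have flip: "un c \<alpha> r q \<longleftrightarrow> \<not> (if q = 0 then un c \<alpha> (prev_slot r) 3 else un c \<alpha> r (q - 1))"
    if "c < n" "\<alpha> < b" "r < Q" "q < 4" for c \<alpha> r q
    using gadget_rel[OF p that, of False] by (auto simp: inv_rel_def un_def pred_ch_def)
  have un: "un c \<alpha> r q \<longleftrightarrow> val c \<alpha> = odd q" if "c < n" "\<alpha> < b" "r < Q" "q < 4" for c \<alpha> r q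
  proof -
    have row: "un c \<alpha> r q \<longleftrightarrow> val c \<alpha> = odd q" if "un c \<alpha> r 0 \<longleftrightarrow> \<not> val c \<alpha>" "r < Q" "q < 4" for r q
      using that(3)
    proof (induction q)
      case (Suc q)
      then show ?case using flip[of c \<alpha> r "Suc q"] that(2) \<open>c < n\<close> \<open>\<alpha> < b\<close> by auto
    qed (use that in simp)
    have "un c \<alpha> r 0 \<longleftrightarrow> \<not> val c \<alpha>" if "r < Q" for r
      using that
    proof (induction r)
      case 0
      then show ?case using flip[of c \<alpha> 0 0] \<open>c < n\<close> \<open>\<alpha> < b\<close> by (simp add: val_def prev_slot_def)
    next
      case (Suc r)
      then show ?case using flip[of c \<alpha> "Suc r" 0] row[of r 3] \<open>c < n\<close> \<open>\<alpha> < b\<close> by (simp add: prev_slot_def)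
    qed
    then show ?thesis using row that by blast
  qed
  have thread: "col (fst (outer (lit_cell c i) False (i mod b) (lit_row a i) (port a i))) =
      col (fst (outer (lit_cell c i) False (i mod b) (lit_row a i) (Suc (port a i))))"
    if h: "c < n" "a < N" "i < m" "val (lit_cell c i) (i mod b) = bit_of a i" for c a i
  proof -
    let ?c = "lit_cell c i" and ?\<alpha> = "i mod b" and ?r = "lit_row a i" and ?p = "port a i"
    have B: "?c < n" "?\<alpha> < b" "?r < Q" "?p < 4" "Suc ?p < 4"
      using lit_cell_lt lit_bounds[OF h(2,3)] port_le[of a i] h by auto
    have "un ?c ?\<alpha> ?r ?p" using un[OF B(1-4)] h(4) by (simp add: port_def)
    moreover have "col (fst (outer ?c False ?\<alpha> ?r ?p)) < 3" "col (fst (outer ?c False ?\<alpha> ?r (Suc ?p))) < 3"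
      "col (?c, Ch False ?\<alpha> ?r ?p False) < 3" "col (?c, Ch False ?\<alpha> ?r ?p True) < 3"
      using lt[OF outer_E[OF B(1-4)]] lt[OF outer_E[OF B(1-3) B(5)]] B by (auto intro: lt simp: E_def)
    ultimately show ?thesis
      using gadget_rel[OF p B(1-4), of False] gadget_rel[OF p B(1-3) B(5), of False]
      by (auto simp: inv_rel_def un_def pred_ch_def)
  qed
  have "\<exists>i<m. val (lit_cell c i) (i mod b) \<noteq> bit_of a i" if h: "c < n" "a < N" "act c a" for c a
  proof (rule ccontr)
    assume "\<not> (\<exists>i<m. val (lit_cell c i) (i mod b) \<noteq> bit_of a i)"
    then have f: "i < m \<Longrightarrow> val (lit_cell c i) (i mod b) = bit_of a i" for i by blast
    have "i < m \<Longrightarrow> col (c, Th False a i) = col (c, Th False a 0)" for i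
    proof (induction i)
      case (Suc i)
      then show ?case
        using thread[OF h(1,2), of i] f[of i] outer_in[OF h(1,2), of i False] outer_out[OF h(1,2), of i False] by simp
    qed simp
    from this[of "m - 1"] have "col (c, Cl a False) = col (c, Th False a 0)"
      using thread[OF h(1,2), of "m - 1"] f[of "m - 1"] outer_in[OF h(1,2), of "m - 1" False]
        outer_out[OF h(1,2), of "m - 1" False] m_pos h(3) by simp
    moreover have "(c, ZV False a) \<in> V" using h by (simp add: V_def)
    then have "distinct (map (\<lambda>d. col (fst d)) (inc (c, ZV False a)))"
      using p unfolding proper_def by blast
    ultimately show False using h(3) by simp
  qed
  then show ?thesis unfolding satisfies_def by blast
qed

text \<open>The thread of an active clause changes its colour once, at a literal that differs from
  the forbidden pattern; there the pair between the two components has equal colours and lets the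
  two fifth half-edges differ. Both copies are coloured alike, so each joining edge meets the same
  requirement at both ends.\<close>

lemma proper_of_satisfies:
  assumes "satisfies val"
  shows "\<exists>col. proper col"
proof -
  have "\<forall>c a. \<exists>j. c < n \<longrightarrow> a < N \<longrightarrow> act c a \<longrightarrow> j < m \<and> val (lit_cell c j) (j mod b) \<noteq> bit_of a j"
    using assms unfolding satisfies_def by blast
  then obtain J where J: "\<And>c a. c < n \<Longrightarrow> a < N \<Longrightarrow> act c a \<Longrightarrow>
      J c a < m \<and> val (lit_cell c (J c a)) (J c a mod b) \<noteq> bit_of a (J c a)" by metis
  \<comment> \<open>0 up to the literal \<open>J c a\<close>, 1 behind it. An inactive thread keeps
    0, the colour that \<open>Cl a False\<close> gets when it joins the two copies.\<close>
  define thc where "thc c a i = (if act c a \<and> J c a < i then 1 else 0 :: nat)" for c a i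
  define slot_in where "slot_in c \<alpha> r = thc (row_centre r c) (row_clause r) (row_lit \<alpha> r)" for c \<alpha> r
  define slot_out where "slot_out c \<alpha> r = thc (row_centre r c) (row_clause r) (Suc (row_lit \<alpha> r))" for c \<alpha> r
  \<comment> \<open>The colour at the fifth half-edge of component \<open>q\<close>. Two components
    separated by a pair of different colours must agree here; such pairs follow the odd
    \<open>q\<close> if \<open>val\<close> holds and the even \<open>q\<close> otherwise. Half-edges
    off the thread copy the neighbour for which this is demanded.\<close>
  define ec where "ec c \<alpha> r q = (if q = 0 then slot_in c \<alpha> r else if q = 1 then
      (if row_port \<alpha> r = 0 then slot_out c \<alpha> r else slot_in c \<alpha> r) else if q = 2 then slot_out c \<alpha> r
      else if val c \<alpha> then slot_in c \<alpha> (next_slot r) else slot_out c \<alpha> r)" for c \<alpha> r and q :: nat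
  \<comment> \<open>A pair of different colours takes the two colours other than \<open>ec\<close>;
    a pair of equal colours may take any, and gets 0.\<close>
  define chc where "chc c \<alpha> r q s = (if val c \<alpha> = odd q then (ec c \<alpha> r q + (if s then 2 else 1)) mod 3 else 0)"
    for c \<alpha> r and q :: nat and s
  have ec3: "ec c \<alpha> r q < 3" for c \<alpha> r q by (simp add: ec_def slot_in_def slot_out_def thc_def)
  have lit_false: "slot_in c \<alpha> r = slot_out c \<alpha> r"
    if h: "c < n" "\<alpha> < b" "r < Q" "val c \<alpha> \<longleftrightarrow> row_port \<alpha> r = 1" for c \<alpha> r
  proof -
    note rb = row_bounds[OF h(2,3)]
    let ?c0 = "row_centre r c" and ?a = "row_clause r" and ?i = "row_lit \<alpha> r"
    have c0: "?c0 < n" "lit_cell ?c0 ?i = c" using nbi[OF rb(3) h(1)] rb by (auto simp: row_centre_def lit_cell_def)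
    have "val (lit_cell ?c0 ?i) (?i mod b) = bit_of ?a ?i"
      using h(4) c0 rb by (simp add: row_port_def port_def)
    then have "act ?c0 ?a \<Longrightarrow> J ?c0 ?a \<noteq> ?i" using J[OF c0(1) rb(1)] by metis
    then show ?thesis by (auto simp: slot_in_def slot_out_def thc_def)
  qed
  have port01: "row_port \<alpha> r = 0 \<or> row_port \<alpha> r = 1" for \<alpha> r by (simp add: row_port_def port_def)
  have key: "ec c \<alpha> r q = (if q = 0 then ec c \<alpha> (prev_slot r) 3 else ec c \<alpha> r (q - 1))"
    if h: "c < n" "\<alpha> < b" "r < Q" "q < 4" "val c \<alpha> \<noteq> odd q" for c \<alpha> r q
  proof -
    have "q = 0 \<or> q = 1 \<or> q = 2 \<or> q = 3" using h(4) by auto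
    then show ?thesis using h(5) lit_false[OF h(1-3)] port01[of \<alpha> r] slot_bounds[OF h(3)]
      by (elim disjE) (auto simp: ec_def)
  qed
  have rel: "inv_rel (if q = 0 then chc c \<alpha> (prev_slot r) 3 False else chc c \<alpha> r (q - 1) False)
      (if q = 0 then chc c \<alpha> (prev_slot r) 3 True else chc c \<alpha> r (q - 1) True)
      (chc c \<alpha> r q False) (chc c \<alpha> r q True) (ec c \<alpha> r q)"
    if h: "c < n" "\<alpha> < b" "r < Q" "q < 4" for c \<alpha> r q
  proof -
    have mod: "distinct [(e + 1) mod 3, (e + 2) mod 3, e]" if "e < 3" for e :: nat
      using less_3_cases[OF that] by auto
    show ?thesis
    proof (cases "val c \<alpha> = odd q")
      case True
      then have "chc c \<alpha> r q False = (ec c \<alpha> r q + 1) mod 3" "chc c \<alpha> r q True = (ec c \<alpha> r q + 2) mod 3"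
        by (simp_all add: chc_def)
      moreover have "(if q = 0 then chc c \<alpha> (prev_slot r) 3 s else chc c \<alpha> r (q - 1) s) = 0" for s
        using True by (cases q) (auto simp: chc_def)
      ultimately show ?thesis using mod[OF ec3] unfolding inv_rel_def by metis
    next
      case False
      then have "chc c \<alpha> r q False = 0" "chc c \<alpha> r q True = 0" by (simp_all add: chc_def)
      moreover have "(if q = 0 then chc c \<alpha> (prev_slot r) 3 s else chc c \<alpha> r (q - 1) s) =
          (ec c \<alpha> r q + (if s then 2 else 1)) mod 3" for s
        using False key[OF h False] by (cases q) (auto simp: chc_def)
      ultimately show ?thesis using mod[OF ec3] unfolding inv_rel_def by simp
    qed
  qed
  have chc3: "chc c \<alpha> r q s < 3" for c \<alpha> r q s by (simp add: chc_def)
  have "\<exists>f. (\<forall>h. f h < 3) \<and> (c < n \<longrightarrow> \<alpha> < b \<longrightarrow> r < Q \<longrightarrow> q < 4 \<longrightarrow>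
      inv_proper f (if q = 0 then chc c \<alpha> (prev_slot r) 3 False else chc c \<alpha> r (q - 1) False)
      (if q = 0 then chc c \<alpha> (prev_slot r) 3 True else chc c \<alpha> r (q - 1) True)
      (chc c \<alpha> r q False) (chc c \<alpha> r q True) (ec c \<alpha> r q))" for c \<alpha> r q
  proof (cases "c < n \<and> \<alpha> < b \<and> r < Q \<and> q < 4")
    case True
    then show ?thesis using inv_proper_complete[OF rel[of c \<alpha> r q]] chc3 ec3 by simp
  next
    case False
    then show ?thesis by (intro exI[of _ "\<lambda>_. 0"]) auto
  qed
  then obtain F where F3: "\<And>c \<alpha> r q h. F c \<alpha> r q h < (3::nat)" and F: "\<And>c \<alpha> r q. c < n \<Longrightarrow> \<alpha> < b \<Longrightarrow> r < Q \<Longrightarrow> q < 4 \<Longrightarrow>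
      inv_proper (F c \<alpha> r q) (if q = 0 then chc c \<alpha> (prev_slot r) 3 False else chc c \<alpha> r (q - 1) False)
      (if q = 0 then chc c \<alpha> (prev_slot r) 3 True else chc c \<alpha> r (q - 1) True)
      (chc c \<alpha> r q False) (chc c \<alpha> r q True) (ec c \<alpha> r q)" by metis
  define col where "col = (\<lambda>(c, e). case e of Inn k \<alpha> r q h \<Rightarrow> F c \<alpha> r q h | Ch k \<alpha> r q s \<Rightarrow> chc c \<alpha> r q s
    | Fr \<alpha> r s \<Rightarrow> ec c \<alpha> r (unused \<alpha> r s) | Th k a i \<Rightarrow> thc c a i
    | Cl a k \<Rightarrow> (if act c a \<or> k then 1 else 0) | ZZ a \<Rightarrow> 2)"
  have outer_col: "col (fst (outer c k \<alpha> r q)) = ec c \<alpha> r q"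
    if h: "c < n" "\<alpha> < b" "r < Q" "q < 4" for c k \<alpha> r q
  proof -
    note rb = row_bounds[OF h(2,3)]
    let ?c0 = "row_centre r c" and ?a = "row_clause r" and ?i = "row_lit \<alpha> r"
    have c0: "?c0 < n" using nbi[OF rb(3) h(1)] by (auto simp: row_centre_def)
    consider "q = row_port \<alpha> r" | "q = Suc (row_port \<alpha> r)" | "q \<noteq> row_port \<alpha> r" "q \<noteq> Suc (row_port \<alpha> r)" by blast
    then show ?thesis
    proof cases
      case 1
      then show ?thesis using port01[of \<alpha> r] by (auto simp: outer_def Let_def col_def ec_def slot_in_def)
    next
      case 2
      have "J ?c0 ?a < Suc ?i" if "act ?c0 ?a" "\<not> Suc ?i < m"
        using J[OF c0 rb(1) that(1)] that(2) by linarith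
      then have "col (fst (outer c k \<alpha> r q)) = slot_out c \<alpha> r"
        using 2 by (auto simp: outer_def Let_def col_def slot_out_def thc_def)
      then show ?thesis using 2 port01[of \<alpha> r] by (auto simp: ec_def)
    next
      case 3
      then have "unused \<alpha> r (q = 3) = q" using h(4) port01[of \<alpha> r] by (auto simp: unused_def)
      then show ?thesis using 3 by (simp add: outer_def Let_def col_def)
    qed
  qed
  have pred_col: "col (pred_ch c k \<alpha> r q s) = (if q = 0 then chc c \<alpha> (prev_slot r) 3 s else chc c \<alpha> r (q - 1) s)"
    for c k \<alpha> r q s by (simp add: pred_ch_def col_def)
  have "distinct (map (\<lambda>d. col (fst d)) (inc v))" if v: "v \<in> V" for v
  proof -
    obtain c l where cl: "v = (c, l)" "c < n" "valid_vert l" using v by (auto simp: V_def)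
    show ?thesis
    proof (cases l)
      case (IV k \<alpha> r q g)
      then have h: "\<alpha> < b" "r < Q" "q < 4" "g < 7" using cl by auto
      have i: "col (c, Inn k \<alpha> r q x) = F c \<alpha> r q x" "col (c, Ch k \<alpha> r q s) = chc c \<alpha> r q s" for x s by (simp_all add: col_def)
      have "g = 0 \<or> g = 1 \<or> g = 2 \<or> g = 3 \<or> g = 4 \<or> g = 5 \<or> g = 6" using h by auto
      then show ?thesis
        using F[OF cl(2) h(1-3)] outer_col[OF cl(2) h(1-3), of k]
        by (elim disjE) (simp_all add: cl IV Let_def inv_proper_def i pred_col)
    next
      case (ZV k a)
      then show ?thesis by (simp add: cl col_def thc_def)
    qed
  qed
  moreover have "col e < 3" for e
    using F3 chc3 ec3 by (cases e) (auto simp: col_def thc_def split: ledge.splits)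
  ultimately show ?thesis unfolding proper_def by blast
qed

lemma finite_valid: "finite (Collect valid_vert)" "finite (Collect valid_edge)"
proof -
  have "Collect valid_vert \<subseteq> (\<Union>k. \<Union>\<alpha><b. \<Union>r<Q. \<Union>q<4. \<Union>g<7. {IV k \<alpha> r q g}) \<union> (\<Union>k. \<Union>a<N. {ZV k a})"
  proof
    fix l assume "l \<in> Collect valid_vert"
    then show "l \<in> (\<Union>k. \<Union>\<alpha><b. \<Union>r<Q. \<Union>q<4. \<Union>g<7. {IV k \<alpha> r q g}) \<union> (\<Union>k. \<Union>a<N. {ZV k a})"
      by (cases l) simp_all
  qed
  then show "finite (Collect valid_vert)" by (rule finite_subset) simp
  have "Collect valid_edge \<subseteq> (\<Union>k. \<Union>\<alpha><b. \<Union>r<Q. \<Union>q<4. \<Union>h<8. {Inn k \<alpha> r q h}) \<union>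
      (\<Union>k. \<Union>\<alpha><b. \<Union>r<Q. \<Union>q<4. \<Union>s. {Ch k \<alpha> r q s}) \<union> (\<Union>\<alpha><b. \<Union>r<Q. \<Union>s. {Fr \<alpha> r s}) \<union>
      (\<Union>k. \<Union>a<N. \<Union>i<m. {Th k a i}) \<union> (\<Union>a<N. \<Union>k. {Cl a k}) \<union> (\<Union>a<N. {ZZ a})" (is "_ \<subseteq> ?S")
  proof
    fix e assume "e \<in> Collect valid_edge"
    then show "e \<in> ?S" by (cases e) simp_all
  qed
  then show "finite (Collect valid_edge)" by (rule finite_subset) simp
qed

end

section \<open>Computations as tilings\<close>

type_synonym tile = "nat \<times> nat list \<times> (nat \<times> nat) list \<times> (nat \<times> nat) list"

text \<open>A tile holds the state, the scanned symbols, and the contents of its own and of the previous column.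
  A tape is folded at its head: column \<open>j\<close> holds the cells \<open>j\<close> and \<open>-1-j\<close>.\<close>

definition win :: "tape \<Rightarrow> nat \<Rightarrow> nat \<times> nat" where
  "win \<tau> j = (\<tau> (int j), \<tau> (- 1 - int j))"

definition tile_of :: "nat \<times> tape list \<Rightarrow> nat \<Rightarrow> tile" where
  "tile_of C j = (fst C, scan (snd C), map (\<lambda>\<tau>. win \<tau> j) (snd C), map (\<lambda>\<tau>. win \<tau> (j - 1)) (snd C))"

text \<open>\<open>jc\<close> is the column number cut off at 2. As the head moves by at most one,
  the cell just written can only reappear in column 0 or 1, and the contents further out merely
  shift by a column.\<close>

fun upd_win :: "nat \<Rightarrow> nat \<times> int \<Rightarrow> nat \<times> nat \<Rightarrow> nat \<times> nat \<Rightarrow> nat \<times> nat \<Rightarrow> nat \<times> nat" where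
  "upd_win jc (s, d) (r, l) (pr, pl) (nr, nl) =
     (if d = 0 then (if jc = 0 then s else r) else if d = 1 then nr
        else (if jc = 0 then l else if jc = 1 then s else pr),
      if d = 0 then l else if d = 1 then (if jc = 0 then s else pl) else nl)"

lemma win_write_move:
  assumes "d \<in> {-1, 0, 1}"
  shows "win (write_move (s, d) \<tau>) j = upd_win (min j 2) (s, d) (win \<tau> j) (win \<tau> (j - 1)) (win \<tau> (Suc j))"
proof -
  have "j = 0 \<or> j = 1 \<or> 2 \<le> j" by linarith
  then show ?thesis
  proof (elim disjE)
    assume j: "2 \<le> j"
    then have m: "min j 2 = 2" by simp
    have "int (j - 1) = int j - 1" using j by simp
    moreover have "\<tau> (- 2 - int j) = \<tau> (- int j - 2)" by (rule arg_cong[of _ _ \<tau>]) simp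
    ultimately show ?thesis using assms j unfolding m
      by (elim insertE emptyE) (simp_all add: win_def write_move_def algebra_simps)
  qed (use assms in \<open>auto simp: win_def write_move_def\<close>)
qed

definition next_cells :: "machine \<Rightarrow> nat \<Rightarrow> tile \<Rightarrow> (nat \<times> nat) list \<Rightarrow> nat \<times> (nat \<times> nat) list" where
  "next_cells M jc = (\<lambda>(q, sc, cur, prv) cur1. if q = 1 then (q, cur) else
     (fst (trans M q sc), map (\<lambda>k. upd_win jc (snd (trans M q sc) ! k) (cur ! k) (prv ! k) (cur1 ! k)) [0..<tapes M]))"

definition good_config :: "machine \<Rightarrow> nat \<times> tape list \<Rightarrow> bool" where
  "good_config M C \<longleftrightarrow> fst C < states M \<and> length (snd C) = tapes M \<and> (\<forall>\<tau>\<in>set (snd C). \<forall>z. \<tau> z < symbols M)"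

lemma trans_good:
  assumes "turing_machine M" "good_config M (q, ts)"
  shows "fst (trans M q (scan ts)) < states M" "length (snd (trans M q (scan ts))) = tapes M"
    "\<And>s d. (s, d) \<in> set (snd (trans M q (scan ts))) \<Longrightarrow> s < symbols M \<and> d \<in> {-1, 0, 1}"
proof -
  have "q < states M" "length (scan ts) = tapes M" "set (scan ts) \<subseteq> {..<symbols M}"
    using assms(2) by (auto simp: good_config_def)
  then have *: "fst (trans M q (scan ts)) < states M \<and> length (snd (trans M q (scan ts))) = tapes M \<and>
     (\<forall>(s, d)\<in>set (snd (trans M q (scan ts))). s < symbols M \<and> d \<in> {-1, 0, 1})"
    using assms(1) unfolding turing_machine_def by blast
  then show "fst (trans M q (scan ts)) < states M" "length (snd (trans M q (scan ts))) = tapes M"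
    "\<And>s d. (s, d) \<in> set (snd (trans M q (scan ts))) \<Longrightarrow> s < symbols M \<and> d \<in> {-1, 0, 1}" by blast+
qed

lemma step_alt:
  "step M (q, ts) = (if q = 1 then (q, ts) else
     (fst (trans M q (scan ts)), map2 write_move (snd (trans M q (scan ts))) ts))"
  by (simp add: step_def case_prod_beta Let_def)

lemma good_step:
  assumes "turing_machine M" "good_config M C"
  shows "good_config M (step M C)"
proof -
  obtain q ts where C: "C = (q, ts)" by (cases C)
  note g = trans_good[OF assms(1) assms(2)[unfolded C]]
  have "write_move a \<tau> z < symbols M" if "(a, \<tau>) \<in> set (zip (snd (trans M q (scan ts))) ts)" for a \<tau> z
  proof -
    have "a \<in> set (snd (trans M q (scan ts)))" "\<tau> \<in> set ts" using that set_zip_leftD set_zip_rightD by metis+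
    then show ?thesis using g(3)[of "fst a" "snd a"] assms(2)
      by (auto simp: write_move_def good_config_def C case_prod_beta)
  qed
  then show ?thesis using g assms(2) unfolding C step_alt good_config_def by auto
qed

lemma next_cells_step:
  assumes "turing_machine M" "good_config M C"
  shows "next_cells M (min j 2) (tile_of C j) (map (\<lambda>\<tau>. win \<tau> (Suc j)) (snd C)) =
    (fst (step M C), map (\<lambda>\<tau>. win \<tau> j) (snd (step M C)))"
proof -
  obtain q ts where C: "C = (q, ts)" by (cases C)
  note g = trans_good[OF assms(1) assms(2)[unfolded C]]
  have len: "length ts = tapes M" using assms(2) by (simp add: good_config_def C)
  show ?thesis
  proof (cases "q = 1")
    case False
    let ?a = "snd (trans M q (scan ts))"
    have "map (\<lambda>k. upd_win (min j 2) (?a ! k) (map (\<lambda>\<tau>. win \<tau> j) ts ! k) (map (\<lambda>\<tau>. win \<tau> (j - 1)) ts ! k)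
        (map (\<lambda>\<tau>. win \<tau> (Suc j)) ts ! k)) [0..<tapes M] = map (\<lambda>\<tau>. win \<tau> j) (map2 write_move ?a ts)"
    proof (rule nth_equalityI)
      fix k assume "k < length (map (\<lambda>k. upd_win (min j 2) (?a ! k) (map (\<lambda>\<tau>. win \<tau> j) ts ! k) (map (\<lambda>\<tau>. win \<tau> (j - 1)) ts ! k)
        (map (\<lambda>\<tau>. win \<tau> (Suc j)) ts ! k)) [0..<tapes M])"
      then have k: "k < tapes M" by simp
      obtain s d where sd: "?a ! k = (s, d)" by (cases "?a ! k")
      then have "d \<in> {-1, 0, 1}" using g(2) g(3)[of s d] nth_mem[of k ?a] k by metis
      then show "map (\<lambda>k. upd_win (min j 2) (?a ! k) (map (\<lambda>\<tau>. win \<tau> j) ts ! k) (map (\<lambda>\<tau>. win \<tau> (j - 1)) ts ! k)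
        (map (\<lambda>\<tau>. win \<tau> (Suc j)) ts ! k)) [0..<tapes M] ! k = map (\<lambda>\<tau>. win \<tau> j) (map2 write_move ?a ts) ! k"
        using k len g(2) win_write_move[of d s "ts ! k" j] sd by simp
    qed (use g len in simp)
    then show ?thesis using False unfolding C step_alt tile_of_def next_cells_def by simp
  qed (simp add: C step_alt tile_of_def next_cells_def)
qed

definition tiles :: "machine \<Rightarrow> tile set" where
  "tiles M = {..<states M} \<times> {l. set l \<subseteq> {..<symbols M} \<and> length l = tapes M} \<times>
     {l. set l \<subseteq> {..<symbols M} \<times> {..<symbols M} \<and> length l = tapes M} \<times>
     {l. set l \<subseteq> {..<symbols M} \<times> {..<symbols M} \<and> length l = tapes M}"

lemma finite_tiles: "finite (tiles M)"
  unfolding tiles_def by (intro finite_cartesian_product finite_lists_length_eq) auto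

lemma tile_of_tiles: "good_config M C \<Longrightarrow> tile_of C j \<in> tiles M"
  by (auto simp: good_config_def tile_of_def tiles_def win_def)

text \<open>First row, last row, column (up to 2), last column, input symbol at the column, column within the bound for
  certificates.\<close>

type_synonym cell_class = "bool \<times> bool \<times> nat \<times> bool \<times> nat \<times> bool"

definition cell_class :: "bool list \<Rightarrow> nat \<Rightarrow> nat \<Rightarrow> nat \<Rightarrow> nat \<Rightarrow> cell_class" where
  "cell_class x P R t j = (t = 0, Suc t = R, min j 2, Suc j = R, word_tape x (int j), j < P)"

text \<open>State and scanned symbols are repeated in every tile of a row, because each column needs
  them for its update and only neighbouring tiles can be compared. The first row leaves the
  certificate open: the second tape may begin with any bits, followed by blanks from column
  \<open>P\<close> at the latest.\<close>

definition tile_rel :: "machine \<Rightarrow> cell_class \<Rightarrow> tile \<Rightarrow> tile \<Rightarrow> tile \<Rightarrow> bool" where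
  "tile_rel M = (\<lambda>(t0, tl, jc, jl, xs, ju) (q, sc, cur, prv) (q1, sc1, cur1, prv1) (q2, sc2, cur2, prv2).
     (\<not> jl \<longrightarrow> q1 = q \<and> sc1 = sc \<and> prv1 = cur) \<and>
     (jc = 0 \<longrightarrow> sc = map fst cur) \<and>
     (\<not> jl \<and> \<not> tl \<longrightarrow> (q2, cur2) = next_cells M jc (q, sc, cur, prv) cur1) \<and>
     (t0 \<longrightarrow> q = 0 \<and> cur ! 0 = (xs, 0) \<and> snd (cur ! 1) = 0 \<and> fst (cur ! 1) \<le> 2 \<and> (\<not> ju \<longrightarrow> fst (cur ! 1) = 0) \<and>
        (\<not> jl \<and> fst (cur ! 1) = 0 \<longrightarrow> fst (cur1 ! 1) = 0) \<and> (\<forall>k. 2 \<le> k \<longrightarrow> k < tapes M \<longrightarrow> cur ! k = (0, 0))) \<and>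
     (tl \<and> jc = 0 \<longrightarrow> q = 1 \<and> fst (cur ! 0) = 2))"

text \<open>The last column is not constrained by its right neighbour. The resulting errors travel one column per step, and so
  they do not reach the head within \<open>R\<close> steps.\<close>

definition tiling :: "machine \<Rightarrow> bool list \<Rightarrow> nat \<Rightarrow> nat \<Rightarrow> (nat \<Rightarrow> tile) \<Rightarrow> bool" where
  "tiling M x P R y \<longleftrightarrow> (\<forall>c<R * R. y c \<in> tiles M \<and>
     tile_rel M (cell_class x P R (c div R) (c mod R)) (y c) (y (Suc c mod (R * R))) (y ((c + R) mod (R * R))))"

definition accepts :: "machine \<Rightarrow> bool list \<Rightarrow> bool list \<Rightarrow> nat \<Rightarrow> bool" where
  "accepts M x u T \<longleftrightarrow> (case (step M ^^ T) (init_config M [x, u]) of (q, ts) \<Rightarrow> q = 1 \<and> hd ts 0 = 2)"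

lemma good_init: "turing_machine M \<Longrightarrow> good_config M (init_config M [x, u])"
  by (auto simp: good_config_def init_config_def turing_machine_def word_tape_def)

lemma good_run: "turing_machine M \<Longrightarrow> good_config M ((step M ^^ t) (init_config M [x, u]))"
  by (induction t) (auto simp: good_init good_step)

lemma cell_index:
  assumes "t < R" "j < R"
  shows "t * R + j < R * R" "(t * R + j) div R = t" "(t * R + j) mod R = j"
    "Suc j < R \<Longrightarrow> Suc (t * R + j) mod (R * R) = t * R + Suc j"
    "Suc t < R \<Longrightarrow> (t * R + j + R) mod (R * R) = Suc t * R + j"
proof -
  have lt: "t' * R + j' < R * R" if "t' < R" "j' < R" for t' j'
  proof -
    have "t' * R + j' < Suc t' * R" using that by simp
    also have "\<dots> \<le> R * R" using that by (intro mult_le_mono1) simp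
    finally show ?thesis .
  qed
  show "t * R + j < R * R" using lt assms by blast
  show "(t * R + j) div R = t" "(t * R + j) mod R = j" using assms by simp_all
  show "Suc j < R \<Longrightarrow> Suc (t * R + j) mod (R * R) = t * R + Suc j" using lt[of t "Suc j"] assms by simp
  show "Suc t < R \<Longrightarrow> (t * R + j + R) mod (R * R) = Suc t * R + j" using lt[of "Suc t" j] assms by (simp add: ac_simps)
qed

lemma tiling_of_run:
  assumes M: "turing_machine M" "2 \<le> tapes M" and R: "length u \<le> P" "0 < R" and acc: "accepts M x u (R - 1)"
  shows "\<exists>y. tiling M x P R y"
proof -
  define C where "C t = (step M ^^ t) (init_config M [x, u])" for t
  define y where "y c = tile_of (C (c div R)) (c mod R)" for c
  have good: "good_config M (C t)" for t unfolding C_def by (rule good_run[OF M(1)])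
  have C0: "C 0 = (0, map (\<lambda>k. if k < 2 then word_tape ([x, u] ! k) else word_tape []) [0..<tapes M])"
    by (auto simp: C_def init_config_def)
  have wneg: "word_tape w (- 1 - int j) = 0" for w j by (simp add: word_tape_def)
  have w2: "word_tape w z \<le> 2" for w z by (simp add: word_tape_def)
  have we: "word_tape [] = (\<lambda>_. 0)" by (simp add: word_tape_def fun_eq_iff)
  have "tile_rel M (cell_class x P R t j) (y (t * R + j)) (y (Suc (t * R + j) mod (R * R))) (y ((t * R + j + R) mod (R * R)))"
    if t: "t < R" and j: "j < R" for t j
  proof -
    note ci = cell_index[OF t j]
    have yc: "y (t' * R + j') = tile_of (C t') j'" if "t' < R" "j' < R" for t' j' using that by (simp add: y_def)
    have 0: "y (t * R + j) = tile_of (C t) j" using yc t j by blast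
    have 1: "y (Suc (t * R + j) mod (R * R)) = tile_of (C t) (Suc j)" if "Suc j \<noteq> R"
      using ci(4) yc[of t "Suc j"] that t j by simp
    have 2: "y ((t * R + j + R) mod (R * R)) = tile_of (C (Suc t)) j" if "Suc t \<noteq> R"
      using ci(5) yc[of "Suc t" j] that t j by simp
    obtain q1 sc1 cur1 prv1 where e1: "y (Suc (t * R + j) mod (R * R)) = (q1, sc1, cur1, prv1)" by (metis prod.exhaust)
    obtain q2 sc2 cur2 prv2 where e2: "y ((t * R + j + R) mod (R * R)) = (q2, sc2, cur2, prv2)" by (metis prod.exhaust)
    have CS: "C (Suc t) = step M (C t)" by (simp add: C_def)
    have nx: "(fst (C (Suc t)), map (\<lambda>\<tau>. win \<tau> j) (snd (C (Suc t)))) = next_cells M (min j 2) (tile_of (C t) j)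
        (map (\<lambda>\<tau>. win \<tau> (Suc j)) (snd (C t)))"
      using next_cells_step[OF M(1) good, of j t] by (simp add: CS)
    have h1: "Suc j \<noteq> R \<Longrightarrow> q1 = fst (C t) \<and> sc1 = scan (snd (C t)) \<and> cur1 = map (\<lambda>\<tau>. win \<tau> (Suc j)) (snd (C t)) \<and>
        prv1 = map (\<lambda>\<tau>. win \<tau> j) (snd (C t))"
      using 1 e1 by (simp add: tile_of_def)
    have h2: "Suc t \<noteq> R \<Longrightarrow> q2 = fst (C (Suc t)) \<and> cur2 = map (\<lambda>\<tau>. win \<tau> j) (snd (C (Suc t)))"
      using 2 e2 by (simp add: tile_of_def)
    have h3: "j = 0 \<Longrightarrow> scan (snd (C t)) = map fst (map (\<lambda>\<tau>. win \<tau> j) (snd (C t)))"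
      by (simp add: win_def comp_def)
    have len: "length (snd (C 0)) = tapes M" by (simp add: C0)
    have h4: "t = 0 \<Longrightarrow> fst (C t) = 0 \<and> map (\<lambda>\<tau>. win \<tau> j) (snd (C t)) ! 0 = (word_tape x (int j), 0) \<and>
        map (\<lambda>\<tau>. win \<tau> j') (snd (C t)) ! 1 = (word_tape u (int j'), 0) \<and>
        (\<forall>k. 2 \<le> k \<longrightarrow> k < tapes M \<longrightarrow> map (\<lambda>\<tau>. win \<tau> j) (snd (C t)) ! k = (0, 0))" for j'
      using M(2) by (auto simp: C0 win_def wneg we)
    have h5: "Suc t = R \<Longrightarrow> j = 0 \<Longrightarrow> fst (C t) = 1 \<and> fst (map (\<lambda>\<tau>. win \<tau> j) (snd (C t)) ! 0) = 2"
    proof -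
      assume "Suc t = R" "j = 0"
      then have t: "R - 1 = t" by auto
      have "length (snd (C t)) = tapes M" using good[of t] by (simp add: good_config_def)
      then have "snd (C t) \<noteq> []" using M(2) by auto
      then show ?thesis using acc \<open>j = 0\<close> unfolding accepts_def t C_def[symmetric]
        by (auto simp: win_def hd_conv_nth case_prod_beta)
    qed
    have wu: "\<not> j < P \<Longrightarrow> word_tape u (int j) = 0" "word_tape u (int j) = 0 \<Longrightarrow> word_tape u (int (Suc j)) = 0"
      using R(1) by (auto simp: word_tape_def split: if_splits)
    show ?thesis
      unfolding tile_rel_def cell_class_def e1 e2 0 tile_of_def prod.case
      using h1 h2 h3 h4[of j] h4[of "Suc j"] h5 nx wu w2[of u "int j"]
      by (auto simp: tile_of_def min_def split: if_splits)
  qed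
  moreover have "\<exists>t j. t < R \<and> j < R \<and> c = t * R + j" if "c < R * R" for c
    using that R(2) by (intro exI[of _ "c div R"] exI[of _ "c mod R"]) (auto simp: less_mult_imp_div_less)
  moreover have "y c \<in> tiles M" for c unfolding y_def by (rule tile_of_tiles[OF good])
  ultimately have "tiling M x P R y"
    unfolding tiling_def using cell_index(2,3) by (metis (no_types, lifting))
  then show ?thesis by blast
qed

lemma run_of_tiling:
  assumes M: "turing_machine M" "2 \<le> tapes M" and R: "P < R" "length x < R" and til: "tiling M x P R y"
  shows "\<exists>u. length u \<le> P \<and> accepts M x u (R - 1)"
proof -
  define Y where "Y t j = y (t * R + j)" for t j
  define qq where "qq t j = fst (Y t j)" for t j
  define sc where "sc t j = fst (snd (Y t j))" for t j
  define cur where "cur t j = fst (snd (snd (Y t j)))" for t j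
  define prv where "prv t j = snd (snd (snd (Y t j)))" for t j
  have Yeq: "Y t j = (qq t j, sc t j, cur t j, prv t j)" for t j by (simp add: qq_def sc_def cur_def prv_def)
  have len: "length (cur t j) = tapes M" if "t < R" "j < R" for t j
    using til cell_index(1)[OF that] unfolding tiling_def cur_def Y_def tiles_def by fastforce
  have rel: "tile_rel M (cell_class x P R t j) (Y t j) (y (Suc (t * R + j) mod (R * R))) (y ((t * R + j + R) mod (R * R)))"
    if "t < R" "j < R" for t j
    using til cell_index[OF that] unfolding tiling_def Y_def by metis
  have relH: "qq t (Suc j) = qq t j \<and> sc t (Suc j) = sc t j \<and> prv t (Suc j) = cur t j" if "t < R" "Suc j < R" for t j
  proof -
    have "y (Suc (t * R + j) mod (R * R)) = Y t (Suc j)" using cell_index(4)[of t R j] that by (simp add: Y_def)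
    then show ?thesis using rel[of t j] that
      by (cases "y ((t * R + j + R) mod (R * R))") (auto simp: tile_rel_def cell_class_def Yeq)
  qed
  have rel0: "sc t 0 = map fst (cur t 0)" if "t < R" for t
    using rel[of t 0] that R
    by (cases "y ((t * R + 0 + R) mod (R * R))"; cases "y (Suc (t * R + 0) mod (R * R))")
      (auto simp: tile_rel_def cell_class_def Yeq)
  have relV: "(qq (Suc t) j, cur (Suc t) j) = next_cells M (min j 2) (Y t j) (cur t (Suc j))" if "Suc t < R" "Suc j < R" for t j
  proof -
    have "y (Suc (t * R + j) mod (R * R)) = Y t (Suc j)" "y ((t * R + j + R) mod (R * R)) = Y (Suc t) j"
      using cell_index(4)[of t R j] cell_index(5)[of t R j] that by (simp_all add: Y_def)
    then show ?thesis using rel[of t j] that by (auto simp: tile_rel_def cell_class_def Yeq)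
  qed
  have relI: "qq 0 j = 0 \<and> cur 0 j ! 0 = (word_tape x (int j), 0) \<and> snd (cur 0 j ! 1) = 0 \<and> fst (cur 0 j ! 1) \<le> 2 \<and>
      (\<not> j < P \<longrightarrow> fst (cur 0 j ! 1) = 0) \<and> (\<forall>k. 2 \<le> k \<longrightarrow> k < tapes M \<longrightarrow> cur 0 j ! k = (0, 0))" if "j < R" for j
    using rel[of 0 j] that
    by (cases "y ((0 * R + j + R) mod (R * R))"; cases "y (Suc (0 * R + j) mod (R * R))")
      (auto simp: tile_rel_def cell_class_def Yeq)
  have relIH: "fst (cur 0 j ! 1) = 0 \<longrightarrow> fst (cur 0 (Suc j) ! 1) = 0" if "Suc j < R" for j
  proof -
    have "y (Suc (0 * R + j) mod (R * R)) = Y 0 (Suc j)" using cell_index(4)[of 0 R j] that by (simp add: Y_def)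
    then show ?thesis using rel[of 0 j] that
      by (cases "y ((0 * R + j + R) mod (R * R))") (auto simp: tile_rel_def cell_class_def Yeq)
  qed
  have relF: "qq (R - 1) 0 = 1 \<and> fst (cur (R - 1) 0 ! 0) = 2"
    using rel[of "R - 1" 0] R
    by (cases "y (((R - 1) * R + 0 + R) mod (R * R))"; cases "y (Suc ((R - 1) * R + 0) mod (R * R))")
      (auto simp: tile_rel_def cell_class_def Yeq)
  have wneg: "word_tape w (- 1 - int j) = 0" for w j by (simp add: word_tape_def)
  define b where "b j = fst (cur 0 j ! 1)" for j
  \<comment> \<open>The certificate is recovered from the first row. Its length is the first blank
    column of the second tape; there is one at \<open>P\<close>, which is inside the torus because
    \<open>P < R\<close>.\<close>
  define L where "L = (LEAST j. b j = 0)"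
  have bP: "b P = 0" using relI[of P] R by (simp add: b_def)
  have L: "b L = 0" "L \<le> P" unfolding L_def using LeastI[of "\<lambda>j. b j = 0" P] Least_le[of "\<lambda>j. b j = 0" P] bP by auto
  have bL: "b j \<noteq> 0" if "j < L" for j using that not_less_Least unfolding L_def by blast
  have b0: "b j = 0" if "L \<le> j" "j < R" for j
    using that by (induction j rule: dec_induct) (use L relIH b_def in auto)
  define u where "u = map (\<lambda>j. b j = 2) [0..<L]"
  have bu: "b j = word_tape u (int j)" if "j < R" for j
  proof (cases "j < L")
    case True
    have "b j \<le> 2" using relI[OF that] by (simp add: b_def)
    then show ?thesis using True bL[OF True] by (auto simp: word_tape_def u_def)
  qed (use b0 that in \<open>auto simp: word_tape_def u_def\<close>)
  define C where "C t = (step M ^^ t) (init_config M [x, u])" for t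
  have good: "good_config M (C t)" for t unfolding C_def by (rule good_run[OF M(1)])
  have inv: "\<forall>j. j + t < R \<longrightarrow> qq t j = fst (C t) \<and> sc t j = scan (snd (C t)) \<and> cur t j = map (\<lambda>\<tau>. win \<tau> j) (snd (C t))"
    if "t < R" for t
    using that
  proof (induction t)
    case 0
    have C0: "C 0 = (0, map (\<lambda>k. if k < 2 then word_tape ([x, u] ! k) else word_tape []) [0..<tapes M])"
      by (auto simp: C_def init_config_def)
    have cur: "cur 0 j = map (\<lambda>\<tau>. win \<tau> j) (snd (C 0))" if "j < R" for j
    proof (rule nth_equalityI)
      show "length (cur 0 j) = length (map (\<lambda>\<tau>. win \<tau> j) (snd (C 0)))" using len[of 0 j] that by (simp add: C0)
      fix k assume "k < length (cur 0 j)"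
      then have k: "k < tapes M" using len[of 0 j] that by simp
      have "k = 0 \<or> k = 1 \<or> 2 \<le> k" by linarith
      then show "cur 0 j ! k = map (\<lambda>\<tau>. win \<tau> j) (snd (C 0)) ! k"
      proof (elim disjE)
        assume "k = 0"
        then show ?thesis using relI[OF that] k by (simp add: C0 win_def word_tape_def)
      next
        assume k1: "k = 1"
        have "cur 0 j ! 1 = (b j, 0)" using relI[OF that] unfolding b_def by (metis prod.collapse)
        then show ?thesis using bu[OF that] k k1 by (simp add: C0 win_def wneg)
      next
        assume "2 \<le> k"
        then show ?thesis using relI[OF that] k by (simp add: C0 win_def word_tape_def)
      qed
    qed
    have "sc 0 0 = scan (snd (C 0))" using rel0[of 0] cur[of 0] R by (simp add: win_def comp_def)
    then have "j < R \<Longrightarrow> sc 0 j = scan (snd (C 0))" for j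
      by (induction j) (use relH[of 0] in auto)
    then show ?case using cur relI C0 by auto
  next
    case (Suc t)
    then have IH: "j + t < R \<Longrightarrow> qq t j = fst (C t) \<and> sc t j = scan (snd (C t)) \<and> cur t j = map (\<lambda>\<tau>. win \<tau> j) (snd (C t))" for j by simp
    have CS: "C (Suc t) = step M (C t)" by (simp add: C_def)
    have qc: "qq (Suc t) j = fst (C (Suc t)) \<and> cur (Suc t) j = map (\<lambda>\<tau>. win \<tau> j) (snd (C (Suc t)))" if j: "j + Suc t < R" for j
    proof -
      have nx: "next_cells M (min j 2) (Y t j) (cur t (Suc j)) = next_cells M (min j 2) (tile_of (C t) j) (map (\<lambda>\<tau>. win \<tau> (Suc j)) (snd (C t)))"
      proof (cases j)
        case 0
        \<comment> \<open>Column 0 has no previous column, and nothing is known about that field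
          there; the update of column 0 does not look at it.\<close>
        have irr: "upd_win 0 a c p e = upd_win 0 a c p' e" for a c p p' e
          by (cases a; cases c; cases p; cases p'; cases e) auto
        then show ?thesis using IH[of j] IH[of "Suc j"] j 0
          by (auto simp: next_cells_def Yeq tile_of_def intro!: map_cong)
      next
        case (Suc i)
        then have "prv t j = map (\<lambda>\<tau>. win \<tau> i) (snd (C t))" using relH[of t i] IH[of i] j by simp
        then show ?thesis using IH[of j] IH[of "Suc j"] j Suc by (simp add: Yeq tile_of_def)
      qed
      have "(qq (Suc t) j, cur (Suc t) j) = (fst (step M (C t)), map (\<lambda>\<tau>. win \<tau> j) (snd (step M (C t))))"
        using relV[of t j] j unfolding nx next_cells_step[OF M(1) good] by simp
      then show ?thesis by (simp add: CS)
    qed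
    have "sc (Suc t) 0 = scan (snd (C (Suc t)))" using rel0[of "Suc t"] qc[of 0] Suc.prems by (simp add: win_def comp_def)
    then have "j < R \<Longrightarrow> sc (Suc t) j = scan (snd (C (Suc t)))" for j
      by (induction j) (use relH[of "Suc t"] Suc.prems in auto)
    then show ?case using qc by auto
  qed
  have lenC: "snd (C (R - 1)) \<noteq> []" using good[of "R - 1"] M(2) by (auto simp: good_config_def)
  have "fst (C (R - 1)) = 1 \<and> hd (snd (C (R - 1))) 0 = 2"
    using inv[of "R - 1"] relF R lenC by (auto simp: win_def hd_conv_nth)
  then have "accepts M x u (R - 1)" unfolding accepts_def C_def[symmetric] by (simp add: case_prod_beta)
  moreover have "length u \<le> P" using L by (simp add: u_def)
  ultimately show ?thesis by blast
qed

section \<open>Tilings as clauses\<close>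

lemma bit_of_eq_bit: "bit_of a i \<longleftrightarrow> bit a i"
  by (simp add: bit_of_def bit_iff_odd)

lemma bits_exist: "\<exists>a<2 ^ k. \<forall>i<k. bit_of a i \<longleftrightarrow> f i"
  by (rule exI[of _ "take_bit k (horner_sum of_bool 2 (map f [0..<k]))"])
    (auto simp: bit_of_eq_bit bit_take_bit_iff bit_horner_sum_bit_iff)

lemma bits_inj:
  assumes "a < 2 ^ k" "c < 2 ^ k" "\<And>i. i < k \<Longrightarrow> bit_of a i \<longleftrightarrow> bit_of c i"
  shows "a = c"
proof -
  have "take_bit k a = take_bit k c"
    by (rule bit_eqI) (use assms(3) in \<open>auto simp: bit_take_bit_iff bit_of_eq_bit\<close>)
  then show ?thesis using assms(1,2) by (simp add: take_bit_nat_eq_self)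
qed

text \<open>A pattern that encodes no tile in one of the three places is forbidden as well, so a
  satisfying assignment automatically consists of codes.\<close>

definition forbids :: "machine \<Rightarrow> nat \<Rightarrow> (tile \<Rightarrow> nat) \<Rightarrow> cell_class \<Rightarrow> nat \<Rightarrow> bool" where
  "forbids M b enc cl a \<longleftrightarrow> \<not> (\<exists>p\<in>tiles M. \<exists>q\<in>tiles M. \<exists>r\<in>tiles M. tile_rel M cl p q r \<and>
     (\<forall>i<b. (bit_of a i \<longleftrightarrow> bit_of (enc p) i) \<and> (bit_of a (b + i) \<longleftrightarrow> bit_of (enc q) i) \<and>
        (bit_of a (2 * b + i) \<longleftrightarrow> bit_of (enc r) i)))"

text \<open>Wrapping around turns all three neighbour maps into bijections of the cells, as
  \<open>clause_system\<close> demands for its slots. Wrapped neighbours put no condition on a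
  tiling, since \<open>tile_rel\<close> does not compare across the last row or column.\<close>

definition torus :: "nat \<Rightarrow> nat \<Rightarrow> nat \<Rightarrow> nat" where
  "torus R i c = (if i = 0 then c else if i = 1 then Suc c mod (R * R) else (c + R) mod (R * R))"

definition torus_inv :: "nat \<Rightarrow> nat \<Rightarrow> nat \<Rightarrow> nat" where
  "torus_inv R i c = (if i = 0 then c else if i = 1 then (c + (R * R - 1)) mod (R * R) else (c + (R * R - R)) mod (R * R))"

lemma clause_system_torus:
  assumes "0 < R" "0 < b"
  shows "clause_system (R * R) b (torus R) (torus_inv R)"
proof -
  have RR: "0 < R * R" "R \<le> R * R" using assms by auto
  have shift: "((c + s) mod k + (k - s)) mod k = c" "((c + (k - s)) mod k + s) mod k = c"
    if "s \<le> k" "c < k" for c s k :: nat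
  proof -
    have "c + s + (k - s) = c + k" "c + (k - s) + s = c + k" using that by simp_all
    then show "((c + s) mod k + (k - s)) mod k = c" "((c + (k - s)) mod k + s) mod k = c"
      using that mod_add_left_eq[of "c + s" k "k - s"] mod_add_left_eq[of "c + (k - s)" k s] by simp_all
  qed
  have 1: "1 \<le> R * R" using RR by simp
  show ?thesis
  proof
    fix i c :: nat assume "i < 3" "c < R * R"
    then show "torus R i c < R * R \<and> torus_inv R i (torus R i c) = c"
      "torus_inv R i c < R * R \<and> torus R i (torus_inv R i c) = c"
      using RR shift[OF 1, of c] shift[OF RR(2), of c] by (auto simp: torus_def torus_inv_def)
  qed (use assms RR in \<open>auto simp: torus_def\<close>)
qed

definition active :: "machine \<Rightarrow> nat \<Rightarrow> (tile \<Rightarrow> nat) \<Rightarrow> bool list \<Rightarrow> nat \<Rightarrow> nat \<Rightarrow> nat \<Rightarrow> nat \<Rightarrow> bool" where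
  "active M b enc x P R c a = forbids M b enc (cell_class x P R (c div R) (c mod R)) a"

lemma satisfiable_iff_tiling:
  assumes R: "0 < R" and b: "0 < b" and enc: "inj_on enc (tiles M)" "\<And>p. p \<in> tiles M \<Longrightarrow> enc p < 2 ^ b"
  shows "(\<exists>val. clause_system.satisfies (R * R) b (torus R) (active M b enc x P R) val) \<longleftrightarrow> (\<exists>y. tiling M x P R y)"
proof -
  interpret G: clause_system "R * R" b "torus R" "torus_inv R" "active M b enc x P R"
    using clause_system_torus[OF R b] .
  let ?rel = "\<lambda>c. tile_rel M (cell_class x P R (c div R) (c mod R))"
  have idx: "\<alpha> < G.m" "b + \<alpha> < G.m" "2 * b + \<alpha> < G.m" "\<alpha> div b = 0" "(b + \<alpha>) div b = 1" "(2 * b + \<alpha>) div b = 2"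
    "\<alpha> mod b = \<alpha>" "(b + \<alpha>) mod b = \<alpha>" "(2 * b + \<alpha>) mod b = \<alpha>" if "\<alpha> < b" for \<alpha>
    using that b by (auto simp: G.m_def div_add1_eq)
  show ?thesis
  proof
    assume "\<exists>val. G.satisfies val"
    then obtain val where val: "G.satisfies val" by blast
    define match where "match c p \<longleftrightarrow> p \<in> tiles M \<and> (\<forall>\<alpha><b. bit_of (enc p) \<alpha> \<longleftrightarrow> val c \<alpha>)" for c p
    have uniq: "p = q" if "match c p" "match c q" for c p q
    proof -
      have "enc p = enc q" by (rule bits_inj[of _ b]) (use that enc(2) in \<open>auto simp: match_def\<close>)
      then show ?thesis using enc(1) that by (auto simp: match_def inj_on_def)
    qed
    have ex: "\<exists>p q r. match c p \<and> match (torus R 1 c) q \<and> match (torus R 2 c) r \<and> ?rel c p q r" if c: "c < R * R" for c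
    proof -
      \<comment> \<open>The clause whose pattern is the present assignment around \<open>c\<close>.
        The assignment violates it, so it cannot be active, and its pattern must come from a fitting
        triple of tiles.\<close>
      obtain a where a: "a < G.N" "\<And>i. i < G.m \<Longrightarrow> bit_of a i \<longleftrightarrow> val (torus R (i div b) c) (i mod b)"
        using bits_exist[of G.m "\<lambda>i. val (torus R (i div b) c) (i mod b)"] by (auto simp: G.N_def)
      have "\<not> active M b enc x P R c a" using val a c unfolding G.satisfies_def G.lit_cell_def by blast
      then obtain p q r where pqr: "p \<in> tiles M" "q \<in> tiles M" "r \<in> tiles M" "?rel c p q r"
        "\<And>i. i < b \<Longrightarrow> (bit_of a i \<longleftrightarrow> bit_of (enc p) i) \<and> (bit_of a (b + i) \<longleftrightarrow> bit_of (enc q) i) \<and>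
          (bit_of a (2 * b + i) \<longleftrightarrow> bit_of (enc r) i)"
        unfolding active_def forbids_def by blast
      have "match c p" "match (torus R 1 c) q" "match (torus R 2 c) r"
        unfolding match_def using pqr a(2) idx by (auto simp: torus_def[of R 0])
      then show ?thesis using pqr(4) by blast
    qed
    define y where "y c = (SOME p. match c p)" for c
    have y: "y c = p" if "match c p" for c p
      unfolding y_def using uniq[OF _ that] that by (metis someI)
    have "tiling M x P R y"
      unfolding tiling_def
    proof (intro allI impI)
      fix c assume c: "c < R * R"
      obtain p q r where pqr: "match c p" "match (torus R 1 c) q" "match (torus R 2 c) r" "?rel c p q r" using ex[OF c] by blast
      have "y (Suc c mod (R * R)) = q" "y ((c + R) mod (R * R)) = r"
        using y[OF pqr(2)] y[OF pqr(3)] by (simp_all add: torus_def)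
      then show "y c \<in> tiles M \<and> ?rel c (y c) (y (Suc c mod (R * R))) (y ((c + R) mod (R * R)))"
        using y[OF pqr(1)] pqr by (simp add: match_def)
    qed
    then show "\<exists>y. tiling M x P R y" by blast
  next
    assume "\<exists>y. tiling M x P R y"
    then obtain y where y: "tiling M x P R y" by blast
    define val where "val c \<alpha> = bit_of (enc (y c)) \<alpha>" for c \<alpha>
    have "\<exists>i<G.m. val (torus R (i div b) c) (i mod b) \<noteq> bit_of a i"
      if c: "c < R * R" and act: "active M b enc x P R c a" for c a
    proof (rule ccontr)
      assume "\<not> ?thesis"
      then have eq: "i < G.m \<Longrightarrow> bit_of a i \<longleftrightarrow> val (torus R (i div b) c) (i mod b)" for i by blast
      have "\<forall>i<b. (bit_of a i \<longleftrightarrow> bit_of (enc (y c)) i) \<and> (bit_of a (b + i) \<longleftrightarrow> bit_of (enc (y (Suc c mod (R * R)))) i) \<and>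
          (bit_of a (2 * b + i) \<longleftrightarrow> bit_of (enc (y ((c + R) mod (R * R)))) i)"
        using eq idx by (simp add: val_def torus_def)
      moreover have "Suc c mod (R * R) < R * R" "(c + R) mod (R * R) < R * R" using R by simp_all
      ultimately show False using y c act unfolding tiling_def active_def forbids_def by blast
    qed
    then have "G.satisfies val" unfolding G.satisfies_def G.lit_cell_def by blast
    then show "\<exists>val. G.satisfies val" by blast
  qed
qed

section \<open>Generating the graph\<close>

text \<open>Only the ends of closing edges depend on whether their clause is active; 0 is a default
  for all other edges.\<close>

fun clause_of :: "ledge \<Rightarrow> nat" where
  "clause_of (Cl a k) = a"
| "clause_of _ = 0"

context clause_system begin

text \<open>\<open>ends\<close> relative to the cell: the first component is the number of a
  neighbour, 0, 1 or 2, in place of a cell, and activity has become the Boolean \<open>f\<close>. So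
  \<open>sends\<close> depends on \<open>b\<close> alone and can be built into a generator before
  the input is known.\<close>

fun sends :: "bool \<Rightarrow> ledge \<Rightarrow> (nat \<times> lvert) \<times> (nat \<times> lvert)" where
  "sends f (Inn k \<alpha> r q h) = ((0, IV k \<alpha> r q (fst (int_ends ! h))), (0, IV k \<alpha> r q (snd (int_ends ! h))))"
| "sends f (Ch k \<alpha> r q s) = ((0, IV k \<alpha> r q (if s then 4 else 0)),
     (0, if q < 3 then IV k \<alpha> r (Suc q) (if s then 2 else 1) else IV k \<alpha> (next_slot r) 0 (if s then 2 else 1)))"
| "sends f (Fr \<alpha> r s) = ((0, IV False \<alpha> r (unused \<alpha> r s) 3), (0, IV True \<alpha> r (unused \<alpha> r s) 3))"
| "sends f (Th k a i) = (if i = 0 then (0, ZV k a)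
       else ((i - 1) div b, IV k ((i - 1) mod b) (lit_row a (i - 1)) (Suc (port a (i - 1))) 3),
     (i div b, IV k (i mod b) (lit_row a i) (port a i) 3))"
| "sends f (Cl a k) = (let z = (\<lambda>k. (0, ZV k a)); w = (\<lambda>k. ((m - 1) div b, IV k ((m - 1) mod b) (lit_row a (m - 1)) (Suc (port a (m - 1))) 3))
     in if f then (w k, z k) else if k then (z False, z True) else (w False, w True))"
| "sends f (ZZ a) = ((0, ZV False a), (0, ZV True a))"

definition place :: "nat \<Rightarrow> nat \<times> lvert \<Rightarrow> nat \<times> lvert" where
  "place c v = (nb (fst v) c, snd v)"

lemma ends_sends:
  "ends (c, e) = (place c (fst (sends (act c (clause_of e)) e)), place c (snd (sends (act c (clause_of e)) e)))"
  by (cases e) (auto simp: place_def nb_0 lit_in_def lit_out_def lit_cell_def Let_def)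

lemma sends_bounds:
  assumes "valid_edge e"
  shows "fst (fst (sends f e)) < 3" "fst (snd (sends f e)) < 3"
proof -
  have "i < m \<Longrightarrow> i div b < 3" for i using lit_bounds(1)[OF N_pos] by blast
  then show "fst (fst (sends f e)) < 3" "fst (snd (sends f e)) < 3"
    using assms m_pos by (cases e; auto simp: Let_def)+
qed

lemma listing:
  assumes el: "set el = Collect valid_edge" "distinct el" and idx: "bij_betw idx (Collect valid_vert) {..<D}"
  defines "vn \<equiv> \<lambda>v. fst v * D + idx (snd v)"
  defines "G \<equiv> listed_graph (n * D) (map (\<lambda>e. (vn (fst (ends e)), vn (snd (ends e)))) (List.product [0..<n] el))"
  shows "cubic_graph G" "(\<exists>col. three_colouring G col) \<longleftrightarrow> (\<exists>val. satisfies val)"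
proof -
  let ?names = "List.product [0..<n] el"
  have names: "set ?names = E" "distinct ?names" using el by (auto simp: E_def distinct_product)
  have idx_lt: "idx l < D" if "valid_vert l" for l using idx that by (auto simp: bij_betw_def)
  have inj: "inj_on vn V"
  proof (rule inj_onI)
    fix u v assume u: "u \<in> V" and v: "v \<in> V" and eq: "vn u = vn v"
    have l: "idx (snd u) < D" "idx (snd v) < D" using u v idx_lt by (auto simp: V_def)
    have "fst u = vn u div D" "fst v = vn v div D" "idx (snd u) = vn u mod D" "idx (snd v) = vn v mod D"
      using l by (simp_all add: vn_def)
    then have "fst u = fst v" "idx (snd u) = idx (snd v)" using eq by simp_all
    moreover have "snd u = snd v"
      using calculation(2) idx u v unfolding bij_betw_def by (auto simp: V_def dest: inj_onD)
    ultimately show "u = v" by (simp add: prod_eq_iff)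
  qed
  have sub: "vn ` V \<subseteq> {..<n * D}"
  proof
    fix w assume "w \<in> vn ` V"
    then obtain c l where cl: "w = c * D + idx l" "c < n" "valid_vert l" by (auto simp: V_def vn_def)
    then have "w < Suc c * D" using idx_lt[of l] by simp
    also have "\<dots> \<le> n * D" using cl by (intro mult_le_mono1) simp
    finally show "w \<in> {..<n * D}" by simp
  qed
  have "card (Collect valid_vert) = D" using bij_betw_same_card[OF idx] by simp
  then have "card V = n * D" by (simp add: V_def card_cartesian_product)
  then have "vn ` V = {..<n * D}" using card_image[OF inj] sub by (intro card_subset_eq) auto
  then have vn: "bij_betw vn V {..<n * D}" using inj by (simp add: bij_betw_def)
  have ne: "V \<noteq> {}" using n_pos N_pos by (auto simp: V_def intro!: exI[of _ "ZV False 0"])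
  note L = listed_graph_of_incidence[where ends = ends and inc = inc, OF names(2) vn ne, unfolded names(1), OF incidence1 incidence2 R_all]
  show "cubic_graph G" unfolding G_def by (rule L(1))
  have "(\<exists>col. three_colouring G col) \<longleftrightarrow> (\<exists>col. proper col)"
    unfolding G_def proper_def by (rule L(2))
  then show "(\<exists>col. three_colouring G col) \<longleftrightarrow> (\<exists>val. satisfies val)"
    using satisfies_of_proper proper_of_satisfies by blast
qed

end

subsection \<open>Formulas and loops\<close>

text \<open>The mark \<open>3\<close> stands at position 0 only, so \<open>Sym d 3\<close> is a test
  for zero.\<close>

definition lessf :: "nat \<Rightarrow> nat \<Rightarrow> nat \<Rightarrow> fm" where
  "lessf d a c = Ex d (And (Plus a d c) (Neg (Sym d 3)))"

lemma evf_lessf [simp]: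
  assumes "marked ws" "d \<noteq> a" "d \<noteq> c" "\<sigma> c < length ws - 1"
  shows "evf (lessf d a c) ws \<sigma> \<longleftrightarrow> \<sigma> a < \<sigma> c"
proof -
  have "ws ! i = 3 \<longleftrightarrow> i = 0" if "i < length ws - 1" for i using marked_nth(1)[OF assms(1), of i] that by simp
  then have "evf (lessf d a c) ws \<sigma> \<longleftrightarrow> (\<exists>i<length ws - 1. \<sigma> a + i = \<sigma> c \<and> i \<noteq> 0)"
    using assms by (auto simp: lessf_def)
  also have "\<dots> \<longleftrightarrow> \<sigma> a < \<sigma> c"
    using assms(4) by (auto intro!: exI[of _ "\<sigma> c - \<sigma> a"])
  finally show ?thesis .
qed

lemma wff_lessf [simp]: "wff k (lessf d a c) \<longleftrightarrow> k \<le> d \<and> a < Suc d \<and> c < Suc d \<and> a \<noteq> d \<and> a \<noteq> c \<and> d \<noteq> c"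
  by (auto simp: lessf_def)

definition sucf :: "nat \<Rightarrow> nat \<Rightarrow> nat \<Rightarrow> fm" where
  "sucf d a c = And (lessf d a c) (Neg (Ex d (And (lessf (Suc d) a d) (lessf (Suc d) d c))))"

lemma evf_sucf [simp]:
  assumes "marked ws" "a < d" "c < d" "\<sigma> c < length ws - 1"
  shows "evf (sucf d a c) ws \<sigma> \<longleftrightarrow> Suc (\<sigma> a) = \<sigma> c"
proof -
  have "evf (lessf (Suc d) a d) ws (\<sigma>(d := i)) \<longleftrightarrow> \<sigma> a < i" "evf (lessf (Suc d) d c) ws (\<sigma>(d := i)) \<longleftrightarrow> i < \<sigma> c"
    if "i < length ws - 1" for i
    using evf_lessf[of ws "Suc d" a d "\<sigma>(d := i)"] evf_lessf[of ws "Suc d" d c "\<sigma>(d := i)"] assms that by simp_all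
  then have "evf (sucf d a c) ws \<sigma> \<longleftrightarrow> \<sigma> a < \<sigma> c \<and> \<not> (\<exists>i<length ws - 1. \<sigma> a < i \<and> i < \<sigma> c)"
    using assms by (auto simp: sucf_def simp del: evf_lessf) (simp_all add: evf_lessf)
  also have "\<dots> \<longleftrightarrow> Suc (\<sigma> a) = \<sigma> c"
    using assms(4) by (metis Suc_lessD Suc_lessI lessI not_less_eq less_trans)
  finally show ?thesis .
qed

lemma wff_sucf [simp]: "wff k (sucf d a c) \<longleftrightarrow> k \<le> d \<and> a < d \<and> c < d \<and> a \<noteq> c"
  by (auto simp: sucf_def)

definition falsef :: fm where "falsef = And (Sym 0 3) (Neg (Sym 0 3))"

fun orfs :: "fm list \<Rightarrow> fm" where
  "orfs [] = falsef"
| "orfs (\<phi> # \<phi>s) = Neg (And (Neg \<phi>) (Neg (orfs \<phi>s)))"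

lemma evf_orfs [simp]: "evf (orfs \<phi>s) ws \<sigma> \<longleftrightarrow> (\<exists>\<phi>\<in>set \<phi>s. evf \<phi> ws \<sigma>)"
  by (induction \<phi>s) (auto simp: falsef_def)

lemma wff_orfs [simp]: "wff k (orfs \<phi>s) \<longleftrightarrow> 0 < k \<and> (\<forall>\<phi>\<in>set \<phi>s. wff k \<phi>)"
  by (induction \<phi>s) (auto simp: falsef_def)

definition litf :: "bool \<Rightarrow> fm \<Rightarrow> fm" where
  "litf b \<phi> = (if b then \<phi> else Neg \<phi>)"

lemma litf_simps [simp]: "evf (litf b \<phi>) ws \<sigma> \<longleftrightarrow> b = evf \<phi> ws \<sigma>" "wff k (litf b \<phi>) \<longleftrightarrow> wff k \<phi>"
  by (auto simp: litf_def)

fun reps :: "nat \<Rightarrow> gn" where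
  "reps 0 = GNil"
| "reps (Suc n) = Cat (Emit True) (reps n)"

lemma og_reps [simp]: "og (reps n) ws \<sigma> = replicate n True"
  by (induction n) auto

lemma wfg_reps [simp]: "wfg k (reps n)"
  by (induction n) auto

fun cats :: "gn list \<Rightarrow> gn" where
  "cats [] = GNil"
| "cats (g # gs) = Cat g (cats gs)"

lemma og_cats [simp]: "og (cats gs) ws \<sigma> = concat (map (\<lambda>g. og g ws \<sigma>) gs)"
  by (induction gs) auto

lemma wfg_cats [simp]: "wfg k (cats gs) \<longleftrightarrow> (\<forall>g\<in>set gs. wfg k g)"
  by (induction gs) auto

text \<open>Meant for a test that holds at exactly one position; the loop then binds
  \<open>r\<close> to that position.\<close>

definition bindg :: "nat \<Rightarrow> fm \<Rightarrow> gn \<Rightarrow> gn" where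
  "bindg r \<phi> g = For r (GIf \<phi> g GNil)"

lemma concat_if_eq: "a < k \<Longrightarrow> concat (map (\<lambda>i. if i = a then f i else []) [0..<k]) = f a"
  by (induction k) (auto simp: less_Suc_eq intro!: concat_eq_Nil_conv[THEN iffD2])

lemma og_bindg:
  assumes "\<And>i. i < length ws - 1 \<Longrightarrow> evf \<phi> ws (\<sigma>(r := i)) \<longleftrightarrow> i = a" "a < length ws - 1"
  shows "og (bindg r \<phi> g) ws \<sigma> = og g ws (\<sigma>(r := a))"
proof -
  have "og (bindg r \<phi> g) ws \<sigma> = concat (map (\<lambda>i. if i = a then og g ws (\<sigma>(r := i)) else []) [0..<length ws - 1])"
    unfolding bindg_def og.simps by (intro arg_cong[of _ _ concat] map_cong) (auto simp: assms(1))
  then show ?thesis using concat_if_eq[OF assms(2), of "\<lambda>i. og g ws (\<sigma>(r := i))"] by simp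
qed

definition forlt :: "nat \<Rightarrow> nat \<Rightarrow> gn \<Rightarrow> gn" where
  "forlt r s g = For r (GIf (lessf (Suc r) r s) g GNil)"

lemma concat_if_less: "s \<le> k \<Longrightarrow> concat (map (\<lambda>i. if i < s then f i else []) [0..<k]) = concat (map f [0..<s])"
  by (induction k) (auto simp: le_Suc_eq intro!: arg_cong[of _ _ concat] map_cong)

lemma og_forlt [simp]:
  assumes "marked ws" "r \<noteq> s" "Suc r \<noteq> s" "\<sigma> s < length ws - 1"
  shows "og (forlt r s g) ws \<sigma> = concat (map (\<lambda>i. og g ws (\<sigma>(r := i))) [0..<\<sigma> s])"
proof -
  have "og (forlt r s g) ws \<sigma> = concat (map (\<lambda>i. if i < \<sigma> s then og g ws (\<sigma>(r := i)) else []) [0..<length ws - 1])"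
    unfolding forlt_def og.simps using assms by (intro arg_cong[of _ _ concat] map_cong) auto
  then show ?thesis using assms(4) by (simp add: concat_if_less)
qed

lemma wfg_forlt [simp]: "wfg k (forlt r s g) \<longleftrightarrow> k \<le> r \<and> s < r \<and> wfg (Suc r) g"
  by (auto simp: forlt_def)

lemma concat_replicates: "concat (map (\<lambda>i. replicate k c) [0..<l]) = replicate (l * k) c"
proof (induction l)
  case (Suc l)
  then show ?case by (simp add: replicate_add[symmetric] add.commute)
qed simp

subsection \<open>Listing cells, edges and vertices\<close>

text \<open>From here on registers 0 and 1 hold the ends of the two unary numbers at the start of
  the padded word, 2 the side of the torus, and 3 and 4 the row and the column of the cell.\<close>

definition first_col :: fm where "first_col = Sym 4 3"
definition last_row :: fm where "last_row = sucf 5 3 2"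
definition last_col :: fm where "last_col = sucf 5 4 2"
definition second_col :: fm where
  "second_col = And (Neg first_col) (Neg (Ex 5 (And (Neg (Sym 5 3)) (lessf 6 5 4))))"
text \<open>The letter for column \<open>j\<close> stands \<open>j + 1\<close> places behind
  register 1. Past the input this place is the separator or out of range, so neither bit is found,
  which stands for the blank.\<close>

definition input_sym :: "nat \<Rightarrow> fm" where
  "input_sym s = Ex 5 (And (Plus 1 4 5) (Ex 6 (And (sucf 7 5 6) (Sym 6 s))))"
text \<open>Register 0 holds \<open>P + 1\<close>, so a position strictly between it and the column
  exists exactly if the column is below \<open>P\<close>.\<close>

definition in_bound :: fm where "in_bound = Ex 5 (And (lessf 6 4 5) (lessf 6 5 0))"

fun classf :: "cell_class \<Rightarrow> fm" where
  "classf (t0, t1, jc, jl, xs, ju) = And (litf t0 (Sym 3 3)) (And (litf t1 last_row)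
     (And (litf (jc = 0) first_col) (And (litf (jc = 1) second_col) (And (litf jl last_col)
     (And (litf (xs = 1) (input_sym 1)) (And (litf (xs = 2) (input_sym 2)) (litf ju in_bound)))))))"

lemma wff_classf [simp]: "wff 5 (classf cl)"
  by (cases cl) (simp add: first_col_def last_row_def last_col_def second_col_def input_sym_def in_bound_def)

definition all_classes :: "cell_class list" where
  "all_classes = concat (map (\<lambda>t0. concat (map (\<lambda>t1. concat (map (\<lambda>jc. concat (map (\<lambda>jl. concat (map (\<lambda>xs.
     map (\<lambda>ju. (t0, t1, jc, jl, xs, ju)) [True, False]) [0, 1, 2])) [True, False])) [0, 1, 2])) [True, False])) [True, False])"

lemma set_all_classes: "(t0, t1, jc, jl, xs, ju) \<in> set all_classes \<longleftrightarrow> jc < 3 \<and> xs < 3"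
proof -
  have "k < 3 \<longleftrightarrow> k = 0 \<or> k = 1 \<or> k = (2::nat)" for k by auto
  then show ?thesis by (cases t0; cases t1; cases jl; cases ju) (auto simp: all_classes_def)
qed

text \<open>Which classes forbid the clause is decided while the formula is built; the running
  machine only determines the class of the cell. The classes are finitely many because columns are
  counted up to 2.\<close>

definition activef :: "(cell_class \<Rightarrow> nat \<Rightarrow> bool) \<Rightarrow> nat \<Rightarrow> fm" where
  "activef F a = orfs (map classf (filter (\<lambda>cl. F cl a) all_classes))"

definition cell_gn :: "nat \<Rightarrow> gn" where
  "cell_gn D = Cat (forlt 5 3 (forlt 6 2 (reps D))) (forlt 5 4 (reps D))"

text \<open>Numbers are emitted in unary, so a product is a nest of loops. Reduction modulo
  \<open>R * R\<close> takes effect only at the last cell for neighbour 1 and in the last row for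
  neighbour 2, and becomes a case distinction.\<close>

definition vert_gn :: "nat \<Rightarrow> (lvert \<Rightarrow> nat) \<Rightarrow> nat \<times> lvert \<Rightarrow> gn" where
  "vert_gn D idx v = Cat
     (if fst v = 0 then cell_gn D
      else if fst v = 1 then GIf (And last_row last_col) GNil (Cat (cell_gn D) (reps D))
      else GIf last_row (forlt 5 4 (reps D)) (Cat (cell_gn D) (forlt 5 2 (reps D))))
     (Cat (reps (idx (snd v))) (Emit False))"

definition edge_gn :: "nat \<Rightarrow> (lvert \<Rightarrow> nat) \<Rightarrow> fm \<Rightarrow> (bool \<Rightarrow> (nat \<times> lvert) \<times> (nat \<times> lvert)) \<Rightarrow> gn" where
  "edge_gn D idx \<phi> S = GIf \<phi>
     (Cat (vert_gn D idx (fst (S True))) (vert_gn D idx (snd (S True))))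
     (Cat (vert_gn D idx (fst (S False))) (vert_gn D idx (snd (S False))))"

text \<open>The three bindings recover the parameters from the padded word: its first
  \<open>False\<close>, the next one, and their distance, which exceeds the second unary number by
  one and is the side of the torus.\<close>

definition graph_gn :: "nat \<Rightarrow> (lvert \<Rightarrow> nat) \<Rightarrow> (cell_class \<Rightarrow> nat \<Rightarrow> bool) \<Rightarrow>
    (bool \<Rightarrow> ledge \<Rightarrow> (nat \<times> lvert) \<times> (nat \<times> lvert)) \<Rightarrow> ledge list \<Rightarrow> gn" where
  "graph_gn D idx F S el =
     bindg 0 (And (Sym 0 1) (Neg (Ex 1 (And (lessf 2 1 0) (Sym 1 1)))))
     (bindg 1 (And (Sym 1 1) (And (lessf 2 0 1) (Neg (Ex 2 (And (lessf 3 0 2) (And (lessf 3 2 1) (Sym 2 1)))))))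
     (bindg 2 (Plus 0 2 1)
     (Cat (Cat (forlt 3 2 (forlt 4 2 (reps D))) (Emit False))
        (forlt 3 2 (forlt 4 2 (cats (map (\<lambda>e. edge_gn D idx (activef F (clause_of e)) (\<lambda>f. S f e)) el)))))))"

lemma wff_rows [simp]: "wff 5 last_row" "wff 5 last_col"
  by (simp_all add: last_row_def last_col_def)

lemma wfg_graph_gn: "wfg 0 (graph_gn D idx F S el)"
  by (auto simp: graph_gn_def bindg_def edge_gn_def vert_gn_def cell_gn_def activef_def)

context
  fixes ws :: "nat list" and \<sigma> :: "nat \<Rightarrow> nat" and P R :: nat and x :: "bool list"
  assumes ws: "marked ws" and lt: "\<sigma> 0 < length ws - 1" "\<sigma> 1 < length ws - 1" "\<sigma> 2 < length ws - 1"
    and tj: "\<sigma> 3 < \<sigma> 2" "\<sigma> 4 < \<sigma> 2"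
begin

lemma lt': "\<sigma> 3 < length ws - 1" "\<sigma> 4 < length ws - 1" "\<sigma> (Suc 0) < length ws - 1"
  using tj lt by auto

lemma evf_conditions:
  "evf last_row ws \<sigma> \<longleftrightarrow> Suc (\<sigma> 3) = \<sigma> 2" "evf last_col ws \<sigma> \<longleftrightarrow> Suc (\<sigma> 4) = \<sigma> 2"
  "evf first_col ws \<sigma> \<longleftrightarrow> \<sigma> 4 = 0" "evf (Sym 3 3) ws \<sigma> \<longleftrightarrow> \<sigma> 3 = 0"
  "evf second_col ws \<sigma> \<longleftrightarrow> \<sigma> 4 = 1" "evf in_bound ws \<sigma> \<longleftrightarrow> Suc (\<sigma> 4) < \<sigma> 0"
  "evf (input_sym s) ws \<sigma> \<longleftrightarrow> Suc (\<sigma> 1 + \<sigma> 4) < length ws - 1 \<and> ws ! Suc (\<sigma> 1 + \<sigma> 4) = s"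
proof -
  have 3: "ws ! i = 3 \<longleftrightarrow> i = 0" if "i < length ws - 1" for i using marked_nth(1)[OF ws, of i] that by simp
  show "evf last_row ws \<sigma> \<longleftrightarrow> Suc (\<sigma> 3) = \<sigma> 2" "evf last_col ws \<sigma> \<longleftrightarrow> Suc (\<sigma> 4) = \<sigma> 2"
    using ws lt by (simp_all add: last_row_def last_col_def)
  show fc: "evf first_col ws \<sigma> \<longleftrightarrow> \<sigma> 4 = 0" "evf (Sym 3 3) ws \<sigma> \<longleftrightarrow> \<sigma> 3 = 0"
    using 3 lt' by (simp_all add: first_col_def)
  have "evf second_col ws \<sigma> \<longleftrightarrow> \<sigma> 4 \<noteq> 0 \<and> \<not> (\<exists>i<length ws - 1. i \<noteq> 0 \<and> i < \<sigma> 4)"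
    using ws lt' fc 3 by (auto simp: second_col_def)
  also have "\<dots> \<longleftrightarrow> \<sigma> 4 = 1" using lt' by (auto dest: spec[of _ 1])
  finally show "evf second_col ws \<sigma> \<longleftrightarrow> \<sigma> 4 = 1" .
  have "evf in_bound ws \<sigma> \<longleftrightarrow> (\<exists>i<length ws - 1. \<sigma> 4 < i \<and> i < \<sigma> 0)"
    using ws lt by (auto simp: in_bound_def)
  also have "\<dots> \<longleftrightarrow> Suc (\<sigma> 4) < \<sigma> 0" using lt by (auto intro: exI[of _ "Suc (\<sigma> 4)"])
  finally show "evf in_bound ws \<sigma> \<longleftrightarrow> Suc (\<sigma> 4) < \<sigma> 0" .
  show "evf (input_sym s) ws \<sigma> \<longleftrightarrow> Suc (\<sigma> 1 + \<sigma> 4) < length ws - 1 \<and> ws ! Suc (\<sigma> 1 + \<sigma> 4) = s"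
    using ws by (auto simp: input_sym_def)
qed

lemma evf_activef:
  assumes P: "\<sigma> 0 = Suc P" and R: "\<sigma> 2 = R"
    and x: "\<And>s. s = 1 \<or> s = 2 \<Longrightarrow>
      (Suc (\<sigma> 1 + \<sigma> 4) < length ws - 1 \<and> ws ! Suc (\<sigma> 1 + \<sigma> 4) = s) \<longleftrightarrow> word_tape x (int (\<sigma> 4)) = s"
  shows "evf (activef F a) ws \<sigma> \<longleftrightarrow> F (cell_class x P R (\<sigma> 3) (\<sigma> 4)) a"
proof -
  have w3: "word_tape x z < 3" for z by (simp add: word_tape_def)
  have cl: "evf (classf cl) ws \<sigma> \<longleftrightarrow> cl = cell_class x P R (\<sigma> 3) (\<sigma> 4)" if "cl \<in> set all_classes" for cl
  proof -
    obtain t0 t1 jc jl xs ju where c: "cl = (t0, t1, jc, jl, xs, ju)" by (metis prod.exhaust)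
    have b: "jc < 3" "xs < 3" using that by (auto simp: c set_all_classes)
    have jc: "jc = min (\<sigma> 4) 2 \<longleftrightarrow> ((jc = 0) = (\<sigma> 4 = 0)) \<and> ((jc = 1) = (\<sigma> 4 = 1))"
      using b(1) by (auto simp: min_def)
    have xs: "xs = word_tape x (int (\<sigma> 4)) \<longleftrightarrow> ((xs = 1) = (word_tape x (int (\<sigma> 4)) = 1)) \<and> ((xs = 2) = (word_tape x (int (\<sigma> 4)) = 2))"
      using b(2) w3[of "int (\<sigma> 4)"] by auto
    have x12: "(Suc (\<sigma> 1 + \<sigma> 4) < length ws - 1 \<and> ws ! Suc (\<sigma> 1 + \<sigma> 4) = 1) \<longleftrightarrow> word_tape x (int (\<sigma> 4)) = 1"
      "(Suc (\<sigma> 1 + \<sigma> 4) < length ws - 1 \<and> ws ! Suc (\<sigma> 1 + \<sigma> 4) = 2) \<longleftrightarrow> word_tape x (int (\<sigma> 4)) = 2"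
      using x by blast+
    show ?thesis
      unfolding c classf.simps evf.simps(4) litf_simps evf_conditions x12 cell_class_def prod.inject jc xs
      by (simp only: P R conj_assoc Suc_less_eq)
  qed
  have "cell_class x P R (\<sigma> 3) (\<sigma> 4) \<in> set all_classes"
    using w3 by (auto simp: cell_class_def set_all_classes)
  then show ?thesis using cl by (auto simp: activef_def)
qed

lemma og_vert_gn:
  assumes R: "\<sigma> 2 = R" and o: "fst v < 3"
  shows "og (vert_gn D idx v) ws \<sigma> = unary (torus R (fst v) (\<sigma> 3 * R + \<sigma> 4) * D + idx (snd v))"
proof -
  have t: "\<sigma> 3 < R" "\<sigma> 4 < R" using tj R by auto
  note ci = cell_index[OF t]
  have c: "og (cell_gn D) ws \<sigma> = replicate ((\<sigma> 3 * R + \<sigma> 4) * D) True"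
    using ws lt lt' by (simp add: cell_gn_def concat_replicates R replicate_add[symmetric] algebra_simps)
  have 1: "Suc (\<sigma> 3 * R + \<sigma> 4) mod (R * R) = (if Suc (\<sigma> 3) = R \<and> Suc (\<sigma> 4) = R then 0 else Suc (\<sigma> 3 * R + \<sigma> 4))"
  proof (cases "Suc (\<sigma> 4) = R")
    case True
    then have e: "Suc (\<sigma> 3 * R + \<sigma> 4) = Suc (\<sigma> 3) * R" by simp
    show ?thesis
    proof (cases "Suc (\<sigma> 3) = R")
      case False
      then have "Suc (\<sigma> 3) * R < R * R" using t by (intro mult_less_mono1) auto
      then show ?thesis unfolding e using False by simp
    qed (use e True in simp)
  qed (use ci t in auto)
  have 2: "(\<sigma> 3 * R + \<sigma> 4 + R) mod (R * R) = (if Suc (\<sigma> 3) = R then \<sigma> 4 else \<sigma> 3 * R + \<sigma> 4 + R)"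
  proof (cases "Suc (\<sigma> 3) = R")
    case True
    then have e: "\<sigma> 3 * R + \<sigma> 4 + R = R * R + \<sigma> 4" by (metis add.commute add.left_commute mult_Suc)
    have "\<sigma> 4 < R * R" using t by (metis less_le_trans le_square)
    then show ?thesis unfolding e using True by simp
  qed (use ci t in auto)
  have T: "torus R (fst v) (\<sigma> 3 * R + \<sigma> 4) = (if fst v = 0 then \<sigma> 3 * R + \<sigma> 4
      else if fst v = 1 then (if Suc (\<sigma> 3) = R \<and> Suc (\<sigma> 4) = R then 0 else Suc (\<sigma> 3 * R + \<sigma> 4))
      else (if Suc (\<sigma> 3) = R then \<sigma> 4 else \<sigma> 3 * R + \<sigma> 4 + R))"
    unfolding torus_def 1 2 ..
  have "fst v = 0 \<or> fst v = 1 \<or> fst v = 2" using o by auto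
  then show ?thesis
    unfolding T using ws lt lt'
    by (elim disjE) (simp_all add: vert_gn_def c evf_conditions R unary_def concat_replicates
        replicate_add[symmetric] algebra_simps flip: replicate_append_same)
qed

end

section \<open>Words listing graphs\<close>

lemma unary_append_inject: "unary a @ r = unary b @ s \<longleftrightarrow> a = b \<and> r = s"
proof (induction a arbitrary: b)
  case 0
  then show ?case by (cases b) (auto simp: unary_def)
next
  case (Suc a)
  then show ?case by (cases b) (auto simp: unary_def)
qed

lemma concat_unary_inject: "concat (map unary ns) = concat (map unary ms) \<Longrightarrow> ns = ms"
proof (induction ns arbitrary: ms)
  case Nil
  then show ?case by (cases ms) (auto simp: unary_def)
next
  case (Cons a ns)
  then show ?case by (cases ms) (auto simp: unary_append_inject, simp_all add: unary_def)
qed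

definition flat_pairs :: "(nat \<times> nat) list \<Rightarrow> nat list" where
  "flat_pairs es = concat (map (\<lambda>(u, v). [u, v]) es)"

lemma flat_pairs_simps [simp]: "flat_pairs [] = []" "flat_pairs ((u, v) # es) = u # v # flat_pairs es"
  by (simp_all add: flat_pairs_def)

lemma flat_pairs_inject: "flat_pairs es = flat_pairs es' \<Longrightarrow> es = es'"
proof (induction es arbitrary: es')
  case Nil
  then show ?case by (cases es') (auto simp: flat_pairs_def)
next
  case (Cons e es)
  then show ?case by (cases es'; cases e; cases "hd es'") auto
qed

lemma encode_graph_flat: "encode_graph n es = concat (map unary (n # flat_pairs es))"
proof -
  have "concat (map (\<lambda>(u, v). unary u @ unary v) es) = concat (map unary (flat_pairs es))"
    by (induction es) (auto simp: flat_pairs_def)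
  then show ?thesis by (simp add: encode_graph_def)
qed

text \<open>Needed to read off membership: a code in the language must stem from the very graph that
  was encoded.\<close>

lemma encode_graph_inject: "encode_graph n es = encode_graph n' es' \<longleftrightarrow> n = n' \<and> es = es'"
proof
  assume "encode_graph n es = encode_graph n' es'"
  then have "n # flat_pairs es = n' # flat_pairs es'" unfolding encode_graph_flat by (rule concat_unary_inject)
  then show "n = n' \<and> es = es'" by (auto dest: flat_pairs_inject)
qed simp

section \<open>Hardness\<close>

lemma upt_split: "[0..<n + 2] = 0 # map Suc [0..<n] @ [Suc n]"
  by (simp add: map_Suc_upt upt_conv_Cons)

lemma label_nth:
  "label x u ! 0 = 3" "i < length x \<Longrightarrow> label x u ! Suc i = bitn (x ! i)" "label x u ! Suc (length x) = 4"
  by (auto simp: label_def nth_append)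

lemma concat_inner:
  "f 0 = [] \<Longrightarrow> f (Suc n) = [] \<Longrightarrow> concat (map f [0..<n + 2]) = concat (map (\<lambda>i. f (Suc i)) [0..<n])"
  unfolding upt_split by (simp add: comp_def)

definition input_gn :: "nat \<Rightarrow> gn" where
  "input_gn r = For r (GIf (Sym r 1) (Emit False) (GIf (Sym r 2) (Emit True) GNil))"

lemma og_input_gn: "og (input_gn r) (label x []) \<sigma> = x"
proof -
  let ?f = "\<lambda>i. if label x [] ! i = 1 then [False] else if label x [] ! i = 2 then [True] else []"
  have "og (input_gn r) (label x []) \<sigma> = concat (map ?f [0..<length x + 2])"
    unfolding input_gn_def og.simps evf.simps fun_upd_same by (simp add: numeral_3_eq_3)
  also have "\<dots> = concat (map (\<lambda>i. [x ! i]) [0..<length x])"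
  proof (subst concat_inner)
    show "concat (map (\<lambda>i. ?f (Suc i)) [0..<length x]) = concat (map (\<lambda>i. [x ! i]) [0..<length x])"
      by (intro arg_cong[of _ _ concat] map_cong) (auto simp: label_nth bitn_def)
  qed (simp_all add: label_nth)
  also have "\<dots> = x" by (simp add: concat_map_singleton map_nth)
  finally show ?thesis .
qed

text \<open>Horner's scheme: each loop over the letters of \<open>x\<close> multiplies by the
  length. Testing for \<open>1\<close> or \<open>2\<close> skips the start mark and the
  separator.\<close>

lemma ex_poly_gn: "\<exists>g. wfg k g \<and> (\<forall>x \<sigma>. og g (label x []) \<sigma> = replicate (poly p (length x)) True)"
proof (induction p arbitrary: k)
  case 0
  show ?case by (intro exI[of _ GNil]) simp
next
  case (pCons a p)
  obtain g where g: "wfg (Suc k) g" "\<And>x \<sigma>. og g (label x []) \<sigma> = replicate (poly p (length x)) True"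
    using pCons.IH[of "Suc k"] by blast
  let ?h = "For k (GIf (orfs [Sym k 1, Sym k 2]) g GNil)"
  have "og ?h (label x []) \<sigma> = replicate (length x * poly p (length x)) True" for x \<sigma>
  proof -
    let ?f = "\<lambda>i. if label x [] ! i = 1 \<or> label x [] ! i = 2 then replicate (poly p (length x)) True else []"
    have "og ?h (label x []) \<sigma> = concat (map ?f [0..<length x + 2])"
      unfolding og.simps g(2) by (intro arg_cong[of _ _ concat] map_cong) (auto simp: falsef_def)
    also have "\<dots> = concat (map (\<lambda>i. replicate (poly p (length x)) True) [0..<length x])"
    proof (subst concat_inner)
      show "concat (map (\<lambda>i. ?f (Suc i)) [0..<length x]) =
          concat (map (\<lambda>i. replicate (poly p (length x)) True) [0..<length x])"
        by (intro arg_cong[of _ _ concat] map_cong) (auto simp: label_nth bitn_def)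
    qed (simp_all add: label_nth)
    finally show ?thesis by (simp add: concat_replicates)
  qed
  then show ?case using g(1) by (intro exI[of _ "Cat (reps a) ?h"]) (simp add: replicate_add falsef_def del: og.simps(5))
qed

lemma ex_pad_gn:
  "\<exists>g. wfg 0 g \<and> (\<forall>x. og g (label x []) (\<lambda>_. 0) = unary (poly p (length x)) @ unary (poly r (length x)) @ x)"
proof -
  obtain gp gr where "wfg 0 gp" "\<And>x \<sigma>. og gp (label x []) \<sigma> = replicate (poly p (length x)) True"
    "wfg 0 gr" "\<And>x \<sigma>. og gr (label x []) \<sigma> = replicate (poly r (length x)) True"
    using ex_poly_gn[of 0] by metis
  then show ?thesis
    by (intro exI[of _ "Cat gp (Cat (Emit False) (Cat gr (Cat (Emit False) (input_gn 0))))"])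
      (auto simp: og_input_gn unary_def, simp add: input_gn_def)
qed

lemma concat_rows:
  "concat (map (\<lambda>t. concat (map (\<lambda>j. f (t * R + j)) [0..<R])) [0..<k]) = concat (map f [0..<k * R])"
proof (induction k)
  case (Suc k)
  have "[0..<Suc k * R] = [0..<k * R] @ map (\<lambda>j. k * R + j) [0..<R]"
    using upt_add_eq_append[of 0 "k * R" R] map_add_upt[of "k * R" R] by (simp add: add.commute)
  then show ?case using Suc by (simp add: comp_def)
qed simp

lemma concat_product:
  "concat (map h (List.product xs ys)) = concat (map (\<lambda>x. concat (map (\<lambda>y. h (x, y)) ys)) xs)"
  by (induction xs) (auto simp: comp_def)

section \<open>The graph generator on padded words\<close>

context
  fixes P R' :: nat and x :: "bool list" and ws :: "nat list"
  defines "ws \<equiv> label (unary P @ unary R' @ x) []"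
begin

lemma ws_eq: "ws = [3] @ replicate P 2 @ [1] @ replicate R' 2 @ [1] @ map bitn x @ [4, 5]"
  by (simp add: ws_def label_def unary_def bitn_def)

lemma length_ws: "length ws - 1 = P + R' + length x + 4" "length ws - Suc 0 = P + R' + length x + 4"
  by (simp_all add: ws_eq)

text \<open>Restricted to positions up to the second end, because the input behind it may contain
  further letters \<open>1\<close>.\<close>

lemma ws_ones:
  "i \<le> P + R' + 2 \<Longrightarrow> ws ! i = 1 \<longleftrightarrow> i = P + 1 \<or> i = P + R' + 2"
  by (auto simp: ws_eq nth_append nth_Cons')

lemma ws_input:
  assumes "s = 1 \<or> s = 2"
  shows "(Suc (P + R' + 2 + j) < length ws - 1 \<and> ws ! Suc (P + R' + 2 + j) = s) \<longleftrightarrow> word_tape x (int j) = s"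
proof -
  consider "j < length x" | "j = length x" | "length x < j" by linarith
  then show ?thesis
  proof cases
    case 1
    then have "ws ! Suc (P + R' + 2 + j) = bitn (x ! j)" by (auto simp: ws_eq nth_append nth_Cons')
    then show ?thesis using 1 by (simp add: length_ws word_tape_def bitn_def)
  next
    case 2
    then have "ws ! Suc (P + R' + 2 + j) = 4" by (auto simp: ws_eq nth_append nth_Cons')
    then show ?thesis using 2 assms by (auto simp: word_tape_def)
  qed (use assms in \<open>auto simp: word_tape_def length_ws\<close>)
qed

lemma marked_ws: "marked ws"
  by (simp add: ws_def marked_label)

lemma og_graph_gn:
  "og (graph_gn D idx F S el) ws (\<lambda>_. 0) = unary (Suc R' * (Suc R' * D)) @
     concat (map (\<lambda>t. concat (map (\<lambda>j. concat (map (\<lambda>e. og (edge_gn D idx (activef F (clause_of e)) (\<lambda>f. S f e)) ws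
       ((\<lambda>_. 0)(0 := P + 1, 1 := P + R' + 2, 2 := Suc R', 3 := t, 4 := j))) el)) [0..<Suc R'])) [0..<Suc R'])"
proof -
  let ?L = "length ws - 1"
  let ?A = "P + 1" and ?B = "P + R' + 2"
  have A: "?A < ?L" and B: "?B < ?L" and RL: "Suc R' < ?L" by (simp_all add: length_ws)
  note m [simp] = marked_ws
  have 0: "evf (And (Sym 0 1) (Neg (Ex 1 (And (lessf 2 1 0) (Sym 1 1))))) ws ((\<lambda>_. 0)(0 := i)) \<longleftrightarrow> i = ?A"
    if i: "i < ?L" for i
  proof -
    have "evf (And (Sym 0 1) (Neg (Ex 1 (And (lessf 2 1 0) (Sym 1 1))))) ws ((\<lambda>_. 0)(0 := i)) \<longleftrightarrow>
        ws ! i = 1 \<and> \<not> (\<exists>k<?L. k < i \<and> ws ! k = 1)"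
      using i by simp
    also have "\<dots> \<longleftrightarrow> i = ?A"
    proof
      assume h: "ws ! i = 1 \<and> \<not> (\<exists>k<?L. k < i \<and> ws ! k = 1)"
      have "\<not> ?A < i" using h A ws_ones[of ?A] by auto
      then show "i = ?A" using h ws_ones[of i] by auto
    qed (use A ws_ones in auto)
    finally show ?thesis .
  qed
  have 1: "evf (And (Sym 1 1) (And (lessf 2 0 1) (Neg (Ex 2 (And (lessf 3 0 2) (And (lessf 3 2 1) (Sym 2 1))))))) ws
      ((\<lambda>_. 0)(0 := ?A, 1 := i)) \<longleftrightarrow> i = ?B" if i: "i < ?L" for i
  proof -
    have "evf (And (Sym 1 1) (And (lessf 2 0 1) (Neg (Ex 2 (And (lessf 3 0 2) (And (lessf 3 2 1) (Sym 2 1))))))) ws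
      ((\<lambda>_. 0)(0 := ?A, 1 := i)) \<longleftrightarrow> ws ! i = 1 \<and> ?A < i \<and> \<not> (\<exists>k<?L. ?A < k \<and> k < i \<and> ws ! k = 1)"
      using i by auto
    also have "\<dots> \<longleftrightarrow> i = ?B"
    proof
      assume h: "ws ! i = 1 \<and> ?A < i \<and> \<not> (\<exists>k<?L. ?A < k \<and> k < i \<and> ws ! k = 1)"
      have "\<not> ?B < i" using h B ws_ones[of ?B] by auto
      then show "i = ?B" using h ws_ones[of i] by auto
    qed (use B ws_ones in auto)
    finally show ?thesis .
  qed
  let ?\<sigma> = "(\<lambda>_. 0)(0 := ?A, 1 := ?B, 2 := Suc R')"
  let ?body = "Cat (Cat (forlt 3 2 (forlt 4 2 (reps D))) (Emit False))
        (forlt 3 2 (forlt 4 2 (cats (map (\<lambda>e. edge_gn D idx (activef F (clause_of e)) (\<lambda>f. S f e)) el))))"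
  have "og (graph_gn D idx F S el) ws (\<lambda>_. 0) = og ?body ws ?\<sigma>"
    unfolding graph_gn_def
    by (subst og_bindg[OF 0 A], assumption, subst og_bindg[OF 1 B], assumption, subst og_bindg[where a = "Suc R'"])
      (use RL in auto)
  also have "\<dots> = unary (Suc R' * (Suc R' * D)) @
     concat (map (\<lambda>t. concat (map (\<lambda>j. concat (map (\<lambda>e. og (edge_gn D idx (activef F (clause_of e)) (\<lambda>f. S f e)) ws
       (?\<sigma>(3 := t, 4 := j))) el)) [0..<Suc R'])) [0..<Suc R'])"
    using RL by (simp add: concat_replicates unary_def comp_def del: upt_Suc)
  finally show ?thesis by simp
qed

lemma og_edge_gn:
  fixes D :: nat and idx :: "lvert \<Rightarrow> nat"
  assumes "t < Suc R'" "j < Suc R'" "\<And>f. fst (fst (S f)) < 3 \<and> fst (snd (S f)) < 3"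
  defines "\<sigma> \<equiv> (\<lambda>_. 0)(0 := P + 1, 1 := P + R' + 2, 2 := Suc R', 3 := t, 4 := j)"
    and "v \<equiv> \<lambda>w. unary (torus (Suc R') (fst w) (t * Suc R' + j) * D + idx (snd w))"
  shows "og (edge_gn D idx (activef F a) S) ws \<sigma> =
    v (fst (S (F (cell_class x P (Suc R') t j) a))) @ v (snd (S (F (cell_class x P (Suc R') t j) a)))"
proof -
  have s: "\<sigma> 0 = Suc P" "\<sigma> 1 = P + R' + 2" "\<sigma> 2 = Suc R'" "\<sigma> 3 = t" "\<sigma> 4 = j" by (simp_all add: \<sigma>_def)
  have lt: "\<sigma> 0 < length ws - 1" "\<sigma> 1 < length ws - 1" "\<sigma> 2 < length ws - 1" "\<sigma> 3 < \<sigma> 2" "\<sigma> 4 < \<sigma> 2"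
    using assms(1,2) unfolding s by (simp_all add: length_ws)
  have act: "evf (activef F a) ws \<sigma> \<longleftrightarrow> F (cell_class x P (Suc R') t j) a"
    using evf_activef[OF marked_ws lt s(1) s(3), of x F a] ws_input unfolding s by blast
  have vert: "fst w < 3 \<Longrightarrow> og (vert_gn D idx w) ws \<sigma> = v w" for w
    using og_vert_gn[OF marked_ws lt s(3), of w D idx] unfolding s v_def by blast
  show ?thesis unfolding edge_gn_def og.simps act using vert assms(3) by simp
qed

end

lemma accepts_iff:
  assumes c: "computes_within M [x, u] [v] T" and T: "T \<le> T'"
  shows "accepts M x u T' \<longleftrightarrow> v"
proof -
  obtain q ts where C: "(step M ^^ T) (init_config M [x, u]) = (q, ts)" by (metis prod.exhaust)
  then have q: "q = 1" "hd ts 0 = word_tape [v] 0" using c by (auto simp: computes_within_def)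
  have "(step M ^^ j) (1, ts) = (1, ts)" for j by (induction j) (auto simp: step_def)
  then have "(step M ^^ T') (init_config M [x, u]) = (1, ts)"
    using C q(1) funpow_add[of "T' - T" T "step M"] T by simp
  then show ?thesis using q by (auto simp: accepts_def word_tape_def)
qed

text \<open>\<open>enc0\<close>, \<open>b\<close>, \<open>idx\<close>, \<open>el\<close> and
  \<open>F\<close> depend on the verifier but not on \<open>x\<close>, so they enter the two
  generators as constants.\<close>

lemma reduction_of_verifier:
  assumes M: "turing_machine M" "2 \<le> tapes M"
    and V: "\<And>x u. computes_within M [x, u] [V x u] (poly q (length x + length u))"
  shows "\<exists>f. polytime_computable f \<and> (\<forall>x. \<exists>n es. f x = encode_graph n es \<and> cubic_graph (listed_graph n es) \<and>
    ((\<exists>col. three_colouring (listed_graph n es) col) \<longleftrightarrow> (\<exists>u. length u \<le> poly p (length x) \<and> V x u)))"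
proof -
  obtain enc0 :: "tile \<Rightarrow> nat" and K where enc0: "enc0 ` tiles M = {i. i < K}" "inj_on enc0 (tiles M)"
    using finite_imp_inj_to_nat_seg[OF finite_tiles[of M]] by blast
  \<comment> \<open>Large enough for all codes below \<open>K\<close>, and positive as
    \<open>clause_system\<close> requires.\<close>
  define b where "b = Suc K"
  have b: "0 < b" by (simp add: b_def)
  have encb: "enc0 p < 2 ^ b" if "p \<in> tiles M" for p
  proof -
    have "enc0 p < K" using enc0(1) that by auto
    also have "K < 2 ^ b" unfolding b_def using less_exp[of "Suc K"] by linarith
    finally show ?thesis .
  qed
  \<comment> \<open>At \<open>length x\<close> this is the run time on certificates of maximal
    length, plus the lengths of certificate and input, plus 1. With the torus side one larger still,
    the \<open>R - 1\<close> steps of a tiling let the verifier halt, and \<open>R\<close> exceeds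
    both lengths.\<close>
  define r where "r = pcompose q ([:0, 1:] + p) + p + [:1, 1:]"
  have cs: "clause_system (R * R) b (torus R) (torus_inv R)" if "0 < R" for R using clause_system_torus[OF that b] .
  have fin: "finite (Collect (clause_system.valid_vert b))" "finite (Collect (clause_system.valid_edge b))"
    using clause_system.finite_valid[OF cs[of 1]] by simp_all
  define D where "D = card (Collect (clause_system.valid_vert b))"
  obtain idx where idx: "bij_betw idx (Collect (clause_system.valid_vert b)) {..<D}"
    using ex_bij_betw_finite_nat[OF fin(1)] by (auto simp: D_def atLeast0LessThan)
  obtain el where el: "set el = Collect (clause_system.valid_edge b)" "distinct el"
    using finite_distinct_list[OF fin(2)] by blast
  define F where "F = forbids M b enc0"
  obtain g1 where g1: "wfg 0 g1"
    "\<And>x. og g1 (label x []) (\<lambda>_. 0) = unary (poly p (length x)) @ unary (poly r (length x)) @ x"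
    using ex_pad_gn by blast
  define g2 where "g2 = graph_gn D idx F (clause_system.sends b) el"
  define f where "f x = og g2 (label (og g1 (label x []) (\<lambda>_. 0)) []) (\<lambda>_. 0)" for x
  have "polytime_computable f"
    unfolding f_def by (rule polytime_computable_generated[OF g1(1)]) (simp add: g2_def wfg_graph_gn)
  moreover have "\<exists>n es. f x = encode_graph n es \<and> cubic_graph (listed_graph n es) \<and>
    ((\<exists>col. three_colouring (listed_graph n es) col) \<longleftrightarrow> (\<exists>u. length u \<le> poly p (length x) \<and> V x u))" for x
  proof -
    define P where "P = poly p (length x)"
    define R' where "R' = poly r (length x)"
    define R where "R = Suc R'"
    have R: "0 < R" by (simp add: R_def)
    let ?act = "active M b enc0 x P R"
    interpret G: clause_system "R * R" b "torus R" "torus_inv R" ?act using cs[OF R] .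
    define vn where "vn v = fst v * D + idx (snd v)" for v
    define es where "es = map (\<lambda>e. (vn (fst (G.ends e)), vn (snd (G.ends e)))) (List.product [0..<R * R] el)"
    have list: "cubic_graph (listed_graph (R * R * D) es)"
      "(\<exists>col. three_colouring (listed_graph (R * R * D) es) col) \<longleftrightarrow> (\<exists>val. G.satisfies val)"
      using G.listing[OF el idx] unfolding es_def vn_def by simp_all
    have rR: "R' = poly q (length x + P) + P + length x + 1"
      by (simp add: R'_def r_def poly_pcompose P_def)
    have "(\<exists>val. G.satisfies val) \<longleftrightarrow> (\<exists>y. tiling M x P R y)"
      by (rule satisfiable_iff_tiling[OF R b enc0(2) encb])
    also have "\<dots> \<longleftrightarrow> (\<exists>u. length u \<le> P \<and> accepts M x u (R - 1))"
    proof
      assume "\<exists>y. tiling M x P R y"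
      then show "\<exists>u. length u \<le> P \<and> accepts M x u (R - 1)"
        using run_of_tiling[OF M, of P R x] rR by (auto simp: R_def)
    next
      assume "\<exists>u. length u \<le> P \<and> accepts M x u (R - 1)"
      then show "\<exists>y. tiling M x P R y" using tiling_of_run[OF M _ R] by blast
    qed
    also have "\<dots> \<longleftrightarrow> (\<exists>u. length u \<le> P \<and> V x u)"
    proof -
      have "accepts M x u (R - 1) \<longleftrightarrow> V x u" if "length u \<le> P" for u
      proof (rule accepts_iff[OF V])
        have "poly q (length x + length u) \<le> poly q (length x + P)" using that by (intro poly_nat_mono) simp
        then show "poly q (length x + length u) \<le> R - 1" using rR by (simp add: R_def)
      qed
      then show ?thesis by blast
    qed
    finally have iff: "(\<exists>col. three_colouring (listed_graph (R * R * D) es) col) \<longleftrightarrow> (\<exists>u. length u \<le> P \<and> V x u)"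
      using list(2) by simp
    have "f x = encode_graph (R * R * D) es"
    proof -
      have fx: "f x = og g2 (label (unary P @ unary R' @ x) []) (\<lambda>_. 0)"
        by (simp add: f_def g1(2) P_def R'_def)
      let ?h = "\<lambda>(c, e). unary (vn (fst (G.ends (c, e)))) @ unary (vn (snd (G.ends (c, e))))"
      have edge: "og (edge_gn D idx (activef F (clause_of e)) (\<lambda>f. G.sends f e)) (label (unary P @ unary R' @ x) [])
          ((\<lambda>_. 0)(0 := P + 1, 1 := P + R' + 2, 2 := R, 3 := t, 4 := j)) = ?h (t * R + j, e)"
        if tj: "t < R" "j < R" and e: "e \<in> set el" for t j e
      proof -
        have ve: "G.valid_edge e" using e el by simp
        have act: "F (cell_class x P R t j) a = ?act (t * R + j) a" for a
          using cell_index[OF tj] by (simp add: F_def active_def)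
        show ?thesis
          using og_edge_gn[where t = t and R' = R' and j = j and S = "\<lambda>f. G.sends f e" and P = P and x = x and D = D and
              idx = idx and F = F and a = "clause_of e"] tj G.sends_bounds[OF ve]
          unfolding R_def[symmetric] act by (simp add: G.ends_sends G.place_def vn_def)
      qed
      have "f x = unary (R * (R * D)) @ concat (map (\<lambda>t. concat (map (\<lambda>j. concat (map (\<lambda>e. ?h (t * R + j, e)) el))
          [0..<R])) [0..<R])"
        unfolding fx g2_def og_graph_gn R_def[symmetric] using edge
        by (intro arg_cong2[of _ _ _ _ append] arg_cong[of _ _ concat] map_cong refl) auto
      also have "\<dots> = unary (R * R * D) @ concat (map ?h (List.product [0..<R * R] el))"
        using concat_rows[of "\<lambda>c. concat (map (\<lambda>e. ?h (c, e)) el)" R R]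
        by (simp only: concat_product mult.assoc)
      also have "\<dots> = encode_graph (R * R * D) es"
        by (auto simp: encode_graph_def es_def intro!: arg_cong[of _ _ concat])
      finally show ?thesis .
    qed
    then show ?thesis using list(1) iff unfolding P_def by blast
  qed
  ultimately show ?thesis by blast
qed

definition flow_graphs :: "bool list set" where
  "flow_graphs = {encode_graph n es | n es.
       cubic_graph (listed_graph n es) \<and>
       (\<exists>\<pi>. rotation_system (listed_graph n es) \<pi> \<and>
         (\<exists>\<omega> f. nowhere_identity_dihedral_flow 2 (listed_graph n es) \<pi> \<omega> f))}"

lemma mem_flow_graphs:
  "encode_graph n es \<in> flow_graphs \<longleftrightarrow>
     cubic_graph (listed_graph n es) \<and> (\<exists>col. three_colouring (listed_graph n es) col)"
  using flow_iff_three_colouring[of "listed_graph n es"]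
  unfolding flow_graphs_def by (auto simp: encode_graph_inject)

lemma flow_graphs_hard:
  assumes "in_NP K"
  shows "polytime_reducible K flow_graphs"
proof -
  obtain V p where V: "polytime_verifier V" and K: "\<And>x. x \<in> K \<longleftrightarrow> (\<exists>u. length u \<le> poly p (length x) \<and> V x u)"
    using assms by (auto simp: in_NP_def)
  obtain M q where M: "turing_machine M" "2 \<le> tapes M"
    "\<And>x u. computes_within M [x, u] [V x u] (poly q (length x + length u))"
    using V by (auto simp: polytime_verifier_def)
  obtain f where f: "polytime_computable f" "\<And>x. \<exists>n es. f x = encode_graph n es \<and> cubic_graph (listed_graph n es) \<and>
    ((\<exists>col. three_colouring (listed_graph n es) col) \<longleftrightarrow> (\<exists>u. length u \<le> poly p (length x) \<and> V x u))"
    using reduction_of_verifier[OF M, of p] by blast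
  have "x \<in> K \<longleftrightarrow> f x \<in> flow_graphs" for x
    using f(2)[of x] K[of x] mem_flow_graphs by metis
  then show ?thesis using f(1) unfolding polytime_reducible_def by blast
qed

section \<open>Blocks of a word\<close>

text \<open>In a labelled word the letters start at position 1. There
  \<open>block_end ns (Suc i)\<close> is the position of the \<open>False\<close> that closes block
  \<open>i\<close>, and \<open>block_end ns 0\<close> is the start mark.\<close>

definition block_end :: "nat list \<Rightarrow> nat \<Rightarrow> nat" where
  "block_end ns i = length (concat (map unary (take i ns)))"

lemma block_end_simps [simp]:
  "block_end ns 0 = 0" "block_end (a # ns) (Suc i) = Suc a + block_end ns i"
  by (simp_all add: block_end_def unary_def)

lemma block_end_Suc: "i < length ns \<Longrightarrow> block_end ns (Suc i) = block_end ns i + Suc (ns ! i)"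
  by (simp add: block_end_def take_Suc_conv_app_nth unary_def)

lemma block_end_length: "block_end ns (length ns) = length (concat (map unary ns))"
  by (simp add: block_end_def)

lemma block_end_mono: "i < j \<Longrightarrow> j \<le> length ns \<Longrightarrow> block_end ns i < block_end ns j"
proof (induction j)
  case (Suc j)
  then show ?case using block_end_Suc[of j ns] by (cases "i = j") auto
qed simp

lemma block_end_inj: "i \<le> length ns \<Longrightarrow> j \<le> length ns \<Longrightarrow> block_end ns i = block_end ns j \<longleftrightarrow> i = j"
  using block_end_mono[of i j ns] block_end_mono[of j i ns] by (metis less_irrefl nat_neq_iff)

lemma unary_nth: "k \<le> a \<Longrightarrow> unary a ! k \<longleftrightarrow> k < a"
  by (auto simp: unary_def nth_append)

lemma concat_unary_nth:
  "k < length (concat (map unary ns)) \<Longrightarrow> \<not> concat (map unary ns) ! k \<longleftrightarrow> (\<exists>i<length ns. Suc k = block_end ns (Suc i))"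
proof (induction ns arbitrary: k)
  case (Cons a ns)
  have e: "(\<exists>i<length (a # ns). Suc k = block_end (a # ns) (Suc i)) \<longleftrightarrow>
      k = a \<or> (\<exists>i<length ns. Suc k = Suc a + block_end ns (Suc i))"
    by (auto simp: less_Suc_eq_0_disj)
  have l: "length (unary a) = Suc a" by (simp add: unary_def)
  show ?case
  proof (cases "k \<le> a")
    case True
    have "Suc k \<noteq> Suc a + block_end ns (Suc i)" if "i < length ns" for i
      using True block_end_mono[of 0 "Suc i" ns] that by simp
    then show ?thesis unfolding e using True unary_nth[OF True] by (auto simp: nth_append l)
  next
    case False
    then have "k - Suc a < length (concat (map unary ns))" using Cons.prems l by simp
    from Cons.IH[OF this] show ?thesis unfolding e using False by (auto simp: nth_append l)
  qed
qed simp

lemma unary_blocks: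
  assumes "x \<noteq> [] \<Longrightarrow> \<not> last x"
  shows "\<exists>ns. x = concat (map unary ns)"
  using assms
proof (induction x rule: length_induct)
  case (1 x)
  show ?case
  proof (cases "x = []")
    case False
    then have "\<not> last x" using 1 by blast
    then have "False \<in> set x" using False last_in_set[of x] by auto
    then have split: "x = takeWhile id x @ False # tl (dropWhile id x)" "length (tl (dropWhile id x)) < length x"
    proof -
      have "dropWhile id x \<noteq> []" using \<open>False \<in> set x\<close> by (auto simp: dropWhile_eq_Nil_conv)
      then have "dropWhile id x = False # tl (dropWhile id x)"
        using hd_dropWhile[of id x] by (cases "dropWhile id x") auto
      then show "x = takeWhile id x @ False # tl (dropWhile id x)" using takeWhile_dropWhile_id[of id x] by metis
      show "length (tl (dropWhile id x)) < length x"
        using False length_dropWhile_le[of id x] by (cases x) auto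
    qed
    let ?r = "tl (dropWhile id x)"
    have "?r \<noteq> [] \<Longrightarrow> \<not> last ?r" using \<open>\<not> last x\<close> split(1) by (metis last_ConsR last_appendR list.distinct(1))
    then obtain ns where ns: "?r = concat (map unary ns)" using 1 split(2) by blast
    have "takeWhile id x = replicate (length (takeWhile id x)) True"
      using set_takeWhileD[of _ id x] by (intro replicate_eqI) auto
    then have "x = concat (map unary (length (takeWhile id x) # ns))"
      using split(1) ns by (simp add: unary_def)
    then show ?thesis by blast
  qed (auto intro: exI[of _ "[]"])
qed

text \<open>\<open>Z\<close> holds at the closing letters and \<open>b\<close> is the position just
  before the first block. So the letters of a block lie behind \<open>q\<close> up to
  \<open>p\<close>, and its length is \<open>p - q\<close>.\<close>

definition block :: "(nat \<Rightarrow> bool) \<Rightarrow> nat \<Rightarrow> nat \<Rightarrow> nat \<Rightarrow> bool" where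
  "block Z b q p \<longleftrightarrow> Z p \<and> q < p \<and> (q = b \<or> Z q) \<and> \<not> (\<exists>r. q < r \<and> r < p \<and> Z r)"

lemma block_iff:
  assumes Z: "\<And>p. Z p \<longleftrightarrow> (\<exists>i<length ns. p = b + block_end ns (Suc i))"
  shows "block Z b q p \<longleftrightarrow> (\<exists>i<length ns. q = b + block_end ns i \<and> p = b + block_end ns (Suc i))"
proof
  assume h: "block Z b q p"
  then obtain i where i: "i < length ns" "p = b + block_end ns (Suc i)" using Z by (auto simp: block_def)
  have "q = b + block_end ns i"
  proof (cases "q = b")
    case True
    have "i = 0"
    proof (rule ccontr)
      assume "i \<noteq> 0"
      then obtain k where "i = Suc k" by (cases i) auto
      then have "q < b + block_end ns i" "b + block_end ns i < p" "Z (b + block_end ns i)"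
        using block_end_mono[of 0 i ns] block_end_mono[of i "Suc i" ns] i True Z by (auto intro!: exI[of _ k])
      then show False using h by (auto simp: block_def)
    qed
    then show ?thesis using True by simp
  next
    case False
    then obtain k where k: "k < length ns" "q = b + block_end ns (Suc k)" using h Z by (auto simp: block_def)
    have "k \<noteq> i" using h i k by (auto simp: block_def)
    moreover have "\<not> i < k" using h i k block_end_mono[of "Suc i" "Suc k" ns] by (auto simp: block_def)
    ultimately have "k < i" by simp
    have "Suc k = i"
    proof (rule ccontr)
      assume "Suc k \<noteq> i"
      then have s: "Suc k < i" using \<open>k < i\<close> by simp
      then obtain l where l: "i = Suc l" by (cases i) auto
      have "q < b + block_end ns i" "b + block_end ns i < p" using s k i block_end_mono by auto
      moreover have "Z (b + block_end ns i)" using Z i l by (auto intro!: exI[of _ l])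
      ultimately show False using h by (auto simp: block_def)
    qed
    then show ?thesis using k by simp
  qed
  then show "\<exists>i<length ns. q = b + block_end ns i \<and> p = b + block_end ns (Suc i)" using i by blast
next
  assume "\<exists>i<length ns. q = b + block_end ns i \<and> p = b + block_end ns (Suc i)"
  then obtain i where i: "i < length ns" "q = b + block_end ns i" "p = b + block_end ns (Suc i)" by blast
  have "q = b \<or> Z q"
  proof (cases i)
    case (Suc k)
    then show ?thesis using i Z by (auto intro!: exI[of _ k])
  qed (use i in simp)
  moreover have "\<not> (q < r \<and> r < p \<and> Z r)" for r
  proof
    assume r: "q < r \<and> r < p \<and> Z r"
    then obtain k where k: "k < length ns" "r = b + block_end ns (Suc k)" using Z by auto
    have "i < Suc k" using r i k block_end_mono[of "Suc k" i ns] by (metis Suc_leI add_less_cancel_left less_or_eq_imp_le linorder_neqE_nat not_less_iff_gr_or_eq)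
    moreover have "Suc k < Suc i" using r i k block_end_mono[of "Suc i" "Suc k" ns]
      by (metis Suc_leI add_less_cancel_left linorder_neqE_nat not_less_iff_gr_or_eq)
    ultimately show False by simp
  qed
  ultimately show "block Z b q p" unfolding block_def using i Z block_end_mono[of i "Suc i" ns] by auto
qed

section \<open>Colourable cubic graphs in terms of their listing\<close>

definition adjacent :: "(nat \<times> nat) list \<Rightarrow> (nat \<times> nat) set" where
  "adjacent es = set es \<union> (set es)\<inverse>"

lemma flat_pairs_nth: "e < length es \<Longrightarrow> flat_pairs es ! (2 * e) = fst (es ! e) \<and> flat_pairs es ! Suc (2 * e) = snd (es ! e)"
proof (induction es arbitrary: e)
  case (Cons a es)
  then show ?case by (cases e; cases a) auto
qed simp

lemma length_flat_pairs [simp]: "length (flat_pairs es) = 2 * length es"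
  by (induction es) (auto simp: flat_pairs_def)

lemma flat_pairs_surj: "even (length ns) \<Longrightarrow> \<exists>es. ns = flat_pairs es"
proof (induction ns rule: length_induct)
  case (1 ns)
  then show ?case
  proof (cases ns)
    case (Cons a ms)
    then obtain c ks where "ms = c # ks" using 1 by (cases ms) auto
    then obtain es where "ks = flat_pairs es" using 1(1)[rule_format, of ks] 1(2) Cons by auto
    then show ?thesis using Cons \<open>ms = c # ks\<close> by (intro exI[of _ "(a, c) # es"]) simp
  qed (auto intro: exI[of _ "[]"])
qed

text \<open>Position \<open>k\<close> of the flattened list is a dart of the edge
  \<open>k div 2\<close>. Seeing each of the three colours exactly once expresses degree 3 and
  proper colouring at the same time.\<close>

definition perfect :: "nat \<Rightarrow> nat list \<Rightarrow> (nat \<Rightarrow> nat) \<Rightarrow> bool" where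
  "perfect n ds col \<longleftrightarrow> (\<forall>k<length ds. col (k div 2) < 3) \<and>
     (\<forall>v<n. \<forall>c<3. \<exists>!k. k < length ds \<and> ds ! k = v \<and> col (k div 2) = c)"

lemma connected_listed_graph:
  assumes "\<And>w. w \<in> set (flat_pairs es) \<Longrightarrow> w < n"
  shows "Digraph_Component.connected (listed_graph n es) \<longleftrightarrow>
    0 < n \<and> (\<forall>u<n. \<forall>v<n. (u, v) \<in> (adjacent es)\<^sup>*)"
proof -
  let ?S = "with_proj (mk_symmetric (listed_graph n es))"
  have V: "verts ?S = {..<n}" by (simp add: listed_graph_def)
  have A: "arcs_ends ?S = adjacent es"
  proof -
    have "arcs_ends ?S = (\<lambda>i. es ! i) ` {..<length es} \<union> (\<lambda>i. (snd (es ! i), fst (es ! i))) ` {..<length es}"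
      by (auto simp: parcs_mk_symmetric listed_graph_def)
    also have "(\<lambda>i. (snd (es ! i), fst (es ! i))) ` {..<length es} = (\<lambda>p. (snd p, fst p)) ` (\<lambda>i. es ! i) ` {..<length es}"
      by (simp add: image_image)
    also have "(\<lambda>i. es ! i) ` {..<length es} = set es" unfolding set_conv_nth by blast
    also have "(\<lambda>p. (snd p, fst p)) ` set es = (set es)\<inverse>" by (auto intro: rev_image_eqI)
    finally show ?thesis unfolding adjacent_def .
  qed
  have lt: "u < n \<and> v < n" if "(u, v) \<in> adjacent es" for u v
  proof -
    have "u \<in> set (flat_pairs es) \<and> v \<in> set (flat_pairs es)"
      using that by (force simp: adjacent_def flat_pairs_def)
    then show ?thesis using assms by blast
  qed
  have "(u, v) \<in> rtrancl_on {..<n} (adjacent es) \<longleftrightarrow> (u, v) \<in> (adjacent es)\<^sup>*" if "u < n" for u v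
  proof
    assume "(u, v) \<in> rtrancl_on {..<n} (adjacent es)"
    then show "(u, v) \<in> (adjacent es)\<^sup>*" by induction auto
  next
    assume "(u, v) \<in> (adjacent es)\<^sup>*"
    then show "(u, v) \<in> rtrancl_on {..<n} (adjacent es)"
    proof induction
      case (step y z)
      then show ?case using lt[of y z] rtrancl_on_into_rtrancl_on by fastforce
    qed (use that in simp)
  qed
  then show ?thesis
    unfolding connected_def strongly_connected_def reachable_def V A by auto
qed

lemma colourable_cubic_iff:
  "cubic_graph (listed_graph n es) \<and> (\<exists>col. three_colouring (listed_graph n es) col) \<longleftrightarrow>
     0 < n \<and> (\<forall>w\<in>set (flat_pairs es). w < n) \<and> (\<forall>u<n. \<forall>v<n. (u, v) \<in> (adjacent es)\<^sup>*) \<and>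
     (\<exists>col. perfect n (flat_pairs es) col)"
proof -
  let ?G = "listed_graph n es" and ?ds = "flat_pairs es"
  have G: "verts ?G = {..<n}" "arcs ?G = {..<length es}" "tail ?G e = fst (es ! e)" "head ?G e = snd (es ! e)" for e
    by (simp_all add: listed_graph_def)
  \<comment> \<open>Darts as positions in the flattened list: twice the edge, plus one at the
    head.\<close>
  define dk where "dk = (\<lambda>(e, s). 2 * e + of_bool s :: nat)"
  define ks where "ks v = {k. k < length ?ds \<and> ?ds ! k = v}" for v
  have bij: "bij_betw dk (darts_at ?G v) (ks v)" for v
  proof (rule bij_betw_byWitness[where f' = "\<lambda>k. (k div 2, odd k)"])
    show "\<forall>d\<in>darts_at ?G v. (dk d div 2, odd (dk d)) = d" by (auto simp: dk_def)
    show "\<forall>k\<in>ks v. dk (k div 2, odd k) = k" by (auto simp: dk_def)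
    show "dk ` darts_at ?G v \<subseteq> ks v"
      using flat_pairs_nth by (auto simp: dk_def ks_def darts_at_def G split: if_splits)
    show "(\<lambda>k. (k div 2, odd k)) ` ks v \<subseteq> darts_at ?G v"
    proof
      fix d assume "d \<in> (\<lambda>k. (k div 2, odd k)) ` ks v"
      then obtain k where k: "d = (k div 2, odd k)" "k < 2 * length es" "?ds ! k = v" by (auto simp: ks_def)
      have "k = 2 * (k div 2) \<or> k = Suc (2 * (k div 2))" by presburger
      moreover have "k div 2 < length es" using k(2) by simp
      ultimately show "d \<in> darts_at ?G v"
        using k flat_pairs_nth[of "k div 2" es] by (cases "odd k") (auto simp: darts_at_def G)
    qed
  qed
  have dk2: "dk d div 2 = fst d" for d by (auto simp: dk_def split: prod.splits)
  have colour: "card (darts_at ?G v) = 3 \<and> inj_on (\<lambda>d. col (fst d)) (darts_at ?G v) \<longleftrightarrow>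
      (\<forall>c<3. \<exists>!k. k < length ?ds \<and> ?ds ! k = v \<and> col (k div 2) = c)"
    if c3: "\<forall>k<length ?ds. col (k div 2) < 3" for col :: "nat \<Rightarrow> nat" and v
  proof -
    have "(\<lambda>d. col (fst d)) = (\<lambda>k. col (k div 2)) \<circ> dk"
      by (rule ext) (simp only: comp_def dk2)
    then have i: "inj_on (\<lambda>d. col (fst d)) (darts_at ?G v) \<longleftrightarrow> inj_on (\<lambda>k. col (k div 2)) (ks v)"
      using comp_inj_on_iff[OF bij_betw_imp_inj_on[OF bij[of v]], of "\<lambda>k. col (k div 2)"]
      by (simp only: bij_betw_imp_surj_on[OF bij])
    have sub: "(\<lambda>k. col (k div 2)) ` ks v \<subseteq> {..<3}" using c3 by (auto simp: ks_def)
    have fin: "finite (ks v)" by (simp add: ks_def)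
    have "card (ks v) = 3 \<and> inj_on (\<lambda>k. col (k div 2)) (ks v) \<longleftrightarrow> bij_betw (\<lambda>k. col (k div 2)) (ks v) {..<3}"
    proof
      assume h: "card (ks v) = 3 \<and> inj_on (\<lambda>k. col (k div 2)) (ks v)"
      then have "card ((\<lambda>k. col (k div 2)) ` ks v) = card {..<3::nat}" by (simp add: card_image)
      then show "bij_betw (\<lambda>k. col (k div 2)) (ks v) {..<3}"
        using h sub by (simp add: bij_betw_def card_subset_eq)
    next
      assume h: "bij_betw (\<lambda>k. col (k div 2)) (ks v) {..<3}"
      then show "card (ks v) = 3 \<and> inj_on (\<lambda>k. col (k div 2)) (ks v)"
        using bij_betw_same_card[OF h] by (simp add: bij_betw_def)
    qed
    also have "\<dots> \<longleftrightarrow> (\<forall>c<3. \<exists>!k. k \<in> ks v \<and> col (k div 2) = c)"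
    proof (intro iffI allI impI)
      fix c :: nat assume b: "bij_betw (\<lambda>k. col (k div 2)) (ks v) {..<3}" and "c < 3"
      then have "c \<in> (\<lambda>k. col (k div 2)) ` ks v" by (simp add: bij_betw_def)
      then obtain k where k: "k \<in> ks v" "col (k div 2) = c" by auto
      show "\<exists>!k. k \<in> ks v \<and> col (k div 2) = c"
      proof (rule ex1I[of _ k])
        fix l assume "l \<in> ks v \<and> col (l div 2) = c"
        then show "l = k" using k inj_onD[OF bij_betw_imp_inj_on[OF b], of l k] by simp
      qed (use k in simp)
    next
      assume h: "\<forall>c<3. \<exists>!k. k \<in> ks v \<and> col (k div 2) = c"
      have "inj_on (\<lambda>k. col (k div 2)) (ks v)"
      proof (rule inj_onI)
        fix k l assume "k \<in> ks v" "l \<in> ks v" "col (k div 2) = col (l div 2)"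
        moreover have "col (k div 2) < 3" using sub calculation(1) by auto
        ultimately show "k = l" using h[rule_format, of "col (k div 2)"] by auto
      qed
      moreover have "{..<3} \<subseteq> (\<lambda>k. col (k div 2)) ` ks v"
      proof
        fix c :: nat assume "c \<in> {..<3}"
        then obtain k where "k \<in> ks v" "col (k div 2) = c" using h[rule_format, of c] by auto
        then show "c \<in> (\<lambda>k. col (k div 2)) ` ks v" by auto
      qed
      ultimately show "bij_betw (\<lambda>k. col (k div 2)) (ks v) {..<3}" using sub by (auto simp: bij_betw_def)
    qed
    finally show ?thesis unfolding i bij_betw_same_card[OF bij] by (simp add: ks_def conj_assoc)
  qed
  have c3: "(\<forall>e\<in>arcs ?G. col e < 3) \<longleftrightarrow> (\<forall>k<length ?ds. col (k div 2) < 3)" for col :: "nat \<Rightarrow> nat"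
  proof
    assume "\<forall>k<length ?ds. col (k div 2) < 3"
    then show "\<forall>e\<in>arcs ?G. col e < 3"
      unfolding G by (metis lessThan_iff length_flat_pairs mult_less_cancel1 nonzero_mult_div_cancel_left zero_less_numeral zero_neq_numeral)
  qed (auto simp: G)
  have fin: "fin_digraph ?G \<longleftrightarrow> (\<forall>w\<in>set ?ds. w < n)"
  proof
    assume "fin_digraph ?G"
    then interpret fin_digraph ?G .
    show "\<forall>w\<in>set ?ds. w < n"
    proof
      fix w assume "w \<in> set ?ds"
      then obtain e where "e < length es" "w = fst (es ! e) \<or> w = snd (es ! e)"
        by (auto simp: flat_pairs_def in_set_conv_nth[of _ es])
      then show "w < n" using tail_in_verts[of e] head_in_verts[of e] by (auto simp: G)
    qed
  next
    assume "\<forall>w\<in>set ?ds. w < n"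
    then have h: "fst (es ! e) < n \<and> snd (es ! e) < n" if "e < length es" for e
      using flat_pairs_nth[OF that] that nth_mem[of "2 * e" ?ds] nth_mem[of "Suc (2 * e)" ?ds] by auto
    show "fin_digraph ?G" by unfold_locales (use h in \<open>auto simp: G\<close>)
  qed
  have key: "three_colouring ?G col \<and> (\<forall>v\<in>verts ?G. card (darts_at ?G v) = 3) \<longleftrightarrow> perfect n ?ds col" for col
  proof (cases "\<forall>k<length ?ds. col (k div 2) < 3")
    case True
    show ?thesis
      unfolding perfect_def three_colouring_def c3 G(1) using True by (simp only: colour[OF True, symmetric]) auto
  next
    case False
    then show ?thesis unfolding perfect_def three_colouring_def c3 by blast
  qed
  have "cubic_graph ?G \<and> (\<exists>col. three_colouring ?G col) \<longleftrightarrow>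
      fin_digraph ?G \<and> Digraph_Component.connected ?G \<and> (\<exists>col. perfect n ?ds col)"
    unfolding cubic_graph_def key[symmetric] by blast
  then show ?thesis using fin connected_listed_graph[of es n] by blast
qed

text \<open>Greedy extension: a path from the first listed vertex to one not yet listed must leave
  the listed set, and an edge on which it does so supplies the next vertex.\<close>

lemma search_order:
  assumes n: "0 < n" and lt: "\<And>u v. (u, v) \<in> N \<Longrightarrow> u < n \<and> v < n" and conn: "\<And>u v. u < n \<Longrightarrow> v < n \<Longrightarrow> (u, v) \<in> N\<^sup>*"
  shows "\<exists>vs. length vs = n \<and> set vs = {..<n::nat} \<and> (\<forall>i. 0 < i \<longrightarrow> i < n \<longrightarrow> (\<exists>j<i. (vs ! j, vs ! i) \<in> N))"
proof -
  have "\<exists>vs. length vs = k \<and> distinct vs \<and> set vs \<subseteq> {..<n} \<and> (\<forall>i. 0 < i \<longrightarrow> i < k \<longrightarrow> (\<exists>j<i. (vs ! j, vs ! i) \<in> N))"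
    if "0 < k" "k \<le> n" for k
    using that
  proof (induction k)
    case (Suc k)
    show ?case
    proof (cases "k = 0")
      case True
      then show ?thesis using n by (intro exI[of _ "[0]"]) auto
    next
      case False
      then obtain vs where vs: "length vs = k" "distinct vs" "set vs \<subseteq> {..<n}"
        "\<forall>i. 0 < i \<longrightarrow> i < k \<longrightarrow> (\<exists>j<i. (vs ! j, vs ! i) \<in> N)"
        using Suc.IH Suc.prems(2) by (meson Suc_leD gr0I)
      have "card (set vs) = k" using distinct_card[OF vs(2)] vs(1) by simp
      then have "card (set vs) \<noteq> card {..<n}" using Suc.prems(2) by simp
      then have "\<not> {..<n} \<subseteq> set vs" using vs(3) subset_antisym by metis
      then obtain w where w: "w < n" "w \<notin> set vs" by blast
      have v0: "vs ! 0 \<in> set vs" using vs(1) False by simp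
      have "\<exists>y z. y \<in> set vs \<and> z \<notin> set vs \<and> (y, z) \<in> N"
      proof (rule ccontr)
        assume h: "\<not> ?thesis"
        have "(vs ! 0, w) \<in> N\<^sup>*" using conn v0 vs(3) w by blast
        then have "w \<in> set vs" by induction (use v0 h in auto)
        then show False using w by simp
      qed
      then obtain y z where yz: "y \<in> set vs" "z \<notin> set vs" "(y, z) \<in> N" by blast
      then obtain j where j: "j < k" "vs ! j = y" using vs(1) by (metis in_set_conv_nth)
      have "\<exists>l<i. ((vs @ [z]) ! l, (vs @ [z]) ! i) \<in> N" if i: "0 < i" "i < Suc k" for i
      proof (cases "i = k")
        case True
        then show ?thesis using j yz vs(1) by (intro exI[of _ j]) (simp add: nth_append)
      next
        case False
        then have "i < k" using i by simp
        then obtain l where "l < i" "(vs ! l, vs ! i) \<in> N" using vs(4) i by blast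
        then show ?thesis using False i vs(1) by (intro exI[of _ l]) (simp add: nth_append)
      qed
      moreover have "z < n" using yz lt by blast
      ultimately show ?thesis using vs(1-3) yz(2) by (intro exI[of _ "vs @ [z]"]) simp
    qed
  qed simp
  from this[of n] obtain vs where vs: "length vs = n" "distinct vs" "set vs \<subseteq> {..<n}"
    "\<forall>i. 0 < i \<longrightarrow> i < n \<longrightarrow> (\<exists>j<i. (vs ! j, vs ! i) \<in> N)" using n by blast
  then have "set vs = {..<n}" using distinct_card[of vs] by (intro card_subset_eq) simp_all
  then show ?thesis using vs by blast
qed

section \<open>A first-order verifier for colourable cubic graphs\<close>

definition coloured :: "(nat \<Rightarrow> bool) \<Rightarrow> (nat \<Rightarrow> bool) \<Rightarrow> (nat \<Rightarrow> bool) \<Rightarrow> bool \<Rightarrow> bool \<Rightarrow> nat \<Rightarrow> nat \<Rightarrow> nat \<Rightarrow> bool" where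
  "coloured Z B C f g v q p \<longleftrightarrow> block Z 0 q p \<and> q \<noteq> 0 \<and> q + v = p \<and> f = B p \<and> g = C p"

text \<open>The first block is the number of vertices and is marked, so further marks fall on the
  second end of each edge. Excluding that both colour bits are clear leaves three codes.\<close>

definition alternating :: "nat \<Rightarrow> (nat \<Rightarrow> bool) \<Rightarrow> (nat \<Rightarrow> bool) \<Rightarrow> (nat \<Rightarrow> bool) \<Rightarrow> (nat \<Rightarrow> bool) \<Rightarrow> bool" where
  "alternating L Z M B C \<longleftrightarrow> (\<forall>q<L. \<forall>p<L. block Z 0 q p \<longrightarrow> (q = 0 \<longrightarrow> M p) \<and>
     (q \<noteq> 0 \<longrightarrow> (M p \<longleftrightarrow> \<not> M q) \<and> (B p \<or> C p) \<and> (M p \<longrightarrow> (B q \<longleftrightarrow> B p) \<and> (C q \<longleftrightarrow> C p))))"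

text \<open>Uniqueness is phrased with the order because \<open>fm\<close> has no equality
  atom.\<close>

definition once :: "nat \<Rightarrow> (nat \<Rightarrow> bool) \<Rightarrow> (nat \<Rightarrow> bool) \<Rightarrow> (nat \<Rightarrow> bool) \<Rightarrow> bool \<Rightarrow> bool \<Rightarrow> nat \<Rightarrow> bool" where
  "once L Z B C f g v \<longleftrightarrow> (\<exists>q<L. \<exists>p<L. coloured Z B C f g v q p) \<and>
     \<not> (\<exists>q<L. \<exists>p<L. \<exists>q'<L. \<exists>p'<L. coloured Z B C f g v q p \<and> coloured Z B C f g v q' p' \<and> p < p')"

definition vertices :: "nat \<Rightarrow> nat \<Rightarrow> (nat \<Rightarrow> bool) \<Rightarrow> (nat \<Rightarrow> bool) \<Rightarrow> (nat \<Rightarrow> bool) \<Rightarrow> (nat \<Rightarrow> bool) \<Rightarrow> bool" where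
  "vertices L b Z B C Y \<longleftrightarrow> (\<exists>s<L. block Z 0 0 s \<and> (\<exists>v<L. v \<noteq> 0 \<and> v < s) \<and>
     (\<forall>q<L. \<forall>p<L. \<forall>v<L. block Z 0 q p \<and> q \<noteq> 0 \<and> q + v = p \<longrightarrow> v < s) \<and>
     (\<forall>v<L. v \<noteq> 0 \<and> v < s \<longrightarrow> (\<exists>q<L. \<exists>p<L. block Y b q p \<and> q + v = p) \<and>
        once L Z B C True False v \<and> once L Z B C False True v \<and> once L Z B C True True v))"

definition joined :: "nat \<Rightarrow> (nat \<Rightarrow> bool) \<Rightarrow> (nat \<Rightarrow> bool) \<Rightarrow> nat \<Rightarrow> nat \<Rightarrow> bool" where
  "joined L Z M v w \<longleftrightarrow> (\<exists>a<L. \<exists>c<L. \<exists>d<L. block Z 0 a c \<and> block Z 0 c d \<and> a \<noteq> 0 \<and> M d \<and>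
     (a + v = c \<and> c + w = d \<or> a + w = c \<and> c + v = d))"

definition searched :: "nat \<Rightarrow> nat \<Rightarrow> (nat \<Rightarrow> bool) \<Rightarrow> (nat \<Rightarrow> bool) \<Rightarrow> (nat \<Rightarrow> bool) \<Rightarrow> bool" where
  "searched L b Z M Y \<longleftrightarrow> (\<forall>q<L. \<forall>p<L. block Y b q p \<and> b < q \<longrightarrow>
     (\<exists>q'<L. \<exists>p'<L. block Y b q' p' \<and> \<not> q < p' \<and> (\<exists>v<L. \<exists>w<L. q + v = p \<and> q' + w = p' \<and> joined L Z M v w)))"

text \<open>\<open>Z\<close> and \<open>Y\<close> are the ends of the unary numbers in the word and in a list of all vertices, which begins at \<open>b\<close>. The certificate
  annotates the ends in the word with a parity mark \<open>M\<close>, which tells where the pair of ends of an edge is complete, and with the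
  colour bits \<open>B\<close> and \<open>C\<close> of the edge. Each vertex of the list except the first has a neighbour further to the left, which
  witnesses connectedness. A block of length \<open>v\<close> stands for the vertex \<open>v - 1\<close>.\<close>

definition certified :: "nat \<Rightarrow> nat \<Rightarrow> nat \<Rightarrow> (nat \<Rightarrow> bool) \<Rightarrow> (nat \<Rightarrow> bool) \<Rightarrow> (nat \<Rightarrow> bool) \<Rightarrow> (nat \<Rightarrow> bool) \<Rightarrow> (nat \<Rightarrow> bool) \<Rightarrow> bool" where
  "certified L n b Z M B C Y \<longleftrightarrow> Z n \<and> M n \<and> alternating L Z M B C \<and> vertices L b Z B C Y \<and> searched L b Z M Y"

subsection \<open>The formula\<close>

definition allf :: "nat \<Rightarrow> fm \<Rightarrow> fm" where "allf r \<phi> = Neg (Ex r (Neg \<phi>))"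
definition impf :: "fm \<Rightarrow> fm \<Rightarrow> fm" where "impf \<phi> \<psi> = Neg (And \<phi> (Neg \<psi>))"
definition orf :: "fm \<Rightarrow> fm \<Rightarrow> fm" where "orf \<phi> \<psi> = Neg (And (Neg \<phi>) (Neg \<psi>))"
definition iff :: "fm \<Rightarrow> fm \<Rightarrow> fm" where "iff \<phi> \<psi> = And (impf \<phi> \<psi>) (impf \<psi> \<phi>)"
definition zerof :: "nat \<Rightarrow> fm" where "zerof r = Sym r 3"

lemma evf_macros [simp]:
  "evf (allf r \<phi>) ws \<sigma> \<longleftrightarrow> (\<forall>i<length ws - 1. evf \<phi> ws (\<sigma>(r := i)))"
  "evf (impf \<phi> \<psi>) ws \<sigma> \<longleftrightarrow> (evf \<phi> ws \<sigma> \<longrightarrow> evf \<psi> ws \<sigma>)"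
  "evf (orf \<phi> \<psi>) ws \<sigma> \<longleftrightarrow> evf \<phi> ws \<sigma> \<or> evf \<psi> ws \<sigma>"
  "evf (iff \<phi> \<psi>) ws \<sigma> \<longleftrightarrow> (evf \<phi> ws \<sigma> \<longleftrightarrow> evf \<psi> ws \<sigma>)"
  by (auto simp: allf_def impf_def orf_def iff_def)

lemma wff_macros [simp]:
  "wff k (allf r \<phi>) \<longleftrightarrow> k \<le> r \<and> wff (Suc r) \<phi>" "wff k (impf \<phi> \<psi>) \<longleftrightarrow> wff k \<phi> \<and> wff k \<psi>"
  "wff k (orf \<phi> \<psi>) \<longleftrightarrow> wff k \<phi> \<and> wff k \<psi>" "wff k (iff \<phi> \<psi>) \<longleftrightarrow> wff k \<phi> \<and> wff k \<psi>"
  "wff k (zerof r) \<longleftrightarrow> r < k"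
  by (auto simp: allf_def impf_def orf_def iff_def zerof_def)

text \<open>\<open>s\<close> chooses between the input word, before register 0, and the list of
  vertices, behind register 4; \<open>Sym r 1\<close> finds the closing letters.\<close>

definition zonef :: "bool \<Rightarrow> nat \<Rightarrow> nat \<Rightarrow> fm" where
  "zonef s r d = And (if s then lessf d 4 r else lessf d r 0) (Sym r 1)"

definition startf :: "bool \<Rightarrow> nat \<Rightarrow> nat \<Rightarrow> fm" where
  "startf s r d = (if s then And (Neg (lessf d r 4)) (Neg (lessf d 4 r)) else zerof r)"

definition blockf :: "bool \<Rightarrow> nat \<Rightarrow> nat \<Rightarrow> nat \<Rightarrow> fm" where
  "blockf s q p d = And (zonef s p d) (And (lessf d q p) (And (orf (startf s q d) (zonef s q d))
     (Neg (Ex d (And (lessf (Suc d) q d) (And (lessf (Suc d) d p) (zonef s d (Suc d))))))))"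

definition markf :: "nat \<Rightarrow> nat \<Rightarrow> nat \<Rightarrow> fm" where
  "markf r p d = Ex d (And (Plus r p d) (Sym d 2))"

lemma wff_blockf [simp]: "5 \<le> q \<Longrightarrow> 5 \<le> p \<Longrightarrow> wff k (blockf s q p d) \<longleftrightarrow> k \<le> d \<and> q < d \<and> p < d \<and> q \<noteq> p"
  if "q < k" "p < k"
  using that by (auto simp: blockf_def zonef_def startf_def)

lemma wff_zonef [simp]: "wff k (zonef False r d) \<longleftrightarrow> k \<le> d \<and> r < k \<and> r < d \<and> r \<noteq> 0"
  by (auto simp: zonef_def)

lemma wff_markf [simp]: "wff k (markf r p d) \<longleftrightarrow> k \<le> d \<and> r < d \<and> p < d \<and> r \<noteq> p"
  by (auto simp: markf_def)

text \<open>Registers 0 to 4 are bound once at the top of \<open>verifierf\<close> and stay constant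
  inside; \<open>c\<close> gives their values, and only the other registers vary.\<close>

definition env :: "nat list \<Rightarrow> (nat \<Rightarrow> nat) \<Rightarrow> (nat \<Rightarrow> nat) \<Rightarrow> bool" where
  "env ws c \<sigma> \<longleftrightarrow> (\<forall>r. \<sigma> r < length ws - 1) \<and> (\<forall>r<5. \<sigma> r = c r)"

definition zone :: "nat list \<Rightarrow> (nat \<Rightarrow> nat) \<Rightarrow> bool \<Rightarrow> nat \<Rightarrow> bool" where
  "zone ws c s p \<longleftrightarrow> (if s then c 4 < p \<and> p < length ws - 1 else p < c 0) \<and> ws ! p = 1"

definition mark :: "nat list \<Rightarrow> nat \<Rightarrow> nat \<Rightarrow> bool" where
  "mark ws a p \<longleftrightarrow> a + p < length ws - 1 \<and> ws ! (a + p) = 2"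

lemma env_upd [simp]: "env ws c \<sigma> \<Longrightarrow> 5 \<le> r \<Longrightarrow> i < length ws - 1 \<Longrightarrow> env ws c (\<sigma>(r := i))"
  by (auto simp: env_def)

lemma env_lt: "env ws c \<sigma> \<Longrightarrow> \<sigma> r < length ws - 1"
  by (auto simp: env_def)

lemma env_const: "env ws c \<sigma> \<Longrightarrow> r < 5 \<Longrightarrow> \<sigma> r = c r"
  by (auto simp: env_def)

context
  fixes ws :: "nat list" and c :: "nat \<Rightarrow> nat"
  assumes ws: "marked ws"
begin

lemma evf_zerof [simp]: "env ws c \<sigma> \<Longrightarrow> evf (zerof r) ws \<sigma> \<longleftrightarrow> \<sigma> r = 0"
  using marked_nth(1)[OF ws, of "\<sigma> r"] env_lt[of ws c \<sigma> r] by (simp add: zerof_def)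

lemma evf_less [simp]: "env ws c \<sigma> \<Longrightarrow> d \<noteq> a \<Longrightarrow> d \<noteq> e \<Longrightarrow> evf (lessf d a e) ws \<sigma> \<longleftrightarrow> \<sigma> a < \<sigma> e"
  using ws env_lt[of ws c \<sigma> e] by simp

lemma evf_zonef [simp]: "env ws c \<sigma> \<Longrightarrow> r < d \<Longrightarrow> 5 \<le> d \<Longrightarrow> evf (zonef s r d) ws \<sigma> \<longleftrightarrow> zone ws c s (\<sigma> r)"
  using env_lt[of ws c \<sigma> r] by (auto simp: zonef_def zone_def env_const[of ws c \<sigma>])

lemma evf_blockf [simp]:
  assumes e: "env ws c \<sigma>" and lt: "q < d" "p < d" "5 \<le> d" "q \<noteq> p"
  shows "evf (blockf s q p d) ws \<sigma> \<longleftrightarrow> block (zone ws c s) (if s then c 4 else 0) (\<sigma> q) (\<sigma> p)"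
proof -
  have st: "evf (startf s q d) ws \<sigma> \<longleftrightarrow> \<sigma> q = (if s then c 4 else 0)"
    using e lt by (auto simp: startf_def env_const[of ws c \<sigma>])
  have "evf (blockf s q p d) ws \<sigma> \<longleftrightarrow> zone ws c s (\<sigma> p) \<and> \<sigma> q < \<sigma> p \<and> (\<sigma> q = (if s then c 4 else 0) \<or> zone ws c s (\<sigma> q)) \<and>
      \<not> (\<exists>r<length ws - 1. \<sigma> q < r \<and> r < \<sigma> p \<and> zone ws c s r)"
    unfolding blockf_def using e lt by (simp add: st cong: conj_cong)
  also have "\<dots> \<longleftrightarrow> block (zone ws c s) (if s then c 4 else 0) (\<sigma> q) (\<sigma> p)"
    unfolding block_def using less_trans[OF _ env_lt[OF e, of p]] by blast
  finally show ?thesis .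
qed

lemma evf_markf [simp]:
  "env ws c \<sigma> \<Longrightarrow> r < 5 \<Longrightarrow> p < d \<Longrightarrow> 5 \<le> d \<Longrightarrow> evf (markf r p d) ws \<sigma> \<longleftrightarrow> mark ws (c r) (\<sigma> p)"
  by (auto simp: markf_def mark_def env_const[of ws c \<sigma>])

end

definition colouredf :: "bool \<Rightarrow> bool \<Rightarrow> nat \<Rightarrow> nat \<Rightarrow> nat \<Rightarrow> nat \<Rightarrow> fm" where
  "colouredf f g v q p d = And (blockf False q p d) (And (Neg (zerof q)) (And (Plus q v p)
     (And (litf f (markf 2 p d)) (litf g (markf 3 p d)))))"

definition alternatingf :: fm where
  "alternatingf = allf 5 (allf 6 (impf (blockf False 5 6 7) (And (impf (zerof 5) (markf 0 6 7))
     (impf (Neg (zerof 5)) (And (iff (markf 0 6 7) (Neg (markf 0 5 7))) (And (orf (markf 2 6 7) (markf 3 6 7))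
       (impf (markf 0 6 7) (And (iff (markf 2 5 7) (markf 2 6 7)) (iff (markf 3 5 7) (markf 3 6 7))))))))))"

definition oncef :: "bool \<Rightarrow> bool \<Rightarrow> fm" where
  "oncef f g = And (Ex 7 (Ex 8 (colouredf f g 6 7 8 9)))
     (Neg (Ex 7 (Ex 8 (Ex 9 (Ex 10 (And (colouredf f g 6 7 8 11) (And (colouredf f g 6 9 10 11) (lessf 11 8 10))))))))"

definition verticesf :: fm where
  "verticesf = Ex 5 (And (Ex 6 (And (zerof 6) (blockf False 6 5 7))) (And (Ex 6 (And (Neg (zerof 6)) (lessf 7 6 5)))
     (And (allf 6 (allf 7 (allf 8 (impf (And (blockf False 6 7 9) (And (Neg (zerof 6)) (Plus 6 8 7))) (lessf 9 8 5)))))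
       (allf 6 (impf (And (Neg (zerof 6)) (lessf 7 6 5)) (And (Ex 7 (Ex 8 (And (blockf True 7 8 9) (Plus 7 6 8))))
          (And (oncef True False) (And (oncef False True) (oncef True True)))))))))"

definition joinedf :: fm where
  "joinedf = Ex 11 (Ex 12 (Ex 13 (And (blockf False 11 12 14) (And (blockf False 12 13 14) (And (Neg (zerof 11))
     (And (markf 0 13 14) (orf (And (Plus 11 9 12) (Plus 12 10 13)) (And (Plus 11 10 12) (Plus 12 9 13)))))))))"

definition searchedf :: fm where
  "searchedf = allf 5 (allf 6 (impf (And (blockf True 5 6 7) (lessf 7 4 5))
     (Ex 7 (Ex 8 (And (blockf True 7 8 9) (And (Neg (lessf 9 5 8))
        (Ex 9 (Ex 10 (And (Plus 5 9 6) (And (Plus 7 10 8) joinedf))))))))))"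

definition certifiedf :: fm where
  "certifiedf = And (zonef False 1 5) (And (markf 0 1 5) (And alternatingf (And verticesf searchedf)))"

text \<open>The registers 0 to 4 hold the separator, the length \<open>n\<close> of the input, and the offsets of the second and third
  annotation and of the list of vertices; a certificate is three words of length \<open>n\<close> followed by the list.\<close>

definition verifierf :: fm where
  "verifierf = Ex 0 (And (Sym 0 4) (Ex 1 (And (sucf 2 1 0) (Ex 2 (And (Plus 0 1 2)
     (Ex 3 (And (Plus 1 2 3) (Ex 4 (And (Plus 1 3 4) certifiedf)))))))))"

lemma wff_verifierf: "wff 0 verifierf"
  by (simp add: verifierf_def certifiedf_def alternatingf_def verticesf_def searchedf_def joinedf_def oncef_def
      colouredf_def)

context
  fixes ws :: "nat list" and c :: "nat \<Rightarrow> nat"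
  assumes ws: "marked ws"
begin

private lemmas macros = evf_zerof[OF ws, where c = c] evf_less[OF ws, where c = c] evf_zonef[OF ws, where c = c]
  evf_blockf[OF ws, where c = c] evf_markf[OF ws, where c = c]

lemma evf_colouredf:
  "env ws c \<sigma> \<Longrightarrow> v < d \<Longrightarrow> q < d \<Longrightarrow> p < d \<Longrightarrow> 5 \<le> d \<Longrightarrow> q \<noteq> p \<Longrightarrow> evf (colouredf f g v q p d) ws \<sigma> \<longleftrightarrow>
     coloured (zone ws c False) (mark ws (c 2)) (mark ws (c 3)) f g (\<sigma> v) (\<sigma> q) (\<sigma> p)"
  by (simp add: colouredf_def coloured_def macros)

lemma evf_alternatingf:
  "env ws c \<sigma> \<Longrightarrow> evf alternatingf ws \<sigma> \<longleftrightarrow>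
     alternating (length ws - 1) (zone ws c False) (mark ws (c 0)) (mark ws (c 2)) (mark ws (c 3))"
  unfolding alternatingf_def alternating_def by (simp add: macros cong: imp_cong conj_cong del: One_nat_def)

lemma evf_oncef:
  "env ws c \<sigma> \<Longrightarrow> evf (oncef f g) ws \<sigma> \<longleftrightarrow>
     once (length ws - 1) (zone ws c False) (mark ws (c 2)) (mark ws (c 3)) f g (\<sigma> 6)"
  unfolding oncef_def once_def by (simp add: macros evf_colouredf cong: imp_cong conj_cong del: One_nat_def)

lemma evf_verticesf:
  assumes "env ws c \<sigma>"
  shows "evf verticesf ws \<sigma> \<longleftrightarrow>
     vertices (length ws - 1) (c 4) (zone ws c False) (mark ws (c 2)) (mark ws (c 3)) (zone ws c True)"
proof -
  let ?L = "length ws - 1" and ?Z = "zone ws c False"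
  note e = assms
  have parts: "evf (Ex 6 (And (zerof 6) (blockf False 6 5 7))) ws \<tau> \<longleftrightarrow> block ?Z 0 0 (\<tau> 5)"
    "evf (Ex 6 (And (Neg (zerof 6)) (lessf 7 6 5))) ws \<tau> \<longleftrightarrow> (\<exists>v<?L. v \<noteq> 0 \<and> v < \<tau> 5)"
    "evf (allf 6 (allf 7 (allf 8 (impf (And (blockf False 6 7 9) (And (Neg (zerof 6)) (Plus 6 8 7))) (lessf 9 8 5))))) ws \<tau> \<longleftrightarrow>
      (\<forall>q<?L. \<forall>p<?L. \<forall>v<?L. block ?Z 0 q p \<and> q \<noteq> 0 \<and> q + v = p \<longrightarrow> v < \<tau> 5)"
    "evf (Ex 7 (Ex 8 (And (blockf True 7 8 9) (Plus 7 6 8)))) ws \<tau> \<longleftrightarrow>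
      (\<exists>q<?L. \<exists>p<?L. block (zone ws c True) (c 4) q p \<and> q + \<tau> 6 = p)"
    if t: "env ws c \<tau>" for \<tau>
  proof -
    have L: "0 < ?L" using marked_length[OF ws] by simp
    show "evf (Ex 6 (And (zerof 6) (blockf False 6 5 7))) ws \<tau> \<longleftrightarrow> block ?Z 0 0 (\<tau> 5)"
      using t L by (simp add: macros cong: conj_cong del: One_nat_def)
    show "evf (Ex 6 (And (Neg (zerof 6)) (lessf 7 6 5))) ws \<tau> \<longleftrightarrow> (\<exists>v<?L. v \<noteq> 0 \<and> v < \<tau> 5)"
      using t by (simp add: macros cong: conj_cong del: One_nat_def)
    show "evf (allf 6 (allf 7 (allf 8 (impf (And (blockf False 6 7 9) (And (Neg (zerof 6)) (Plus 6 8 7))) (lessf 9 8 5))))) ws \<tau> \<longleftrightarrow>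
      (\<forall>q<?L. \<forall>p<?L. \<forall>v<?L. block ?Z 0 q p \<and> q \<noteq> 0 \<and> q + v = p \<longrightarrow> v < \<tau> 5)"
      using t by (simp add: macros cong: imp_cong del: One_nat_def)
    show "evf (Ex 7 (Ex 8 (And (blockf True 7 8 9) (Plus 7 6 8)))) ws \<tau> \<longleftrightarrow>
      (\<exists>q<?L. \<exists>p<?L. block (zone ws c True) (c 4) q p \<and> q + \<tau> 6 = p)"
      using t by (simp add: macros cong: conj_cong del: One_nat_def)
  qed
  have served: "evf (allf 6 (impf (And (Neg (zerof 6)) (lessf 7 6 5)) (And (Ex 7 (Ex 8 (And (blockf True 7 8 9) (Plus 7 6 8))))
          (And (oncef True False) (And (oncef False True) (oncef True True)))))) ws \<tau> \<longleftrightarrow>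
      (\<forall>v<?L. v \<noteq> 0 \<and> v < \<tau> 5 \<longrightarrow> (\<exists>q<?L. \<exists>p<?L. block (zone ws c True) (c 4) q p \<and> q + v = p) \<and>
        once ?L ?Z (mark ws (c 2)) (mark ws (c 3)) True False v \<and> once ?L ?Z (mark ws (c 2)) (mark ws (c 3)) False True v \<and>
        once ?L ?Z (mark ws (c 2)) (mark ws (c 3)) True True v)"
    if t: "env ws c \<tau>" for \<tau>
    unfolding evf_macros evf.simps(4)
  proof (intro all_cong1 imp_cong refl)
    fix v assume "v < ?L"
    then have t': "env ws c (\<tau>(6 := v))" using t by simp
    show "(evf (Neg (zerof 6)) ws (\<tau>(6 := v)) \<and> evf (lessf 7 6 5) ws (\<tau>(6 := v))) \<longleftrightarrow> v \<noteq> 0 \<and> v < \<tau> 5"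
      using t' by (simp add: macros)
    show "(evf (Ex 7 (Ex 8 (And (blockf True 7 8 9) (Plus 7 6 8)))) ws (\<tau>(6 := v)) \<and>
          evf (oncef True False) ws (\<tau>(6 := v)) \<and> evf (oncef False True) ws (\<tau>(6 := v)) \<and> evf (oncef True True) ws (\<tau>(6 := v))) \<longleftrightarrow>
       (\<exists>q<?L. \<exists>p<?L. block (zone ws c True) (c 4) q p \<and> q + v = p) \<and>
        once ?L ?Z (mark ws (c 2)) (mark ws (c 3)) True False v \<and> once ?L ?Z (mark ws (c 2)) (mark ws (c 3)) False True v \<and>
        once ?L ?Z (mark ws (c 2)) (mark ws (c 3)) True True v"
      unfolding parts(4)[OF t'] evf_oncef[OF t'] by simp
  qed
  have "evf verticesf ws \<sigma> \<longleftrightarrow> (\<exists>s<?L. evf (Ex 6 (And (zerof 6) (blockf False 6 5 7))) ws (\<sigma>(5 := s)) \<and>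
      evf (Ex 6 (And (Neg (zerof 6)) (lessf 7 6 5))) ws (\<sigma>(5 := s)) \<and>
      evf (allf 6 (allf 7 (allf 8 (impf (And (blockf False 6 7 9) (And (Neg (zerof 6)) (Plus 6 8 7))) (lessf 9 8 5))))) ws (\<sigma>(5 := s)) \<and>
      evf (allf 6 (impf (And (Neg (zerof 6)) (lessf 7 6 5)) (And (Ex 7 (Ex 8 (And (blockf True 7 8 9) (Plus 7 6 8))))
          (And (oncef True False) (And (oncef False True) (oncef True True)))))) ws (\<sigma>(5 := s)))"
    unfolding verticesf_def by (simp only: evf.simps(4,5))
  also have "\<dots> \<longleftrightarrow> vertices ?L (c 4) ?Z (mark ws (c 2)) (mark ws (c 3)) (zone ws c True)"
    unfolding vertices_def
  proof (rule ex_cong1, rule conj_cong[OF refl])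
    fix s assume "s < ?L"
    then have t: "env ws c (\<sigma>(5 := s))" using e by simp
    show "(evf (Ex 6 (And (zerof 6) (blockf False 6 5 7))) ws (\<sigma>(5 := s)) \<and>
      evf (Ex 6 (And (Neg (zerof 6)) (lessf 7 6 5))) ws (\<sigma>(5 := s)) \<and>
      evf (allf 6 (allf 7 (allf 8 (impf (And (blockf False 6 7 9) (And (Neg (zerof 6)) (Plus 6 8 7))) (lessf 9 8 5))))) ws (\<sigma>(5 := s)) \<and>
      evf (allf 6 (impf (And (Neg (zerof 6)) (lessf 7 6 5)) (And (Ex 7 (Ex 8 (And (blockf True 7 8 9) (Plus 7 6 8))))
          (And (oncef True False) (And (oncef False True) (oncef True True)))))) ws (\<sigma>(5 := s))) \<longleftrightarrow>
     block ?Z 0 0 s \<and> (\<exists>v<?L. v \<noteq> 0 \<and> v < s) \<and>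
     (\<forall>q<?L. \<forall>p<?L. \<forall>v<?L. block ?Z 0 q p \<and> q \<noteq> 0 \<and> q + v = p \<longrightarrow> v < s) \<and>
     (\<forall>v<?L. v \<noteq> 0 \<and> v < s \<longrightarrow> (\<exists>q<?L. \<exists>p<?L. block (zone ws c True) (c 4) q p \<and> q + v = p) \<and>
        once ?L ?Z (mark ws (c 2)) (mark ws (c 3)) True False v \<and> once ?L ?Z (mark ws (c 2)) (mark ws (c 3)) False True v \<and>
        once ?L ?Z (mark ws (c 2)) (mark ws (c 3)) True True v)"
      unfolding parts(1-3)[OF t] served[OF t] fun_upd_same by (rule refl)
  qed
  finally show ?thesis .
qed

lemma evf_joinedf:
  "env ws c \<sigma> \<Longrightarrow> evf joinedf ws \<sigma> \<longleftrightarrow>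
     joined (length ws - 1) (zone ws c False) (mark ws (c 0)) (\<sigma> 9) (\<sigma> 10)"
  unfolding joinedf_def joined_def by (simp add: macros cong: imp_cong conj_cong del: One_nat_def)

lemma evf_searchedf:
  "env ws c \<sigma> \<Longrightarrow> evf searchedf ws \<sigma> \<longleftrightarrow>
     searched (length ws - 1) (c 4) (zone ws c False) (mark ws (c 0)) (zone ws c True)"
  unfolding searchedf_def searched_def
  by (simp add: macros evf_joinedf env_const[of ws c] cong: imp_cong conj_cong del: One_nat_def)

lemma evf_certifiedf:
  "env ws c \<sigma> \<Longrightarrow> evf certifiedf ws \<sigma> \<longleftrightarrow> certified (length ws - 1) (c 1) (c 4)
     (zone ws c False) (mark ws (c 0)) (mark ws (c 2)) (mark ws (c 3)) (zone ws c True)"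
  unfolding certifiedf_def certified_def
  by (simp add: macros evf_alternatingf evf_verticesf evf_searchedf env_const[of ws c] del: One_nat_def)

end

lemma evf_verifierf:
  fixes n :: nat
  defines "c \<equiv> \<lambda>r. [n + 1, n, 2 * n + 1, 3 * n + 1, 4 * n + 1] ! r"
  assumes n: "n = length x" and ws: "ws = label x u"
  shows "evf verifierf ws (\<lambda>_. 0) \<longleftrightarrow> 4 * n + 1 < length ws - 1 \<and> certified (length ws - 1) n (4 * n + 1)
     (zone ws c False) (mark ws (n + 1)) (mark ws (2 * n + 1)) (mark ws (3 * n + 1)) (zone ws c True)"
proof -
  define L where "L = length ws - 1"
  have m: "marked ws" using ws marked_label by simp
  have 4: "ws ! i = 4 \<longleftrightarrow> i = n + 1" if "i < L" for i
  proof -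
    consider "i \<le> n" | "i = n + 1" | "n + 1 < i" by linarith
    then show ?thesis
    proof cases
      case 1
      then have "ws ! i \<in> {1, 2, 3}" by (cases i) (auto simp: ws n label_nth bitn_def)
      then show ?thesis using 1 by auto
    next
      case 2
      then show ?thesis using label_nth(3)[of x u] by (simp add: ws n)
    next
      case 3
      then have k: "i = n + 2 + (i - (n + 2))" by simp
      define k where "k = i - (n + 2)"
      have k: "i = n + 2 + k" using k by (simp only: k_def)
      then have "k < length u" using that by (simp add: L_def ws n)
      then have "ws ! i = bitn (u ! k)" using k by (simp add: ws label_def n nth_append)
      then show ?thesis using 3 by (simp add: bitn_def)
    qed
  qed
  let ?s = "(\<lambda>_. 0)(0 := n + 1, 1 := n, 2 := 2 * n + 1, 3 := 3 * n + 1, 4 := 4 * n + 1)"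
  have "evf verifierf ws (\<lambda>_. 0) \<longleftrightarrow> (\<exists>i0<L. i0 = n + 1 \<and> (\<exists>i1<L. Suc i1 = i0 \<and> (\<exists>i2<L. i0 + i1 = i2 \<and> (\<exists>i3<L. i1 + i2 = i3 \<and>
      (\<exists>i4<L. i1 + i3 = i4 \<and> evf certifiedf ws ((\<lambda>_. 0)(0 := i0, 1 := i1, 2 := i2, 3 := i3, 4 := i4)))))))"
    unfolding verifierf_def evf.simps L_def[symmetric] using m by (simp add: 4 L_def[symmetric] cong: conj_cong del: One_nat_def)
  also have "\<dots> \<longleftrightarrow> 4 * n + 1 < L \<and> evf certifiedf ws ?s"
  proof
    assume h: "4 * n + 1 < L \<and> evf certifiedf ws ?s"
    show "\<exists>i0<L. i0 = n + 1 \<and> (\<exists>i1<L. Suc i1 = i0 \<and> (\<exists>i2<L. i0 + i1 = i2 \<and> (\<exists>i3<L. i1 + i2 = i3 \<and>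
      (\<exists>i4<L. i1 + i3 = i4 \<and> evf certifiedf ws ((\<lambda>_. 0)(0 := i0, 1 := i1, 2 := i2, 3 := i3, 4 := i4))))))"
      by (rule exI[of _ "n + 1"], rule conjI, use h in simp, rule conjI, rule refl,
          rule exI[of _ n], rule conjI, use h in simp, rule conjI, simp,
          rule exI[of _ "2 * n + 1"], rule conjI, use h in simp, rule conjI, simp,
          rule exI[of _ "3 * n + 1"], rule conjI, use h in simp, rule conjI, simp,
          rule exI[of _ "4 * n + 1"]) (use h in simp)
  next
    assume "\<exists>i0<L. i0 = n + 1 \<and> (\<exists>i1<L. Suc i1 = i0 \<and> (\<exists>i2<L. i0 + i1 = i2 \<and> (\<exists>i3<L. i1 + i2 = i3 \<and>
      (\<exists>i4<L. i1 + i3 = i4 \<and> evf certifiedf ws ((\<lambda>_. 0)(0 := i0, 1 := i1, 2 := i2, 3 := i3, 4 := i4))))))"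
    then obtain i0 i1 i2 i3 i4 where i: "i0 = n + 1" "Suc i1 = i0" "i0 + i1 = i2" "i1 + i2 = i3" "i1 + i3 = i4" "i4 < L"
      and e: "evf certifiedf ws ((\<lambda>_. 0)(0 := i0, 1 := i1, 2 := i2, 3 := i3, 4 := i4))" by blast
    have "i1 = n" "i2 = 2 * n + 1" "i3 = 3 * n + 1" "i4 = 4 * n + 1" using i(1-5) by linarith+
    then show "4 * n + 1 < L \<and> evf certifiedf ws ?s" using e i(1,6) by simp
  qed
  also have "\<dots> \<longleftrightarrow> 4 * n + 1 < L \<and> certified L n (4 * n + 1)
     (zone ws c False) (mark ws (n + 1)) (mark ws (2 * n + 1)) (mark ws (3 * n + 1)) (zone ws c True)"
  proof (rule conj_cong[OF refl])
    assume "4 * n + 1 < L"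
    then have "env ws c ?s"
      unfolding env_def L_def[symmetric] by (auto simp: c_def less_Suc_eq numeral_eq_Suc)
    moreover have "c 0 = n + 1" "c 1 = n" "c 2 = 2 * n + 1" "c 3 = 3 * n + 1" "c 4 = 4 * n + 1"
      by (simp_all add: c_def)
    ultimately show "evf certifiedf ws ?s \<longleftrightarrow> certified L n (4 * n + 1)
     (zone ws c False) (mark ws (n + 1)) (mark ws (2 * n + 1)) (mark ws (3 * n + 1)) (zone ws c True)"
      using evf_certifiedf[OF m] by (simp add: L_def)
  qed
  finally show ?thesis unfolding L_def .
qed

subsection \<open>Certificates and colourings\<close>

lemma block_end_le: "i \<le> j \<Longrightarrow> j \<le> length ns \<Longrightarrow> block_end ns i \<le> block_end ns j"
  using block_end_mono[of i j ns] by (cases "i = j") auto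

lemma adjacent_sym: "(u, v) \<in> adjacent es \<Longrightarrow> (v, u) \<in> adjacent es"
  by (auto simp: adjacent_def)

lemma ex1_iff_not_two: "(\<exists>!k::nat. P k) \<longleftrightarrow> (\<exists>k. P k) \<and> \<not> (\<exists>k l. P k \<and> P l \<and> k < l)"
proof
  assume h: "(\<exists>k. P k) \<and> \<not> (\<exists>k l. P k \<and> P l \<and> k < l)"
  then obtain k where k: "P k" by blast
  show "\<exists>!k. P k"
  proof (rule ex1I[of _ k], rule k)
    fix l assume "P l"
    then show "l = k" using h k by (cases l k rule: linorder_cases) auto
  qed
qed (auto dest: less_not_refl2)

context
  fixes ns :: "nat list" and nv :: nat and es :: "(nat \<times> nat) list" and Z :: "nat \<Rightarrow> bool" and L :: nat
  assumes ns: "ns = nv # flat_pairs es"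
    and Z: "\<And>p. Z p \<longleftrightarrow> (\<exists>i<length ns. p = block_end ns (Suc i))"
    and L: "block_end ns (length ns) < L"
begin

private abbreviation ends :: "nat \<Rightarrow> nat" where "ends \<equiv> block_end ns"

lemma block_iff0: "block Z 0 q p \<longleftrightarrow> (\<exists>i<length ns. q = ends i \<and> p = ends (Suc i))"
  using block_iff[of Z ns 0] Z by simp

lemma ends_lt: "i \<le> length ns \<Longrightarrow> ends i < L"
  using block_end_le[of i "length ns" ns] L by simp

lemma ends_0: "i \<le> length ns \<Longrightarrow> ends i = 0 \<longleftrightarrow> i = 0"
  using block_end_inj[of i ns 0] by simp

lemma length_ns: "length ns = Suc (2 * length es)"
  by (simp add: ns)

lemma dart_block: "block Z 0 q p \<and> q \<noteq> 0 \<longleftrightarrow> (\<exists>k<2 * length es. q = ends (Suc k) \<and> p = ends (Suc (Suc k)))"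
proof
  assume "block Z 0 q p \<and> q \<noteq> 0"
  then obtain i where i: "i < length ns" "q = ends i" "p = ends (Suc i)" "q \<noteq> 0" using block_iff0 by blast
  then obtain k where "i = Suc k" by (cases i) simp_all
  then show "\<exists>k<2 * length es. q = ends (Suc k) \<and> p = ends (Suc (Suc k))"
    using i length_ns by (intro exI[of _ k]) simp
next
  assume "\<exists>k<2 * length es. q = ends (Suc k) \<and> p = ends (Suc (Suc k))"
  then obtain k where k: "k < 2 * length es" "q = ends (Suc k)" "p = ends (Suc (Suc k))" by blast
  then have "Suc k < length ns" using length_ns by simp
  then show "block Z 0 q p \<and> q \<noteq> 0" using k block_iff0 ends_0[of "Suc k"] by auto
qed

lemma dart_value: "k < 2 * length es \<Longrightarrow> ends (Suc (Suc k)) = ends (Suc k) + Suc (flat_pairs es ! k)"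
  using block_end_Suc[of "Suc k" ns] length_ns by (simp add: ns)

lemma once_iff: "once L Z B C f g (Suc v) \<longleftrightarrow> (\<exists>!k. k < 2 * length es \<and> flat_pairs es ! k = v \<and>
    f = B (ends (Suc (Suc k))) \<and> g = C (ends (Suc (Suc k))))" (is "_ \<longleftrightarrow> (\<exists>!k. ?P k)")
proof -
  have c: "coloured Z B C f g (Suc v) q p \<longleftrightarrow> (\<exists>k. ?P k \<and> q = ends (Suc k) \<and> p = ends (Suc (Suc k)))" for q p
  proof -
    have "coloured Z B C f g (Suc v) q p \<longleftrightarrow> (block Z 0 q p \<and> q \<noteq> 0) \<and> q + Suc v = p \<and> f = B p \<and> g = C p"
      by (auto simp: coloured_def)
    also have "\<dots> \<longleftrightarrow> (\<exists>k. ?P k \<and> q = ends (Suc k) \<and> p = ends (Suc (Suc k)))"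
      unfolding dart_block using dart_value by auto
    finally show ?thesis .
  qed
  have lt: "ends (Suc k) < L" "ends (Suc (Suc k)) < L" if "?P k" for k
    using that ends_lt[of "Suc k"] ends_lt[of "Suc (Suc k)"] length_ns by auto
  have ex: "(\<exists>q<L. \<exists>p<L. coloured Z B C f g (Suc v) q p) \<longleftrightarrow> (\<exists>k. ?P k)"
    unfolding c using lt by blast
  have two: "(\<exists>q<L. \<exists>p<L. \<exists>q'<L. \<exists>p'<L. coloured Z B C f g (Suc v) q p \<and> coloured Z B C f g (Suc v) q' p' \<and> p < p') \<longleftrightarrow>
      (\<exists>k l. ?P k \<and> ?P l \<and> ends (Suc (Suc k)) < ends (Suc (Suc l)))" (is "?l \<longleftrightarrow> ?r")
  proof
    assume ?l
    then obtain q p q' p' where "coloured Z B C f g (Suc v) q p" "coloured Z B C f g (Suc v) q' p'" "p < p'" by blast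
    then show ?r unfolding c by (elim exE conjE) (intro exI conjI, assumption+, simp)
  next
    assume ?r
    then obtain k l where kl: "?P k" "?P l" "ends (Suc (Suc k)) < ends (Suc (Suc l))" by blast
    have "coloured Z B C f g (Suc v) (ends (Suc k)) (ends (Suc (Suc k)))"
      "coloured Z B C f g (Suc v) (ends (Suc l)) (ends (Suc (Suc l)))"
      unfolding c using kl(1,2) by blast+
    then show ?l using lt[OF kl(1)] lt[OF kl(2)] kl(3) by blast
  qed
  have "ends (Suc (Suc k)) < ends (Suc (Suc l)) \<longleftrightarrow> k < l" if "?P k" "?P l" for k l
  proof -
    have "Suc (Suc k) \<le> length ns" "Suc (Suc l) \<le> length ns" using that length_ns by auto
    then show ?thesis using block_end_mono[of "Suc (Suc k)" "Suc (Suc l)" ns] block_end_le[of "Suc (Suc l)" "Suc (Suc k)" ns]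
      by (cases "k < l") auto
  qed
  then have "(\<exists>k l. ?P k \<and> ?P l \<and> ends (Suc (Suc k)) < ends (Suc (Suc l))) \<longleftrightarrow> (\<exists>k l. ?P k \<and> ?P l \<and> k < l)"
    by blast
  then have "once L Z B C f g (Suc v) \<longleftrightarrow> (\<exists>k. ?P k) \<and> \<not> (\<exists>k l. ?P k \<and> ?P l \<and> k < l)"
    unfolding once_def ex two by simp
  also have "\<dots> \<longleftrightarrow> (\<exists>!k. ?P k)" by (rule ex1_iff_not_two[symmetric])
  finally show ?thesis .
qed

lemma joined_iff:
  assumes M: "\<And>i. i < length ns \<Longrightarrow> M (ends (Suc i)) \<longleftrightarrow> even i"
  shows "joined L Z M (Suc v) (Suc w) \<longleftrightarrow> (v, w) \<in> adjacent es"
proof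
  assume "joined L Z M (Suc v) (Suc w)"
  then obtain a c d where h: "block Z 0 a c \<and> a \<noteq> 0" "block Z 0 c d" "M d"
    "a + Suc v = c \<and> c + Suc w = d \<or> a + Suc w = c \<and> c + Suc v = d" by (auto simp: joined_def)
  obtain k where k: "k < 2 * length es" "a = ends (Suc k)" "c = ends (Suc (Suc k))" using h(1) dart_block by blast
  obtain i where i: "i < length ns" "c = ends i" "d = ends (Suc i)" using h(2) block_iff0 by blast
  have "Suc (Suc k) \<le> length ns" using k(1) length_ns by simp
  then have i2: "i = Suc (Suc k)" using block_end_inj[of "Suc (Suc k)" ns i] i k(3) by simp
  then have "even k" using M[OF i(1)] h(3) i(3) by simp
  then obtain e where e: "k = 2 * e" by (elim evenE)
  have el: "e < length es" and k1: "Suc k < 2 * length es" using i(1) i2 length_ns e by simp_all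
  have "c = a + Suc (fst (es ! e))" "d = c + Suc (snd (es ! e))"
    using dart_value[OF k(1)] dart_value[OF k1] flat_pairs_nth[OF el] k i i2 e by simp_all
  then have "es ! e = (v, w) \<or> es ! e = (w, v)" using h(4) by (auto simp: prod_eq_iff)
  moreover have "es ! e \<in> set es" using el by simp
  ultimately show "(v, w) \<in> adjacent es" by (auto simp: adjacent_def)
next
  assume "(v, w) \<in> adjacent es"
  then have "(v, w) \<in> set es \<or> (w, v) \<in> set es" by (auto simp: adjacent_def)
  then obtain e where e: "e < length es" "es ! e = (v, w) \<or> es ! e = (w, v)" by (metis in_set_conv_nth)
  have k: "2 * e < 2 * length es" "Suc (2 * e) < 2 * length es" using e(1) by simp_all
  let ?a = "ends (Suc (2 * e))" and ?c = "ends (Suc (Suc (2 * e)))" and ?d = "ends (Suc (Suc (Suc (2 * e))))"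
  have "block Z 0 ?a ?c \<and> ?a \<noteq> 0" using k(1) dart_block by blast
  moreover have "block Z 0 ?c ?d \<and> ?c \<noteq> 0" using k(2) dart_block by blast
  moreover have "M ?d" using M[of "Suc (Suc (2 * e))"] k length_ns by simp
  moreover have "?a < L" "?c < L" "?d < L" using ends_lt k length_ns by simp_all
  moreover have "?a + Suc v = ?c \<and> ?c + Suc w = ?d \<or> ?a + Suc w = ?c \<and> ?c + Suc v = ?d"
    using dart_value[OF k(1)] dart_value[OF k(2)] flat_pairs_nth[OF e(1)] e(2) by auto
  ultimately show "joined L Z M (Suc v) (Suc w)" unfolding joined_def by blast
qed

lemma vertices_iff:
  "vertices L b Z B C Y \<longleftrightarrow> 0 < nv \<and> (\<forall>w\<in>set (flat_pairs es). w < nv) \<and>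
     (\<forall>v<nv. (\<exists>q<L. \<exists>p<L. block Y b q p \<and> q + Suc v = p) \<and>
        once L Z B C True False (Suc v) \<and> once L Z B C False True (Suc v) \<and> once L Z B C True True (Suc v))"
proof -
  have e1: "ends (Suc 0) = Suc nv" by (simp add: ns)
  have s: "s < L \<and> block Z 0 0 s \<longleftrightarrow> s = Suc nv" for s
  proof
    assume "s < L \<and> block Z 0 0 s"
    then obtain i where "i < length ns" "0 = ends i" "s = ends (Suc i)" using block_iff0 by blast
    then show "s = Suc nv" using ends_0[of i] e1 by simp
  next
    assume "s = Suc nv"
    then show "s < L \<and> block Z 0 0 s" using block_iff0 e1 ends_lt[of "Suc 0"] length_ns by (auto intro!: exI[of _ 0])
  qed
  have nvL: "Suc nv < L" using s by blast
  have b1: "(\<exists>v<L. v \<noteq> 0 \<and> v < Suc nv) \<longleftrightarrow> 0 < nv" using nvL by (auto intro!: exI[of _ 1])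
  have b2: "(\<forall>q<L. \<forall>p<L. \<forall>v<L. block Z 0 q p \<and> q \<noteq> 0 \<and> q + v = p \<longrightarrow> v < Suc nv) \<longleftrightarrow>
      (\<forall>w\<in>set (flat_pairs es). w < nv)"
  proof
    assume h: "\<forall>q<L. \<forall>p<L. \<forall>v<L. block Z 0 q p \<and> q \<noteq> 0 \<and> q + v = p \<longrightarrow> v < Suc nv"
    show "\<forall>w\<in>set (flat_pairs es). w < nv"
    proof
      fix w assume "w \<in> set (flat_pairs es)"
      then obtain k where k: "k < 2 * length es" "flat_pairs es ! k = w" by (metis in_set_conv_nth length_flat_pairs)
      have p: "ends (Suc (Suc k)) < L" using ends_lt[of "Suc (Suc k)"] k(1) length_ns by simp
      have "block Z 0 (ends (Suc k)) (ends (Suc (Suc k))) \<and> ends (Suc k) \<noteq> 0" using dart_block k(1) by blast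
      then show "w < nv" using h[rule_format, of "ends (Suc k)" "ends (Suc (Suc k))" "Suc w"] p dart_value[OF k(1)] k(2) by simp
    qed
  next
    assume h: "\<forall>w\<in>set (flat_pairs es). w < nv"
    show "\<forall>q<L. \<forall>p<L. \<forall>v<L. block Z 0 q p \<and> q \<noteq> 0 \<and> q + v = p \<longrightarrow> v < Suc nv"
    proof (intro allI impI)
      fix q p v assume "block Z 0 q p \<and> q \<noteq> 0 \<and> q + v = p"
      then obtain k where k: "k < 2 * length es" "q = ends (Suc k)" "p = ends (Suc (Suc k))" "q + v = p"
        using dart_block by blast
      have "flat_pairs es ! k < nv" using h k(1) by simp
      then show "v < Suc nv" using k dart_value[OF k(1)] by simp
    qed
  qed
  have b3: "(\<forall>v<L. v \<noteq> 0 \<and> v < Suc nv \<longrightarrow> Q v) \<longleftrightarrow> (\<forall>v<nv. Q (Suc v))" for Q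
    using nvL by (auto simp: gr0_conv_Suc)
  have "vertices L b Z B C Y \<longleftrightarrow> (\<exists>s. (s < L \<and> block Z 0 0 s) \<and> (\<exists>v<L. v \<noteq> 0 \<and> v < s) \<and>
     (\<forall>q<L. \<forall>p<L. \<forall>v<L. block Z 0 q p \<and> q \<noteq> 0 \<and> q + v = p \<longrightarrow> v < s) \<and>
     (\<forall>v<L. v \<noteq> 0 \<and> v < s \<longrightarrow> (\<exists>q<L. \<exists>p<L. block Y b q p \<and> q + v = p) \<and>
        once L Z B C True False v \<and> once L Z B C False True v \<and> once L Z B C True True v))"
    unfolding vertices_def by blast
  then show ?thesis unfolding s simp_thms by (simp only: b1 b2 b3)
qed

end

text \<open>Inverse to the coding by the bits "colour is not 1" and "colour is not 0". Two clear
  bits, sent to 1 here, are excluded by \<open>alternating\<close>.\<close>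

definition colour_code :: "bool \<Rightarrow> bool \<Rightarrow> nat" where
  "colour_code f g = (if f then if g then 2 else 0 else 1)"

text \<open>The mark at the last end makes the number of blocks odd, so the word is a number
  followed by pairs. \<open>vertices\<close> then yields the range of the ends, the degrees and the
  colouring, and following the list backwards connects every vertex to the first one.\<close>

lemma certified_sound:
  assumes Z: "\<And>p. Z p \<longleftrightarrow> (\<exists>i<length ns. p = block_end ns (Suc i))" and N: "N = block_end ns (length ns)" "N < L"
    and Yb: "\<And>q. Y q \<Longrightarrow> b < q" and cert: "certified L N b Z M B C Y"
  shows "\<exists>nv es. ns = nv # flat_pairs es \<and> 0 < nv \<and> (\<forall>w\<in>set (flat_pairs es). w < nv) \<and>
     (\<forall>u<nv. \<forall>v<nv. (u, v) \<in> (adjacent es)\<^sup>*) \<and> (\<exists>col. perfect nv (flat_pairs es) col)"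
proof -
  let ?e = "block_end ns"
  have cs: "Z N" "M N" "alternating L Z M B C" "vertices L b Z B C Y" "searched L b Z M Y"
    using cert by (simp_all add: certified_def)
  have lt: "?e i < L" if "i \<le> length ns" for i using block_end_le[of i "length ns" ns] that N by simp
  have alt: "(i = 0 \<longrightarrow> M (?e (Suc i))) \<and> (i \<noteq> 0 \<longrightarrow> (M (?e (Suc i)) \<longleftrightarrow> \<not> M (?e i)) \<and> (B (?e (Suc i)) \<or> C (?e (Suc i))) \<and>
      (M (?e (Suc i)) \<longrightarrow> (B (?e i) \<longleftrightarrow> B (?e (Suc i))) \<and> (C (?e i) \<longleftrightarrow> C (?e (Suc i)))))" if i: "i < length ns" for i
  proof -
    have "block Z 0 (?e i) (?e (Suc i))" using block_iff[of Z ns 0] Z i by auto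
    moreover have "?e i = 0 \<longleftrightarrow> i = 0" using block_end_inj[of i ns 0] i by simp
    ultimately show ?thesis
      using cs(3)[unfolded alternating_def, rule_format, of "?e i" "?e (Suc i)"] lt[of i] lt[of "Suc i"] i by simp
  qed
  have M: "M (?e (Suc i)) \<longleftrightarrow> even i" if "i < length ns" for i
    using that
  proof (induction i)
    case (Suc i)
    then show ?case using alt[of "Suc i"] by simp
  qed (use alt[of 0] in simp)
  obtain i where i: "i < length ns" "N = ?e (Suc i)" using cs(1) Z by blast
  then have "length ns = Suc i" using block_end_inj[of "length ns" ns "Suc i"] N by simp
  moreover have "even i" using M[OF i(1)] i(2) cs(2) by simp
  ultimately obtain nv ds where ds: "ns = nv # ds" "even (length ds)" by (cases ns) auto
  then obtain es where es: "ds = flat_pairs es" using flat_pairs_surj by blast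
  have ns: "ns = nv # flat_pairs es" using ds es by simp
  have L: "?e (length ns) < L" using N by simp
  note len = length_ns[OF ns Z L]
  define P where "P k = ?e (Suc (Suc k))" for k
  have vs: "0 < nv" "\<forall>w\<in>set (flat_pairs es). w < nv"
    "\<And>v. v < nv \<Longrightarrow> \<exists>q<L. \<exists>p<L. block Y b q p \<and> q + Suc v = p"
    "\<And>v f g. v < nv \<Longrightarrow> f \<or> g \<Longrightarrow> \<exists>!k. k < 2 * length es \<and> flat_pairs es ! k = v \<and> f = B (P k) \<and> g = C (P k)"
  proof -
    note V = cs(4)[unfolded vertices_iff[OF ns Z L] once_iff[OF ns Z L] P_def[symmetric]]
    show "0 < nv" "\<forall>w\<in>set (flat_pairs es). w < nv" using V by blast+
    show "\<exists>q<L. \<exists>p<L. block Y b q p \<and> q + Suc v = p" if "v < nv" for v using V that by blast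
    show "\<exists>!k. k < 2 * length es \<and> flat_pairs es ! k = v \<and> f = B (P k) \<and> g = C (P k)" if "v < nv" "f \<or> g" for v f g
      using V that by (cases f; cases g) simp_all
  qed
  define col where "col e = colour_code (B (P (2 * e))) (C (P (2 * e)))" for e
  have bits: "B (P k) \<or> C (P k)" "col (k div 2) = colour_code (B (P k)) (C (P k))" if k: "k < 2 * length es" for k
  proof -
    have a: "Suc k < length ns" using k len by simp
    show "B (P k) \<or> C (P k)" using alt[OF a] by (simp add: P_def)
    show "col (k div 2) = colour_code (B (P k)) (C (P k))"
    proof (cases "even k")
      case False
      then obtain e where e: "k = Suc (2 * e)" by (metis oddE Suc_eq_plus1)
      have "M (?e (Suc (Suc k)))" using M[OF a] False by simp
      then have "B (P (2 * e)) = B (P k)" "C (P (2 * e)) = C (P k)" using alt[OF a] e by (simp_all add: P_def)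
      then show ?thesis using e by (simp add: col_def)
    qed (auto simp: col_def)
  qed
  have "perfect nv (flat_pairs es) col"
    unfolding perfect_def length_flat_pairs
  proof (intro conjI allI impI)
    fix k assume "k < 2 * length es"
    then show "col (k div 2) < 3" by (simp add: bits(2) colour_code_def)
  next
    fix v c :: nat assume v: "v < nv" and c: "c < 3"
    have "c = 0 \<or> c = 1 \<or> c = 2" using c by auto
    define f where "f = (c \<noteq> 1)"
    define g where "g = (c \<noteq> 0)"
    have fg1: "f \<or> g" by (auto simp: f_def g_def)
    have fg3: "colour_code f' g' = c \<longleftrightarrow> f = f' \<and> g = g'" if "f' \<or> g'" for f' g'
      using that \<open>c = 0 \<or> c = 1 \<or> c = 2\<close> by (cases f'; cases g') (auto simp: f_def g_def colour_code_def)
    have "k < 2 * length es \<and> flat_pairs es ! k = v \<and> col (k div 2) = c \<longleftrightarrow>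
        k < 2 * length es \<and> flat_pairs es ! k = v \<and> f = B (P k) \<and> g = C (P k)" for k
      using bits[of k] fg3[of "B (P k)" "C (P k)"] by auto
    then show "\<exists>!k. k < 2 * length es \<and> flat_pairs es ! k = v \<and> col (k div 2) = c"
      using vs(4)[OF v fg1] by simp
  qed
  moreover have "(u, v) \<in> (adjacent es)\<^sup>*" if u: "u < nv" and v: "v < nv" for u v
  proof -
    \<comment> \<open>The vertex of the first block of the list. A joined earlier block ends at or
      before the start of the present one, hence the induction on the end \<open>p\<close>.\<close>
    define t where "t = (SOME p. block Y b b p) - b - 1"
    have "block Y b q p \<Longrightarrow> p < L \<Longrightarrow> q + Suc w = p \<Longrightarrow> (t, w) \<in> (adjacent es)\<^sup>*" for q p w
    proof (induction p arbitrary: q w rule: less_induct)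
      case (less p)
      show ?case
      proof (cases "q = b")
        case True
        have "p' = p" if "block Y b b p'" for p'
          using that less.prems(1) True by (metis block_def linorder_neqE_nat)
        then have "(SOME p. block Y b b p) = p" using less.prems(1) True by (metis someI)
        then have "t = w" using less.prems(3) True by (simp add: t_def)
        then show ?thesis by simp
      next
        case False
        then have "b < q \<and> q < p" using less.prems(1) Yb by (auto simp: block_def)
        then obtain q' p' x y where h: "block Y b q' p'" "p' < L" "\<not> q < p'" "q + x = p" "q' + y = p'" "joined L Z M x y"
          using cs(5)[unfolded searched_def, rule_format, of q p] less.prems(1,2) by fastforce
        have "q' < p'" using h(1) by (simp add: block_def)
        then obtain y' where y': "y = Suc y'" using h(5) by (cases y) auto
        have "x = Suc w" using h(4) less.prems(3) by simp
        then have "(w, y') \<in> adjacent es" using h(6) joined_iff[OF ns Z L M] y' by simp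
        moreover have "(t, y') \<in> (adjacent es)\<^sup>*"
          using less.IH[of p' q' y'] h y' \<open>b < q \<and> q < p\<close> by simp
        ultimately show ?thesis using adjacent_sym by (meson rtrancl.rtrancl_into_rtrancl)
      qed
    qed
    then have t: "(t, w) \<in> (adjacent es)\<^sup>*" if "w < nv" for w using vs(3)[OF that] by blast
    have "sym (adjacent es)" by (auto intro: symI adjacent_sym)
    then have "(u, t) \<in> (adjacent es)\<^sup>*" using t[OF u] sym_rtrancl symD by metis
    then show ?thesis using t[OF v] by (rule rtrancl_trans)
  qed
  ultimately show ?thesis using ns vs(1,2) by blast
qed

lemma certified_complete:
  assumes ns: "ns = nv # flat_pairs es" and Z: "\<And>p. Z p \<longleftrightarrow> (\<exists>i<length ns. p = block_end ns (Suc i))"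
    and N: "N = block_end ns (length ns)" "N < L"
    and M: "\<And>i. i < length ns \<Longrightarrow> M (block_end ns (Suc i)) \<longleftrightarrow> even i"
    and B: "\<And>k. k < 2 * length es \<Longrightarrow> B (block_end ns (Suc (Suc k))) \<longleftrightarrow> col (k div 2) \<noteq> 1"
    and C: "\<And>k. k < 2 * length es \<Longrightarrow> C (block_end ns (Suc (Suc k))) \<longleftrightarrow> col (k div 2) \<noteq> 0"
    and Y: "\<And>p. Y p \<longleftrightarrow> (\<exists>i<length vs. p = b + block_end vs (Suc i))" and bL: "b + block_end vs (length vs) < L"
    and vs: "length vs = nv" "set vs = {..<nv}" "\<And>i. 0 < i \<Longrightarrow> i < nv \<Longrightarrow> \<exists>j<i. (vs ! j, vs ! i) \<in> adjacent es"
    and nv: "0 < nv" "\<forall>w\<in>set (flat_pairs es). w < nv" and col: "perfect nv (flat_pairs es) col"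
  shows "certified L N b Z M B C Y"
proof -
  let ?e = "block_end ns" and ?v = "\<lambda>i. b + block_end vs i"
  have L: "?e (length ns) < L" using N by simp
  note len = length_ns[OF ns Z L]
  have Yb: "block Y b q p \<longleftrightarrow> (\<exists>i<nv. q = ?v i \<and> p = ?v (Suc i))" for q p
    using block_iff[of Y vs b] Y vs(1) by simp
  have vL: "?v i < L" if "i \<le> nv" for i using block_end_le[of i "length vs" vs] that vs(1) bL by simp
  have vSuc: "?v (Suc i) = ?v i + Suc (vs ! i)" if "i < nv" for i using block_end_Suc[of i vs] that vs(1) by simp
  have "Z N" using Z N(1) len by auto
  moreover have "M N" using M[of "length ns - 1"] N(1) len by simp
  moreover have "alternating L Z M B C"
    unfolding alternating_def
  proof (intro allI impI)
    fix q p assume "block Z 0 q p"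
    then obtain i where i: "i < length ns" "q = ?e i" "p = ?e (Suc i)" using block_iff0[OF ns Z L] by blast
    show "(q = 0 \<longrightarrow> M p) \<and> (q \<noteq> 0 \<longrightarrow> (M p \<longleftrightarrow> \<not> M q) \<and> (B p \<or> C p) \<and> (M p \<longrightarrow> (B q \<longleftrightarrow> B p) \<and> (C q \<longleftrightarrow> C p)))"
    proof (cases i)
      case 0
      then show ?thesis using i M[of 0] by simp
    next
      case (Suc k)
      have k: "k < 2 * length es" using i(1) Suc len by simp
      have m: "M p \<longleftrightarrow> odd k" "M q \<longleftrightarrow> even k" using i Suc M[of k] M[of i] by simp_all
      have bc: "B p \<longleftrightarrow> col (k div 2) \<noteq> 1" "C p \<longleftrightarrow> col (k div 2) \<noteq> 0" using B[OF k] C[OF k] i Suc by simp_all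
      have "B q \<longleftrightarrow> B p" "C q \<longleftrightarrow> C p" if o: "odd k"
      proof -
        obtain l where l: "k = Suc (2 * l)" using o by (metis oddE Suc_eq_plus1)
        have "2 * l < 2 * length es" using k l by simp
        from B[OF this] C[OF this] show "B q \<longleftrightarrow> B p" "C q \<longleftrightarrow> C p" unfolding bc using i(2) Suc l by simp_all
      qed
      moreover have "q \<noteq> 0" using ends_0[OF ns Z L, of i] i Suc by simp
      ultimately show ?thesis using m bc by auto
    qed
  qed
  moreover have "vertices L b Z B C Y"
    unfolding vertices_iff[OF ns Z L]
  proof (intro conjI allI impI)
    fix v assume v: "v < nv"
    then obtain i where i: "i < nv" "vs ! i = v" using vs(1,2) by (metis in_set_conv_nth lessThan_iff)
    show "\<exists>q<L. \<exists>p<L. block Y b q p \<and> q + Suc v = p"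
    proof (intro exI conjI)
      show "?v i < L" "?v (Suc i) < L" using vL i(1) by simp_all
      show "block Y b (?v i) (?v (Suc i))" using Yb i(1) by blast
      show "?v i + Suc v = ?v (Suc i)" using vSuc[OF i(1)] i(2) by simp
    qed
    have "once L Z B C f g (Suc v)" if "f \<or> g" for f g
    proof -
      have "colour_code f g < 3" by (simp add: colour_code_def)
      then have u: "\<exists>!k. k < 2 * length es \<and> flat_pairs es ! k = v \<and> col (k div 2) = colour_code f g"
        using col v unfolding perfect_def length_flat_pairs by blast
      have "k < 2 * length es \<and> flat_pairs es ! k = v \<and> col (k div 2) = colour_code f g \<longleftrightarrow>
         k < 2 * length es \<and> flat_pairs es ! k = v \<and> f = B (?e (Suc (Suc k))) \<and> g = C (?e (Suc (Suc k)))" for k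
      proof (cases "k < 2 * length es")
        case True
        then have "col (k div 2) < 3" using col by (simp add: perfect_def)
        then have "col (k div 2) = colour_code f g \<longleftrightarrow> f = (col (k div 2) \<noteq> 1) \<and> g = (col (k div 2) \<noteq> 0)"
          using that by (auto simp: colour_code_def)
        then show ?thesis using B[OF True] C[OF True] by simp
      qed simp
      then show ?thesis using u unfolding once_iff[OF ns Z L] by simp
    qed
    then show "once L Z B C True False (Suc v)" "once L Z B C False True (Suc v)" "once L Z B C True True (Suc v)"
      by simp_all
  qed (use nv in auto)
  moreover have "searched L b Z M Y"
    unfolding searched_def
  proof (intro allI impI)
    fix q p assume qp: "block Y b q p \<and> b < q"
    then obtain i where i: "i < nv" "q = ?v i" "p = ?v (Suc i)" using Yb by blast
    have "0 < i" using qp i(2) by (cases i) auto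
    then obtain j where j: "j < i" "(vs ! j, vs ! i) \<in> adjacent es" using vs(3) i(1) by blast
    have jn: "j < nv" using j i by simp
    show "\<exists>q'<L. \<exists>p'<L. block Y b q' p' \<and> \<not> q < p' \<and> (\<exists>v<L. \<exists>w<L. q + v = p \<and> q' + w = p' \<and> joined L Z M v w)"
    proof (intro exI conjI)
      show "?v j < L" "?v (Suc j) < L" using vL jn by simp_all
      show "block Y b (?v j) (?v (Suc j))" using Yb jn by blast
      show "\<not> q < ?v (Suc j)" using block_end_le[of "Suc j" i vs] j i vs(1) by simp
      show "q + Suc (vs ! i) = p" "?v j + Suc (vs ! j) = ?v (Suc j)" using vSuc i jn by simp_all
      show "Suc (vs ! i) < L" "Suc (vs ! j) < L" using vSuc[OF i(1)] vSuc[OF jn] vL[of "Suc i"] vL[of "Suc j"] i jn by simp_all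
      show "joined L Z M (Suc (vs ! i)) (Suc (vs ! j))" using joined_iff[OF ns Z L M] adjacent_sym[OF j(2)] by simp
    qed
  qed
  ultimately show ?thesis by (simp add: certified_def)
qed

subsection \<open>Membership in NP\<close>

lemma label_nth_right: "j < length u \<Longrightarrow> label x u ! (length x + 2 + j) = bitn (u ! j)"
  by (simp add: label_def nth_append)

lemma zone_input:
  assumes x: "x = concat (map unary ns)" and c: "c 0 = length x + 1"
  shows "zone (label x u) c False p \<longleftrightarrow> (\<exists>i<length ns. p = block_end ns (Suc i))"
proof -
  have "zone (label x u) c False p \<longleftrightarrow> (\<exists>k<length x. p = Suc k \<and> \<not> x ! k)"
    using c label_nth(1)[of x u] label_nth(2)[of _ x u] by (cases p) (auto simp: zone_def bitn_def)
  also have "\<dots> \<longleftrightarrow> (\<exists>i<length ns. p = block_end ns (Suc i))"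
  proof
    assume "\<exists>k<length x. p = Suc k \<and> \<not> x ! k"
    then show "\<exists>i<length ns. p = block_end ns (Suc i)" using concat_unary_nth[of _ ns] x by blast
  next
    assume "\<exists>i<length ns. p = block_end ns (Suc i)"
    then obtain i where i: "i < length ns" "p = block_end ns (Suc i)" by blast
    then have "0 < p" "p \<le> length x"
      using block_end_mono[of 0 "Suc i" ns] block_end_le[of "Suc i" "length ns" ns] block_end_length[of ns] x by simp_all
    then obtain k where k: "p = Suc k" "k < length x" by (cases p) auto
    then show "\<exists>k<length x. p = Suc k \<and> \<not> x ! k" using concat_unary_nth[of k ns] x i by auto
  qed
  finally show ?thesis .
qed

lemma zone_order:
  assumes c: "c 4 = length x + 1 + length pre"
  shows "zone (label x (pre @ concat (map unary vs))) c True p \<longleftrightarrow> (\<exists>i<length vs. p = c 4 + block_end vs (Suc i))"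
proof -
  let ?y = "concat (map unary vs)" and ?ws = "label x (pre @ concat (map unary vs))"
  have at: "?ws ! (c 4 + Suc k) = bitn (?y ! k)" if "k < length ?y" for k
    using label_nth_right[of "length pre + k" "pre @ ?y" x] that c by (simp add: nth_append add.assoc)
  have L: "length ?ws - 1 = c 4 + Suc (length ?y)" using c by simp
  have "zone ?ws c True p \<longleftrightarrow> (\<exists>k<length ?y. p = c 4 + Suc k \<and> \<not> ?y ! k)"
  proof
    assume z: "zone ?ws c True p"
    define k where "k = p - c 4 - 1"
    have "p = c 4 + Suc k" "k < length ?y" using z L by (auto simp: zone_def k_def)
    then show "\<exists>k<length ?y. p = c 4 + Suc k \<and> \<not> ?y ! k" using z at[of k] by (auto simp: zone_def bitn_def)
  next
    assume "\<exists>k<length ?y. p = c 4 + Suc k \<and> \<not> ?y ! k"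
    then obtain k where k: "k < length ?y" "p = c 4 + Suc k" "\<not> ?y ! k" by blast
    then show "zone ?ws c True p" using at[of k] L by (simp add: zone_def bitn_def)
  qed
  also have "\<dots> \<longleftrightarrow> (\<exists>i<length vs. p = c 4 + block_end vs (Suc i))"
  proof
    assume "\<exists>k<length ?y. p = c 4 + Suc k \<and> \<not> ?y ! k"
    then show "\<exists>i<length vs. p = c 4 + block_end vs (Suc i)" using concat_unary_nth[of _ vs] by metis
  next
    assume "\<exists>i<length vs. p = c 4 + block_end vs (Suc i)"
    then obtain i where i: "i < length vs" "p = c 4 + block_end vs (Suc i)" by blast
    then have "0 < block_end vs (Suc i)" "block_end vs (Suc i) \<le> length ?y"
      using block_end_mono[of 0 "Suc i" vs] block_end_le[of "Suc i" "length vs" vs] block_end_length[of vs] by simp_all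
    then obtain k where k: "block_end vs (Suc i) = Suc k" "k < length ?y" by (cases "block_end vs (Suc i)") auto
    then have "\<not> ?y ! k" using concat_unary_nth[of k vs] i(1) by metis
    then show "\<exists>k<length ?y. p = c 4 + Suc k \<and> \<not> ?y ! k" using k i(2) by auto
  qed
  finally show ?thesis .
qed

lemma mark_annotation:
  assumes "0 < p" "p \<le> length x"
  shows "mark (label x (pre @ map f [1..<Suc (length x)] @ post)) (length x + 1 + length pre) p \<longleftrightarrow> f p"
proof -
  let ?u = "pre @ map f [1..<Suc (length x)] @ post"
  obtain j where j: "p = Suc j" "j < length x" using assms by (cases p) auto
  have "?u ! (length pre + j) = f p" using j by (simp add: nth_append del: upt_Suc)
  then have "label x ?u ! (length x + 1 + length pre + p) = bitn (f p)"
    using label_nth_right[of "length pre + j" ?u x] j by (simp add: add.assoc del: upt_Suc)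
  then show ?thesis using j by (simp add: mark_def bitn_def del: upt_Suc)
qed

lemma length_unaries_le: "\<forall>v\<in>set vs. v < m \<Longrightarrow> length (concat (map unary vs)) \<le> length vs * m"
  by (induction vs) (auto simp: unary_def)

lemma flow_graphs_verifier:
  "x \<in> flow_graphs \<longleftrightarrow> (\<exists>u. length u \<le> poly [:0, 3, 1:] (length x) \<and> evf verifierf (label x u) (\<lambda>_. 0))"
proof
  define n where "n = length x"
  define c where "c = (\<lambda>r. [n + 1, n, 2 * n + 1, 3 * n + 1, 4 * n + 1] ! r)"
  have c: "c 0 = n + 1" "c 4 = 4 * n + 1" by (simp_all add: c_def)
  {
    assume "\<exists>u. length u \<le> poly [:0, 3, 1:] (length x) \<and> evf verifierf (label x u) (\<lambda>_. 0)"
    then obtain u where "evf verifierf (label x u) (\<lambda>_. 0)" by blast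
    then have cert: "certified (length (label x u) - 1) n (4 * n + 1) (zone (label x u) c False) (mark (label x u) (n + 1))
       (mark (label x u) (2 * n + 1)) (mark (label x u) (3 * n + 1)) (zone (label x u) c True)"
      using evf_verifierf[OF n_def refl, of u] by (simp only: c_def)
    have "zone (label x u) c False n" using cert by (simp add: certified_def)
    \<comment> \<open>For nonempty \<open>x\<close>, position \<open>n\<close> holds its last
      letter; as this is \<open>False\<close>, \<open>x\<close> splits into unary numbers.\<close>
    then have s: "label x u ! n = 1" by (simp add: zone_def)
    have "\<not> last x" if "x \<noteq> []"
    proof -
      have "n \<noteq> 0" using that by (simp add: n_def)
      then obtain k where k: "n = Suc k" using not0_implies_Suc by blast
      have kx: "k < length x" using k unfolding n_def by simp
      have "bitn (x ! k) = 1" using s label_nth(2)[OF kx, of u] unfolding k by simp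
      then have "\<not> x ! k" by (cases "x ! k") (simp_all add: bitn_def)
      moreover have "last x = x ! k" using last_conv_nth[OF that] k unfolding n_def by simp
      ultimately show ?thesis by simp
    qed
    then obtain ns where ns: "x = concat (map unary ns)" using unary_blocks by blast
    have N: "n = block_end ns (length ns)" using ns by (simp add: n_def block_end_length)
    obtain nv es where g: "ns = nv # flat_pairs es" "0 < nv" "\<forall>w\<in>set (flat_pairs es). w < nv"
      "\<forall>u<nv. \<forall>v<nv. (u, v) \<in> (adjacent es)\<^sup>*" "\<exists>col. perfect nv (flat_pairs es) col"
      using certified_sound[OF zone_input[OF ns] N _ _ cert] c by (auto simp: zone_def n_def)
    have "x = encode_graph nv es" using ns g(1) by (simp only: encode_graph_flat)
    then show "x \<in> flow_graphs"
      using g(2-5) mem_flow_graphs colourable_cubic_iff[of nv es] by simp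
  next
    assume "x \<in> flow_graphs"
    then obtain nv es where x: "x = encode_graph nv es" unfolding flow_graphs_def by blast
    define ns where "ns = nv # flat_pairs es"
    have xn: "x = concat (map unary ns)" using x by (simp only: encode_graph_flat ns_def)
    have g: "0 < nv" "\<forall>w\<in>set (flat_pairs es). w < nv" "\<forall>u<nv. \<forall>v<nv. (u, v) \<in> (adjacent es)\<^sup>*"
      "\<exists>col. perfect nv (flat_pairs es) col"
      using \<open>x \<in> flow_graphs\<close> colourable_cubic_iff[of nv es] unfolding x mem_flow_graphs by blast+
    obtain col where col: "perfect nv (flat_pairs es) col" using g(4) by blast
    have "u < nv \<and> v < nv" if "(u, v) \<in> adjacent es" for u v
    proof -
      have "u \<in> set (flat_pairs es) \<and> v \<in> set (flat_pairs es)"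
        using that by (force simp: adjacent_def flat_pairs_def)
      then show ?thesis using g(2) by blast
    qed
    then obtain vs where vs: "length vs = nv" "set vs = {..<nv}"
      "\<And>i. 0 < i \<Longrightarrow> i < nv \<Longrightarrow> \<exists>j<i. (vs ! j, vs ! i) \<in> adjacent es"
      using search_order[of nv "adjacent es"] g(1,3) by blast
    define annot where "annot f = map f [1..<Suc (length x)]" for f :: "nat \<Rightarrow> bool"
    define M where "M p \<longleftrightarrow> (\<exists>i<length ns. p = block_end ns (Suc i) \<and> even i)" for p
    define B where "B a p \<longleftrightarrow> (\<exists>k<2 * length es. p = block_end ns (Suc (Suc k)) \<and> col (k div 2) \<noteq> a)" for a :: nat and p
    \<comment> \<open>Three annotations as long as the input, then the search order; their offsets
      are the values of registers 0, 2, 3 and 4 of \<open>verifierf\<close>.\<close>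
    define u where "u = annot M @ annot (B 1) @ annot (B 0) @ concat (map unary vs)"
    have la: "length (annot f) = n" for f by (simp add: annot_def n_def del: upt_Suc)
    have len: "length ns = Suc (2 * length es)" by (simp add: ns_def)
    have N: "n = block_end ns (length ns)" using xn by (simp add: n_def block_end_length)
    have pos: "0 < block_end ns (Suc i)" "block_end ns (Suc i) \<le> length x" if "i < length ns" for i
      using block_end_mono[of 0 "Suc i" ns] block_end_le[of "Suc i" "length ns" ns] that N by (simp_all add: n_def)
    have inj: "block_end ns (Suc i) = block_end ns (Suc j) \<longleftrightarrow> i = j" if "i < length ns" "j < length ns" for i j
      using block_end_inj[of "Suc i" ns "Suc j"] that by simp
    have marks: "mark (label x u) (n + 1) p \<longleftrightarrow> M p" "mark (label x u) (2 * n + 1) p \<longleftrightarrow> B 1 p"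
      "mark (label x u) (3 * n + 1) p \<longleftrightarrow> B 0 p" if p: "0 < p" "p \<le> length x" for p
    proof -
      have at: "mark (label x (pre @ annot f @ post)) (n + 1 + length pre) p \<longleftrightarrow> f p" for pre post f
        unfolding annot_def n_def by (rule mark_annotation[OF p])
      have three: "3 * n + 1 = n + 1 + length (annot M @ annot (B 1))" by (simp add: la)
      show "mark (label x u) (n + 1) p \<longleftrightarrow> M p"
        using at[of "[]" M] by (simp add: u_def)
      show "mark (label x u) (2 * n + 1) p \<longleftrightarrow> B 1 p"
        using at[of "annot M" "B 1"] by (simp add: u_def la mult_2)
      show "mark (label x u) (3 * n + 1) p \<longleftrightarrow> B 0 p"
        unfolding three u_def using at[of "annot M @ annot (B 1)" "B 0" "concat (map unary vs)"] by simp
    qed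
    have L: "length (label x u) - 1 = 4 * n + 2 + block_end vs (length vs)"
      by (simp add: u_def la n_def[symmetric] block_end_length)
    have "certified (length (label x u) - 1) n (4 * n + 1) (zone (label x u) c False) (mark (label x u) (n + 1))
       (mark (label x u) (2 * n + 1)) (mark (label x u) (3 * n + 1)) (zone (label x u) c True)"
    proof (rule certified_complete[where col = col, OF ns_def _ N _ _ _ _ _ _ vs g(1,2) col])
      show "zone (label x u) c False p \<longleftrightarrow> (\<exists>i<length ns. p = block_end ns (Suc i))" for p
        by (rule zone_input[OF xn]) (simp add: c n_def)
      show "n < length (label x u) - 1" "4 * n + 1 + block_end vs (length vs) < length (label x u) - 1"
        using L by simp_all
      show "mark (label x u) (n + 1) (block_end ns (Suc i)) \<longleftrightarrow> even i" if "i < length ns" for i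
        using marks(1)[OF pos[OF that]] inj that by (auto simp: M_def)
      show "mark (label x u) (2 * n + 1) (block_end ns (Suc (Suc k))) \<longleftrightarrow> col (k div 2) \<noteq> 1"
        "mark (label x u) (3 * n + 1) (block_end ns (Suc (Suc k))) \<longleftrightarrow> col (k div 2) \<noteq> 0" if "k < 2 * length es" for k
      proof -
        have k: "Suc k < length ns" using that len by simp
        have "B a (block_end ns (Suc (Suc k))) \<longleftrightarrow> col (k div 2) \<noteq> a" for a
          using inj[of "Suc k"] k that len unfolding B_def by auto
        then show "mark (label x u) (2 * n + 1) (block_end ns (Suc (Suc k))) \<longleftrightarrow> col (k div 2) \<noteq> 1"
          "mark (label x u) (3 * n + 1) (block_end ns (Suc (Suc k))) \<longleftrightarrow> col (k div 2) \<noteq> 0"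
          using marks(2,3)[OF pos[OF k]] by simp_all
      qed
      show "zone (label x u) c True p \<longleftrightarrow> (\<exists>i<length vs. p = 4 * n + 1 + block_end vs (Suc i))" for p
        using zone_order[of c x "annot M @ annot (B 1) @ annot (B 0)" vs p] c la by (simp add: u_def n_def)
    qed
    then have "evf verifierf (label x u) (\<lambda>_. 0)"
      using evf_verifierf[OF n_def refl, of u] L by (simp only: c_def) simp
    \<comment> \<open>Each of the \<open>nv\<close> vertices in the list takes at most
      \<open>nv\<close> letters, and \<open>nv < n\<close> because the input contains
      \<open>nv\<close> in unary. This gives the square in the bound; the three annotations give the
      linear term.\<close>
    moreover have "length u \<le> poly [:0, 3, 1:] (length x)"
    proof -
      have "nv < n" using pos(2)[of 0] len by (simp add: ns_def n_def)
      then have "nv * nv \<le> n * n" by (intro mult_le_mono) simp_all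
      moreover have "length (concat (map unary vs)) \<le> nv * nv" using length_unaries_le[of vs nv] vs(1,2) by simp
      ultimately have "length (concat (map unary vs)) \<le> n * n" by (rule order_trans[rotated])
      then show ?thesis by (simp add: u_def la n_def[symmetric] algebra_simps)
    qed
    ultimately show "\<exists>u. length u \<le> poly [:0, 3, 1:] (length x) \<and> evf verifierf (label x u) (\<lambda>_. 0)" by blast
  }
qed

lemma flow_graphs_in_NP: "in_NP flow_graphs"
  unfolding in_NP_def
proof (intro exI conjI allI)
  show "polytime_verifier (\<lambda>x u. evf verifierf (label x u) (\<lambda>_. 0))"
    by (rule polytime_verifier_definable[OF wff_verifierf])
  show "x \<in> flow_graphs \<longleftrightarrow> (\<exists>u. length u \<le> poly [:0, 3, 1:] (length x) \<and> evf verifierf (label x u) (\<lambda>_. 0))" for x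
    by (rule flow_graphs_verifier)
qed

theorem corollary3p7:
  shows "NP_complete
    {encode_graph n es | n es.
       cubic_graph (listed_graph n es) \<and>
       (\<exists>\<pi>. rotation_system (listed_graph n es) \<pi> \<and>
         (\<exists>\<omega> f. nowhere_identity_dihedral_flow 2 (listed_graph n es) \<pi> \<omega> f))}"
  unfolding NP_complete_def flow_graphs_def[symmetric] using flow_graphs_in_NP flow_graphs_hard by blast

end
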